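(* Suppose Assumptions A and B hold and that $\mathbb{E}[|\varphi(Y,Z)|^{2+\delta}]<\infty$ for some $\delta>0$. Let $\gamma_n=\gamma_1 n^{-\beta}$, $n\ge1$, with $\gamma_1>0$ and $\beta\in(\frac12,1]$, and assume $\lambda\gamma_1>1$ if $\beta=1$. Then, as $\mathcal H\ni h\downarrow 0$, $$\begin{pmatrix} h^{-\beta}\big(\xi^h_{\lceil h^{-2}\rceil}-\xi^h_\star\big)\\ h^{-1}\big(\chi^h_{\lceil h^{-2}\rceil}-\chi^h_\star\big)\end{pmatrix}\xrightarrow{\ \mathcal L\ }\mathcal N(0,\Sigma_\beta),$$ where $$\Sigma_\beta=\begin{pmatrix}\dfrac{\alpha\gamma_1}{2f_{X_0}(\xi^0_\star)-\gamma_1^{-1}(1-\alpha)\mathbf 1_{\beta=1}} & \alpha\dfrac{\chi^0_\star-\xi^0_\star}{f_{X_0}(\xi^0_\star)}\mathbf 1_{\beta=1}\\[2mm] \alpha\dfrac{\chi^0_\star-\xi^0_\star}{f_{X_0}(\xi^0_\star)}\mathbf 1_{\beta=1} & \dfrac{\mathrm{Var}((X_0-\xi^0_\star)^+)}{(1-\alpha)^2}\end{pmatrix}.$$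
   Context: Fix $\alpha\in(0,1)$. Let $Y$ ($\mathbb R^d$-valued) and $Z$ ($\mathbb R^q$-valued) be independent random variables and $\varphi:\mathbb R^d\times\mathbb R^q\to\mathbb R$ measurable with $\varphi(Y,Z)\in L^1$. Set $X_0=\mathbb E[\varphi(Y,Z)\mid Y]$ and $\mathcal H=\{1/K:K\in\mathbb N,K\ge1\}$. For $h=1/K\in\mathcal H$, $X_h=\frac1K\sum_{k=1}^K\varphi(Y,Z^{(k)})$, where $Z^{(1)},\dots,Z^{(K)}$ are i.i.d. copies of $Z$ independent of $Y$. For $h\in\mathcal H\cup\{0\}$, $F_{X_h}$ denotes the cdf and $f_{X_h}$ the pdf of $X_h$, and $V_h(\xi)=\xi+\frac1{1-\alpha}\mathbb E[(X_h-\xi)^+]$, so that $V_h''=f_{X_h}/(1-\alpha)$; under Assumption A, $V_h$ has a unique minimizer $\xi^h_\star$, and $\chi^h_\star:=V_h(\xi^h_\star)=\min V_h$ ($\xi^0_\star,\chi^0_\star$ are the value-at-risk and expected shortfall of $X_0$ at level $\alpha$). Let $H_1(\xi,x)=1-\frac1{1-\alpha}\mathbf 1_{x\ge\xi}$ and $H_2(\xi,\chi,x)=\chi-\xi-\frac1{1-\alpha}(x-\xi)^+$. NSA scheme: given positive steps $(\gamma_n)_{n\ge1}$ and $h\in\mathcal H$, let $(X_h^{(n)})_{n\ge1}$ be i.i.d. copies of $X_h$, $\xi^h_0$ a real random variable independent of them, $\chi^h_0=0$, and for $n\ge0$: $\xi^h_{n+1}=\xi^h_n-\gamma_{n+1}H_1(\xi^h_n,X_h^{(n+1)})$,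 $\chi^h_{n+1}=\chi^h_n-\frac1{n+1}H_2(\xi^h_n,\chi^h_n,X_h^{(n+1)})$. Assumption A: (i) for each $h\in\mathcal H$, $F_{X_h}(\xi)-F_{X_0}(\xi)=v(\xi)h+w(\xi,h)h$ for all $\xi\in\mathbb R$, for functions $v,w(\cdot,h):\mathbb R\to\mathbb R$ with $\int_{\xi^0_\star}^\infty v(\xi)d\xi<\infty$ and $\lim_{\mathcal H\ni h\downarrow0}w(\xi^0_\star,h)=\lim_{\mathcal H\ni h\downarrow0}\int_{\xi^0_\star}^\infty w(\xi,h)d\xi=0$ for any minimizer $\xi^0_\star$ of $V_0$; (ii) for each $h\in\mathcal H\cup\{0\}$, $X_h$ has a continuous pdf $f_{X_h}$, and $f_{X_h}\to f_{X_0}$ locally uniformly as $\mathcal H\ni h\downarrow0$; (iii) for every $R>0$, $\inf_{h\in\mathcal H\cup\{0\},\,\xi\in B(\xi^0_\star,R)}f_{X_h}(\xi)>0$; (iv) $\sup_{h\in\mathcal H\cup\{0\}}(\|f_{X_h}\|_\infty+[f_{X_h}]_{\rm Lip})<\infty$, where $[\cdot]_{\rm Lip}$ is the Lipschitz constant. Assumption B: with $c_\alpha=1\vee\frac{\alpha}{1-\alpha}$, $\sup_{h\in\mathcal H}\mathbb E\big[|\xi^h_0|^2\exp\big(\frac{4}{1-\alpha}c_\alpha\sup_{h'\in\mathcal H}\|f_{X_{h'}}\|_\infty|\xi^h_0|\big)\big]<\infty$. The constant $\lambda:=\inf_{h\in\mathcal H\cup\{0\}}\Big(\frac38V_h''(\xi^h_\star)\wedge\|V_h''\|_\infty\frac{V_h''(\xi^h_\star)^4}{4[V_h'']_{\rm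 Lip}^2}\Big)>0$. *)

theory Defs
  imports "HOL-Probability.Probability"
begin

definition Hset :: "real set" where
  "Hset = {1 / real K | K. K \<ge> 1}"

definition Kof :: "real \<Rightarrow> nat" where
  "Kof h = nat (round (1 / h))"

definition lawXK :: "'d measure \<Rightarrow> 'q measure \<Rightarrow> ('d \<Rightarrow> 'q \<Rightarrow> real) \<Rightarrow> nat \<Rightarrow> real measure" where
  "lawXK PY PZ \<phi> K =
     distr (PY \<Otimes>\<^sub>M PiM {..<K} (\<lambda>_. PZ)) borel
       (\<lambda>(y, zs). (\<Sum>k<K. \<phi> y (zs k)) / real K)"

text \<open>Law of X_0 = E[phi(Y,Z) | Y] = g(Y) with g(y) = E[phi(y,Z)] (Y, Z independent).\<close>
definition lawX0 :: "'d measure \<Rightarrow> 'q measure \<Rightarrow> ('d \<Rightarrow> 'q \<Rightarrow> real) \<Rightarrow> real measure" where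
  "lawX0 PY PZ \<phi> = distr PY borel (\<lambda>y. \<integral>z. \<phi> y z \<partial>PZ)"

definition lawX :: "'d measure \<Rightarrow> 'q measure \<Rightarrow> ('d \<Rightarrow> 'q \<Rightarrow> real) \<Rightarrow> real \<Rightarrow> real measure" where
  "lawX PY PZ \<phi> h = (if h = 0 then lawX0 PY PZ \<phi> else lawXK PY PZ \<phi> (Kof h))"

definition Vfun :: "real \<Rightarrow> real measure \<Rightarrow> real \<Rightarrow> real" where
  "Vfun \<alpha> \<mu> \<xi> = \<xi> + 1 / (1 - \<alpha>) * (\<integral>x. max (x - \<xi>) 0 \<partial>\<mu>)"

definition is_minimizer :: "(real \<Rightarrow> real) \<Rightarrow> real \<Rightarrow> bool" where
  "is_minimizer V \<xi> \<longleftrightarrow> (\<forall>\<eta>. V \<xi> \<le> V \<eta>)"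

text \<open>The (unique, under Assumption A) minimizer xi^h_* and the minimum chi^h_*.\<close>
definition xi_star :: "real \<Rightarrow> real measure \<Rightarrow> real" where
  "xi_star \<alpha> \<mu> = (THE \<xi>. is_minimizer (Vfun \<alpha> \<mu>) \<xi>)"

definition chi_star :: "real \<Rightarrow> real measure \<Rightarrow> real" where
  "chi_star \<alpha> \<mu> = Vfun \<alpha> \<mu> (xi_star \<alpha> \<mu>)"

definition supnorm :: "(real \<Rightarrow> real) \<Rightarrow> real" where
  "supnorm g = (SUP x. \<bar>g x\<bar>)"

definition lipconst :: "(real \<Rightarrow> real) \<Rightarrow> real" where
  "lipconst g = Sup {\<bar>g x - g y\<bar> / \<bar>x - y\<bar> | x y. x \<noteq> y}"

text \<open>The constant lambda, with V_h'' = f_{X_h}/(1-alpha) and f h the pdf of X_h.\<close>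
definition lambda_const :: "real \<Rightarrow> (real \<Rightarrow> real \<Rightarrow> real) \<Rightarrow> (real \<Rightarrow> real) \<Rightarrow> real" where
  "lambda_const \<alpha> f xs =
     (INF h\<in>Hset \<union> {0}.
        let V2 = (\<lambda>x. f h x / (1 - \<alpha>)) in
        min (3 / 8 * V2 (xs h))
            (supnorm V2 * V2 (xs h) ^ 4 / (4 * (lipconst V2)\<^sup>2)))"

definition H1 :: "real \<Rightarrow> real \<Rightarrow> real \<Rightarrow> real" where
  "H1 \<alpha> \<xi> x = 1 - 1 / (1 - \<alpha>) * (if x \<ge> \<xi> then 1 else 0)"

definition H2 :: "real \<Rightarrow> real \<Rightarrow> real \<Rightarrow> real \<Rightarrow> real" where
  "H2 \<alpha> \<xi> ch x = ch - \<xi> - 1 / (1 - \<alpha>) * max (x - \<xi>) 0"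

text \<open>The NSA scheme: nsa alpha gamma xi0 X n = (xi_n, chi_n), where X (n+1) is the
  (n+1)-th sample X_h^(n+1) and gamma (n+1) the step.\<close>
fun nsa :: "real \<Rightarrow> (nat \<Rightarrow> real) \<Rightarrow> real \<Rightarrow> (nat \<Rightarrow> real) \<Rightarrow> nat \<Rightarrow> real \<times> real" where
  "nsa \<alpha> \<gamma> \<xi>0 X 0 = (\<xi>0, 0)"
| "nsa \<alpha> \<gamma> \<xi>0 X (Suc n) =
     (let (\<xi>, ch) = nsa \<alpha> \<gamma> \<xi>0 X n in
       (\<xi> - \<gamma> (Suc n) * H1 \<alpha> \<xi> (X (Suc n)),
        ch - 1 / real (Suc n) * H2 \<alpha> \<xi> ch (X (Suc n))))"

definition char2 :: "(real \<times> real) measure \<Rightarrow> real \<times> real \<Rightarrow> complex" where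
  "char2 N u = (CLINT x|N. cis (u \<bullet> x))"

definition conv_in_law2 ::
  "('i \<Rightarrow> 'w measure) \<Rightarrow> ('i \<Rightarrow> 'w \<Rightarrow> real \<times> real) \<Rightarrow> (real \<times> real) measure \<Rightarrow> 'i filter \<Rightarrow> bool" where
  "conv_in_law2 M U N F \<longleftrightarrow>
     (\<forall>g :: real \<times> real \<Rightarrow> real. continuous_on UNIV g \<and> bounded (range g) \<longrightarrow>
        ((\<lambda>i. \<integral>\<omega>. g (U i \<omega>) \<partial>M i) \<longlongrightarrow> (\<integral>x. g x \<partial>N)) F)"

definition is_gaussian2 :: "(real \<times> real) measure \<Rightarrow> real \<Rightarrow> real \<Rightarrow> real \<Rightarrow> bool" where
  "is_gaussian2 N s11 s12 s22 \<longleftrightarrow>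
     prob_space N \<and> sets N = sets borel \<and>
     (\<forall>u. char2 N u =
        complex_of_real (exp (- (s11 * (fst u)\<^sup>2 + 2 * s12 * fst u * snd u + s22 * (snd u)\<^sup>2) / 2)))"

end

theory Submission imports Defs begin

text \<open>With \<open>K = 1/h\<close> the iteration runs for \<open>K\<^sup>2\<close> steps. Freezing the noise at the
  quantile and linearising the drift there splits the pair of estimates into a weighted sum of
  i.i.d. vectors plus a remainder. The remainder is a martingale part, small in mean square, plus a
  drift part, small in mean; both follow from the rate \<open>\<gamma>\<^sub>n\<close> of the mean-square error of the
  quantile iterates, with constants that do not depend on \<open>h\<close>. That rate comes from a
  \<open>cosh\<close> Lyapunov function once the initial value is clamped to a bounded interval, which by
  Assumption B changes the process only with small probability. The weighted sum is treated by a
  Lyapunov-type expansion of its characteristic function, the \<open>2 + \<delta>\<close> moment giving the error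
  term and the step-size recursions giving the limits of the sums of powers of the weights.
  Convergence of characteristic functions in the plane is upgraded to weak convergence by
  approximating a continuous function on a square by trigonometric polynomials.\<close>

subsection \<open>Step-size recursions\<close>

text \<open>Every \<open>h\<close> has its own law and its own probability space, so all estimates
  must hold with constants built from \<alpha>, a common bound on the densities, the steps and a
  lower bound for V'' at the quantile. Clamping is forced by the Lyapunov function: its growth rate
  is dictated by the drift and need not be covered by the exponential moment of Assumption B, which
  therefore enters as tightness of the initial values; the leading sums do not see the initial
  value. The indicator in \<open>H1\<close> is discontinuous, so freezing the noise at the quantile
  costs in mean square the distance to the quantile rather than its square; the martingale remainder
  is then of size n^(-3\<beta>/4), still below the scale n^(-\<beta>/2). The estimate of \<chi>
  averages errors whose bias and variance are of order k^(-\<beta>), and the sum of these over k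
  \<le> K^2, divided by K, vanishes because \<beta> > 1/2. The sum of the noise weights stays
  bounded, so the two components decouple in the limit unless \<beta> = 1. In that case \<lambda>
  \<gamma>_1 > 1 yields a contraction faster than the decay rates sought.\<close>

lemma step_recursion_decay:
  fixes g b a s C B Y :: real
  assumes g: "g > 0" and b: "0 < b" "b \<le> 1" and a: "a > 0" and s: "s \<ge> 0"
    and crit: "b = 1 \<Longrightarrow> s < a * g" and C: "C \<ge> 0" and B: "B \<ge> 0" and Y: "Y \<ge> 0"
  defines "\<gamma> \<equiv> (\<lambda>n::nat. g * real n powr (- b))"
  shows "\<exists>D\<ge>0. \<forall>y. (\<forall>n. 0 \<le> y n) \<longrightarrow> y 0 \<le> Y \<longrightarrow>
    (\<forall>n. y (Suc n) \<le> (1 - a * \<gamma> (Suc n) + C * (\<gamma> (Suc n))\<^sup>2) * y n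
                       + B * \<gamma> (Suc n) * real (Suc n) powr (- s)) \<longrightarrow>
    (\<forall>n. y n \<le> D * real (Suc n) powr (- s))"
proof -
  \<comment> \<open>The rate \<open>a\<close> is split: the share \<open>c\<close> will absorb the
    forcing term, and \<open>a - c\<close> has to dominate \<open>C * \<gamma> n\<close> together
    with the relative loss s/n of the target n^(-s) in one step. Measured in units of
    \<open>\<gamma> n\<close> that loss is \<open>s / g * real n powr (b - 1)\<close>, which tends
    to 0 for b < 1 but stays at s/g for b = 1; there \<open>crit\<close> makes \<open>c\<close>
    positive.\<close>
  define c where "c = (if b = 1 then (a - s / g) / 2 else a / 2)"
  have c0: "c > 0" using a g crit by (auto simp: c_def field_simps)
  have \<gamma>pos: "\<gamma> n \<ge> 0" for n using g by (auto simp: \<gamma>_def)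
  have \<gamma>lim: "\<gamma> \<longlonglongrightarrow> 0"
    unfolding \<gamma>_def using b by (intro tendsto_mult_right_zero tendsto_neg_powr) (auto simp: filterlim_real_sequentially)
  have lim1: "(\<lambda>n. s / g * real n powr (b - 1) + C * \<gamma> n) \<longlonglongrightarrow> (if b = 1 then s / g else 0)"
  proof (cases "b = 1")
    case True
    have "(\<lambda>n. s / g * 1 + C * \<gamma> n) \<longlonglongrightarrow> s / g * 1 + C * 0"
      by (intro tendsto_intros \<gamma>lim)
    moreover have "\<forall>\<^sub>F n in sequentially. s / g * 1 + C * \<gamma> n = s / g * real n powr (b - 1) + C * \<gamma> n"
      using True eventually_gt_at_top[of "0::nat"] by (auto elim!: eventually_mono)
    ultimately show ?thesis using True by (auto elim: Lim_transform_eventually)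
  next
    case False
    have "(\<lambda>n. real n powr (b - 1)) \<longlonglongrightarrow> 0"
      using False b by (intro tendsto_neg_powr) (auto simp: filterlim_real_sequentially)
    then have "(\<lambda>n. s / g * real n powr (b - 1) + C * \<gamma> n) \<longlonglongrightarrow> s / g * 0 + C * 0"
      by (intro tendsto_intros \<gamma>lim)
    with False show ?thesis by simp
  qed
  have "(if b = 1 then s / g else 0) < a - c"
    using a g crit by (auto simp: c_def field_simps)
  with lim1 have "\<forall>\<^sub>F n in sequentially. s / g * real n powr (b - 1) + C * \<gamma> n < a - c"
    by (rule order_tendstoD)
  moreover have "\<forall>\<^sub>F n in sequentially. \<gamma> n < 1 / a"
    using \<gamma>lim a by (intro order_tendstoD) auto
  ultimately have "\<forall>\<^sub>F n in sequentially. s / g * real n powr (b - 1) + C * \<gamma> n < a - c \<and> \<gamma> n < 1 / a \<and> n > 0"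
    using eventually_gt_at_top[of "0::nat"] by eventually_elim auto
  then obtain n0 where n0: "\<And>n. n \<ge> n0 \<Longrightarrow> s / g * real n powr (b - 1) + C * \<gamma> n < a - c \<and> \<gamma> n < 1 / a \<and> n > 0"
    by (auto simp: eventually_sequentially)
  have step: "(1 - a * \<gamma> n + C * (\<gamma> n)\<^sup>2 + c * \<gamma> n) * real n powr (- s) \<le> real (Suc n) powr (- s)"
    and fac: "1 - a * \<gamma> n + C * (\<gamma> n)\<^sup>2 \<ge> 0" if "n \<ge> n0" for n
  proof -
    have n: "n > 0" and h1: "s / g * real n powr (b - 1) + C * \<gamma> n < a - c" and h2: "\<gamma> n < 1 / a"
      using n0[OF that] by auto
    have "a * \<gamma> n < 1" using h2 a by (simp add: field_simps)
    then show "1 - a * \<gamma> n + C * (\<gamma> n)\<^sup>2 \<ge> 0" using C by (smt (verit) mult_nonneg_nonneg zero_le_power2)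
    have g1: "\<gamma> n > 0" using n g by (simp add: \<gamma>_def)
    have "s / g * real n powr (b - 1) * \<gamma> n = s * (real n powr (b - 1) * real n powr (- b))"
      using g by (simp add: \<gamma>_def)
    also have "\<dots> = s / real n" using n by (simp add: powr_diff powr_minus divide_simps)
    finally have e1: "s / g * real n powr (b - 1) * \<gamma> n = s / real n" .
    have "(s / g * real n powr (b - 1) + C * \<gamma> n) * \<gamma> n \<le> (a - c) * \<gamma> n"
      using h1 g1 by (intro mult_right_mono) auto
    then have h3: "s / real n + C * (\<gamma> n)\<^sup>2 \<le> (a - c) * \<gamma> n"
      using e1 by (simp add: algebra_simps power2_eq_square)
    have "1 - a * \<gamma> n + C * (\<gamma> n)\<^sup>2 + c * \<gamma> n \<le> 1 + (- s / real n)"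
      using h3 by (simp add: algebra_simps)
    also have "\<dots> \<le> exp (- s / real n)" by (rule exp_ge_add_one_self)
    finally have k1: "1 - a * \<gamma> n + C * (\<gamma> n)\<^sup>2 + c * \<gamma> n \<le> exp (- s / real n)" .
    have "ln (1 + 1 / real n) \<le> 1 / real n" using n by (intro ln_add_one_self_le_self) auto
    then have "s * ln (1 + 1 / real n) \<le> s / real n" using s
      by (metis mult.right_neutral mult_left_mono times_divide_eq_right)
    moreover have "ln (1 + 1 / real n) = ln (real (Suc n)) - ln (real n)"
    proof -
      have "real (Suc n) = real n * (1 + 1 / real n)" using n by (simp add: field_simps)
      then show ?thesis using n by (simp only: ln_mult_pos) (simp add: ln_mult_pos add_pos_nonneg)
    qed
    ultimately have "- s / real n - s * ln (real n) \<le> - s * ln (real (Suc n))"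
      by (simp add: algebra_simps)
    then have "exp (- s / real n) * real n powr (- s) \<le> real (Suc n) powr (- s)"
      using n by (simp add: powr_def exp_add[symmetric] exp_le_cancel_iff del: of_nat_Suc)
    moreover have "(1 - a * \<gamma> n + C * (\<gamma> n)\<^sup>2 + c * \<gamma> n) * real n powr (- s) \<le> exp (- s / real n) * real n powr (- s)"
      using k1 by (intro mult_right_mono) auto
    ultimately show "(1 - a * \<gamma> n + C * (\<gamma> n)\<^sup>2 + c * \<gamma> n) * real n powr (- s) \<le> real (Suc n) powr (- s)"
      by linarith
  qed
  \<comment> \<open>A majorant for the indices up to \<open>n0\<close>, where the factor of the
    recursion may be negative: the contraction is dropped and the recursion is run from
    \<open>Y\<close>. It depends on the parameters alone, which is why \<open>D\<close> can be fixed
    before the sequence \<open>y\<close>.\<close>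
  define yb where "yb = rec_nat Y (\<lambda>n z. (1 + C * (\<gamma> (Suc n))\<^sup>2) * z + B * \<gamma> (Suc n) * real (Suc n) powr (- s))"
  have yb0: "yb 0 = Y" and ybS: "yb (Suc n) = (1 + C * (\<gamma> (Suc n))\<^sup>2) * yb n + B * \<gamma> (Suc n) * real (Suc n) powr (- s)" for n
    by (auto simp: yb_def)
  have ybpos: "yb n \<ge> 0" for n
    by (induct n) (auto simp: yb0 ybS Y B C \<gamma>pos intro!: add_nonneg_nonneg mult_nonneg_nonneg)
  \<comment> \<open>The first summand gives \<open>B \<le> D * c\<close>, so the forcing is paid for
    by the share \<open>c\<close>; the sum covers all indices up to \<open>n0\<close> at
    once.\<close>
  define D where "D = B / c + (\<Sum>n\<le>n0. yb n * real (Suc n) powr s)"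
  have D0: "D \<ge> 0" unfolding D_def using B c0 ybpos by (intro add_nonneg_nonneg sum_nonneg) auto
  have DB: "B \<le> D * c"
  proof -
    have "B / c \<le> D" unfolding D_def using ybpos by (simp add: sum_nonneg)
    then show ?thesis using c0 by (simp add: field_simps)
  qed
  have "y n \<le> D * real (Suc n) powr (- s)"
    if y0: "\<forall>n. 0 \<le> y n" and yY: "y 0 \<le> Y" and
      rec: "\<forall>n. y (Suc n) \<le> (1 - a * \<gamma> (Suc n) + C * (\<gamma> (Suc n))\<^sup>2) * y n + B * \<gamma> (Suc n) * real (Suc n) powr (- s)" for y n
  proof -
    have yyb: "y n \<le> yb n" for n
    proof (induct n)
      case (Suc n)
      have "(1 - a * \<gamma> (Suc n) + C * (\<gamma> (Suc n))\<^sup>2) * y n \<le> (1 + C * (\<gamma> (Suc n))\<^sup>2) * y n"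
        using y0 a \<gamma>pos by (intro mult_right_mono) auto
      also have "\<dots> \<le> (1 + C * (\<gamma> (Suc n))\<^sup>2) * yb n" using Suc C by (intro mult_left_mono) auto
      finally show ?case using rec[rule_format, of n] ybS[of n] by linarith
    qed (use yY yb0 in auto)
    show ?thesis
    proof (induct n)
      case 0
      have "yb 0 * real (Suc 0) powr s \<le> (\<Sum>n\<le>n0. yb n * real (Suc n) powr s)"
        by (intro member_le_sum) (auto simp: ybpos)
      moreover have "0 \<le> B / c" using B c0 by simp
      ultimately show ?case using yyb[of 0] unfolding D_def by simp
    next
      case (Suc n)
      show ?case
      proof (cases "Suc n \<le> n0")
        case True
        have "yb (Suc n) * real (Suc (Suc n)) powr s \<le> (\<Sum>n\<le>n0. yb n * real (Suc n) powr s)"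
          using True by (intro member_le_sum) (auto simp: ybpos simp del: of_nat_Suc)
        also have "\<dots> \<le> D" unfolding D_def using B c0 by simp
        finally have "yb (Suc n) * real (Suc (Suc n)) powr s * real (Suc (Suc n)) powr (- s) \<le> D * real (Suc (Suc n)) powr (- s)"
          by (intro mult_right_mono) auto
        then have "yb (Suc n) \<le> D * real (Suc (Suc n)) powr (- s)"
          by (simp add: mult.assoc powr_add[symmetric] del: of_nat_Suc)
        then show ?thesis using yyb[of "Suc n"] by linarith
      next
        case False
        let ?N = "Suc n"
        let ?f = "1 - a * \<gamma> ?N + C * (\<gamma> ?N)\<^sup>2"
        have "y (Suc n) \<le> ?f * y n + B * \<gamma> ?N * real ?N powr (- s)" using rec by blast
        also have "?f * y n \<le> ?f * (D * real ?N powr (- s))"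
          using Suc fac[of ?N] False by (intro mult_left_mono) auto
        also have "B * \<gamma> ?N * real ?N powr (- s) \<le> D * c * \<gamma> ?N * real ?N powr (- s)"
          using DB \<gamma>pos by (intro mult_right_mono) auto
        also have "?f * (D * real ?N powr (- s)) + D * c * \<gamma> ?N * real ?N powr (- s)
          = D * ((?f + c * \<gamma> ?N) * real ?N powr (- s))" by (simp add: algebra_simps)
        also have "\<dots> \<le> D * real (Suc ?N) powr (- s)"
          using step[of ?N] False D0 by (intro mult_left_mono) auto
        finally show ?thesis by simp
      qed
    qed
  qed
  with D0 show ?thesis by blast
qed

text \<open>Meant for the factor 1 - \<gamma> v, with a lower bound \<open>x\<close> and an upper
  bound \<open>c\<close> of \<gamma> v. The lower bound keeps the linear contraction, the upper
  bound pays for the square. The estimates include \<open>y > 1\<close>, so early steps that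
  overshoot are covered.\<close>

lemma abs_one_minus_le:
  fixes x y c :: real
  assumes "0 \<le> x" "x \<le> y" "y \<le> c"
  shows "\<bar>1 - y\<bar> \<le> 1 - x + c\<^sup>2" "(1 - y)\<^sup>2 \<le> 1 - 2 * x + c\<^sup>2"
        "(1 - y) ^ 4 \<le> 1 - 4 * x + (6 + c\<^sup>2) * c\<^sup>2"
proof -
  have c: "y\<^sup>2 \<le> c\<^sup>2" using assms by (simp add: power_mono)
  have "\<bar>1 - y\<bar> \<le> 1 - y + y\<^sup>2"
  proof (cases "y \<le> 1")
    case False
    have "0 \<le> (y - 1)\<^sup>2" by simp
    then show ?thesis using False by (simp add: power2_eq_square algebra_simps)
  qed auto
  then show "\<bar>1 - y\<bar> \<le> 1 - x + c\<^sup>2" using c assms by linarith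
  show "(1 - y)\<^sup>2 \<le> 1 - 2 * x + c\<^sup>2" 
  proof -
    have "(1 - y)\<^sup>2 = 1 - 2 * y + y\<^sup>2" by (simp add: power2_diff)
    then show ?thesis using c assms by linarith
  qed
  have "(1 - y) ^ 4 = 1 - 4 * y + (6 + y\<^sup>2) * y\<^sup>2 - 4 * y ^ 3"
    by (simp add: power4_eq_xxxx power2_eq_square power3_eq_cube algebra_simps)
  also have "\<dots> \<le> 1 - 4 * x + (6 + c\<^sup>2) * c\<^sup>2"
    using c assms by (smt (verit) mult_mono zero_le_power zero_le_power2)
  finally show "(1 - y) ^ 4 \<le> 1 - 4 * x + (6 + c\<^sup>2) * c\<^sup>2" .
qed

subsection \<open>Weak convergence in the plane\<close>

text \<open>Trigonometric polynomials of two variables with arbitrary real frequencies and complex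
  coefficients. The rules list what passes to the limit directly, single exponentials and sums;
  closure under products is derived, since polynomials in sines require it.\<close>

inductive trig_fun :: "(real \<times> real \<Rightarrow> complex) \<Rightarrow> bool" where
  expo: "trig_fun (\<lambda>x. c * cis (u \<bullet> x))"
| add: "trig_fun f \<Longrightarrow> trig_fun g \<Longrightarrow> trig_fun (\<lambda>x. f x + g x)"

lemma trig_fun_mult_expo: "trig_fun f \<Longrightarrow> trig_fun (\<lambda>x. f x * (c * cis (u \<bullet> x)))"
proof (induct rule: trig_fun.induct)
  case (expo d w)
  have "(\<lambda>x. d * cis (w \<bullet> x) * (c * cis (u \<bullet> x))) = (\<lambda>x. (d * c) * cis ((w + u) \<bullet> x))"
    by (auto simp: inner_add_left cis_mult[symmetric])
  then show ?case by (simp only: trig_fun.expo)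
next
  case (add f g)
  then show ?case by (simp add: distrib_right trig_fun.add)
qed

lemma trig_fun_mult: "trig_fun g \<Longrightarrow> trig_fun f \<Longrightarrow> trig_fun (\<lambda>x. f x * g x)"
  by (induct rule: trig_fun.induct) (auto simp: trig_fun_mult_expo distrib_left trig_fun.add)

lemma trig_fun_const: "trig_fun (\<lambda>x. c)"
  using trig_fun.expo[of c 0] by simp

lemma trig_fun_sin: "trig_fun (\<lambda>x. complex_of_real (sin (u \<bullet> x)))"
proof -
  have "(\<lambda>x. complex_of_real (sin (u \<bullet> x))) =
      (\<lambda>x. (- \<i> / 2) * cis (u \<bullet> x) + (\<i> / 2) * cis ((- u) \<bullet> x))"
    by (auto simp: complex_eq_iff cis.ctr)
  then show ?thesis by (simp only:) (intro trig_fun.intros)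
qed

lemma trig_fun_polynomial_sin:
  fixes q :: "real \<times> real \<Rightarrow> real"
  assumes "real_polynomial_function q"
  shows "trig_fun (\<lambda>x. complex_of_real (q (sin (w * fst x), sin (w * snd x))))"
  using assms
proof (induct rule: real_polynomial_function.induct)
  case (linear f)
  interpret bounded_linear f by fact
  have lin: "f (s, t) = s * f (1, 0) + t * f (0, 1)" for s t
  proof -
    have "f (s, t) = f (s *\<^sub>R (1, 0) + t *\<^sub>R (0, 1))" by simp
    also have "\<dots> = s * f (1, 0) + t * f (0, 1)" by (simp only: add scaleR real_scaleR_def)
    finally show ?thesis .
  qed
  have "(\<lambda>x. complex_of_real (f (sin (w * fst x), sin (w * snd x)))) =
     (\<lambda>x. complex_of_real (sin ((w, 0) \<bullet> x)) * complex_of_real (f (1, 0))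
        + complex_of_real (sin ((0, w) \<bullet> x)) * complex_of_real (f (0, 1)))"
    by (rule ext) (subst lin, simp add: inner_prod_def)
  moreover have "trig_fun (\<lambda>x. complex_of_real (sin ((w, 0) \<bullet> x)) * complex_of_real (f (1, 0))
        + complex_of_real (sin ((0, w) \<bullet> x)) * complex_of_real (f (0, 1)))"
    by (rule trig_fun.add[OF trig_fun_mult[OF trig_fun_const trig_fun_sin] trig_fun_mult[OF trig_fun_const trig_fun_sin]])
  ultimately show ?case by metis
next
  case (const c)
  then show ?case by (rule trig_fun_const)
next
  case (add f g)
  show ?case unfolding of_real_add by (rule trig_fun.add[OF add(2,4)])
next
  case (mult f g)
  show ?case unfolding of_real_mult by (rule trig_fun_mult[OF mult(4,2)])
qed

lemma trig_fun_continuous: "trig_fun f \<Longrightarrow> continuous_on UNIV f"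
  by (induct rule: trig_fun.induct) (auto intro!: continuous_intros simp: cis_conv_exp)

lemma trig_fun_bounded: "trig_fun f \<Longrightarrow> \<exists>B. \<forall>x. norm (f x) \<le> B"
proof (induct rule: trig_fun.induct)
  case (expo c u)
  then show ?case by (auto simp: norm_mult intro!: exI[of _ "norm c"])
next
  case (add f g)
  then obtain A B where "\<forall>x. norm (f x) \<le> A" "\<forall>x. norm (g x) \<le> B" by blast
  then show ?case by (intro exI[of _ "A + B"]) (auto intro!: norm_triangle_le add_mono)
qed

lemma integrable_bounded_continuous:
  fixes g :: "real \<times> real \<Rightarrow> 'b::{banach,second_countable_topology}"
  assumes "prob_space P" "U \<in> borel_measurable P" "continuous_on UNIV g" "\<And>x. norm (g x) \<le> B"
  shows "integrable P (\<lambda>\<omega>. g (U \<omega>))"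
proof -
  interpret prob_space P by fact
  have "g \<in> borel_measurable borel" using assms(3) by (rule borel_measurable_continuous_onI)
  then have "(\<lambda>\<omega>. g (U \<omega>)) \<in> borel_measurable P" using assms(2) by measurable
  then show ?thesis using assms(4) by (intro integrable_const_bound[where B=B]) auto
qed

lemma (in prob_space) integrable_const_add_indicator:
  assumes "A \<in> events"
  shows "integrable M (\<lambda>\<omega>. c + d * indicator A \<omega> :: real)"
  using assms by (intro Bochner_Integration.integrable_add integrable_mult_right integrable_const
    integrable_real_indicator) (auto simp: emeasure_eq_measure)

lemma (in prob_space) integral_const_add_indicator:
  assumes "A \<in> events"
  shows "(\<integral>\<omega>. c + d * indicator A \<omega> \<partial>M) = c + d * prob A"
proof -
  have "integrable M (indicator A :: _ \<Rightarrow> real)"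
    using assms by (auto simp: emeasure_eq_measure)
  then show ?thesis using assms by (subst Bochner_Integration.integral_add) (auto simp: prob_space)
qed

text \<open>Serves both sides of a limit: the variables converging in law and, taking the identity
  for \<open>W\<close>, the limit law itself. A trigonometric polynomial close to \<open>g\<close>
  on a ball costs \<open>e\<close> there and, being bounded, \<open>c\<close> times a tail
  probability outside.\<close>

lemma integral_diff_le_off_ball:
  fixes g p :: "real \<times> real \<Rightarrow> real"
  assumes Q: "prob_space Q" and W[measurable]: "W \<in> borel_measurable Q"
    and g: "continuous_on UNIV g" "\<And>x. \<bar>g x\<bar> \<le> G" and p: "continuous_on UNIV p" "\<And>x. \<bar>p x\<bar> \<le> G'"
    and pg: "\<And>x. \<bar>g x - p x\<bar> \<le> e + c * indicator {x. norm x > R} x"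
  shows "\<bar>(\<integral>\<omega>. g (W \<omega>) \<partial>Q) - (\<integral>\<omega>. p (W \<omega>) \<partial>Q)\<bar> \<le> e + c * measure Q {\<omega>\<in>space Q. norm (W \<omega>) > R}"
proof -
  interpret prob_space Q by fact
  have i: "integrable Q (\<lambda>\<omega>. g (W \<omega>))" "integrable Q (\<lambda>\<omega>. p (W \<omega>))"
    using integrable_bounded_continuous[OF Q W g(1), of G] integrable_bounded_continuous[OF Q W p(1), of G'] g(2) p(2) by auto
  have "\<bar>(\<integral>\<omega>. g (W \<omega>) \<partial>Q) - (\<integral>\<omega>. p (W \<omega>) \<partial>Q)\<bar> = \<bar>\<integral>\<omega>. g (W \<omega>) - p (W \<omega>) \<partial>Q\<bar>" using i by simp
  also have "\<dots> \<le> (\<integral>\<omega>. \<bar>g (W \<omega>) - p (W \<omega>)\<bar> \<partial>Q)" by (rule integral_abs_bound)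
  also have "\<dots> \<le> (\<integral>\<omega>. e + c * indicator {\<omega>\<in>space Q. norm (W \<omega>) > R} \<omega> \<partial>Q)"
  proof (rule integral_mono)
    show "integrable Q (\<lambda>\<omega>. e + c * indicator {\<omega>\<in>space Q. norm (W \<omega>) > R} \<omega>)"
      by (rule integrable_const_add_indicator) measurable
    show "\<bar>g (W \<omega>) - p (W \<omega>)\<bar> \<le> e + c * indicator {\<omega>\<in>space Q. norm (W \<omega>) > R} \<omega>" if "\<omega> \<in> space Q" for \<omega>
      using pg[of "W \<omega>"] that by (auto simp: indicator_def)
  qed (use i in auto)
  also have "\<dots> = e + c * prob {\<omega>\<in>space Q. norm (W \<omega>) > R}"
    by (rule integral_const_add_indicator) measurable
  finally show ?thesis .
qed

lemma trig_fun_tendsto: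
  fixes P :: "nat \<Rightarrow> 'w measure" and U :: "nat \<Rightarrow> 'w \<Rightarrow> real \<times> real"
  assumes P: "\<And>n. prob_space (P n)" and U: "\<And>n. U n \<in> borel_measurable (P n)"
    and N: "prob_space N" "sets N = sets borel"
    and conv: "\<And>u. (\<lambda>n. CLINT \<omega>|P n. cis (u \<bullet> U n \<omega>)) \<longlonglongrightarrow> char2 N u"
    and f: "trig_fun f"
  shows "(\<lambda>n. CLINT \<omega>|P n. f (U n \<omega>)) \<longlonglongrightarrow> (CLINT x|N. f x)"
  using f
proof (induct rule: trig_fun.induct)
  case (expo c u)
  show ?case using conv[of u] unfolding char2_def by (simp add: tendsto_mult_left)
next
  case (add f g)
  obtain A B where A: "\<And>x. norm (f x) \<le> A" and B: "\<And>x. norm (g x) \<le> B"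
    using trig_fun_bounded[OF add(1)] trig_fun_bounded[OF add(3)] by blast
  have id: "(\<lambda>x. x) \<in> borel_measurable N" using N(2) by (simp add: measurable_ident_sets)
  have "(\<integral>\<omega>. f (U n \<omega>) + g (U n \<omega>) \<partial>P n) = (\<integral>\<omega>. f (U n \<omega>) \<partial>P n) + (\<integral>\<omega>. g (U n \<omega>) \<partial>P n)" for n
    using integrable_bounded_continuous[OF P U trig_fun_continuous[OF add(1)] A]
          integrable_bounded_continuous[OF P U trig_fun_continuous[OF add(3)] B] by simp
  moreover have "(\<integral>x. f x + g x \<partial>N) = (\<integral>x. f x \<partial>N) + (\<integral>x. g x \<partial>N)"
    using integrable_bounded_continuous[OF N(1) id trig_fun_continuous[OF add(1)] A]
          integrable_bounded_continuous[OF N(1) id trig_fun_continuous[OF add(3)] B] by simp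
  ultimately show ?case using tendsto_add[OF add(2,4)] by simp
qed

text \<open>With w = \<pi>/(2R) the map t \<mapsto> sin(w t) carries [-R, R] bijectively onto
  [-1, 1]. Hence \<open>g\<close> becomes a continuous function of the two sines on a square, where
  Stone-Weierstrass applies. Since sines never leave [-1, 1], the bound \<open>G + e\<close> holds
  on the whole plane and not only where \<open>p\<close> is close to \<open>g\<close>.\<close>

lemma exists_trig_approximation:
  fixes g :: "real \<times> real \<Rightarrow> real"
  assumes g: "continuous_on UNIV g" and G: "\<And>x. \<bar>g x\<bar> \<le> G" and R: "R > 0" and e: "e > 0"
  obtains p :: "real \<times> real \<Rightarrow> real" where "trig_fun (\<lambda>x. complex_of_real (p x))" "\<And>x. \<bar>p x\<bar> \<le> G + e"
    "\<And>x. \<bar>fst x\<bar> \<le> R \<Longrightarrow> \<bar>snd x\<bar> \<le> R \<Longrightarrow> \<bar>p x - g x\<bar> \<le> e"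
proof -
  define w where "w = pi / (2 * R)"
  have w: "w > 0" using R by (simp add: w_def)
  let ?S = "{-1..1} \<times> {-1..1} :: (real \<times> real) set"
  let ?g = "\<lambda>z. g (arcsin (fst z) / w, arcsin (snd z) / w)"
  have gS: "continuous_on ?S ?g"
  proof (rule continuous_on_compose2[OF g _ subset_UNIV])
    show "continuous_on ?S (\<lambda>z. (arcsin (fst z) / w, arcsin (snd z) / w))"
      using w by (intro continuous_on_Pair continuous_on_divide continuous_on_arcsin continuous_on_fst
          continuous_on_snd continuous_on_id continuous_on_const) auto
  qed
  have "compact ?S" by (intro compact_Times compact_Icc)
  from Stone_Weierstrass_real_polynomial_function[OF this gS e] obtain q where q: "real_polynomial_function q" "\<And>z. z \<in> ?S \<Longrightarrow> \<bar>?g z - q z\<bar> < e"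
    by blast
  let ?p = "\<lambda>x :: real \<times> real. q (sin (w * fst x), sin (w * snd x))"
  have q2: "\<bar>?g (sin (w * fst x), sin (w * snd x)) - ?p x\<bar> < e" for x
    by (rule q(2)) auto
  show thesis
  proof (rule that[of ?p])
    show "trig_fun (\<lambda>x. complex_of_real (?p x))" by (rule trig_fun_polynomial_sin[OF q(1)])
    show "\<bar>?p x\<bar> \<le> G + e" for x
      using q2[of x] G[of "(arcsin (sin (w * fst x)) / w, arcsin (sin (w * snd x)) / w)"] by auto
    show "\<bar>?p x - g x\<bar> \<le> e" if "\<bar>fst x\<bar> \<le> R" "\<bar>snd x\<bar> \<le> R" for x
    proof -
      have a: "arcsin (sin (w * t)) / w = t" if "\<bar>t\<bar> \<le> R" for t
      proof -
        have "\<bar>w * t\<bar> \<le> w * R" using that w by (simp add: abs_mult)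
        also have "w * R = pi / 2" using R by (simp add: w_def)
        finally have "arcsin (sin (w * t)) = w * t" by (intro arcsin_sin) auto
        then show ?thesis using w by simp
      qed
      have "?g (sin (w * fst x), sin (w * snd x)) = g x" using a that by simp
      then show ?thesis using q2[of x] by auto
    qed
  qed
qed

text \<open>The characteristic functions and moments are known for the leading variables
  \<open>S\<close>, while \<open>U\<close> is close to them in probability. Tightness of
  \<open>U\<close> comes from the second moments of \<open>S\<close> by Chebyshev, and
  characteristic functions pass from \<open>S\<close> to \<open>U\<close> because the exponential is
  Lipschitz and bounded.\<close>

lemma weak_convergence_from_char2:
  fixes P :: "nat \<Rightarrow> 'w measure" and U S :: "nat \<Rightarrow> 'w \<Rightarrow> real \<times> real"
  assumes P: "\<And>n. prob_space (P n)" and U: "\<And>n. U n \<in> borel_measurable (P n)"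
    and S: "\<And>n. S n \<in> borel_measurable (P n)"
    and N: "prob_space N" "sets N = sets borel"
    and conv: "\<And>u. (\<lambda>n. CLINT \<omega>|P n. cis (u \<bullet> S n \<omega>)) \<longlonglongrightarrow> char2 N u"
    and mom_int: "\<And>n. integrable (P n) (\<lambda>\<omega>. (norm (S n \<omega>))\<^sup>2)"
    and mom: "\<And>n. (\<integral>\<omega>. (norm (S n \<omega>))\<^sup>2 \<partial>P n) \<le> C"
    and near: "\<And>\<tau>. \<tau> > 0 \<Longrightarrow> (\<lambda>n. measure (P n) {\<omega>\<in>space (P n). norm (U n \<omega> - S n \<omega>) > \<tau>}) \<longlonglongrightarrow> 0"
    and g: "continuous_on UNIV g" "\<And>x. \<bar>g x\<bar> \<le> G"
  shows "(\<lambda>n. \<integral>\<omega>. g (U n \<omega>) \<partial>P n) \<longlonglongrightarrow> (\<integral>x. g x \<partial>N :: real)"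
proof -
  have convU: "(\<lambda>n. CLINT \<omega>|P n. cis (u \<bullet> U n \<omega>)) \<longlonglongrightarrow> char2 N u" for u
  proof -
    have "(\<lambda>n. (CLINT \<omega>|P n. cis (u \<bullet> U n \<omega>)) - (CLINT \<omega>|P n. cis (u \<bullet> S n \<omega>))) \<longlonglongrightarrow> 0"
    proof (rule LIMSEQ_I)
      fix e :: real assume e: "e > 0"
      define \<tau> where "\<tau> = e / (4 * (norm u + 1))"
      have \<tau>: "\<tau> > 0" using e by (auto simp: \<tau>_def intro!: divide_pos_pos mult_pos_pos add_nonneg_pos)
      have ut: "norm u * \<tau> \<le> e / 4"
      proof -
        have "norm u * \<tau> \<le> (norm u + 1) * \<tau>" using \<tau> by (intro mult_right_mono) auto
        also have "\<dots> = e / 4" using norm_ge_zero[of u] 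
          by (simp add: \<tau>_def divide_simps) (metis add_nonneg_eq_0_iff mult_nonneg_nonneg norm_ge_zero zero_le_numeral zero_neq_numeral)
        finally show ?thesis .
      qed
      obtain n0 where n0: "\<And>n. n \<ge> n0 \<Longrightarrow> measure (P n) {\<omega>\<in>space (P n). norm (U n \<omega> - S n \<omega>) > \<tau>} < e / 8"
        using LIMSEQ_D[OF near[OF \<tau>], of "e / 8"] e by auto
      show "\<exists>no. \<forall>n\<ge>no. norm ((CLINT \<omega>|P n. cis (u \<bullet> U n \<omega>)) - (CLINT \<omega>|P n. cis (u \<bullet> S n \<omega>)) - 0) < e"
      proof (intro exI[of _ n0] allI impI)
        fix n assume n: "n \<ge> n0"
        interpret prob_space "P n" by (rule P)
        note U[measurable] S[measurable]
        have cisc: "continuous_on UNIV (\<lambda>x::real \<times> real. cis (u \<bullet> x))" by (auto intro!: continuous_intros simp: cis_conv_exp)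
        have i1: "integrable (P n) (\<lambda>\<omega>. cis (u \<bullet> U n \<omega>))"
          by (rule integrable_bounded_continuous[OF P U cisc, of 1]) auto
        have i2: "integrable (P n) (\<lambda>\<omega>. cis (u \<bullet> S n \<omega>))"
          by (rule integrable_bounded_continuous[OF P S cisc, of 1]) auto
        let ?A = "{\<omega>\<in>space (P n). norm (U n \<omega> - S n \<omega>) > \<tau>}"
        have bd: "norm (cis (u \<bullet> U n \<omega>) - cis (u \<bullet> S n \<omega>)) \<le> e / 4 + 2 * indicator ?A \<omega>" if "\<omega> \<in> space (P n)" for \<omega>
        proof (cases "\<omega> \<in> ?A")
          case True
          have "norm (cis (u \<bullet> U n \<omega>) - cis (u \<bullet> S n \<omega>)) \<le> 1 + 1"
            by (rule order_trans[OF norm_triangle_ineq4]) simp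
          then show ?thesis using True e by simp
        next
          case False
          have "norm (cis (u \<bullet> U n \<omega>) - cis (u \<bullet> S n \<omega>)) = norm (cis (u \<bullet> S n \<omega>) * (cis (u \<bullet> (U n \<omega> - S n \<omega>)) - 1))"
            by (simp add: right_diff_distrib cis_mult inner_diff_right)
          also have "\<dots> = norm (cis (u \<bullet> (U n \<omega> - S n \<omega>)) - 1)" by (simp add: norm_mult)
          also have "\<dots> \<le> \<bar>u \<bullet> (U n \<omega> - S n \<omega>)\<bar>"
            using iexp_approx1[of "u \<bullet> (U n \<omega> - S n \<omega>)" 0] by (simp add: cis_conv_exp)
          also have "\<dots> \<le> norm u * norm (U n \<omega> - S n \<omega>)" by (rule Cauchy_Schwarz_ineq2)
          also have "\<dots> \<le> norm u * \<tau>" using False that by (intro mult_left_mono) auto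
          finally show ?thesis using ut False by simp
        qed
        have "norm ((CLINT \<omega>|P n. cis (u \<bullet> U n \<omega>)) - (CLINT \<omega>|P n. cis (u \<bullet> S n \<omega>)))
            = norm (CLINT \<omega>|P n. cis (u \<bullet> U n \<omega>) - cis (u \<bullet> S n \<omega>))" using i1 i2 by simp
        also have "\<dots> \<le> (\<integral>\<omega>. norm (cis (u \<bullet> U n \<omega>) - cis (u \<bullet> S n \<omega>)) \<partial>P n)"
          by (rule integral_norm_bound)
        also have "\<dots> \<le> (\<integral>\<omega>. e / 4 + 2 * indicator ?A \<omega> \<partial>P n)"
          using i1 i2 bd by (intro integral_mono integrable_const_add_indicator) auto
        also have "\<dots> = e / 4 + 2 * prob ?A" by (rule integral_const_add_indicator) measurable
        also have "\<dots> < e" using n0[OF n] e by simp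
        finally show "norm ((CLINT \<omega>|P n. cis (u \<bullet> U n \<omega>)) - (CLINT \<omega>|P n. cis (u \<bullet> S n \<omega>)) - 0) < e" by simp
      qed
    qed
    from tendsto_add[OF this conv[of u]] show ?thesis by simp
  qed
  have G0: "G \<ge> 0" using g(2)[of undefined] by linarith
  show ?thesis
  proof (rule LIMSEQ_I)
    fix r :: real assume r: "r > 0"
    \<comment> \<open>The final error consists of three terms e, two from the approximation on the
      ball and one from the convergence for \<open>p\<close>, and of tail terms amounting to 3 (2G +
      1) e. Together this is (6G + 6) e, at most 3r/20.\<close>
    define e where "e = min 1 (r / (20 * (2 * G + 1 + 1)))"
    have e: "e > 0" "e \<le> 1" using r G0 by (auto simp: e_def)
    have eG: "(2 * G + 1 + 1) * e \<le> r / 20"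
    proof -
      have "(2 * G + 1 + 1) * e \<le> (2 * G + 1 + 1) * (r / (20 * (2 * G + 1 + 1)))"
        using G0 by (intro mult_left_mono) (auto simp: e_def)
      also have "\<dots> = r / 20" using G0 by (simp add: divide_simps)
      finally show ?thesis .
    qed
    interpret N: prob_space N by (rule N)
    have mN: "(\<lambda>x. x) \<in> borel_measurable N" using N(2) by (simp add: measurable_ident_sets)
    have "(\<lambda>n. N.prob {x\<in>space N. norm x > real n}) \<longlonglongrightarrow> N.prob (\<Inter>n. {x\<in>space N. norm x > real n})"
    proof (rule N.finite_Lim_measure_decseq)
      show "range (\<lambda>n. {x\<in>space N. norm x > real n}) \<subseteq> N.events" using mN by auto
      show "decseq (\<lambda>n. {x\<in>space N. norm x > real n})" unfolding decseq_def by force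
    qed
    moreover have "(\<Inter>n. {x\<in>space N. norm x > real n}) = {}"
    proof (rule equals0I)
      fix x assume x: "x \<in> (\<Inter>n. {x\<in>space N. norm x > real n})"
      obtain k where "norm x < real k" using reals_Archimedean2 by blast
      moreover have "norm x > real k" using x by blast
      ultimately show False by simp
    qed
    ultimately have "(\<lambda>n. N.prob {x\<in>space N. norm x > real n}) \<longlonglongrightarrow> 0" by simp
    from LIMSEQ_D[OF this e(1)] obtain n1 where n1: "\<And>n. n \<ge> n1 \<Longrightarrow> N.prob {x\<in>space N. norm x > real n} < e"
      by auto
    \<comment> \<open>\<open>m\<close> handles the tail of the limit law and, by Chebyshev, that of
      \<open>S\<close>; the radius \<open>R\<close> has one unit more, left to the difference of
      \<open>U\<close> and \<open>S\<close>.\<close>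
    define m where "m = max n1 (nat \<lceil>C / e\<rceil> + 1)"
    define R where "R = real m + 1"
    have m1: "real m \<ge> 1" by (auto simp: m_def)
    have R0: "R > 0" by (auto simp: R_def)
    have RN: "N.prob {x\<in>space N. norm x > R} \<le> e"
    proof -
      have "N.prob {x\<in>space N. norm x > R} \<le> N.prob {x\<in>space N. norm x > real m}"
        using mN by (intro N.finite_measure_mono) (auto simp: R_def)
      also have "\<dots> < e" by (rule n1) (simp add: m_def)
      finally show ?thesis by simp
    qed
    have mC: "C / (real m)\<^sup>2 \<le> e"
    proof -
      have "C / e \<le> real m" unfolding m_def by linarith
      then have "C \<le> e * real m" using e by (simp add: field_simps)
      also have "\<dots> \<le> e * (real m)\<^sup>2" using m1 e by (simp add: power2_eq_square)
      finally show ?thesis using m1 by (simp add: field_simps)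
    qed
    obtain n2 where n2: "\<And>n. n \<ge> n2 \<Longrightarrow> measure (P n) {\<omega>\<in>space (P n). norm (U n \<omega> - S n \<omega>) > 1} < e"
      using LIMSEQ_D[OF near[of 1], of e] e by auto
    have RU: "measure (P n) {\<omega>\<in>space (P n). norm (U n \<omega>) > R} \<le> 2 * e" if n: "n \<ge> n2" for n
    proof -
      interpret prob_space "P n" by (rule P)
      note U[measurable] S[measurable]
      have "prob {\<omega>\<in>space (P n). norm (U n \<omega>) > R} \<le>
          prob ({\<omega>\<in>space (P n). norm (U n \<omega> - S n \<omega>) > 1} \<union> {\<omega>\<in>space (P n). (norm (S n \<omega>))\<^sup>2 \<ge> (real m)\<^sup>2})"
      proof (rule finite_measure_mono)
        show "{\<omega>\<in>space (P n). norm (U n \<omega>) > R} \<subseteq>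
          {\<omega>\<in>space (P n). norm (U n \<omega> - S n \<omega>) > 1} \<union> {\<omega>\<in>space (P n). (norm (S n \<omega>))\<^sup>2 \<ge> (real m)\<^sup>2}"
        proof safe
          fix \<omega> assume h: "norm (U n \<omega>) > R" "\<not> (real m)\<^sup>2 \<le> (norm (S n \<omega>))\<^sup>2"
          then have "norm (S n \<omega>) < real m" using power_mono[of "real m" "norm (S n \<omega>)" 2] by linarith
          moreover have "norm (U n \<omega>) \<le> norm (U n \<omega> - S n \<omega>) + norm (S n \<omega>)"
            by (metis diff_add_cancel norm_triangle_ineq)
          ultimately show "norm (U n \<omega> - S n \<omega>) > 1" using h by (simp add: R_def)
        qed
        show "{\<omega>\<in>space (P n). norm (U n \<omega> - S n \<omega>) > 1} \<union> {\<omega>\<in>space (P n). (norm (S n \<omega>))\<^sup>2 \<ge> (real m)\<^sup>2} \<in> events"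
          by measurable
      qed
      also have "\<dots> \<le> prob {\<omega>\<in>space (P n). norm (U n \<omega> - S n \<omega>) > 1} + prob {\<omega>\<in>space (P n). (norm (S n \<omega>))\<^sup>2 \<ge> (real m)\<^sup>2}"
        by (intro measure_Un_le) measurable
      also have "prob {\<omega>\<in>space (P n). (norm (S n \<omega>))\<^sup>2 \<ge> (real m)\<^sup>2} \<le> (\<integral>\<omega>. (norm (S n \<omega>))\<^sup>2 \<partial>P n) / (real m)\<^sup>2"
        by (intro integral_Markov_inequality_measure[where A="{}", simplified]) (use mom_int m1 in auto)
      also have "\<dots> \<le> C / (real m)\<^sup>2" using mom by (intro divide_right_mono) auto
      finally show ?thesis using mC n2[OF n] by simp
    qed
    obtain p where p: "trig_fun (\<lambda>x. complex_of_real (p x))" "\<And>x. \<bar>p x\<bar> \<le> G + e"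
      "\<And>x. \<bar>fst x\<bar> \<le> R \<Longrightarrow> \<bar>snd x\<bar> \<le> R \<Longrightarrow> \<bar>p x - g x\<bar> \<le> e"
      using exists_trig_approximation[OF g R0 e(1)] by blast
    have pc: "continuous_on UNIV p"
      using continuous_on_Re[OF trig_fun_continuous[OF p(1)]] by simp
    have pg: "\<bar>g x - p x\<bar> \<le> e + (2 * G + 1) * indicator {x. norm x > R} x" for x
    proof (cases "norm x > R")
      case True
      then show ?thesis using p(2)[of x] g(2)[of x] e by auto
    next
      case False
      then have "\<bar>fst x\<bar> \<le> R" "\<bar>snd x\<bar> \<le> R" using norm_fst_le[of "fst x" "snd x"] norm_snd_le[of "snd x" "fst x"] by auto
      then show ?thesis using p(3)[of x] False by (auto simp: abs_minus_commute)
    qed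
    note diff = integral_diff_le_off_ball[OF _ _ g pc p(2) pg]
    have "(\<lambda>n. CLINT \<omega>|P n. complex_of_real (p (U n \<omega>))) \<longlonglongrightarrow> (CLINT x|N. complex_of_real (p x))"
      by (rule trig_fun_tendsto[OF P U N convU p(1)])
    then have "(\<lambda>n. \<integral>\<omega>. p (U n \<omega>) \<partial>P n) \<longlonglongrightarrow> (\<integral>x. p x \<partial>N)"
      by (simp add: tendsto_of_real_iff)
    from LIMSEQ_D[OF this e(1)] obtain n3 where n3: "\<And>n. n \<ge> n3 \<Longrightarrow> \<bar>(\<integral>\<omega>. p (U n \<omega>) \<partial>P n) - (\<integral>x. p x \<partial>N)\<bar> < e"
      by auto
    show "\<exists>no. \<forall>n\<ge>no. norm ((\<integral>\<omega>. g (U n \<omega>) \<partial>P n) - (\<integral>x. g x \<partial>N)) < r"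
    proof (intro exI[of _ "max n2 n3"] allI impI)
      fix n assume "n \<ge> max n2 n3"
      then have n: "n \<ge> n2" "n \<ge> n3" by auto
      have "(2 * G + 1) * measure (P n) {\<omega>\<in>space (P n). norm (U n \<omega>) > R} \<le> (2 * G + 1) * (2 * e)"
        using RU[OF n(1)] G0 by (intro mult_left_mono) auto
      moreover have "(2 * G + 1) * measure N {x\<in>space N. norm x > R} \<le> (2 * G + 1) * e"
        using RN G0 by (intro mult_left_mono) auto
      moreover have "\<bar>(\<integral>\<omega>. g (U n \<omega>) \<partial>P n) - (\<integral>\<omega>. p (U n \<omega>) \<partial>P n)\<bar> \<le> e + (2 * G + 1) * measure (P n) {\<omega>\<in>space (P n). norm (U n \<omega>) > R}"
        by (rule diff[OF P U])
      moreover have "\<bar>(\<integral>x. g x \<partial>N) - (\<integral>x. p x \<partial>N)\<bar> \<le> e + (2 * G + 1) * measure N {x\<in>space N. norm x > R}"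
        by (rule diff[OF N(1) mN])
      moreover have "(2 * G + 1) * (2 * e) + (2 * G + 1) * e + 3 * e < r"
        using eG r by (simp add: algebra_simps)
      ultimately show "norm ((\<integral>\<omega>. g (U n \<omega>) \<partial>P n) - (\<integral>x. g x \<partial>N)) < r"
        using n3[OF n(2)] unfolding real_norm_def by linarith
    qed
  qed
qed

text \<open>Cholesky factorisation: the law is the image of two independent standard normals under
  the lower triangular matrix with rows (a, 0) and (b, c), so that a^2 = s11, a b = s12 and b^2 +
  c^2 = s22. The determinant condition is what makes \<open>c\<close> real; \<open>c = 0\<close> is
  permitted.\<close>

lemma exists_gaussian2:
  assumes s11: "s11 > 0" and psd: "s12\<^sup>2 \<le> s11 * s22"
  shows "\<exists>N. is_gaussian2 N s11 s12 s22"
proof -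
  define a b c where "a = sqrt s11" and "b = s12 / a" and "c = sqrt (s22 - b\<^sup>2)"
  have a: "a > 0" "a\<^sup>2 = s11" using s11 by (auto simp: a_def)
  have ab: "a * b = s12" using a by (simp add: b_def)
  have "b\<^sup>2 = s12\<^sup>2 / s11" using a by (simp add: b_def power_divide)
  then have "b\<^sup>2 \<le> s22" using psd s11 by (simp add: pos_divide_le_eq mult.commute)
  then have c: "c\<^sup>2 = s22 - b\<^sup>2" by (simp add: c_def)
  interpret S: prob_space std_normal_distribution by (rule prob_space_normal_density) simp
  interpret SS: pair_prob_space std_normal_distribution std_normal_distribution ..
  let ?P = "std_normal_distribution \<Otimes>\<^sub>M std_normal_distribution"
  let ?f = "\<lambda>z :: real \<times> real. (a * fst z, b * fst z + c * snd z)"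
  have f[measurable]: "?f \<in> borel_measurable ?P" by measurable
  have "char2 (distr ?P borel ?f) u =
      complex_of_real (exp (- (s11 * (fst u)\<^sup>2 + 2 * s12 * fst u * snd u + s22 * (snd u)\<^sup>2) / 2))" for u
  proof -
    let ?p = "fst u * a + snd u * b" and ?q = "snd u * c"
    have cm: "cis \<in> borel_measurable borel" by (intro borel_measurable_continuous_onI) (auto intro!: continuous_intros simp: cis_conv_exp)
    have i: "integrable std_normal_distribution (\<lambda>x. cis (t * x))" for t
      by (rule S.integrable_const_bound[where B=1]) (use cm in \<open>auto intro!: measurable_compose[OF _ cm]\<close>)
    have "char2 (distr ?P borel ?f) u = (CLINT z|?P. cis (u \<bullet> ?f z))"
      unfolding char2_def by (rule integral_distr[OF f]) (auto intro!: borel_measurable_continuous_onI continuous_intros simp: cis_conv_exp)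
    also have "\<dots> = (CLINT z|?P. cis (?p * fst z) * cis (?q * snd z))"
      by (intro Bochner_Integration.integral_cong refl) (simp add: cis_mult inner_prod_def algebra_simps)
    also have "\<dots> = (CLINT x|std_normal_distribution. CLINT y|std_normal_distribution. cis (?p * x) * cis (?q * y))"
    proof (subst SS.integral_fst'[symmetric])
      show "integrable ?P (\<lambda>z. cis (?p * fst z) * cis (?q * snd z))"
        by (rule SS.integrable_const_bound[where B=1]) (auto simp: norm_mult intro!: borel_measurable_times measurable_compose[OF _ cm])
    qed simp
    also have "\<dots> = char std_normal_distribution ?p * char std_normal_distribution ?q"
      unfolding char_def by (simp add: cis_conv_exp)
    also have "\<dots> = complex_of_real (exp (- (?p\<^sup>2) / 2) * exp (- (?q\<^sup>2) / 2))"
      by (simp add: char_std_normal_distribution)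
    also have "exp (- (?p\<^sup>2) / 2) * exp (- (?q\<^sup>2) / 2) = exp (- (s11 * (fst u)\<^sup>2 + 2 * s12 * fst u * snd u + s22 * (snd u)\<^sup>2) / 2)"
    proof -
      have "?p\<^sup>2 + ?q\<^sup>2 = a\<^sup>2 * (fst u)\<^sup>2 + 2 * (a * b) * fst u * snd u + (b\<^sup>2 + c\<^sup>2) * (snd u)\<^sup>2"
        by (simp add: power2_eq_square algebra_simps)
      also have "\<dots> = s11 * (fst u)\<^sup>2 + 2 * s12 * fst u * snd u + s22 * (snd u)\<^sup>2"
        using a ab c by simp
      finally show ?thesis by (simp add: exp_add[symmetric] add_divide_distrib[symmetric])
    qed
    finally show ?thesis .
  qed
  then show ?thesis
    unfolding is_gaussian2_def by (intro exI[of _ "distr ?P borel ?f"]) (auto intro!: SS.prob_space_distr)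
qed

subsection \<open>Laws with a bounded Lipschitz density\<close>

text \<open>The integrand of \<open>Vfun\<close>: \<open>H2 \<alpha> \<xi> ch x\<close> equals
  \<open>ch - Jfun \<alpha> \<xi> x\<close>, so the second component of the scheme is a running
  average of these values.\<close>

definition Jfun :: "real \<Rightarrow> real \<Rightarrow> real \<Rightarrow> real" where
  "Jfun \<alpha> \<xi> x = \<xi> + 1 / (1 - \<alpha>) * max (x - \<xi>) 0"

text \<open>The derivative V' written through the cdf. It enters as the mean of \<open>H1\<close>
  and as a subgradient, so no differentiation under the integral occurs.\<close>

definition dVfun :: "real \<Rightarrow> real measure \<Rightarrow> real \<Rightarrow> real" where
  "dVfun \<alpha> \<mu> \<xi> = (measure \<mu> {..\<xi>} - \<alpha>) / (1 - \<alpha>)"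

text \<open>One number \<open>C\<close> bounds both the density and its Lipschitz constant, so that
  constants formed from \<alpha> and \<open>C\<close> serve a whole family of laws.\<close>

locale lipschitz_law =
  fixes \<alpha> :: real and \<mu> :: "real measure" and f :: "real \<Rightarrow> real" and C :: real
  assumes alpha: "0 < \<alpha>" "\<alpha> < 1"
    and mu: "\<mu> = density lborel (\<lambda>x. ennreal (f x))" and mu_prob: "prob_space \<mu>"
    and f_meas [measurable]: "f \<in> borel_measurable borel"
    and f_nonneg: "\<And>x. 0 \<le> f x" and f_le: "\<And>x. f x \<le> C"
    and f_lip: "\<And>x y. \<bar>f x - f y\<bar> \<le> C * \<bar>x - y\<bar>"
    and mu_L1: "integrable \<mu> (\<lambda>x. x)"
begin

abbreviation F where "F x \<equiv> measure \<mu> {..x}"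

lemma sets_mu [simp, measurable_cong]: "sets \<mu> = sets borel" by (simp add: mu)
lemma space_mu [simp]: "space \<mu> = UNIV" by (simp add: mu)

lemma C_nonneg: "0 \<le> C" using f_nonneg[of 0] f_le[of 0] by linarith

sublocale real_distribution \<mu>
  using mu_prob by (auto simp: real_distribution_def real_distribution_axioms_def)

lemma prob_UNIV [simp]: "measure \<mu> UNIV = 1" using prob_space by simp

lemma prob_eq_integral:
  assumes [measurable]: "A \<in> sets borel"
  shows "integrable lborel (\<lambda>x. f x * indicator A x)" "measure \<mu> A = (\<integral>x. f x * indicator A x \<partial>lborel)"
proof -
  have i: "integrable \<mu> (indicator A :: real \<Rightarrow> real)" by (auto simp: emeasure_eq_measure)
  then show "integrable lborel (\<lambda>x. f x * indicator A x)"
    unfolding mu by (subst (asm) integrable_density) (auto simp: f_nonneg)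
  have "measure \<mu> A = (\<integral>x. indicator A x \<partial>\<mu>)" by simp
  also have "\<dots> = (\<integral>x. f x * indicator A x \<partial>lborel)"
    unfolding mu by (subst integral_density) (auto simp: f_nonneg)
  finally show "measure \<mu> A = (\<integral>x. f x * indicator A x \<partial>lborel)" .
qed

lemma cdf_diff: "a \<le> b \<Longrightarrow> F b - F a = measure \<mu> {a<..b}"
proof -
  assume "a \<le> b"
  then have "{..b} - {..a} = {a<..b}" "{..a} \<subseteq> {..b}" by auto
  then show ?thesis using finite_measure_Diff[of "{..b}" "{..a}"] by simp
qed

text \<open>Source of the estimates on the cdf: the bounds 0 and \<open>C\<close> give its Lipschitz
  constant, \<open>f a\<close> plus or minus \<open>C * \<bar>b - a\<bar>\<close> its linearisation,
  and the minimum of a positive density its strict growth.\<close>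

lemma prob_interval_bounds:
  assumes ab: "a \<le> b" and m: "\<And>x. a < x \<Longrightarrow> x \<le> b \<Longrightarrow> l \<le> f x \<and> f x \<le> u"
  shows "l * (b - a) \<le> F b - F a" "F b - F a \<le> u * (b - a)"
proof -
  have i: "integrable lborel (\<lambda>x. c * indicator {a<..b} x :: real)" for c
    using ab by (intro integrable_mult_right integrable_real_indicator) auto
  have e: "(\<integral>x. c * indicator {a<..b} x \<partial>lborel) = c * (b - a)" for c :: real using ab by simp
  have "(\<integral>x. l * indicator {a<..b} x \<partial>lborel) \<le> (\<integral>x. f x * indicator {a<..b} x \<partial>lborel)"
    by (rule integral_mono[OF i prob_eq_integral(1)]) (use m in \<open>auto simp: indicator_def\<close>)
  then show "l * (b - a) \<le> F b - F a" using e ab by (simp add: cdf_diff prob_eq_integral(2)[of "{a<..b}"])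
  have "(\<integral>x. f x * indicator {a<..b} x \<partial>lborel) \<le> (\<integral>x. u * indicator {a<..b} x \<partial>lborel)"
    by (rule integral_mono[OF prob_eq_integral(1) i]) (use m in \<open>auto simp: indicator_def\<close>)
  then show "F b - F a \<le> u * (b - a)" using e ab by (simp add: cdf_diff prob_eq_integral(2)[of "{a<..b}"])
qed

lemma cdf_mono: "a \<le> b \<Longrightarrow> F a \<le> F b"
  by (intro finite_measure_mono) auto

lemma cdf_lipschitz: "\<bar>F a - F b\<bar> \<le> C * \<bar>a - b\<bar>"
proof (cases "a \<le> b")
  case True
  then show ?thesis using prob_interval_bounds[of a b 0 C] cdf_mono[of a b] f_nonneg f_le by auto
next
  case False
  then show ?thesis using prob_interval_bounds[of b a 0 C] cdf_mono[of b a] f_nonneg f_le by auto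
qed

lemma cdf_linearization: "\<bar>F b - F a - f a * (b - a)\<bar> \<le> C * (b - a)\<^sup>2"
proof -
  have d: "f a - C * \<bar>b - a\<bar> \<le> f x \<and> f x \<le> f a + C * \<bar>b - a\<bar>" if "\<bar>x - a\<bar> \<le> \<bar>b - a\<bar>" for x
    using f_lip[of x a] mult_left_mono[OF that C_nonneg] by linarith
  show ?thesis
  proof (cases "a \<le> b")
    case True
    then show ?thesis
      using prob_interval_bounds[OF True, of "f a - C * \<bar>b - a\<bar>" "f a + C * \<bar>b - a\<bar>"] d
      by (auto simp: algebra_simps power2_eq_square abs_le_iff)
  next
    case False
    then have "b \<le> a" by simp
    from prob_interval_bounds[OF this, of "f a - C * \<bar>b - a\<bar>" "f a + C * \<bar>b - a\<bar>"] d False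
    show ?thesis by (auto simp: algebra_simps power2_eq_square abs_le_iff)
  qed
qed

lemma prob_singleton: "measure \<mu> {a} = 0"
proof -
  have "AE x in lborel. x \<in> {a} \<longrightarrow> ennreal (f x) = 0"
    using AE_lborel_singleton[of a] by (rule eventually_mono) auto
  then have "{a} \<in> null_sets \<mu>"
    unfolding mu by (subst null_sets_density_iff) auto
  then show ?thesis by (simp add: null_sets_def measure_def)
qed

lemma prob_atLeast: "measure \<mu> {a..} = 1 - F a"
proof -
  have "measure \<mu> {a..} = measure \<mu> ({a} \<union> {a<..})" by (rule arg_cong[where f="measure \<mu>"]) auto
  also have "\<dots> = measure \<mu> {a<..}"
    by (subst finite_measure_Union) (auto simp: prob_singleton)
  also have "\<dots> = 1 - F a"
    using prob_compl[of "{..a}"] by (simp add: Compl_eq_Diff_UNIV[symmetric] Compl_atMost)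
  finally show ?thesis .
qed

lemma integrable_shift [simp]: "integrable \<mu> (\<lambda>x. x - \<xi>)" using mu_L1 by simp

lemma integrable_pos_part [simp]: "integrable \<mu> (\<lambda>x. max (x - \<xi>) 0)"
  by (rule Bochner_Integration.integrable_bound[OF integrable_shift[of \<xi>]]) auto

lemma integrable_Jfun [simp]: "integrable \<mu> (Jfun \<alpha> \<xi>)"
  unfolding Jfun_def[abs_def] by simp

lemma integral_Jfun: "(\<integral>x. Jfun \<alpha> \<xi> x \<partial>\<mu>) = Vfun \<alpha> \<mu> \<xi>"
  unfolding Jfun_def Vfun_def by (subst Bochner_Integration.integral_add) (auto simp: prob_space)

lemma H1_indicator: "H1 \<alpha> \<xi> x = 1 - 1 / (1 - \<alpha>) * indicator {\<xi>..} x"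
  by (simp add: H1_def indicator_def)

lemma integrable_ind [simp]: "A \<in> sets borel \<Longrightarrow> integrable \<mu> (indicator A :: real \<Rightarrow> real)"
  by (auto simp: emeasure_eq_measure)

lemma integrable_H1 [simp]: "integrable \<mu> (H1 \<alpha> \<xi>)"
  unfolding H1_indicator[abs_def] by simp

lemma integral_H1: "(\<integral>x. H1 \<alpha> \<xi> x \<partial>\<mu>) = dVfun \<alpha> \<mu> \<xi>"
proof -
  have "(\<integral>x. H1 \<alpha> \<xi> x \<partial>\<mu>) = 1 - 1 / (1 - \<alpha>) * measure \<mu> {\<xi>..}"
    unfolding H1_indicator by (subst Bochner_Integration.integral_diff) (auto simp: prob_space)
  also have "\<dots> = dVfun \<alpha> \<mu> \<xi>" using alpha by (simp add: prob_atLeast dVfun_def field_simps)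
  finally show ?thesis .
qed

text \<open>For every sample \<open>H1\<close> is a subgradient of the convex function \<xi>
  \<mapsto> \<open>Jfun \<alpha> \<xi> x\<close>, and the pointwise inequality is integrated.
  Minimality of the quantile, the Lipschitz bound and the quadratic excess of \<open>Vfun\<close>
  all follow from it.\<close>

lemma Vfun_subgradient: "Vfun \<alpha> \<mu> \<xi> + dVfun \<alpha> \<mu> \<xi> * (\<eta> - \<xi>) \<le> Vfun \<alpha> \<mu> \<eta>"
proof -
  have "Jfun \<alpha> \<xi> x + H1 \<alpha> \<xi> x * (\<eta> - \<xi>) \<le> Jfun \<alpha> \<eta> x" for x
  proof -
    have "max (x - \<xi>) 0 - (if x \<ge> \<xi> then 1 else 0) * (\<eta> - \<xi>) \<le> max (x - \<eta>) 0" by auto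
    then have "1 / (1 - \<alpha>) * (max (x - \<xi>) 0 - (if x \<ge> \<xi> then 1 else 0) * (\<eta> - \<xi>)) \<le> 1 / (1 - \<alpha>) * max (x - \<eta>) 0"
      using alpha by (intro mult_left_mono) auto
    then show ?thesis unfolding Jfun_def H1_def by (simp only: algebra_simps)
  qed
  then have "(\<integral>x. Jfun \<alpha> \<xi> x + H1 \<alpha> \<xi> x * (\<eta> - \<xi>) \<partial>\<mu>) \<le> (\<integral>x. Jfun \<alpha> \<eta> x \<partial>\<mu>)"
    by (intro integral_mono) auto
  then show ?thesis by (simp add: integral_Jfun integral_H1)
qed

lemma quantile_is_minimizer: "F m = \<alpha> \<Longrightarrow> is_minimizer (Vfun \<alpha> \<mu>) m"
  using Vfun_subgradient[of m] by (auto simp: is_minimizer_def dVfun_def)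

lemma exists_quantile: "\<exists>m. F m = \<alpha>"
proof -
  have "continuous_on UNIV F"
    using C_nonneg cdf_lipschitz by (intro lipschitz_on_continuous_on[of C]) (auto simp: lipschitz_on_def dist_real_def)
  then have c: "continuous_on {a..b} F" for a b by (rule continuous_on_subset) auto
  have "\<forall>\<^sub>F x in at_bot. cdf \<mu> x < \<alpha>" using cdf_lim_at_bot alpha by (intro order_tendstoD) auto
  then obtain a where a: "\<And>x. x \<le> a \<Longrightarrow> F x < \<alpha>" by (auto simp: eventually_at_bot_linorder cdf_def)
  have "\<forall>\<^sub>F x in at_top. cdf \<mu> x > \<alpha>" using cdf_lim_at_top_prob alpha by (intro order_tendstoD) auto
  then obtain b where b: "\<And>x. x \<ge> b \<Longrightarrow> F x > \<alpha>" by (auto simp: eventually_at_top_linorder cdf_def)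
  have "a \<le> b" using a[of a] b[of a] by (cases "a \<le> b") auto
  then show ?thesis using IVT'[of F a \<alpha> b] a[of a] b[of b] c by auto
qed

lemma abs_H1_le: "\<bar>H1 \<alpha> \<xi> x\<bar> \<le> 1 / (1 - \<alpha>)"
proof -
  have "1 \<le> 1 / (1 - \<alpha>)" using alpha by (simp add: field_simps)
  then show ?thesis by (auto simp: H1_def)
qed

lemma abs_dVfun_le: "\<bar>dVfun \<alpha> \<mu> \<xi>\<bar> \<le> 1 / (1 - \<alpha>)"
proof -
  have "\<bar>F \<xi> - \<alpha>\<bar> \<le> 1" using alpha prob_le_1[of "{..\<xi>}"] measure_nonneg[of \<mu> "{..\<xi>}"] by linarith
  then show ?thesis using alpha by (simp add: dVfun_def divide_right_mono)
qed

text \<open>The difference of two indicators of half lines squares to the indicator of the interval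
  between them, so the bound is linear in the distance. This loss, compared with a Lipschitz noise,
  determines the rate of the martingale remainder.\<close>

lemma H1_diff_square: "(\<integral>x. (H1 \<alpha> \<xi> x - H1 \<alpha> \<eta> x)\<^sup>2 \<partial>\<mu>) \<le> C / (1 - \<alpha>)\<^sup>2 * \<bar>\<xi> - \<eta>\<bar>"
proof -
  define a b where "a = min \<xi> \<eta>" and "b = max \<xi> \<eta>"
  have ab: "a \<le> b" "b - a = \<bar>\<xi> - \<eta>\<bar>" by (auto simp: a_def b_def)
  have "(H1 \<alpha> \<xi> x - H1 \<alpha> \<eta> x)\<^sup>2 = 1 / (1 - \<alpha>)\<^sup>2 * (indicator {a..} x - indicator {b..} x)" for x
    using alpha by (auto simp: H1_def a_def b_def indicator_def power2_eq_square)
  then have "(\<integral>x. (H1 \<alpha> \<xi> x - H1 \<alpha> \<eta> x)\<^sup>2 \<partial>\<mu>) = 1 / (1 - \<alpha>)\<^sup>2 * (measure \<mu> {a..} - measure \<mu> {b..})"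
    by (simp add: Bochner_Integration.integral_diff)
  also have "\<dots> = 1 / (1 - \<alpha>)\<^sup>2 * (F b - F a)" by (simp add: prob_atLeast)
  also have "\<dots> \<le> 1 / (1 - \<alpha>)\<^sup>2 * (C * \<bar>\<xi> - \<eta>\<bar>)"
    using cdf_lipschitz[of b a] ab by (intro mult_left_mono) auto
  finally show ?thesis by simp
qed

end

text \<open>Positivity makes the quantile unique, so that the definite description in
  \<open>xi_star\<close> denotes it.\<close>

locale positive_law = lipschitz_law +
  assumes f_pos: "\<And>x. 0 < f x"
begin

lemma cdf_strict_mono:
  assumes "a < b" shows "F a < F b"
proof -
  have "continuous_on {a..b} f"
    using C_nonneg f_lip by (intro lipschitz_on_continuous_on[of C]) (auto simp: lipschitz_on_def dist_real_def)
  then obtain c where c: "\<And>x. x \<in> {a..b} \<Longrightarrow> f c \<le> f x"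
    using continuous_attains_inf[of "{a..b}" f] assms by (metis atLeastAtMost_iff compact_Icc empty_iff less_imp_le order_refl)
  have "f c * (b - a) \<le> F b - F a"
    using prob_interval_bounds(1)[of a b "f c" C] c f_le assms by auto
  then show ?thesis using f_pos[of c] assms by (smt (verit) mult_pos_pos)
qed

lemma xi_star: "F (xi_star \<alpha> \<mu>) = \<alpha>"
proof -
  obtain m where m: "F m = \<alpha>" using exists_quantile by blast
  have "xi_star \<alpha> \<mu> = m" unfolding xi_star_def
  proof (rule the_equality)
    show "is_minimizer (Vfun \<alpha> \<mu>) m" by (rule quantile_is_minimizer[OF m])
    fix k assume k: "is_minimizer (Vfun \<alpha> \<mu>) k"
    show "k = m"
    proof (rule ccontr)
      assume ne: "k \<noteq> m"
      \<comment> \<open>The slope at the midpoint has the sign of \<open>k - ?c\<close>, because the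
        midpoint lies on the side of the quantile \<open>m\<close> where \<open>k\<close> is. The
        subgradient inequality at the midpoint then puts the value there strictly below the value at
        \<open>k\<close>.\<close>
      let ?c = "(k + m) / 2"
      have "dVfun \<alpha> \<mu> ?c * (k - ?c) > 0"
      proof (cases "k > m")
        case True
        then have "F ?c > \<alpha>" using cdf_strict_mono[of m ?c] m by simp
        then show ?thesis using True alpha by (auto simp: dVfun_def intro!: mult_pos_pos divide_pos_pos)
      next
        case False
        then have "F ?c < \<alpha>" using cdf_strict_mono[of ?c m] m ne by simp
        then have "dVfun \<alpha> \<mu> ?c < 0" using alpha by (simp add: dVfun_def divide_neg_pos)
        moreover have "k - ?c < 0" using False ne by (simp add: field_simps)
        ultimately show ?thesis by (rule mult_neg_neg)
      qed
      then have "Vfun \<alpha> \<mu> ?c < Vfun \<alpha> \<mu> k" using Vfun_subgradient[of ?c k] by linarith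
      then show False using k by (auto simp: is_minimizer_def not_less[symmetric])
    qed
  qed
  then show ?thesis using m by simp
qed

abbreviation xs where "xs \<equiv> xi_star \<alpha> \<mu>"

lemma dVfun_linearization:
  "\<bar>dVfun \<alpha> \<mu> \<xi> - f xs / (1 - \<alpha>) * (\<xi> - xs)\<bar> \<le> C / (1 - \<alpha>) * (\<xi> - xs)\<^sup>2"
proof -
  have "\<bar>F \<xi> - F xs - f xs * (\<xi> - xs)\<bar> / (1 - \<alpha>) \<le> C * (\<xi> - xs)\<^sup>2 / (1 - \<alpha>)"
    using cdf_linearization[of \<xi> xs] alpha by (intro divide_right_mono) auto
  moreover have "dVfun \<alpha> \<mu> \<xi> - f xs / (1 - \<alpha>) * (\<xi> - xs) = (F \<xi> - F xs - f xs * (\<xi> - xs)) / (1 - \<alpha>)"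
    by (simp add: dVfun_def xi_star diff_divide_distrib)
  ultimately show ?thesis using alpha by (simp add: abs_divide)
qed

lemma dVfun_zero: "dVfun \<alpha> \<mu> xs = 0" by (simp add: dVfun_def xi_star)

lemma dVfun_mono: "\<xi> \<le> \<eta> \<Longrightarrow> dVfun \<alpha> \<mu> \<xi> \<le> dVfun \<alpha> \<mu> \<eta>"
  using cdf_mono alpha by (simp add: dVfun_def divide_right_mono)

text \<open>The subgradient inequality at \<xi> bounds the excess by V'(\<xi>) (\<xi> - xs), and V'
  vanishes at \<open>xs\<close> and is Lipschitz along with the cdf. Thus the bias caused by a wrong
  threshold is of second order in the error of the quantile.\<close>

lemma Vfun_excess: "0 \<le> Vfun \<alpha> \<mu> \<xi> - Vfun \<alpha> \<mu> xs" "Vfun \<alpha> \<mu> \<xi> - Vfun \<alpha> \<mu> xs \<le> C / (1 - \<alpha>) * (\<xi> - xs)\<^sup>2"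
proof -
  show "0 \<le> Vfun \<alpha> \<mu> \<xi> - Vfun \<alpha> \<mu> xs" using Vfun_subgradient[of xs \<xi>] by (simp add: dVfun_zero)
  have "Vfun \<alpha> \<mu> \<xi> - Vfun \<alpha> \<mu> xs \<le> dVfun \<alpha> \<mu> \<xi> * (\<xi> - xs)"
    using Vfun_subgradient[of \<xi> xs] by (simp add: algebra_simps)
  also have "\<dots> \<le> \<bar>dVfun \<alpha> \<mu> \<xi>\<bar> * \<bar>\<xi> - xs\<bar>" by (metis abs_ge_self abs_mult)
  also have "\<bar>dVfun \<alpha> \<mu> \<xi>\<bar> = \<bar>F \<xi> - F xs\<bar> / (1 - \<alpha>)" using alpha by (simp add: dVfun_def xi_star)
  also have "\<dots> \<le> C * \<bar>\<xi> - xs\<bar> / (1 - \<alpha>)" using cdf_lipschitz alpha by (intro divide_right_mono) auto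
  finally show "Vfun \<alpha> \<mu> \<xi> - Vfun \<alpha> \<mu> xs \<le> C / (1 - \<alpha>) * (\<xi> - xs)\<^sup>2"
    by (simp add: power2_eq_square mult_right_mono mult.assoc)
qed

lemma chi_star_eq: "chi_star \<alpha> \<mu> - xs = 1 / (1 - \<alpha>) * (\<integral>x. max (x - xs) 0 \<partial>\<mu>)"
  by (simp add: chi_star_def Vfun_def)

lemma H1_star_moments:
  "(\<integral>x. H1 \<alpha> xs x \<partial>\<mu>) = 0"
  "(\<integral>x. (H1 \<alpha> xs x)\<^sup>2 \<partial>\<mu>) = \<alpha> / (1 - \<alpha>)"
  "(\<integral>x. H1 \<alpha> xs x * (Jfun \<alpha> xs x - Vfun \<alpha> \<mu> xs) \<partial>\<mu>) = - (\<alpha> / (1 - \<alpha>) * (chi_star \<alpha> \<mu> - xs))"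
  "integrable \<mu> (\<lambda>x. H1 \<alpha> xs x * (Jfun \<alpha> xs x - Vfun \<alpha> \<mu> xs))"
proof -
  show z: "(\<integral>x. H1 \<alpha> xs x \<partial>\<mu>) = 0" by (simp add: integral_H1 dVfun_zero)
  have "(H1 \<alpha> xs x)\<^sup>2 = 1 + (1 / (1 - \<alpha>)\<^sup>2 - 2 / (1 - \<alpha>)) * indicator {xs..} x" for x
    using alpha by (auto simp: H1_def indicator_def power2_diff power_divide)
  then have "(\<integral>x. (H1 \<alpha> xs x)\<^sup>2 \<partial>\<mu>) = 1 + (1 / (1 - \<alpha>)\<^sup>2 - 2 / (1 - \<alpha>)) * (1 - \<alpha>)"
    by (simp add: prob_space prob_atLeast xi_star)
  also have "\<dots> = 1 + (1 / (1 - \<alpha>) - 2)"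
  proof -
    have "(1 / b\<^sup>2 - 2 / b) * b = 1 / b - 2" if "b > 0" for b :: real
      using that by (simp add: left_diff_distrib power2_eq_square)
    from this[of "1 - \<alpha>"] show ?thesis using alpha by simp
  qed
  also have "\<dots> = \<alpha> / (1 - \<alpha>)" using alpha by (simp add: divide_simps)
  finally show "(\<integral>x. (H1 \<alpha> xs x)\<^sup>2 \<partial>\<mu>) = \<alpha> / (1 - \<alpha>)" .
  have e: "H1 \<alpha> xs x * (Jfun \<alpha> xs x - Vfun \<alpha> \<mu> xs)
      = H1 \<alpha> xs x * (xs - Vfun \<alpha> \<mu> xs) - (\<alpha> / (1 - \<alpha>)) * (1 / (1 - \<alpha>) * max (x - xs) 0)" for x
  proof (cases "x \<ge> xs")
    case True
    have "1 - 1 / (1 - \<alpha>) = - (\<alpha> / (1 - \<alpha>))" using alpha by (simp add: field_simps)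
    then have h: "H1 \<alpha> xs x = - (\<alpha> / (1 - \<alpha>))" using True by (simp add: H1_def)
    show ?thesis unfolding h Jfun_def by (simp only: ring_distribs)
  next
    case False
    then show ?thesis by (simp add: H1_def Jfun_def)
  qed
  show "integrable \<mu> (\<lambda>x. H1 \<alpha> xs x * (Jfun \<alpha> xs x - Vfun \<alpha> \<mu> xs))" unfolding e by simp
  show "(\<integral>x. H1 \<alpha> xs x * (Jfun \<alpha> xs x - Vfun \<alpha> \<mu> xs) \<partial>\<mu>) = - (\<alpha> / (1 - \<alpha>) * (chi_star \<alpha> \<mu> - xs))"
    unfolding e chi_star_eq by (subst Bochner_Integration.integral_diff) (auto simp: z)
qed

end

subsection \<open>Moments of densities and of nested averages\<close>

text \<open>The second part quantifies uniform integrability: outside [-R, R] a function of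
  quadratic growth gains the factor R^(2-p) against the p-th moment.\<close>

lemma one_plus_square_le:
  fixes x p R :: real
  assumes p: "p > 2"
  shows "1 + x\<^sup>2 \<le> 2 * (1 + \<bar>x\<bar> powr p)"
    and "R \<ge> 1 \<Longrightarrow> \<bar>x\<bar> > R \<Longrightarrow> 1 + x\<^sup>2 \<le> 2 * R powr (2 - p) * (1 + \<bar>x\<bar> powr p)"
proof -
  have sq: "x\<^sup>2 = \<bar>x\<bar> powr 2" if "\<bar>x\<bar> \<ge> 1"
    using that by (simp add: powr_numeral)
  show "1 + x\<^sup>2 \<le> 2 * (1 + \<bar>x\<bar> powr p)"
  proof (cases "\<bar>x\<bar> \<ge> 1")
    case True
    then have "\<bar>x\<bar> powr 2 \<le> \<bar>x\<bar> powr p" using p by (intro powr_mono) auto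
    then show ?thesis using sq[OF True] powr_ge_zero[of "\<bar>x\<bar>" p] by argo
  next
    case False
    then have "x\<^sup>2 \<le> 1" by (simp add: abs_square_le_1)
    then show ?thesis using powr_ge_zero[of "\<bar>x\<bar>" p] by argo
  qed
  assume R: "R \<ge> 1" and x: "\<bar>x\<bar> > R"
  have x1: "\<bar>x\<bar> \<ge> 1" using R x by linarith
  have "1 + x\<^sup>2 \<le> 2 * \<bar>x\<bar> powr 2" using sq[OF x1] x1 power_mono[of 1 "\<bar>x\<bar>" 2] by simp
  also have "\<bar>x\<bar> powr 2 = \<bar>x\<bar> powr (2 - p) * \<bar>x\<bar> powr p" using x1 by (simp add: powr_add[symmetric])
  also have "\<bar>x\<bar> powr (2 - p) \<le> R powr (2 - p)" using R x p by (intro powr_mono2') auto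
  also have "2 * (R powr (2 - p) * \<bar>x\<bar> powr p) \<le> 2 * R powr (2 - p) * (1 + \<bar>x\<bar> powr p)"
    by (simp add: algebra_simps)
  finally show "1 + x\<^sup>2 \<le> 2 * R powr (2 - p) * (1 + \<bar>x\<bar> powr p)" by (simp add: mult_right_mono)
qed

lemma weighted_density_integral:
  fixes f \<psi> :: "real \<Rightarrow> real"
  assumes p: "p > 2" and f[measurable]: "f \<in> borel_measurable borel" and f0: "\<And>x. 0 \<le> f x"
    and m: "(\<integral>\<^sup>+x. ennreal ((1 + \<bar>x\<bar> powr p) * f x) \<partial>lborel) \<le> ennreal B" and B: "B \<ge> 0"
    and psi[measurable]: "\<psi> \<in> borel_measurable borel" and A: "\<And>x. \<bar>\<psi> x\<bar> \<le> A * (1 + x\<^sup>2)"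
  shows "integrable lborel (\<lambda>x. \<psi> x * f x)"
    and "R \<ge> 1 \<Longrightarrow> \<bar>(\<integral>x. \<psi> x * f x \<partial>lborel) - (\<integral>x. indicator {-R..R} x * (\<psi> x * f x) \<partial>lborel)\<bar> \<le> 2 * A * R powr (2 - p) * B"
proof -
  let ?w = "\<lambda>x. (1 + \<bar>x\<bar> powr p) * f x"
  have A0: "A \<ge> 0" using A[of 0] by simp
  have w0: "0 \<le> ?w x" for x using f0 by simp
  have w: "integrable lborel ?w"
    by (rule integrableI_nonneg) (use w0 m in \<open>auto simp: less_top[symmetric] top_unique\<close>)
  have wB: "(\<integral>x. ?w x \<partial>lborel) \<le> B"
    using m B by (subst integral_eq_nn_integral) (auto simp: w0 intro!: enn2real_leI)
  show i: "integrable lborel (\<lambda>x. \<psi> x * f x)"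
  proof (rule Bochner_Integration.integrable_bound[OF integrable_mult_right[OF w, of "2 * A"]])
    have "\<bar>\<psi> x * f x\<bar> \<le> \<bar>2 * A * ?w x\<bar>" for x
    proof -
      have "\<bar>\<psi> x\<bar> \<le> A * (2 * (1 + \<bar>x\<bar> powr p))"
        using A[of x] mult_left_mono[OF one_plus_square_le(1)[OF p, of x] A0] by linarith
      from mult_right_mono[OF this f0[of x]] show ?thesis using f0[of x] A0
        by (simp add: abs_mult mult_ac)
    qed
    then show "AE x in lborel. norm (\<psi> x * f x) \<le> norm (2 * A * ?w x)" by simp
  qed measurable
  assume R: "R \<ge> 1"
  have i2: "integrable lborel (\<lambda>x. indicator {-R..R} x * (\<psi> x * f x))"
    using integrable_mult_indicator[OF _ i, of "{-R..R}"] by simp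
  have "\<bar>(\<integral>x. \<psi> x * f x \<partial>lborel) - (\<integral>x. indicator {-R..R} x * (\<psi> x * f x) \<partial>lborel)\<bar>
      = \<bar>\<integral>x. \<psi> x * f x - indicator {-R..R} x * (\<psi> x * f x) \<partial>lborel\<bar>" using i i2 by simp
  also have "\<dots> \<le> (\<integral>x. \<bar>\<psi> x * f x - indicator {-R..R} x * (\<psi> x * f x)\<bar> \<partial>lborel)" by (rule integral_abs_bound)
  also have "\<dots> \<le> (\<integral>x. (2 * A * R powr (2 - p)) * ?w x \<partial>lborel)"
  proof (rule integral_mono)
    fix x
    show "\<bar>\<psi> x * f x - indicator {-R..R} x * (\<psi> x * f x)\<bar> \<le> (2 * A * R powr (2 - p)) * ?w x"
    proof (cases "x \<in> {-R..R}")
      case True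
      then show ?thesis using A0 w0[of x] by (simp add: mult_nonneg_nonneg)
    next
      case False
      then have "\<bar>x\<bar> > R" by auto
      then have "\<bar>\<psi> x\<bar> \<le> A * (2 * R powr (2 - p) * (1 + \<bar>x\<bar> powr p))"
        using A[of x] mult_left_mono[OF one_plus_square_le(2)[OF p R, of x] A0] by linarith
      from mult_right_mono[OF this f0[of x]] show ?thesis using f0[of x] False
        by (simp add: abs_mult mult_ac)
    qed
  qed (use i i2 w in auto)
  also have "\<dots> \<le> (2 * A * R powr (2 - p)) * B"
    using wB A0 by (simp add: mult_left_mono)
  finally show "\<bar>(\<integral>x. \<psi> x * f x \<partial>lborel) - (\<integral>x. indicator {-R..R} x * (\<psi> x * f x) \<partial>lborel)\<bar> \<le> 2 * A * R powr (2 - p) * B" .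
qed

text \<open>Fatou's lemma along the densities: the limit inherits the moment bound directly, without
  a detour through its description as a conditional expectation.\<close>

lemma density_moment_limit:
  fixes f :: "nat \<Rightarrow> real \<Rightarrow> real" and f0 :: "real \<Rightarrow> real"
  assumes f[measurable]: "\<And>k. f k \<in> borel_measurable borel" and flim: "\<And>x. (\<lambda>k. f k x) \<longlonglongrightarrow> f0 x"
    and m: "\<And>k. (\<integral>\<^sup>+x. ennreal ((1 + \<bar>x\<bar> powr p) * f k x) \<partial>lborel) \<le> ennreal B"
  shows "(\<integral>\<^sup>+x. ennreal ((1 + \<bar>x\<bar> powr p) * f0 x) \<partial>lborel) \<le> ennreal B"
proof -
  have "liminf (\<lambda>k. ennreal ((1 + \<bar>x\<bar> powr p) * f k x)) = ennreal ((1 + \<bar>x\<bar> powr p) * f0 x)" for x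
    by (intro lim_imp_Liminf tendsto_ennrealI tendsto_mult_left flim) simp
  then have "(\<integral>\<^sup>+x. ennreal ((1 + \<bar>x\<bar> powr p) * f0 x) \<partial>lborel)
      = (\<integral>\<^sup>+x. liminf (\<lambda>k. ennreal ((1 + \<bar>x\<bar> powr p) * f k x)) \<partial>lborel)" by simp
  also have "\<dots> \<le> liminf (\<lambda>k. \<integral>\<^sup>+x. ennreal ((1 + \<bar>x\<bar> powr p) * f k x) \<partial>lborel)"
    by (rule nn_integral_liminf) measurable
  also have "\<dots> \<le> ennreal B" by (rule Liminf_le) (auto simp: m)
  finally show ?thesis .
qed

text \<open>Truncation to [-R, R], where the common bound \<open>C\<close> on the densities allows
  dominated convergence, with tails uniformly small by the p-th moment. The integrands vary with k
  because the thresholds of the positive parts will.\<close>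

lemma density_integral_tendsto:
  fixes f \<psi> :: "nat \<Rightarrow> real \<Rightarrow> real" and f0 \<psi>0 :: "real \<Rightarrow> real"
  assumes p: "p > 2" and f[measurable]: "\<And>k. f k \<in> borel_measurable borel" and fnn: "\<And>k x. 0 \<le> f k x"
    and fC: "\<And>k x. f k x \<le> C" and flim: "\<And>x. (\<lambda>k. f k x) \<longlonglongrightarrow> f0 x"
    and m: "\<And>k. (\<integral>\<^sup>+x. ennreal ((1 + \<bar>x\<bar> powr p) * f k x) \<partial>lborel) \<le> ennreal B" and B: "B \<ge> 0"
    and psi[measurable]: "\<And>k. \<psi> k \<in> borel_measurable borel" and A: "\<And>k x. \<bar>\<psi> k x\<bar> \<le> A * (1 + x\<^sup>2)"
    and psilim: "\<And>x. (\<lambda>k. \<psi> k x) \<longlonglongrightarrow> \<psi>0 x"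
  shows "(\<lambda>k. \<integral>x. \<psi> k x * f k x \<partial>lborel) \<longlonglongrightarrow> (\<integral>x. \<psi>0 x * f0 x \<partial>lborel)"
proof -
  have f0m[measurable]: "f0 \<in> borel_measurable borel" by (rule borel_measurable_LIMSEQ_real[OF flim]) simp
  have p0m[measurable]: "\<psi>0 \<in> borel_measurable borel" by (rule borel_measurable_LIMSEQ_real[OF psilim]) simp
  have f0nn: "0 \<le> f0 x" for x using flim[of x] fnn by (intro LIMSEQ_le_const) auto
  have A0: "\<bar>\<psi>0 x\<bar> \<le> A * (1 + x\<^sup>2)" for x
    by (rule LIMSEQ_le_const2[OF tendsto_rabs[OF psilim[of x]]]) (use A in auto)
  have Ann: "A \<ge> 0" using A[of 0 0] by simp
  have Cnn: "C \<ge> 0" using fnn[of 0 0] fC[of 0 0] by linarith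
  note m0 = density_moment_limit[OF f flim m]
  show ?thesis
  proof (rule LIMSEQ_I)
    fix r :: real assume r: "r > 0"
    have "((\<lambda>R. 2 * A * R powr (2 - p) * B) \<longlongrightarrow> 2 * A * 0 * B) at_top"
      using p by (intro tendsto_intros tendsto_neg_powr filterlim_ident) auto
    then have "\<forall>\<^sub>F R in at_top. 2 * A * R powr (2 - p) * B < r / 3" using r by (intro order_tendstoD) auto
    then have "\<forall>\<^sub>F R in at_top. 2 * A * R powr (2 - p) * B < r / 3 \<and> R \<ge> 1"
      using eventually_ge_at_top[of 1] by eventually_elim auto
    then obtain R where R: "2 * A * R powr (2 - p) * B < r / 3" "R \<ge> 1"
      by (metis (mono_tags, lifting) eventually_at_top_linorder order_refl)
    have "(\<lambda>k. \<integral>x. indicator {-R..R} x * (\<psi> k x * f k x) \<partial>lborel) \<longlonglongrightarrow> (\<integral>x. indicator {-R..R} x * (\<psi>0 x * f0 x) \<partial>lborel)"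
    proof (rule integral_dominated_convergence[where w="\<lambda>x. A * (1 + R\<^sup>2) * C * indicator {-R..R} x"])
      show "integrable lborel (\<lambda>x. A * (1 + R\<^sup>2) * C * indicator {-R..R} x)"
        using R by (intro integrable_mult_right integrable_real_indicator) auto
      show "AE x in lborel. (\<lambda>k. indicator {-R..R} x * (\<psi> k x * f k x)) \<longlonglongrightarrow> indicator {-R..R} x * (\<psi>0 x * f0 x)"
        by (intro AE_I2 tendsto_intros psilim flim)
      show "AE x in lborel. norm (indicator {-R..R} x * (\<psi> k x * f k x)) \<le> A * (1 + R\<^sup>2) * C * indicator {-R..R} x" for k
      proof (rule AE_I2)
        fix x
        have "\<bar>\<psi> k x\<bar> * f k x \<le> A * (1 + R\<^sup>2) * C" if "x \<in> {-R..R}"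
        proof (rule mult_mono)
          have "x\<^sup>2 \<le> R\<^sup>2" using that by (intro abs_le_square_iff[THEN iffD1]) auto
          then have "A * (1 + x\<^sup>2) \<le> A * (1 + R\<^sup>2)" using Ann by (intro mult_left_mono) auto
          then show "\<bar>\<psi> k x\<bar> \<le> A * (1 + R\<^sup>2)" using A[of k x] by linarith
        qed (use fC fnn Ann in auto)
        then show "norm (indicator {-R..R} x * (\<psi> k x * f k x)) \<le> A * (1 + R\<^sup>2) * C * indicator {-R..R} x"
          using fnn[of k x] by (auto simp: indicator_def abs_mult)
      qed
    qed measurable
    from LIMSEQ_D[OF this, of "r / 3"] r obtain n where n: "\<And>k. k \<ge> n \<Longrightarrow>
      \<bar>(\<integral>x. indicator {-R..R} x * (\<psi> k x * f k x) \<partial>lborel) - (\<integral>x. indicator {-R..R} x * (\<psi>0 x * f0 x) \<partial>lborel)\<bar> < r / 3"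
      by auto
    show "\<exists>no. \<forall>k\<ge>no. norm ((\<integral>x. \<psi> k x * f k x \<partial>lborel) - (\<integral>x. \<psi>0 x * f0 x \<partial>lborel)) < r"
    proof (intro exI[of _ n] allI impI)
      fix k assume k: "k \<ge> n"
      note a = weighted_density_integral(2)[OF p f fnn m B psi A R(2), of k]
      note b = weighted_density_integral(2)[OF p f0m f0nn m0 B p0m A0 R(2)]
      show "norm ((\<integral>x. \<psi> k x * f k x \<partial>lborel) - (\<integral>x. \<psi>0 x * f0 x \<partial>lborel)) < r"
        using n[OF k] a[of k] b R(1) unfolding real_norm_def by linarith
    qed
  qed
qed

lemma powr_average_le:
  fixes a :: "nat \<Rightarrow> real"
  assumes p: "p \<ge> 1" and K: "K \<ge> 1"
  shows "\<bar>(\<Sum>k<K. a k) / real K\<bar> powr p \<le> (\<Sum>k<K. 1 / real K * \<bar>a k\<bar> powr p)"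
proof -
  have conv: "\<bar>u * x + v * y\<bar> powr p \<le> u * \<bar>x\<bar> powr p + v * \<bar>y\<bar> powr p"
    if "0 < u" "0 < v" "u + v = 1" for u v x y :: real
  proof -
    have "\<bar>u * x + v * y\<bar> powr p \<le> (u * \<bar>x\<bar> + v * \<bar>y\<bar>) powr p"
      using that p abs_triangle_ineq[of "u * x" "v * y"] by (intro powr_mono2) (auto simp: abs_mult)
    also have "\<dots> \<le> u * \<bar>x\<bar> powr p + v * \<bar>y\<bar> powr p"
    \<comment> \<open>Convexity is applied to positive arguments; if one of them vanishes, the claim
      reduces to \<open>t powr p \<le> t\<close> for \<open>t\<close> in (0, 1).\<close>
    proof (cases "x = 0 \<or> y = 0")
      case False
      have "u = 1 - v" using that by simp
      then show ?thesis
        using convex_onD[OF powr_convex[OF p], of v "\<bar>x\<bar>" "\<bar>y\<bar>"] that False by (simp only:) simp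
    next
      case True
      have le: "t powr p \<le> t" if "0 < t" "t < 1" for t :: real
        using powr_mono'[of 1 p t] p that by simp
      have "(t * z) powr p \<le> t * z powr p" if "0 < t" "t < 1" "0 \<le> z" for t z :: real
        using le[OF that(1,2)] that by (simp add: powr_mult mult_right_mono)
      then show ?thesis using True that by (auto simp: powr_zero_eq_one)
    qed
    finally show ?thesis .
  qed
  have "convex_on UNIV (\<lambda>x::real. \<bar>x\<bar> powr p)"
    by (rule convex_onI) (use conv[of "1 - _" _] in auto)
  from convex_on_sum[OF _ _ this, of "{..<K}" "\<lambda>_. 1 / real K" a] K
  show ?thesis by (auto simp: sum_divide_distrib lessThan_empty_iff)
qed

text \<open>By convexity the p-th power of the average is at most the average of the p-th powers,
  and each pair of the outer sample and a single inner sample has the law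
  \<open>PY \<Otimes>\<^sub>M PZ\<close>. The bound is therefore the same for every
  \<open>K\<close>.\<close>

lemma nn_integral_powr_lawXK_le:
  assumes PY: "prob_space PY" and PZ: "prob_space PZ"
    and phi: "(\<lambda>(y, z). \<phi> y z) \<in> borel_measurable (PY \<Otimes>\<^sub>M PZ)" and p: "p \<ge> 1" and K: "K \<ge> 1"
  shows "prob_space (lawXK PY PZ \<phi> K)"
    and "(\<integral>\<^sup>+x. ennreal (\<bar>x\<bar> powr p) \<partial>lawXK PY PZ \<phi> K) \<le> (\<integral>\<^sup>+w. ennreal (\<bar>\<phi> (fst w) (snd w)\<bar> powr p) \<partial>(PY \<Otimes>\<^sub>M PZ))"
proof -
  interpret Y: prob_space PY by fact
  interpret Z: prob_space PZ by fact
  interpret PP: prob_space "PiM {..<K} (\<lambda>_. PZ)" by (rule prob_space_PiM) (rule PZ)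
  interpret YP: pair_prob_space PY "PiM {..<K} (\<lambda>_. PZ)" ..
  let ?Q = "PY \<Otimes>\<^sub>M PiM {..<K} (\<lambda>_. PZ)"
  have phi': "(\<lambda>w. \<phi> (fst w) (snd w)) \<in> borel_measurable (PY \<Otimes>\<^sub>M PZ)" using phi by (simp add: case_prod_beta')
  have mk[measurable]: "(\<lambda>w. \<phi> (fst w) (snd w k)) \<in> borel_measurable ?Q" if "k < K" for k
  proof -
    have "(\<lambda>w. (fst w, snd w k)) \<in> measurable ?Q (PY \<Otimes>\<^sub>M PZ)"
      using that by (intro measurable_Pair measurable_fst measurable_compose[OF measurable_snd measurable_component_singleton]) auto
    from measurable_compose[OF this phi'] show ?thesis by simp
  qed
  have mX[measurable]: "(\<lambda>(y, zs). (\<Sum>k<K. \<phi> y (zs k)) / real K) \<in> borel_measurable ?Q"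
    unfolding case_prod_beta' by (intro borel_measurable_divide borel_measurable_sum mk) auto
  show "prob_space (lawXK PY PZ \<phi> K)" unfolding lawXK_def by (rule YP.prob_space_distr[OF mX])
  have "(\<integral>\<^sup>+x. ennreal (\<bar>x\<bar> powr p) \<partial>lawXK PY PZ \<phi> K)
      = (\<integral>\<^sup>+w. ennreal (\<bar>(\<Sum>k<K. \<phi> (fst w) (snd w k)) / real K\<bar> powr p) \<partial>?Q)"
    unfolding lawXK_def by (subst nn_integral_distr[OF mX]) (auto simp: case_prod_beta')
  also have "\<dots> \<le> (\<integral>\<^sup>+w. (\<Sum>k<K. ennreal (1 / real K) * ennreal (\<bar>\<phi> (fst w) (snd w k)\<bar> powr p)) \<partial>?Q)"
  proof (rule nn_integral_mono)
    fix w
    have "(\<Sum>k<K. ennreal (1 / real K) * ennreal (\<bar>\<phi> (fst w) (snd w k)\<bar> powr p))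
        = ennreal (\<Sum>k<K. 1 / real K * \<bar>\<phi> (fst w) (snd w k)\<bar> powr p)"
      by (subst sum_ennreal[symmetric]) (auto simp: ennreal_mult[symmetric])
    then show "ennreal (\<bar>(\<Sum>k<K. \<phi> (fst w) (snd w k)) / real K\<bar> powr p)
      \<le> (\<Sum>k<K. ennreal (1 / real K) * ennreal (\<bar>\<phi> (fst w) (snd w k)\<bar> powr p))"
      using powr_average_le[OF p K, of "\<lambda>k. \<phi> (fst w) (snd w k)"] by (simp add: ennreal_leI)
  qed
  also have "\<dots> = (\<Sum>k<K. ennreal (1 / real K) * (\<integral>\<^sup>+w. ennreal (\<bar>\<phi> (fst w) (snd w k)\<bar> powr p) \<partial>?Q))"
    by (subst nn_integral_sum) (auto intro!: sum.cong nn_integral_cmult)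
  also have "\<dots> = (\<Sum>k<K. ennreal (1 / real K) * (\<integral>\<^sup>+w. ennreal (\<bar>\<phi> (fst w) (snd w)\<bar> powr p) \<partial>(PY \<Otimes>\<^sub>M PZ)))"
  proof (intro sum.cong refl arg_cong2[where f="(*)"])
    fix k assume "k \<in> {..<K}"
    then have k: "k < K" by simp
    have m2: "(\<lambda>w. ennreal (\<bar>\<phi> (fst w) (snd w)\<bar> powr p)) \<in> borel_measurable (PY \<Otimes>\<^sub>M PZ)"
      using phi' by measurable
    have "(\<integral>\<^sup>+w. ennreal (\<bar>\<phi> (fst w) (snd w k)\<bar> powr p) \<partial>?Q)
        = (\<integral>\<^sup>+y. \<integral>\<^sup>+zs. ennreal (\<bar>\<phi> y (zs k)\<bar> powr p) \<partial>PiM {..<K} (\<lambda>_. PZ) \<partial>PY)"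
      using PP.nn_integral_fst[of "\<lambda>w. ennreal (\<bar>\<phi> (fst w) (snd w k)\<bar> powr p)" PY] mk[OF k] by simp
    also have "\<dots> = (\<integral>\<^sup>+y. \<integral>\<^sup>+z. ennreal (\<bar>\<phi> y z\<bar> powr p) \<partial>PZ \<partial>PY)"
    proof (rule nn_integral_cong)
      fix y assume y: "y \<in> space PY"
      have my: "(\<lambda>z. ennreal (\<bar>\<phi> y z\<bar> powr p)) \<in> borel_measurable PZ"
        using measurable_compose[OF measurable_Pair1'[OF y] m2] by simp
      have "(\<integral>\<^sup>+z. ennreal (\<bar>\<phi> y z\<bar> powr p) \<partial>PZ) = (\<integral>\<^sup>+z. ennreal (\<bar>\<phi> y z\<bar> powr p) \<partial>distr (PiM {..<K} (\<lambda>_. PZ)) PZ (\<lambda>zs. zs k))"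
        using distr_PiM_component[of "{..<K}" "\<lambda>_. PZ" k] k PZ by simp
      also have "\<dots> = (\<integral>\<^sup>+zs. ennreal (\<bar>\<phi> y (zs k)\<bar> powr p) \<partial>PiM {..<K} (\<lambda>_. PZ))"
        using k my by (subst nn_integral_distr) auto
      finally show "(\<integral>\<^sup>+zs. ennreal (\<bar>\<phi> y (zs k)\<bar> powr p) \<partial>PiM {..<K} (\<lambda>_. PZ)) = (\<integral>\<^sup>+z. ennreal (\<bar>\<phi> y z\<bar> powr p) \<partial>PZ)" by simp
    qed
    also have "\<dots> = (\<integral>\<^sup>+w. ennreal (\<bar>\<phi> (fst w) (snd w)\<bar> powr p) \<partial>(PY \<Otimes>\<^sub>M PZ))"
      using Z.nn_integral_fst[OF m2] by simp
    finally show "(\<integral>\<^sup>+w. ennreal (\<bar>\<phi> (fst w) (snd w k)\<bar> powr p) \<partial>?Q) = (\<integral>\<^sup>+w. ennreal (\<bar>\<phi> (fst w) (snd w)\<bar> powr p) \<partial>(PY \<Otimes>\<^sub>M PZ))" .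
  qed
  also have "\<dots> = ennreal (real K * (1 / real K)) * (\<integral>\<^sup>+w. ennreal (\<bar>\<phi> (fst w) (snd w)\<bar> powr p) \<partial>(PY \<Otimes>\<^sub>M PZ))"
    by (subst ennreal_mult) (auto simp: ennreal_of_nat_eq_real_of_nat mult.assoc)
  also have "\<dots> = (\<integral>\<^sup>+w. ennreal (\<bar>\<phi> (fst w) (snd w)\<bar> powr p) \<partial>(PY \<Otimes>\<^sub>M PZ))" using K by simp
  finally show "(\<integral>\<^sup>+x. ennreal (\<bar>x\<bar> powr p) \<partial>lawXK PY PZ \<phi> K) \<le> (\<integral>\<^sup>+w. ennreal (\<bar>\<phi> (fst w) (snd w)\<bar> powr p) \<partial>(PY \<Otimes>\<^sub>M PZ))" .
qed

subsection \<open>Adapted processes\<close>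

text \<open>In place of a filtration, an explicit measurable function of the first n + 1 variables,
  valid for every outcome. In this form conditioning on the past reduces to Fubini.\<close>

definition (in prob_space) adapted_to :: "(nat \<Rightarrow> 'a \<Rightarrow> real) \<Rightarrow> nat \<Rightarrow> ('a \<Rightarrow> 'b::topological_space) \<Rightarrow> bool" where
  "adapted_to Y n P \<longleftrightarrow>
     (\<exists>G\<in>measurable (PiM {..n} (\<lambda>_. borel)) borel. \<forall>\<omega>. P \<omega> = G (\<lambda>i\<in>{..n}. Y i \<omega>))"

context prob_space
begin

lemma adapted_to_Suc: "adapted_to Y n P \<Longrightarrow> adapted_to Y (Suc n) P"
proof -
  assume "adapted_to Y n P"
  then obtain G where G: "G \<in> measurable (PiM {..n} (\<lambda>_. borel)) borel" "\<And>\<omega>. P \<omega> = G (\<lambda>i\<in>{..n}. Y i \<omega>)"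
    unfolding adapted_to_def by blast
  have "(\<lambda>x. G (restrict x {..n})) \<in> measurable (PiM {..Suc n} (\<lambda>_. borel)) borel"
    by (rule measurable_compose[OF measurable_restrict_subset G(1)]) auto
  moreover have "P \<omega> = G (restrict (\<lambda>i\<in>{..Suc n}. Y i \<omega>) {..n})" for \<omega>
    unfolding G(2) by (rule arg_cong[where f=G]) auto
  ultimately show ?thesis unfolding adapted_to_def by (intro bexI[of _ "\<lambda>x. G (restrict x {..n})"]) auto
qed

lemma adapted_to_base: "adapted_to Y n (Y n)"
proof -
  have "(\<lambda>x. x n) \<in> measurable (PiM {..n} (\<lambda>_. borel)) borel" by (rule measurable_component_singleton) simp
  then show ?thesis unfolding adapted_to_def by (intro bexI[of _ "\<lambda>x. x n"]) auto
qed

lemma adapted_to_compose: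
  assumes "adapted_to Y n P" "h \<in> measurable borel borel"
  shows "adapted_to Y n (\<lambda>\<omega>. h (P \<omega>))"
proof -
  obtain G where G: "G \<in> measurable (PiM {..n} (\<lambda>_. borel)) borel" "\<And>\<omega>. P \<omega> = G (\<lambda>i\<in>{..n}. Y i \<omega>)"
    using assms(1) unfolding adapted_to_def by blast
  show ?thesis unfolding adapted_to_def
    by (rule bexI[of _ "\<lambda>x. h (G x)"]) (use G assms(2) in auto)
qed

lemma adapted_to_Pair:
  fixes P :: "'a \<Rightarrow> 'b::second_countable_topology" and Q :: "'a \<Rightarrow> 'c::second_countable_topology"
  assumes "adapted_to Y n P" "adapted_to Y n Q"
  shows "adapted_to Y n (\<lambda>\<omega>. (P \<omega>, Q \<omega>))"
proof -
  obtain G where G: "G \<in> measurable (PiM {..n} (\<lambda>_. borel)) borel" "\<And>\<omega>. P \<omega> = G (\<lambda>i\<in>{..n}. Y i \<omega>)"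
    using assms(1) unfolding adapted_to_def by blast
  obtain G' where G': "G' \<in> measurable (PiM {..n} (\<lambda>_. borel)) borel" "\<And>\<omega>. Q \<omega> = G' (\<lambda>i\<in>{..n}. Y i \<omega>)"
    using assms(2) unfolding adapted_to_def by blast
  show ?thesis unfolding adapted_to_def
    by (rule bexI[of _ "\<lambda>x. (G x, G' x)"]) (use G G' in \<open>auto intro!: borel_measurable_Pair\<close>)
qed

lemma adapted_to_measurable:
  assumes "adapted_to Y n P" "\<And>i. Y i \<in> borel_measurable M"
  shows "P \<in> borel_measurable M"
proof -
  obtain G where G: "G \<in> measurable (PiM {..n} (\<lambda>_. borel)) borel" "\<And>\<omega>. P \<omega> = G (\<lambda>i\<in>{..n}. Y i \<omega>)"
    using assms(1) unfolding adapted_to_def by blast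
  have "(\<lambda>\<omega>. \<lambda>i\<in>{..n}. Y i \<omega>) \<in> measurable M (PiM {..n} (\<lambda>_. borel))"
    by (rule measurable_restrict) (rule assms(2))
  from measurable_compose[OF this G(1)] show ?thesis using G(2) by (simp cong: measurable_cong)
qed

text \<open>Stands in for conditioning on the past: the past and the next variable are independent,
  so their joint law is a product and the next variable can be integrated out with \<open>P\<close>
  frozen.\<close>

lemma adapted_next_expectation:
  fixes P :: "'a \<Rightarrow> 'b::topological_space" and \<phi> :: "'b \<times> real \<Rightarrow> real"
  assumes Y: "indep_vars (\<lambda>_. borel) Y UNIV" and P: "adapted_to Y n P"
    and mu: "distr M borel (Y (Suc n)) = \<mu>"
    and phi: "\<phi> \<in> borel_measurable (borel \<Otimes>\<^sub>M borel)"
    and int: "integrable M (\<lambda>\<omega>. \<phi> (P \<omega>, Y (Suc n) \<omega>))"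
  shows "integrable M (\<lambda>\<omega>. \<integral>x. \<phi> (P \<omega>, x) \<partial>\<mu>)"
    and "(\<integral>\<omega>. \<phi> (P \<omega>, Y (Suc n) \<omega>) \<partial>M) = (\<integral>\<omega>. (\<integral>x. \<phi> (P \<omega>, x) \<partial>\<mu>) \<partial>M)"
proof -
  have Ym: "Y i \<in> borel_measurable M" for i using Y unfolding indep_vars_def by auto
  obtain G where G: "G \<in> measurable (PiM {..n} (\<lambda>_. borel)) borel" "\<And>\<omega>. P \<omega> = G (\<lambda>i\<in>{..n}. Y i \<omega>)"
    using P unfolding adapted_to_def by blast
  define Z W where "Z = (\<lambda>\<omega>. \<lambda>i\<in>{..n}. Y i \<omega>)" and "W = (\<lambda>\<omega>. \<lambda>i\<in>{Suc n}. Y i \<omega>)"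
  let ?A = "PiM {..n} (\<lambda>_. borel) :: (nat \<Rightarrow> real) measure" and ?B = "PiM {Suc n} (\<lambda>_. borel) :: (nat \<Rightarrow> real) measure"
  have "indep_var ?A Z ?B W"
    unfolding Z_def W_def by (rule indep_var_restrict[OF Y]) auto
  then have Zm: "Z \<in> measurable M ?A" and Wm: "W \<in> measurable M ?B"
    and d: "distr M ?A Z \<Otimes>\<^sub>M distr M ?B W = distr M (?A \<Otimes>\<^sub>M ?B) (\<lambda>\<omega>. (Z \<omega>, W \<omega>))"
    unfolding indep_var_distribution_eq by auto
  have PZ: "P \<omega> = G (Z \<omega>)" and YW: "W \<omega> (Suc n) = Y (Suc n) \<omega>" for \<omega> using G(2) by (auto simp: Z_def W_def)
  interpret PZ: prob_space "distr M ?A Z" by (rule prob_space_distr[OF Zm])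
  interpret PW: prob_space "distr M ?B W" by (rule prob_space_distr[OF Wm])
  interpret pp: pair_prob_space "distr M ?A Z" "distr M ?B W" ..
  have cm: "(\<lambda>w. w (Suc n)) \<in> measurable ?B borel" by (rule measurable_component_singleton) simp
  let ?\<psi> = "\<lambda>q. \<phi> (G (fst q), snd q (Suc n))"
  have psi: "?\<psi> \<in> borel_measurable (?A \<Otimes>\<^sub>M ?B)"
    by (rule measurable_compose[OF _ phi])
       (auto intro!: measurable_Pair measurable_compose[OF measurable_fst G(1)] measurable_compose[OF measurable_snd cm])
  have pm: "(\<lambda>\<omega>. (Z \<omega>, W \<omega>)) \<in> measurable M (?A \<Otimes>\<^sub>M ?B)" using Zm Wm by measurable
  have i: "integrable (distr M ?A Z \<Otimes>\<^sub>M distr M ?B W) ?\<psi>"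
    unfolding d using int by (subst integrable_distr_eq[OF pm psi]) (simp add: PZ YW)
  have inner: "(\<integral>w. ?\<psi> (z, w) \<partial>distr M ?B W) = (\<integral>x. \<phi> (G z, x) \<partial>\<mu>)" for z
  proof -
    have m1: "(\<lambda>x. \<phi> (G z, x)) \<in> borel_measurable borel"
      by (rule measurable_compose[OF _ phi]) auto
    have "(\<integral>w. ?\<psi> (z, w) \<partial>distr M ?B W) = (\<integral>\<omega>. \<phi> (G z, Y (Suc n) \<omega>) \<partial>M)"
      using integral_distr[OF Wm measurable_compose[OF cm m1]] by (simp add: YW)
    also have "\<dots> = (\<integral>x. \<phi> (G z, x) \<partial>\<mu>)"
      unfolding mu[symmetric] by (rule integral_distr[OF Ym m1, symmetric])
    finally show ?thesis .
  qed
  note i1 = pp.integrable_fst'[OF i, unfolded inner]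
  have sm: "(\<lambda>z. \<integral>x. \<phi> (G z, x) \<partial>\<mu>) \<in> borel_measurable ?A"
    using borel_measurable_integrable[OF i1] by simp
  show "integrable M (\<lambda>\<omega>. \<integral>x. \<phi> (P \<omega>, x) \<partial>\<mu>)"
    using i1 unfolding PZ by (subst (asm) integrable_distr_eq[OF Zm sm]) simp
  have "(\<integral>\<omega>. \<phi> (P \<omega>, Y (Suc n) \<omega>) \<partial>M) = (\<integral>\<omega>. ?\<psi> (Z \<omega>, W \<omega>) \<partial>M)" by (simp add: PZ YW)
  also have "\<dots> = (\<integral>q. ?\<psi> q \<partial>(distr M ?A Z \<Otimes>\<^sub>M distr M ?B W))"
    unfolding d by (rule integral_distr[OF pm psi, symmetric])
  also have "\<dots> = (\<integral>z. (\<integral>x. \<phi> (G z, x) \<partial>\<mu>) \<partial>distr M ?A Z)"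
    using pp.integral_fst'[OF i] unfolding inner by simp
  also have "\<dots> = (\<integral>\<omega>. (\<integral>x. \<phi> (P \<omega>, x) \<partial>\<mu>) \<partial>M)" unfolding PZ by (rule integral_distr[OF Zm sm])
  finally show "(\<integral>\<omega>. \<phi> (P \<omega>, Y (Suc n) \<omega>) \<partial>M) = (\<integral>\<omega>. (\<integral>x. \<phi> (P \<omega>, x) \<partial>\<mu>) \<partial>M)" .
qed

end

section \<open>Path recursions and hyperbolic inequalities\<close>

fun xi_path :: "real \<Rightarrow> (nat \<Rightarrow> real) \<Rightarrow> (nat \<Rightarrow> real) \<Rightarrow> nat \<Rightarrow> real" where
  "xi_path \<alpha> \<gamma> x 0 = x 0"
| "xi_path \<alpha> \<gamma> x (Suc n) = xi_path \<alpha> \<gamma> x n - \<gamma> (Suc n) * H1 \<alpha> (xi_path \<alpha> \<gamma> x n) (x (Suc n))"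

text \<open>One inhomogeneous linear recursion covers the errors of both estimates and all their
  components; these differ in the factors \<open>\<theta>\<close>, the gains \<open>g\<close>, the
  source \<open>D\<close> and the initial value. The recursion is linear in source and initial
  value, so splitting an error means splitting its source.\<close>

fun lin_path :: "(nat \<Rightarrow> real) \<Rightarrow> (nat \<Rightarrow> real) \<Rightarrow> (real \<Rightarrow> real \<Rightarrow> real) \<Rightarrow> real \<Rightarrow> (nat \<Rightarrow> real) \<Rightarrow> (nat \<Rightarrow> real) \<Rightarrow> nat \<Rightarrow> real" where
  "lin_path \<theta> g D z \<xi> x 0 = z"
| "lin_path \<theta> g D z \<xi> x (Suc n) = \<theta> (Suc n) * lin_path \<theta> g D z \<xi> x n + g (Suc n) * D (\<xi> n) (x (Suc n))"

lemma lin_path_add: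
  "lin_path \<theta> g D z \<xi> x n + lin_path \<theta> g D' z' \<xi> x n = lin_path \<theta> g (\<lambda>a b. D a b + D' a b) (z + z') \<xi> x n"
proof (induct n)
  case (Suc n)
  show ?case by (simp add: Suc[symmetric] algebra_simps)
qed simp

lemma fst_nsa: "fst (nsa \<alpha> \<gamma> (x 0) x n) = xi_path \<alpha> \<gamma> x n"
  by (induct n) (auto simp: Let_def split: prod.splits)

text \<open>Multiplication by n turns averaging with step 1/n into a plain sum, and the starting
  value of the second component is erased by the factor 0.\<close>

lemma snd_nsa:
  "real n * (snd (nsa \<alpha> \<gamma> (x 0) x n) - c) = lin_path (\<lambda>_. 1) (\<lambda>_. 1) (\<lambda>\<xi> y. Jfun \<alpha> \<xi> y - c) 0 (xi_path \<alpha> \<gamma> x) x n"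
proof (induct n)
  case (Suc n)
  have *: "real (Suc n) * (ch - 1 / real (Suc n) * H2 \<alpha> \<xi> ch y - c) = real n * (ch - c) + (Jfun \<alpha> \<xi> y - c)" for ch \<xi> y
    by (simp add: H2_def Jfun_def field_simps)
  have "snd (nsa \<alpha> \<gamma> (x 0) x (Suc n)) = snd (nsa \<alpha> \<gamma> (x 0) x n)
     - 1 / real (Suc n) * H2 \<alpha> (xi_path \<alpha> \<gamma> x n) (snd (nsa \<alpha> \<gamma> (x 0) x n)) (x (Suc n))"
    by (auto simp: Let_def fst_nsa[symmetric] split: prod.splits)
  then show ?case using Suc by (simp only: * lin_path.simps mult_1)
qed simp

text \<open>The linear drift v (\<xi> - s) is moved from the source into the factor 1 - \<gamma> v.
  The identity is algebraic, with \<open>v\<close> and \<open>s\<close> arbitrary; the slope at the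
  quantile and the quantile are inserted later.\<close>

lemma xi_path_decomposition:
  "xi_path \<alpha> \<gamma> x n - s = lin_path (\<lambda>n. 1 - \<gamma> n * v) (\<lambda>n. - \<gamma> n) (\<lambda>\<xi> y. H1 \<alpha> \<xi> y - v * (\<xi> - s)) (x 0 - s) (xi_path \<alpha> \<gamma> x) x n"
proof (induct n)
  case (Suc n)
  let ?l = "lin_path (\<lambda>n. 1 - \<gamma> n * v) (\<lambda>n. - \<gamma> n) (\<lambda>\<xi> y. H1 \<alpha> \<xi> y - v * (\<xi> - s)) (x 0 - s) (xi_path \<alpha> \<gamma> x) x"
  have "?l (Suc n) = (1 - \<gamma> (Suc n) * v) * (xi_path \<alpha> \<gamma> x n - s) - \<gamma> (Suc n) * (H1 \<alpha> (xi_path \<alpha> \<gamma> x n) (x (Suc n)) - v * (xi_path \<alpha> \<gamma> x n - s))"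
    by (simp only: lin_path.simps Suc[symmetric] mult_minus_left)
  then show ?case by (simp add: algebra_simps)
qed simp

text \<open>A Taylor expansion whose remainder is again a multiple of cosh u, which is what closes a
  recursion for the mean of cosh.\<close>

lemma cosh_shift_le:
  fixes u y X :: real
  assumes "\<bar>y\<bar> \<le> X"
  shows "cosh (u - y) \<le> cosh u - y * sinh u + 2 * exp X * y\<^sup>2 * cosh u"
proof -
  have quad: "\<bar>exp z - 1 - z\<bar> \<le> exp X * z\<^sup>2" if "\<bar>z\<bar> \<le> X" for z :: real
  proof -
    obtain t where t: "\<bar>t\<bar> \<le> \<bar>z\<bar>" "exp z = (\<Sum>m<2. z ^ m / fact m) + exp t / fact 2 * z ^ 2"
      using Maclaurin_exp_le[of z 2] by blast
    have "exp z - 1 - z = exp t / 2 * z\<^sup>2" using t(2) by (simp add: numeral_2_eq_2)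
    moreover have "exp t / 2 * z\<^sup>2 \<le> exp X * z\<^sup>2"
    proof (rule mult_right_mono)
      have "exp t \<le> exp X" using t(1) that by auto
      then show "exp t / 2 \<le> exp X" using exp_gt_zero[of X] by linarith
    qed simp
    moreover have "0 \<le> exp t / 2 * z\<^sup>2" by simp
    ultimately show ?thesis by linarith
  qed
  have e1: "exp y \<le> 1 + y + exp X * y\<^sup>2" "exp (- y) \<le> 1 - y + exp X * y\<^sup>2"
    using quad[of y] quad[of "- y"] assms by auto
  have "cosh (u - y) = (exp u * exp (- y) + exp (- u) * exp y) / 2"
    by (simp add: cosh_field_def exp_add[symmetric])
  also have "\<dots> \<le> (exp u * (1 - y + exp X * y\<^sup>2) + exp (- u) * (1 + y + exp X * y\<^sup>2)) / 2"
    using e1 by (intro divide_right_mono add_mono mult_left_mono) auto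
  also have "\<dots> = cosh u - y * sinh u + exp X * y\<^sup>2 * cosh u"
    by (simp add: cosh_field_def sinh_field_def field_simps)
  also have "\<dots> \<le> cosh u - y * sinh u + 2 * exp X * y\<^sup>2 * cosh u"
    by (simp add: mult_right_mono cosh_real_nonneg)
  finally show ?thesis .
qed

text \<open>The first bound serves where the drift is linear, the second where it is merely bounded
  away from zero; the third recovers the squared error from the Lyapunov function.\<close>

lemma cosh_minus_one_le:
  fixes y :: real
  shows "cosh y - 1 \<le> y * sinh y" "0 \<le> y \<Longrightarrow> cosh y - 1 \<le> sinh y" "1 + y\<^sup>2 / 4 \<le> cosh y"
proof -
  have "(1 - y) * exp y \<le> exp (- y) * exp y" "(1 + y) * exp (- y) \<le> exp y * exp (- y)"
    using exp_ge_add_one_self[of "- y"] exp_ge_add_one_self[of y] by (auto intro!: mult_right_mono)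
  then have "(1 - y) * exp y \<le> 1" "(1 + y) * exp (- y) \<le> 1" by (auto simp: exp_add[symmetric])
  then show "cosh y - 1 \<le> y * sinh y" by (simp add: cosh_field_def sinh_field_def field_simps)
  show "cosh y - 1 \<le> sinh y" if "0 \<le> y"
    using that by (simp add: cosh_field_def sinh_field_def field_simps)
  have *: "1 + y\<^sup>2 / 4 \<le> cosh y" if "0 \<le> y" for y :: real
    using exp_lower_Taylor_quadratic[OF that] exp_ge_add_one_self[of "- y"]
    by (simp add: cosh_field_def)
  show "1 + y\<^sup>2 / 4 \<le> cosh y" using *[of "\<bar>y\<bar>"] by simp
qed

section \<open>Regularity in the threshold\<close>

context lipschitz_law
begin

lemma Vfun_lipschitz: "\<bar>Vfun \<alpha> \<mu> \<xi> - Vfun \<alpha> \<mu> \<eta>\<bar> \<le> 1 / (1 - \<alpha>) * \<bar>\<xi> - \<eta>\<bar>"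
proof -
  have *: "Vfun \<alpha> \<mu> \<xi> - Vfun \<alpha> \<mu> \<eta> \<le> 1 / (1 - \<alpha>) * \<bar>\<xi> - \<eta>\<bar>" for \<xi> \<eta>
  proof -
    have "Vfun \<alpha> \<mu> \<xi> - Vfun \<alpha> \<mu> \<eta> \<le> dVfun \<alpha> \<mu> \<xi> * (\<xi> - \<eta>)"
      using Vfun_subgradient[of \<xi> \<eta>] by (simp add: algebra_simps)
    also have "\<dots> \<le> \<bar>dVfun \<alpha> \<mu> \<xi>\<bar> * \<bar>\<xi> - \<eta>\<bar>" by (metis abs_ge_self abs_mult)
    also have "\<dots> \<le> 1 / (1 - \<alpha>) * \<bar>\<xi> - \<eta>\<bar>" using abs_dVfun_le by (intro mult_right_mono) auto
    finally show ?thesis .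
  qed
  show ?thesis using *[of \<xi> \<eta>] *[of \<eta> \<xi>] by (simp add: abs_minus_commute abs_le_iff)
qed

lemma Vfun_measurable [measurable]: "Vfun \<alpha> \<mu> \<in> borel_measurable borel"
  using Vfun_lipschitz alpha
  by (intro borel_measurable_continuous_onI lipschitz_on_continuous_on[of "1 / (1 - \<alpha>)"])
     (auto simp: lipschitz_on_def dist_real_def)

lemma dVfun_measurable [measurable]: "dVfun \<alpha> \<mu> \<in> borel_measurable borel"
proof -
  have "F \<in> borel_measurable borel"
    using cdf_lipschitz C_nonneg
    by (intro borel_measurable_continuous_onI lipschitz_on_continuous_on[of C])
       (auto simp: lipschitz_on_def dist_real_def)
  then show ?thesis unfolding dVfun_def[abs_def] by measurable
qed

lemma Jfun_lipschitz: "\<bar>Jfun \<alpha> \<xi> x - Jfun \<alpha> \<eta> x\<bar> \<le> (1 + 1 / (1 - \<alpha>)) * \<bar>\<xi> - \<eta>\<bar>"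
proof -
  have "\<bar>max (x - \<xi>) 0 - max (x - \<eta>) 0\<bar> \<le> \<bar>\<xi> - \<eta>\<bar>" by auto
  then have "\<bar>1 / (1 - \<alpha>) * (max (x - \<xi>) 0 - max (x - \<eta>) 0)\<bar> \<le> 1 / (1 - \<alpha>) * \<bar>\<xi> - \<eta>\<bar>"
    using alpha by (subst abs_mult) (auto intro!: mult_left_mono simp: divide_right_mono)
  moreover have "Jfun \<alpha> \<xi> x - Jfun \<alpha> \<eta> x = (\<xi> - \<eta>) + 1 / (1 - \<alpha>) * (max (x - \<xi>) 0 - max (x - \<eta>) 0)"
    by (simp add: Jfun_def algebra_simps)
  moreover have "\<bar>u + w\<bar> \<le> (1 + c) * \<bar>u\<bar>" if "\<bar>w\<bar> \<le> c * \<bar>u\<bar>" for u w c :: real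
    using that abs_triangle_ineq[of u w] by (simp add: distrib_right)
  ultimately show ?thesis by metis
qed

end

lemma H1_measurable [measurable]:
  "f \<in> borel_measurable N \<Longrightarrow> g \<in> borel_measurable N \<Longrightarrow> (\<lambda>x. H1 \<alpha> (f x) (g x)) \<in> borel_measurable N"
  unfolding H1_def by measurable

lemma Jfun_measurable [measurable]:
  "f \<in> borel_measurable N \<Longrightarrow> g \<in> borel_measurable N \<Longrightarrow> (\<lambda>x. Jfun \<alpha> (f x) (g x)) \<in> borel_measurable N"
  unfolding Jfun_def by (intro borel_measurable_add borel_measurable_times borel_measurable_const
      borel_measurable_max borel_measurable_diff)

subsection \<open>Mean-square error of the quantile iterates\<close>

context positive_law
begin

lemma C_pos: "0 < C" using f_pos[of 0] f_le[of 0] by linarith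

text \<open>Up to the distance r the curvature term costs at most half of the slope, since C/(1 -
  \<alpha>) r = a/2; beyond r monotonicity keeps the drift at least as large in modulus as at
  distance r.\<close>

lemma drift_lower:
  assumes a: "0 < a" "a \<le> f xs / (1 - \<alpha>)" and e: "0 \<le> e"
  defines "r \<equiv> a * (1 - \<alpha>) / (2 * C)"
  shows "a / 2 * min e r \<le> dVfun \<alpha> \<mu> (xs + e)" "dVfun \<alpha> \<mu> (xs - e) \<le> - (a / 2 * min e r)"
proof -
  have r: "r > 0" using a alpha C_pos by (simp add: r_def)
  define m where "m = min e r"
  have m: "0 \<le> m" "m \<le> r" "m \<le> e" using r e by (auto simp: m_def)
  have Cr: "C / (1 - \<alpha>) * r = a / 2" using alpha C_pos by (simp add: r_def)
  have "C / (1 - \<alpha>) * m\<^sup>2 \<le> C / (1 - \<alpha>) * r * m"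
    using m alpha C_pos unfolding power2_eq_square by (simp add: mult.assoc mult_right_mono divide_right_mono)
  then have q: "C / (1 - \<alpha>) * m\<^sup>2 \<le> a / 2 * m" by (simp only: Cr)
  have am: "a * m \<le> f xs / (1 - \<alpha>) * m" using a m by (intro mult_right_mono) auto
  have "a / 2 * m \<le> dVfun \<alpha> \<mu> (xs + m)"
  proof -
    have "\<bar>dVfun \<alpha> \<mu> (xs + m) - f xs / (1 - \<alpha>) * m\<bar> \<le> C / (1 - \<alpha>) * m\<^sup>2"
      using dVfun_linearization[of "xs + m"] by (simp only: add_diff_cancel_left')
    then show ?thesis using q am by linarith
  qed
  also have "\<dots> \<le> dVfun \<alpha> \<mu> (xs + e)" using m by (intro dVfun_mono) auto
  finally show "a / 2 * min e r \<le> dVfun \<alpha> \<mu> (xs + e)" by (simp add: m_def)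
  have "dVfun \<alpha> \<mu> (xs - e) \<le> dVfun \<alpha> \<mu> (xs - m)" using m by (intro dVfun_mono) auto
  also have "\<dots> \<le> - (a / 2 * m)"
  proof -
    have "\<bar>dVfun \<alpha> \<mu> (xs - m) - f xs / (1 - \<alpha>) * (- m)\<bar> \<le> C / (1 - \<alpha>) * (- m)\<^sup>2"
      using dVfun_linearization[of "xs - m"] by (simp only: diff_diff_eq2 diff_diff_add) simp
    then have "\<bar>dVfun \<alpha> \<mu> (xs - m) + f xs / (1 - \<alpha>) * m\<bar> \<le> C / (1 - \<alpha>) * m\<^sup>2" by simp
    then show ?thesis using q am by linarith
  qed
  finally show "dVfun \<alpha> \<mu> (xs - e) \<le> - (a / 2 * min e r)" by (simp add: m_def)
qed

text \<open>Because the drift is only linear near the quantile and bounded away from it, the Lyapunov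
  function has to grow exponentially at infinity while being quadratic at the quantile.\<close>

lemma cosh_drift:
  assumes a: "0 < a" "a \<le> f xs / (1 - \<alpha>)"
  defines "k \<equiv> 2 * C / (a * (1 - \<alpha>))"
  shows "a / 2 * (cosh (k * (\<xi> - xs)) - 1) \<le> k * (dVfun \<alpha> \<mu> \<xi> * sinh (k * (\<xi> - xs)))"
proof -
  define r where "r = a * (1 - \<alpha>) / (2 * C)"
  have k: "k > 0" using a alpha C_pos by (simp add: k_def)
  \<comment> \<open>At distance \<open>r\<close> the argument of cosh is 1. This normalisation lets
    the linear and the constant lower bound on the drift fit the first two bounds of
    \<open>cosh_minus_one_le\<close>.\<close>
  have kr: "k * r = 1" using a alpha C_pos by (simp add: k_def r_def)
  have *: "a / 2 * (cosh (k * e) - 1) \<le> k * (d * sinh (k * e))" if e: "0 \<le> e" and d: "a / 2 * min e r \<le> d" for e d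
  proof -
    have s: "0 \<le> sinh (k * e)" using k e by simp
    have "cosh (k * e) - 1 \<le> k * min e r * sinh (k * e)"
    proof (cases "e \<le> r")
      case True
      then show ?thesis using cosh_minus_one_le(1)[of "k * e"] by simp
    next
      case False
      then show ?thesis using cosh_minus_one_le(2)[of "k * e"] kr k e by simp
    qed
    from mult_left_mono[OF this, of "a / 2"] a
    have "a / 2 * (cosh (k * e) - 1) \<le> k * sinh (k * e) * (a / 2 * min e r)" by (simp add: mult_ac)
    also have "\<dots> \<le> k * sinh (k * e) * d" using d k s by (intro mult_left_mono) auto
    finally show ?thesis by (simp add: mult_ac)
  qed
  show ?thesis
  proof (cases "\<xi> \<ge> xs")
    case True
    then show ?thesis using *[of "\<xi> - xs" "dVfun \<alpha> \<mu> \<xi>"] drift_lower(1)[OF a, of "\<xi> - xs"] by (simp add: r_def)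
  next
    case False
    then have "a / 2 * min (xs - \<xi>) r \<le> - dVfun \<alpha> \<mu> \<xi>" using drift_lower(2)[OF a, of "xs - \<xi>"] by (simp add: r_def)
    from *[OF _ this] False have "a / 2 * (cosh (k * (xs - \<xi>)) - 1) \<le> k * (- dVfun \<alpha> \<mu> \<xi> * sinh (k * (xs - \<xi>)))" by simp
    moreover have "k * (xs - \<xi>) = - (k * (\<xi> - xs))" by (simp add: algebra_simps)
    ultimately show ?thesis by simp
  qed
qed

end

text \<open>The scheme for one fixed law, with the initial value as \<open>Y 0\<close> and the
  samples from \<open>Y 1\<close> on. The slope enters through a lower bound \<open>a\<close>, so
  that constants can be shared by many laws. The slowest contraction rate met below is a/2, for the
  Lyapunov function; with decay exponent b = 1 it requires a g > 2.\<close>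

locale nsa_process = law: positive_law \<alpha> \<mu> f C + prob_space M
  for \<alpha> :: real and \<mu> :: "real measure" and f :: "real \<Rightarrow> real" and C :: real and M :: "'w measure" +
  fixes Y :: "nat \<Rightarrow> 'w \<Rightarrow> real" and g b a R :: real
  assumes indep: "indep_vars (\<lambda>_. borel) Y UNIV"
    and distr_Y: "\<And>n. distr M borel (Y (Suc n)) = \<mu>"
    and g: "g > 0" and b: "1 / 2 < b" "b \<le> 1" and a: "0 < a" "a \<le> f (xi_star \<alpha> \<mu>) / (1 - \<alpha>)"
    and crit: "b = 1 \<Longrightarrow> 2 < a * g"
    and Y0: "\<And>\<omega>. \<bar>Y 0 \<omega> - xi_star \<alpha> \<mu>\<bar> \<le> R"
begin

abbreviation "xs \<equiv> xi_star \<alpha> \<mu>"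
abbreviation "v \<equiv> f xs / (1 - \<alpha>)"

definition \<gamma> :: "nat \<Rightarrow> real" where "\<gamma> n = g * real n powr (- b)"
definition xi :: "nat \<Rightarrow> 'w \<Rightarrow> real" where "xi n \<omega> = xi_path \<alpha> \<gamma> (\<lambda>i. Y i \<omega>) n"
definition lin where "lin \<theta> h D z n \<omega> = lin_path \<theta> h D (z (Y 0 \<omega>)) (\<lambda>k. xi k \<omega>) (\<lambda>i. Y i \<omega>) n"

lemma xi_0: "xi 0 \<omega> = Y 0 \<omega>" and xi_Suc: "xi (Suc n) \<omega> = xi n \<omega> - \<gamma> (Suc n) * H1 \<alpha> (xi n \<omega>) (Y (Suc n) \<omega>)"
  by (auto simp: xi_def)

lemma lin_0: "lin \<theta> h D z 0 \<omega> = z (Y 0 \<omega>)"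
  and lin_Suc: "lin \<theta> h D z (Suc n) \<omega> = \<theta> (Suc n) * lin \<theta> h D z n \<omega> + h (Suc n) * D (xi n \<omega>) (Y (Suc n) \<omega>)"
  by (auto simp: lin_def)

lemma \<gamma>_nonneg: "0 \<le> \<gamma> n" using g by (simp add: \<gamma>_def)
lemma \<gamma>_le: "\<gamma> n \<le> g"
proof (cases "n = 0")
  case False
  then have "real n powr (- b) \<le> 1" using b by (simp add: powr_minus_divide ge_one_powr_ge_zero)
  then show ?thesis using g by (simp add: \<gamma>_def)
qed (use g in \<open>simp add: \<gamma>_def\<close>)

lemma v_le: "v \<le> C / (1 - \<alpha>)" using law.f_le law.alpha by (simp add: divide_right_mono)

lemma Y_meas [measurable]: "Y i \<in> borel_measurable M"
  using indep unfolding indep_vars_def by auto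

lemma xi_adapted: "adapted_to Y n (xi n)"
proof (induct n)
  case 0
  have "xi 0 = Y 0" by (auto simp: xi_0)
  then show ?case using adapted_to_base[of Y 0] by simp
next
  case (Suc n)
  have "(\<lambda>p. fst p - \<gamma> (Suc n) * H1 \<alpha> (fst p) (snd p)) \<in> borel_measurable (borel :: (real \<times> real) measure)"
    unfolding borel_prod[symmetric] by measurable
  from adapted_to_compose[OF adapted_to_Pair[OF adapted_to_Suc[OF Suc] adapted_to_base] this]
  show ?case by (simp add: xi_Suc[abs_def])
qed

lemma lin_adapted:
  assumes D: "(\<lambda>p. D (fst p) (snd p)) \<in> borel_measurable (borel \<Otimes>\<^sub>M borel)" and z: "z \<in> borel_measurable borel"
  shows "adapted_to Y n (lin \<theta> h D z n)"
proof (induct n)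
  case 0
  show ?case using adapted_to_compose[OF adapted_to_base[of Y 0] z] by (simp add: lin_0[abs_def])
next
  case (Suc n)
  have D2: "(\<lambda>p. D (fst (snd p)) (snd (snd p))) \<in> borel_measurable (borel \<Otimes>\<^sub>M (borel \<Otimes>\<^sub>M borel))"
    by (rule measurable_compose[OF measurable_snd D])
  have "(\<lambda>p. \<theta> (Suc n) * fst p + h (Suc n) * D (fst (snd p)) (snd (snd p))) \<in> borel_measurable (borel :: (real \<times> real \<times> real) measure)"
    unfolding borel_prod[symmetric] using D2 by measurable
  from adapted_to_compose[OF adapted_to_Pair[OF adapted_to_Suc[OF Suc] adapted_to_Pair[OF adapted_to_Suc[OF xi_adapted] adapted_to_base]] this]
  show ?case by (simp add: lin_Suc[abs_def])
qed

lemmas xi_meas [measurable] = adapted_to_measurable[OF xi_adapted Y_meas]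
lemmas lin_meas = adapted_to_measurable[OF lin_adapted Y_meas]

text \<open>The bound depends on n and merely makes expectations finite; rates come from the
  Lyapunov function.\<close>

lemma xi_bounded: "\<exists>B\<ge>0. \<forall>\<omega>. \<bar>xi n \<omega> - xs\<bar> \<le> B"
proof (induct n)
  case 0
  have "0 \<le> R" using Y0[of undefined] by linarith
  then show ?case using Y0 by (intro exI[of _ R]) (auto simp: xi_0)
next
  case (Suc n)
  then obtain B where B: "B \<ge> 0" "\<And>\<omega>. \<bar>xi n \<omega> - xs\<bar> \<le> B" by blast
  have "\<bar>xi (Suc n) \<omega> - xs\<bar> \<le> B + \<gamma> (Suc n) * (1 / (1 - \<alpha>))" for \<omega>
  proof -
    have "\<bar>\<gamma> (Suc n) * H1 \<alpha> (xi n \<omega>) (Y (Suc n) \<omega>)\<bar> \<le> \<gamma> (Suc n) * (1 / (1 - \<alpha>))"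
      unfolding abs_mult using \<gamma>_nonneg[of "Suc n"] law.abs_H1_le by (intro mult_mono) auto
    then show ?thesis using B(2)[of \<omega>] unfolding xi_Suc by linarith
  qed
  moreover have "0 \<le> B + \<gamma> (Suc n) * (1 / (1 - \<alpha>))" using B(1) \<gamma>_nonneg law.alpha by (intro add_nonneg_nonneg mult_nonneg_nonneg) auto
  ultimately show ?case by blast
qed

lemma D_bounded:
  fixes D :: "real \<Rightarrow> real \<Rightarrow> real"
  assumes D: "\<And>\<xi> x. \<bar>D \<xi> x\<bar> \<le> A * (1 + \<bar>\<xi> - xs\<bar>)"
  shows "\<exists>B\<ge>0. \<forall>\<omega> x. \<bar>D (xi n \<omega>) x\<bar> \<le> B"
proof -
  obtain B where B: "B \<ge> 0" "\<And>\<omega>. \<bar>xi n \<omega> - xs\<bar> \<le> B" using xi_bounded by blast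
  have A: "A \<ge> 0" using D[of xs 0] by simp
  have "\<bar>D (xi n \<omega>) x\<bar> \<le> A * (1 + B)" for \<omega> x
    using D[of "xi n \<omega>" x] mult_left_mono[of "1 + \<bar>xi n \<omega> - xs\<bar>" "1 + B" A] A B(2)[of \<omega>] by linarith
  then show ?thesis using A B(1) by (intro exI[of _ "A * (1 + B)"]) auto
qed

lemma lin_bounded:
  assumes D: "\<And>\<xi> x. \<bar>D \<xi> x\<bar> \<le> A * (1 + \<bar>\<xi> - xs\<bar>)" and z: "\<And>\<omega>. \<bar>z (Y 0 \<omega>)\<bar> \<le> Bz"
  shows "\<exists>B\<ge>0. \<forall>\<omega>. \<bar>lin \<theta> h D z n \<omega>\<bar> \<le> B"
proof (induct n)
  case 0
  have "0 \<le> Bz" using z[of undefined] by linarith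
  then show ?case using z by (intro exI[of _ Bz]) (auto simp: lin_0)
next
  case (Suc n)
  then obtain B where B: "B \<ge> 0" "\<And>\<omega>. \<bar>lin \<theta> h D z n \<omega>\<bar> \<le> B" by blast
  obtain B' where B': "B' \<ge> 0" "\<And>\<omega> x. \<bar>D (xi n \<omega>) x\<bar> \<le> B'" using D_bounded[of D A n] D by blast
  have "\<bar>lin \<theta> h D z (Suc n) \<omega>\<bar> \<le> \<bar>\<theta> (Suc n)\<bar> * B + \<bar>h (Suc n)\<bar> * B'" for \<omega>
    unfolding lin_Suc
    by (rule order_trans[OF abs_triangle_ineq]) (auto simp: abs_mult intro!: add_mono mult_left_mono B B')
  then show ?case using B(1) B'(1) by (intro exI[of _ "\<bar>\<theta> (Suc n)\<bar> * B + \<bar>h (Suc n)\<bar> * B'"]) auto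
qed

lemma integrable_bounded: "P \<in> borel_measurable M \<Longrightarrow> (\<And>\<omega>. \<bar>P \<omega>\<bar> \<le> B) \<Longrightarrow> integrable M (P :: 'w \<Rightarrow> real)"
  by (rule integrable_const_bound[where B=B]) auto

lemma integrable_err_sq [simp]: "integrable M (\<lambda>\<omega>. (xi n \<omega> - xs)\<^sup>2)"
proof -
  obtain B where B: "B \<ge> 0" "\<And>\<omega>. \<bar>xi n \<omega> - xs\<bar> \<le> B" using xi_bounded by blast
  have "\<bar>(xi n \<omega> - xs)\<^sup>2\<bar> \<le> B\<^sup>2" for \<omega> using power_mono[OF B(2)[of \<omega>], of 2] by simp
  then show ?thesis by (intro integrable_bounded) measurable
qed

lemma integrable_err_abs [simp]: "integrable M (\<lambda>\<omega>. \<bar>xi n \<omega> - xs\<bar>)"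
proof -
  obtain B where B: "B \<ge> 0" "\<And>\<omega>. \<bar>xi n \<omega> - xs\<bar> \<le> B" using xi_bounded by blast
  then show ?thesis by (intro integrable_bounded[where B=B]) auto
qed

text \<open>The cross term vanishes: \<open>lin\<close> at time n is a function of the past and the
  source has mean zero in the fresh sample. \<open>Q\<close> bounds the conditional second moment of
  the source and is chosen according to the source at hand.\<close>

lemma martingale_second_moment:
  assumes Dm: "(\<lambda>p. D (fst p) (snd p)) \<in> borel_measurable (borel \<Otimes>\<^sub>M borel)" and z: "z \<in> borel_measurable borel"
    and D: "\<And>\<xi> x. \<bar>D \<xi> x\<bar> \<le> A * (1 + \<bar>\<xi> - xs\<bar>)" and Bz: "\<And>\<omega>. \<bar>z (Y 0 \<omega>)\<bar> \<le> Bz"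
    and mean: "\<And>\<xi>. (\<integral>x. D \<xi> x \<partial>\<mu>) = 0"
    and Q: "\<And>\<xi>. (\<integral>x. (D \<xi> x)\<^sup>2 \<partial>\<mu>) \<le> Q \<xi>" "integrable M (\<lambda>\<omega>. Q (xi n \<omega>))"
  shows "integrable M (\<lambda>\<omega>. (lin \<theta> h D z n \<omega>)\<^sup>2)"
    and "(\<integral>\<omega>. (lin \<theta> h D z (Suc n) \<omega>)\<^sup>2 \<partial>M) \<le> (\<theta> (Suc n))\<^sup>2 * (\<integral>\<omega>. (lin \<theta> h D z n \<omega>)\<^sup>2 \<partial>M)
             + (h (Suc n))\<^sup>2 * (\<integral>\<omega>. Q (xi n \<omega>) \<partial>M)"
proof -
  let ?T = "lin \<theta> h D z n" and ?D = "\<lambda>\<omega>. D (xi n \<omega>) (Y (Suc n) \<omega>)"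
  have Tm[measurable]: "?T \<in> borel_measurable M" by (rule lin_meas[OF Dm z])
  have Dmm[measurable]: "?D \<in> borel_measurable M"
    using measurable_compose[OF _ Dm, of "\<lambda>\<omega>. (xi n \<omega>, Y (Suc n) \<omega>)" M] by simp
  obtain B1 where B1: "B1 \<ge> 0" "\<And>\<omega>. \<bar>?T \<omega>\<bar> \<le> B1" using lin_bounded[of D A z Bz] D Bz by blast
  obtain B2 where B2: "B2 \<ge> 0" "\<And>\<omega> x. \<bar>D (xi n \<omega>) x\<bar> \<le> B2" using D_bounded[of D A n] D by blast
  have iT: "integrable M (\<lambda>\<omega>. (?T \<omega>)\<^sup>2)"
    by (intro integrable_bounded[where B="B1\<^sup>2"]) (auto intro!: B1 abs_le_square_iff[THEN iffD1, of _ "B1", simplified abs_of_nonneg[OF B1(1)]])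
  then show "integrable M (\<lambda>\<omega>. (?T \<omega>)\<^sup>2)" .
  have iD: "integrable M (\<lambda>\<omega>. (?D \<omega>)\<^sup>2)"
    by (intro integrable_bounded[where B="B2\<^sup>2"]) (auto intro!: B2 abs_le_square_iff[THEN iffD1, of _ "B2", simplified abs_of_nonneg[OF B2(1)]])
  have iTD: "integrable M (\<lambda>\<omega>. ?T \<omega> * ?D \<omega>)"
    by (intro integrable_bounded[where B="B1 * B2"]) (auto simp: abs_mult intro!: mult_mono B1 B2)
  have ad: "adapted_to Y n (\<lambda>\<omega>. (xi n \<omega>, ?T \<omega>))"
    by (intro adapted_to_Pair xi_adapted lin_adapted Dm z)
  have cross: "(\<integral>\<omega>. ?T \<omega> * ?D \<omega> \<partial>M) = 0"
  proof -
    let ?\<phi> = "\<lambda>q :: (real \<times> real) \<times> real. snd (fst q) * D (fst (fst q)) (snd q)"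
    have m1: "(\<lambda>q. D (fst (fst q)) (snd q)) \<in> borel_measurable ((borel \<Otimes>\<^sub>M borel) \<Otimes>\<^sub>M borel)"
      using measurable_compose[OF _ Dm, of "\<lambda>q. (fst (fst q), snd q)" "(borel \<Otimes>\<^sub>M borel) \<Otimes>\<^sub>M borel"] by simp
    have m: "?\<phi> \<in> borel_measurable ((borel :: (real \<times> real) measure) \<Otimes>\<^sub>M borel)"
      unfolding borel_prod[symmetric] using m1 by measurable
    have "(\<integral>\<omega>. ?\<phi> ((xi n \<omega>, ?T \<omega>), Y (Suc n) \<omega>) \<partial>M) = (\<integral>\<omega>. (\<integral>x. ?\<phi> ((xi n \<omega>, ?T \<omega>), x) \<partial>\<mu>) \<partial>M)"
      by (rule adapted_next_expectation(2)[OF indep ad distr_Y m]) (use iTD in simp)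
    then show ?thesis by (simp add: mean)
  qed
  have sq: "(\<integral>\<omega>. (?D \<omega>)\<^sup>2 \<partial>M) \<le> (\<integral>\<omega>. Q (xi n \<omega>) \<partial>M)"
  proof -
    let ?\<phi> = "\<lambda>q. (D (fst q) (snd q))\<^sup>2"
    have m: "?\<phi> \<in> borel_measurable (borel \<Otimes>\<^sub>M borel)" using Dm by measurable
    have i: "integrable M (\<lambda>\<omega>. ?\<phi> (xi n \<omega>, Y (Suc n) \<omega>))" using iD by simp
    note e = adapted_next_expectation[OF indep xi_adapted distr_Y m i]
    have "(\<integral>\<omega>. (?D \<omega>)\<^sup>2 \<partial>M) = (\<integral>\<omega>. (\<integral>x. (D (xi n \<omega>) x)\<^sup>2 \<partial>\<mu>) \<partial>M)" using e(2) by simp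
    also have "\<dots> \<le> (\<integral>\<omega>. Q (xi n \<omega>) \<partial>M)" using e(1) Q by (intro integral_mono) auto
    finally show ?thesis .
  qed
  have "(lin \<theta> h D z (Suc n) \<omega>)\<^sup>2 = (\<theta> (Suc n))\<^sup>2 * (?T \<omega>)\<^sup>2 + 2 * \<theta> (Suc n) * h (Suc n) * (?T \<omega> * ?D \<omega>) + (h (Suc n))\<^sup>2 * (?D \<omega>)\<^sup>2" for \<omega>
    unfolding lin_Suc by (simp add: power2_sum power_mult_distrib)
  then have "(\<integral>\<omega>. (lin \<theta> h D z (Suc n) \<omega>)\<^sup>2 \<partial>M) = (\<theta> (Suc n))\<^sup>2 * (\<integral>\<omega>. (?T \<omega>)\<^sup>2 \<partial>M) + (h (Suc n))\<^sup>2 * (\<integral>\<omega>. (?D \<omega>)\<^sup>2 \<partial>M)"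
    using iT iD iTD cross by simp
  also have "\<dots> \<le> (\<theta> (Suc n))\<^sup>2 * (\<integral>\<omega>. (?T \<omega>)\<^sup>2 \<partial>M) + (h (Suc n))\<^sup>2 * (\<integral>\<omega>. Q (xi n \<omega>) \<partial>M)"
    using sq by (intro add_left_mono mult_left_mono) auto
  finally show "(\<integral>\<omega>. (lin \<theta> h D z (Suc n) \<omega>)\<^sup>2 \<partial>M) \<le> (\<theta> (Suc n))\<^sup>2 * (\<integral>\<omega>. (?T \<omega>)\<^sup>2 \<partial>M) + (h (Suc n))\<^sup>2 * (\<integral>\<omega>. Q (xi n \<omega>) \<partial>M)" .
qed

text \<open>The scale of \<open>cosh_drift\<close>, of order C/a. Exponential moments of this order
  are required of the initial value, which is why it is assumed bounded.\<close>

definition kap where "kap = 2 * C / (a * (1 - \<alpha>))"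
definition lyap where "lyap n = (\<integral>\<omega>. cosh (kap * (xi n \<omega> - xs)) - 1 \<partial>M)"

lemma kap_pos: "kap > 0" using law.C_pos a law.alpha by (simp add: kap_def)

lemma integrable_cosh [simp]: "integrable M (\<lambda>\<omega>. cosh (kap * (xi n \<omega> - xs)))"
proof -
  obtain B where B: "B \<ge> 0" "\<And>\<omega>. \<bar>xi n \<omega> - xs\<bar> \<le> B" using xi_bounded by blast
  have "\<bar>cosh (kap * (xi n \<omega> - xs))\<bar> \<le> cosh (kap * B)" for \<omega>
  proof -
    have "cosh (kap * (xi n \<omega> - xs)) = cosh (kap * \<bar>xi n \<omega> - xs\<bar>)"
      using kap_pos cosh_real_abs[of "kap * (xi n \<omega> - xs)"] by (simp add: abs_mult)
    also have "\<dots> \<le> cosh (kap * B)" using kap_pos B by (subst cosh_real_nonneg_le_iff) auto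
    finally show ?thesis by simp
  qed
  moreover have "continuous_on UNIV (cosh :: real \<Rightarrow> real)" by (intro continuous_intros)
  then have "(cosh :: real \<Rightarrow> real) \<in> borel_measurable borel" by (rule borel_measurable_continuous_onI)
  ultimately show ?thesis by (intro integrable_bounded) auto
qed

lemma lyap_nonneg: "0 \<le> lyap n" unfolding lyap_def
  by (intro Bochner_Integration.integral_nonneg) (auto simp: cosh_real_ge_1)

lemma lyap_0: "lyap 0 \<le> cosh (kap * R)"
proof -
  have R: "0 \<le> R" using Y0[of undefined] by linarith
  have "cosh (kap * (xi 0 \<omega> - xs)) - 1 \<le> cosh (kap * R)" for \<omega>
  proof -
    have "cosh (kap * (xi 0 \<omega> - xs)) = cosh (kap * \<bar>xi 0 \<omega> - xs\<bar>)"
      using kap_pos cosh_real_abs[of "kap * (xi 0 \<omega> - xs)"] by (simp add: abs_mult)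
    also have "\<dots> \<le> cosh (kap * R)" using kap_pos R Y0 by (subst cosh_real_nonneg_le_iff) (auto simp: xi_0)
    finally show ?thesis by simp
  qed
  then have "lyap 0 \<le> (\<integral>\<omega>. cosh (kap * R) \<partial>M)" unfolding lyap_def by (intro integral_mono) auto
  then show ?thesis by (simp add: prob_space)
qed

text \<open>The second-order coefficient of \<open>cosh_shift_le\<close>, with scaled increments
  bounded by kap g/(1 - \<alpha>).\<close>

definition K1 where "K1 = 2 * exp (kap * g * (1 / (1 - \<alpha>))) * (kap * (1 / (1 - \<alpha>)))\<^sup>2"

text \<open>The mean of the first-order term is the drift of \<open>cosh_drift\<close>, which yields
  the contraction a/2. The additive error K1 \<gamma>^2 is rewritten as a multiple of \<gamma> times
  the power -b of the step number, the forcing of the step-size recursion with decay exponent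
  b.\<close>

lemma lyap_Suc:
  "lyap (Suc n) \<le> (1 - a / 2 * \<gamma> (Suc n) + K1 * (\<gamma> (Suc n))\<^sup>2) * lyap n + K1 * g * \<gamma> (Suc n) * real (Suc n) powr (- b)"
proof -
  let ?G = "\<gamma> (Suc n)" and ?c = "1 / (1 - \<alpha>)"
  let ?u = "\<lambda>\<omega>. kap * (xi n \<omega> - xs)" and ?H = "\<lambda>\<omega>. H1 \<alpha> (xi n \<omega>) (Y (Suc n) \<omega>)"
  obtain B where B: "B \<ge> 0" "\<And>\<omega>. \<bar>xi n \<omega> - xs\<bar> \<le> B" using xi_bounded by blast
  have shm: "(sinh :: real \<Rightarrow> real) \<in> borel_measurable borel"
    by (intro borel_measurable_continuous_onI continuous_intros)
  have pt: "cosh (kap * (xi (Suc n) \<omega> - xs)) \<le> cosh (?u \<omega>) - kap * ?G * (?H \<omega> * sinh (?u \<omega>)) + K1 * ?G\<^sup>2 * cosh (?u \<omega>)" for \<omega>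
  proof -
    let ?y = "kap * ?G * ?H \<omega>"
    have ab: "\<bar>?y\<bar> \<le> kap * ?G * ?c"
      unfolding abs_mult using kap_pos \<gamma>_nonneg[of "Suc n"] law.abs_H1_le by (intro mult_mono) auto
    also have "\<dots> \<le> kap * g * ?c"
      using kap_pos \<gamma>_le law.alpha by (intro mult_right_mono mult_left_mono) auto
    finally have X: "\<bar>?y\<bar> \<le> kap * g * ?c" .
    have "?y\<^sup>2 \<le> (kap * ?G * ?c)\<^sup>2" using ab by (metis abs_ge_zero power2_abs power_mono)
    then have "2 * exp (kap * g * ?c) * ?y\<^sup>2 * cosh (?u \<omega>) \<le> 2 * exp (kap * g * ?c) * (kap * ?G * ?c)\<^sup>2 * cosh (?u \<omega>)"
      by (intro mult_right_mono mult_left_mono) auto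
    also have "\<dots> = K1 * ?G\<^sup>2 * cosh (?u \<omega>)" 
      by (simp add: K1_def power_mult_distrib power_divide mult_ac)
    finally have "cosh (?u \<omega> - ?y) \<le> cosh (?u \<omega>) - ?y * sinh (?u \<omega>) + K1 * ?G\<^sup>2 * cosh (?u \<omega>)"
      using cosh_shift_le[OF X, of "?u \<omega>"] by linarith
    moreover have "kap * (xi (Suc n) \<omega> - xs) = ?u \<omega> - ?y" by (simp add: xi_Suc algebra_simps)
    ultimately show ?thesis by (simp add: mult_ac)
  qed
  have shb: "\<bar>sinh (?u \<omega>)\<bar> \<le> sinh (kap * B)" for \<omega>
  proof -
    have "\<bar>sinh (?u \<omega>)\<bar> = sinh (kap * \<bar>xi n \<omega> - xs\<bar>)" 
      using kap_pos sinh_real_abs[of "?u \<omega>"] by (simp add: abs_mult)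
    also have "\<dots> \<le> sinh (kap * B)" using kap_pos B by simp
    finally show ?thesis .
  qed
  have iHs: "integrable M (\<lambda>\<omega>. ?H \<omega> * sinh (?u \<omega>))"
    by (intro integrable_bounded[where B="?c * sinh (kap * B)"])
       (use shm law.alpha B kap_pos in \<open>auto simp: abs_mult simp del: times_divide_eq_left intro!: mult_mono shb law.abs_H1_le\<close>)
  let ?\<phi> = "\<lambda>q. H1 \<alpha> (fst q) (snd q) * sinh (kap * (fst q - xs))"
  have m: "?\<phi> \<in> borel_measurable (borel \<Otimes>\<^sub>M borel)" using shm by measurable
  have iq: "integrable M (\<lambda>\<omega>. ?\<phi> (xi n \<omega>, Y (Suc n) \<omega>))" using iHs by simp
  note e = adapted_next_expectation[OF indep xi_adapted distr_Y m iq]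
  have i1: "integrable M (\<lambda>\<omega>. dVfun \<alpha> \<mu> (xi n \<omega>) * sinh (?u \<omega>))"
    using e(1) by (simp add: law.integral_H1)
  have e2: "(\<integral>\<omega>. ?H \<omega> * sinh (?u \<omega>) \<partial>M) = (\<integral>\<omega>. dVfun \<alpha> \<mu> (xi n \<omega>) * sinh (?u \<omega>) \<partial>M)"
    using e(2) by (simp add: law.integral_H1)
  have ly: "lyap n = (\<integral>\<omega>. cosh (kap * (xi n \<omega> - xs)) \<partial>M) - 1" for n
    unfolding lyap_def by (simp add: prob_space)
  have "a / 2 * lyap n = (\<integral>\<omega>. a / 2 * (cosh (?u \<omega>) - 1) \<partial>M)" unfolding lyap_def by simp
  also have "\<dots> \<le> (\<integral>\<omega>. kap * (dVfun \<alpha> \<mu> (xi n \<omega>) * sinh (?u \<omega>)) \<partial>M)"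
  proof (rule integral_mono)
    show "a / 2 * (cosh (?u \<omega>) - 1) \<le> kap * (dVfun \<alpha> \<mu> (xi n \<omega>) * sinh (?u \<omega>))" for \<omega>
      unfolding kap_def by (rule law.cosh_drift[OF a])
  qed (use i1 in auto)
  finally have dr: "a / 2 * lyap n \<le> kap * (\<integral>\<omega>. dVfun \<alpha> \<mu> (xi n \<omega>) * sinh (?u \<omega>) \<partial>M)" by simp
  have "(\<integral>\<omega>. cosh (kap * (xi (Suc n) \<omega> - xs)) \<partial>M) \<le>
      (\<integral>\<omega>. cosh (?u \<omega>) - kap * ?G * (?H \<omega> * sinh (?u \<omega>)) + K1 * ?G\<^sup>2 * cosh (?u \<omega>) \<partial>M)"
    using iHs pt by (intro integral_mono) auto
  also have "\<dots> = (\<integral>\<omega>. cosh (?u \<omega>) \<partial>M) - kap * ?G * (\<integral>\<omega>. dVfun \<alpha> \<mu> (xi n \<omega>) * sinh (?u \<omega>) \<partial>M)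
      + K1 * ?G\<^sup>2 * (\<integral>\<omega>. cosh (?u \<omega>) \<partial>M)" using iHs e2 by simp
  finally have main: "(\<integral>\<omega>. cosh (kap * (xi (Suc n) \<omega> - xs)) \<partial>M) \<le> (\<integral>\<omega>. cosh (?u \<omega>) \<partial>M)
      - kap * ?G * (\<integral>\<omega>. dVfun \<alpha> \<mu> (xi n \<omega>) * sinh (?u \<omega>) \<partial>M) + K1 * ?G\<^sup>2 * (\<integral>\<omega>. cosh (?u \<omega>) \<partial>M)" .
  have ly': "(\<integral>\<omega>. cosh (?u \<omega>) \<partial>M) = lyap n + 1" by (simp add: ly)
  have "lyap (Suc n) \<le> lyap n - ?G * (kap * (\<integral>\<omega>. dVfun \<alpha> \<mu> (xi n \<omega>) * sinh (?u \<omega>) \<partial>M)) + K1 * ?G\<^sup>2 * (lyap n + 1)"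
    using main unfolding ly' ly[of "Suc n"] by (simp add: mult_ac)
  also have "\<dots> \<le> lyap n - ?G * (a / 2 * lyap n) + K1 * ?G\<^sup>2 * (lyap n + 1)"
    using mult_left_mono[OF dr \<gamma>_nonneg[of "Suc n"]] by linarith
  also have "\<dots> = (1 - a / 2 * ?G + K1 * ?G\<^sup>2) * lyap n + K1 * ?G\<^sup>2" by (simp add: algebra_simps)
  also have "(1 - a / 2 * ?G + K1 * ?G\<^sup>2) * lyap n + K1 * ?G\<^sup>2
      = (1 - a / 2 * ?G + K1 * ?G\<^sup>2) * lyap n + K1 * g * ?G * real (Suc n) powr (- b)" by (simp add: \<gamma>_def power2_eq_square)
  finally show ?thesis .
qed

lemma err_sq_le_lyap: "(\<integral>\<omega>. (xi n \<omega> - xs)\<^sup>2 \<partial>M) \<le> 4 / kap\<^sup>2 * lyap n"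
proof -
  have "(xi n \<omega> - xs)\<^sup>2 \<le> 4 / kap\<^sup>2 * (cosh (kap * (xi n \<omega> - xs)) - 1)" for \<omega>
  proof -
    have "kap\<^sup>2 * (xi n \<omega> - xs)\<^sup>2 \<le> 4 * (cosh (kap * (xi n \<omega> - xs)) - 1)"
    proof -
      have "x \<le> 4 * (c - 1)" if "1 + x / 4 \<le> c" for x c :: real using that by simp
      then show ?thesis using cosh_minus_one_le(3)[of "kap * (xi n \<omega> - xs)"] unfolding power_mult_distrib by blast
    qed
    then show ?thesis using kap_pos by (simp add: pos_le_divide_eq mult.commute)
  qed
  then have "(\<integral>\<omega>. (xi n \<omega> - xs)\<^sup>2 \<partial>M) \<le> (\<integral>\<omega>. 4 / kap\<^sup>2 * (cosh (kap * (xi n \<omega> - xs)) - 1) \<partial>M)"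
    by (intro integral_mono) auto
  also have "\<dots> = 4 / kap\<^sup>2 * lyap n" unfolding lyap_def by (rule integral_mult_right_zero)
  finally show ?thesis .
qed

end

subsection \<open>Linearisation and remainder\<close>

text \<open>A choice depending only on the parameters of the recursion, so that all bounds built from it
  are uniform in the law of the samples.\<close>

definition decay_const :: "real \<Rightarrow> real \<Rightarrow> real \<Rightarrow> real \<Rightarrow> real \<Rightarrow> real \<Rightarrow> real \<Rightarrow> real" where
  "decay_const g b a s C B Y = (SOME D. D \<ge> 0 \<and> (\<forall>y. (\<forall>n. 0 \<le> y n) \<longrightarrow> y 0 \<le> Y \<longrightarrow>
    (\<forall>n. y (Suc n) \<le> (1 - a * (g * real (Suc n) powr (- b)) + C * (g * real (Suc n) powr (- b))\<^sup>2) * y n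
                       + B * (g * real (Suc n) powr (- b)) * real (Suc n) powr (- s)) \<longrightarrow>
    (\<forall>n. y n \<le> D * real (Suc n) powr (- s))))"

lemma decay_const:
  assumes "g > 0" "0 < b" "b \<le> 1" "a > 0" "s \<ge> 0" "b = 1 \<Longrightarrow> s < a * g" "C \<ge> 0" "B \<ge> 0" "Y \<ge> 0"
  shows "0 \<le> decay_const g b a s C B Y"
    and "(\<And>n. 0 \<le> y n) \<Longrightarrow> y 0 \<le> Y \<Longrightarrow>
      (\<And>n. y (Suc n) \<le> (1 - a * (g * real (Suc n) powr (- b)) + C * (g * real (Suc n) powr (- b))\<^sup>2) * y n
                       + B * (g * real (Suc n) powr (- b)) * real (Suc n) powr (- s)) \<Longrightarrow>
      y n \<le> decay_const g b a s C B Y * real (Suc n) powr (- s)"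
proof -
  note * = someI_ex[OF step_recursion_decay[OF assms], folded decay_const_def]
  show "0 \<le> decay_const g b a s C B Y" using * by blast
  show "(\<And>n. 0 \<le> y n) \<Longrightarrow> y 0 \<le> Y \<Longrightarrow>
      (\<And>n. y (Suc n) \<le> (1 - a * (g * real (Suc n) powr (- b)) + C * (g * real (Suc n) powr (- b))\<^sup>2) * y n
                       + B * (g * real (Suc n) powr (- b)) * real (Suc n) powr (- s)) \<Longrightarrow>
      y n \<le> decay_const g b a s C B Y * real (Suc n) powr (- s)"
    using * by blast
qed

lemma of_nat_square_powr: "K > 0 \<Longrightarrow> real (K\<^sup>2) powr (- c) = real K powr (- 2 * c)"
proof -
  assume "K > 0"
  then have "real (K\<^sup>2) = real K powr 2" by (simp add: powr_numeral)
  then show ?thesis by (simp only: powr_powr) simp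
qed

text \<open>The averages of k^(-b) obey the step-size recursion with \<gamma>_n = 1/n. In that
  critical case the decay exponent must stay below the rate 1, hence the cap 3/4; any exponent
  strictly between 1/2 and 1 and not above \<open>b\<close> would do.\<close>

lemma sum_powr_over_root:
  fixes b :: real
  assumes b: "1 / 2 < b"
  shows "(\<lambda>K::nat. (\<Sum>k<K\<^sup>2. real (Suc k) powr (- b)) / real K) \<longlonglongrightarrow> 0"
proof -
  define s where "s = min b (3 / 4)"
  have s: "1 / 2 < s" "s < 1" "s \<le> b" using b by (auto simp: s_def)
  define y where "y n = (\<Sum>k<n. real (Suc k) powr (- b)) / real n" for n :: nat
  have y0: "0 \<le> y n" for n unfolding y_def by (intro divide_nonneg_nonneg sum_nonneg) auto
  have p1: "real (Suc n) powr - 1 = 1 / real (Suc n)" for n by (simp add: powr_minus_divide)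
  have "y (Suc n) \<le> (1 - 1 * (1 * real (Suc n) powr (- 1)) + 0 * (1 * real (Suc n) powr (- 1))\<^sup>2) * y n
                       + 1 * (1 * real (Suc n) powr (- 1)) * real (Suc n) powr (- s)" for n
  proof -
    have ny: "(\<Sum>k<n. real (Suc k) powr (- b)) = real n * y n" by (cases n) (auto simp: y_def)
    have "y (Suc n) = (real n * y n + real (Suc n) powr (- b)) / real (Suc n)"
      unfolding ny[symmetric] y_def by simp
    also have "\<dots> \<le> (real n * y n + real (Suc n) powr (- s)) / real (Suc n)"
      using s by (intro divide_right_mono add_left_mono powr_mono) auto
    also have "\<dots> = (1 - 1 / real (Suc n)) * y n + 1 / real (Suc n) * real (Suc n) powr (- s)"
    proof -
      have "1 - 1 / real (Suc n) = real n / real (Suc n)" by (simp add: field_simps)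
      then show ?thesis by (simp add: add_divide_distrib)
    qed
    finally show ?thesis unfolding p1 by simp
  qed
  from decay_const(2)[of 1 1 1 s 0 1 0 y, OF _ _ _ _ _ _ _ _ _ y0 _ this] s
  have yD: "y n \<le> decay_const 1 1 1 s 0 1 0 * real (Suc n) powr (- s)" for n by (simp add: y_def)
  define D where "D = decay_const 1 1 1 s 0 1 0"
  have D: "D \<ge> 0" unfolding D_def by (rule decay_const(1)) (use s in auto)
  have lim: "(\<lambda>K. D * real K powr (1 - 2 * s)) \<longlonglongrightarrow> 0"
    using s by (intro tendsto_mult_right_zero tendsto_neg_powr) (auto simp: filterlim_real_sequentially)
  have "(\<Sum>k<K\<^sup>2. real (Suc k) powr (- b)) / real K \<le> D * real K powr (1 - 2 * s)" if "K > 0" for K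
  proof -
    have "(\<Sum>k<K\<^sup>2. real (Suc k) powr (- b)) / real K = real K * y (K\<^sup>2)"
      using that by (simp add: y_def power2_eq_square)
    also have "\<dots> \<le> real K * (D * real (Suc (K\<^sup>2)) powr (- s))"
      by (intro mult_left_mono yD[folded D_def]) auto
    also have "\<dots> \<le> real K * (D * (real (K\<^sup>2)) powr (- s))"
      using that D s by (intro mult_left_mono powr_mono2') auto
    also have "real (K\<^sup>2) powr (- s) = real K powr (- 2 * s)"
      using that by (rule of_nat_square_powr)
    also have "real K * (D * real K powr (- 2 * s)) = D * (real K powr 1 * real K powr (- 2 * s))" by simp
    also have "real K powr 1 * real K powr (- 2 * s) = real K powr (1 - 2 * s)"
      by (subst powr_add[symmetric]) simp
    finally show ?thesis .
  qed
  then show ?thesis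
    by (intro tendsto_sandwich[OF _ _ tendsto_const lim])
       (auto intro!: eventually_sequentiallyI[of 1] divide_nonneg_nonneg sum_nonneg)
qed

text \<open>Young's inequality with a free parameter in place of Cauchy-Schwarz. The best
  \<open>t\<close> is the reciprocal of the root mean square, and powers of that order are inserted
  later.\<close>

lemma (in prob_space) expectation_abs_le_square:
  fixes P :: "'a \<Rightarrow> real"
  assumes t: "t > 0" and P: "P \<in> borel_measurable M" and i: "integrable M (\<lambda>\<omega>. (P \<omega>)\<^sup>2)"
  shows "integrable M (\<lambda>\<omega>. \<bar>P \<omega>\<bar>)"
    and "(\<integral>\<omega>. \<bar>P \<omega>\<bar> \<partial>M) \<le> (t * (\<integral>\<omega>. (P \<omega>)\<^sup>2 \<partial>M) + 1 / t) / 2"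
proof -
  have *: "\<bar>x\<bar> \<le> (t * x\<^sup>2 + 1 / t) / 2" if "t > 0" for x t :: real
  proof -
    have "0 \<le> (t * \<bar>x\<bar> - 1)\<^sup>2 / t" using that by simp
    also have "\<dots> = t * x\<^sup>2 + 1 / t - 2 * \<bar>x\<bar>" using that by (simp add: power2_diff power_mult_distrib field_simps power2_eq_square)
    finally show ?thesis by simp
  qed
  show ia: "integrable M (\<lambda>\<omega>. \<bar>P \<omega>\<bar>)"
    by (rule Bochner_Integration.integrable_bound[of _ "\<lambda>\<omega>. ((P \<omega>)\<^sup>2 + 1) / 2"])
       (use i P *[of 1] in \<open>auto simp: abs_le_iff intro: order_trans\<close>)
  have "(\<integral>\<omega>. \<bar>P \<omega>\<bar> \<partial>M) \<le> (\<integral>\<omega>. (t * (P \<omega>)\<^sup>2 + 1 / t) / 2 \<partial>M)"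
    using ia i *[OF t] by (intro integral_mono) auto
  also have "\<dots> = (t * (\<integral>\<omega>. (P \<omega>)\<^sup>2 \<partial>M) + 1 / t) / 2" using i by (simp add: prob_space)
  finally show "(\<integral>\<omega>. \<bar>P \<omega>\<bar> \<partial>M) \<le> (t * (\<integral>\<omega>. (P \<omega>)\<^sup>2 \<partial>M) + 1 / t) / 2" .
qed

section \<open>Rates for the error and the remainders\<close>

context nsa_process
begin

lemma R_nonneg: "0 \<le> R" using Y0[of undefined] by linarith

text \<open>The arguments of \<open>decay_const\<close> are read off the recursions for
  \<open>lyap\<close>, \<open>R1\<close> and \<open>R2\<close>: contraction rates a/2, 2a, a and
  decay exponents b, 3b/2, b. The constants are formed from \<alpha>, \<open>C\<close>,
  \<open>g\<close>, \<open>b\<close>, \<open>a\<close> and \<open>R\<close>, hence common to all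
  laws with these parameters.\<close>

definition D0 where "D0 = 4 / kap\<^sup>2 * decay_const g b (a / 2) b K1 (K1 * g) (cosh (kap * R))"
definition D1 where "D1 = decay_const g b (2 * a) (3 * b / 2) ((C / (1 - \<alpha>))\<^sup>2) (C / (1 - \<alpha>)\<^sup>2 * ((D0 + 1) / 2) * g) 0"
definition D2 where "D2 = decay_const g b a b ((C / (1 - \<alpha>))\<^sup>2) (C / (1 - \<alpha>) * D0) R"

lemma K1_nonneg: "0 \<le> K1" by (simp add: K1_def)

lemma D0_nonneg: "0 \<le> D0"
  unfolding D0_def using g b a crit K1_nonneg
  by (intro mult_nonneg_nonneg decay_const(1)) (auto simp: mult.commute)

lemma err_sq: "(\<integral>\<omega>. (xi n \<omega> - xs)\<^sup>2 \<partial>M) \<le> D0 * real (Suc n) powr (- b)"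
proof -
  have "lyap n \<le> decay_const g b (a / 2) b K1 (K1 * g) (cosh (kap * R)) * real (Suc n) powr (- b)"
  proof (rule decay_const(2))
    show "lyap (Suc n) \<le> (1 - a / 2 * (g * real (Suc n) powr (- b)) + K1 * (g * real (Suc n) powr (- b))\<^sup>2) * lyap n
                       + K1 * g * (g * real (Suc n) powr (- b)) * real (Suc n) powr (- b)" for n
      using lyap_Suc[of n] unfolding \<gamma>_def .
  qed (use g b a crit K1_nonneg lyap_nonneg lyap_0 in \<open>auto simp: mult.commute\<close>)
  then have "4 / kap\<^sup>2 * lyap n \<le> 4 / kap\<^sup>2 * (decay_const g b (a / 2) b K1 (K1 * g) (cosh (kap * R)) * real (Suc n) powr (- b))"
    by (intro mult_left_mono) auto
  then show ?thesis using err_sq_le_lyap[of n] by (simp add: D0_def)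
qed

lemma err_abs: "(\<integral>\<omega>. \<bar>xi n \<omega> - xs\<bar> \<partial>M) \<le> (D0 + 1) / 2 * real (Suc n) powr (- b / 2)"
proof -
  let ?t = "real (Suc n) powr (b / 2)"
  have t: "?t > 0" by simp
  have "(\<integral>\<omega>. \<bar>xi n \<omega> - xs\<bar> \<partial>M) \<le> (?t * (\<integral>\<omega>. (xi n \<omega> - xs)\<^sup>2 \<partial>M) + 1 / ?t) / 2"
    by (rule expectation_abs_le_square[OF t]) auto
  also have "\<dots> \<le> (?t * (D0 * real (Suc n) powr (- b)) + 1 / ?t) / 2"
    using err_sq t by (intro divide_right_mono add_right_mono mult_left_mono) auto
  also have "?t * (D0 * real (Suc n) powr (- b)) = D0 * (?t * real (Suc n) powr (- b))" by simp
  also have "?t * real (Suc n) powr (- b) = real (Suc n) powr (- b / 2)" by (simp add: powr_add[symmetric])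
  also have "1 / ?t = real (Suc n) powr (- b / 2)" by (simp add: powr_minus_divide)
  finally show ?thesis by (simp add: field_simps)
qed

definition \<theta> where "\<theta> n = 1 - \<gamma> n * v"

lemma \<theta>_bounds:
  "\<bar>\<theta> n\<bar> \<le> 1 - a * \<gamma> n + (C / (1 - \<alpha>))\<^sup>2 * (\<gamma> n)\<^sup>2"
  "(\<theta> n)\<^sup>2 \<le> 1 - 2 * a * \<gamma> n + (C / (1 - \<alpha>))\<^sup>2 * (\<gamma> n)\<^sup>2"
  "(\<theta> n) ^ 4 \<le> 1 - 4 * a * \<gamma> n + (6 + (C / (1 - \<alpha>) * g)\<^sup>2) * (C / (1 - \<alpha>))\<^sup>2 * (\<gamma> n)\<^sup>2"
proof -
  let ?x = "a * \<gamma> n" and ?y = "\<gamma> n * v" and ?c = "C / (1 - \<alpha>) * \<gamma> n"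
  have h: "0 \<le> ?x" "?x \<le> ?y" "?y \<le> ?c"
    unfolding mult.commute[of "\<gamma> n"] using a \<gamma>_nonneg[of n] v_le
    by (intro mult_nonneg_nonneg mult_right_mono; simp)+
  show "\<bar>\<theta> n\<bar> \<le> 1 - a * \<gamma> n + (C / (1 - \<alpha>))\<^sup>2 * (\<gamma> n)\<^sup>2"
    "(\<theta> n)\<^sup>2 \<le> 1 - 2 * a * \<gamma> n + (C / (1 - \<alpha>))\<^sup>2 * (\<gamma> n)\<^sup>2"
    using abs_one_minus_le(1,2)[OF h] unfolding \<theta>_def power_mult_distrib by auto
  have c0: "0 \<le> ?c" using h by linarith
  have "?c \<le> C / (1 - \<alpha>) * g" using \<gamma>_le law.C_nonneg law.alpha by (intro mult_left_mono) auto
  then have "?c\<^sup>2 \<le> (C / (1 - \<alpha>) * g)\<^sup>2" using c0 by (intro power_mono)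
  then have "(6 + ?c\<^sup>2) * ?c\<^sup>2 \<le> (6 + (C / (1 - \<alpha>) * g)\<^sup>2) * ?c\<^sup>2" by (intro mult_right_mono) auto
  also have "\<dots> = (6 + (C / (1 - \<alpha>) * g)\<^sup>2) * (C / (1 - \<alpha>))\<^sup>2 * (\<gamma> n)\<^sup>2" by (simp only: power_mult_distrib mult_ac)
  finally show "(\<theta> n) ^ 4 \<le> 1 - 4 * a * \<gamma> n + (6 + (C / (1 - \<alpha>) * g)\<^sup>2) * (C / (1 - \<alpha>))\<^sup>2 * (\<gamma> n)\<^sup>2"
    using abs_one_minus_le(3)[OF h] unfolding \<theta>_def by linarith
qed

text \<open>\<open>L1\<close> and \<open>S1\<close> are the i.i.d. leading parts of the two estimates,
  \<open>R1\<close> and \<open>T1\<close> the martingale remainders, \<open>R2\<close> and \<open>T2\<close> the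
  drift remainders.\<close>

definition "L1 = lin \<theta> (\<lambda>n. - \<gamma> n) (\<lambda>\<xi> x. H1 \<alpha> xs x) (\<lambda>_. 0)"
definition "R1 = lin \<theta> (\<lambda>n. - \<gamma> n) (\<lambda>\<xi> x. H1 \<alpha> \<xi> x - H1 \<alpha> xs x - dVfun \<alpha> \<mu> \<xi>) (\<lambda>_. 0)"
definition "R2 = lin \<theta> (\<lambda>n. - \<gamma> n) (\<lambda>\<xi> x. dVfun \<alpha> \<mu> \<xi> - v * (\<xi> - xs)) (\<lambda>y. y - xs)"
definition "S1 = lin (\<lambda>_. 1) (\<lambda>_. 1) (\<lambda>\<xi> x. Jfun \<alpha> xs x - Vfun \<alpha> \<mu> xs) (\<lambda>_. 0)"
definition "T1 = lin (\<lambda>_. 1) (\<lambda>_. 1) (\<lambda>\<xi> x. Jfun \<alpha> \<xi> x - Vfun \<alpha> \<mu> \<xi> - (Jfun \<alpha> xs x - Vfun \<alpha> \<mu> xs)) (\<lambda>_. 0)"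
definition "T2 = lin (\<lambda>_. 1) (\<lambda>_. 1) (\<lambda>\<xi> x. Vfun \<alpha> \<mu> \<xi> - Vfun \<alpha> \<mu> xs) (\<lambda>_. 0)"

text \<open>The three sources add up to \<open>H1 \<alpha> \<xi> x - v * (\<xi> - xs)\<close>. The
  initial error is assigned to \<open>R2\<close>, so that \<open>L1\<close> depends on the samples
  from index 1 on and not on the initial value.\<close>

lemma xi_decomposition: "xi n \<omega> - xs = L1 n \<omega> + R1 n \<omega> + R2 n \<omega>"
proof -
  have "xi n \<omega> - xs = lin_path \<theta> (\<lambda>n. - \<gamma> n) (\<lambda>\<xi> y. H1 \<alpha> \<xi> y - v * (\<xi> - xs)) (Y 0 \<omega> - xs) (\<lambda>k. xi k \<omega>) (\<lambda>i. Y i \<omega>) n"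
    using xi_path_decomposition[of \<alpha> \<gamma> "\<lambda>i. Y i \<omega>" n xs v] by (simp add: xi_def[abs_def] \<theta>_def[abs_def])
  then show ?thesis unfolding L1_def R1_def R2_def lin_def lin_path_add by (simp add: algebra_simps)
qed

lemma chi_decomposition:
  "real n * (snd (nsa \<alpha> \<gamma> (Y 0 \<omega>) (\<lambda>i. Y i \<omega>) n) - chi_star \<alpha> \<mu>) = S1 n \<omega> + T1 n \<omega> + T2 n \<omega>"
proof -
  have "real n * (snd (nsa \<alpha> \<gamma> (Y 0 \<omega>) (\<lambda>i. Y i \<omega>) n) - chi_star \<alpha> \<mu>)
     = lin_path (\<lambda>_. 1) (\<lambda>_. 1) (\<lambda>\<xi> y. Jfun \<alpha> \<xi> y - Vfun \<alpha> \<mu> xs) 0 (\<lambda>k. xi k \<omega>) (\<lambda>i. Y i \<omega>) n"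
    using snd_nsa[of n \<alpha> \<gamma> "\<lambda>i. Y i \<omega>" "chi_star \<alpha> \<mu>"] by (simp add: xi_def[abs_def] chi_star_def)
  then show ?thesis unfolding S1_def T1_def T2_def lin_def lin_path_add by (simp add: algebra_simps)
qed

text \<open>By \<open>H1_diff_square\<close> the conditional variance of the source is of order
  |\<xi> - xs|, whose mean is of order n^(-b/2). The forcing \<gamma>^2 n^(-b/2) is, up to a
  constant, \<gamma> times n^(-3b/2).\<close>

lemma R1_square:
  "integrable M (\<lambda>\<omega>. (R1 n \<omega>)\<^sup>2)" "R1 n \<in> borel_measurable M"
  "(\<integral>\<omega>. (R1 n \<omega>)\<^sup>2 \<partial>M) \<le> D1 * real (Suc n) powr (- (3 * b / 2))"
proof -
  let ?D = "\<lambda>\<xi> x. H1 \<alpha> \<xi> x - H1 \<alpha> xs x - dVfun \<alpha> \<mu> \<xi>" and ?c = "1 / (1 - \<alpha>)"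
  let ?q = "C / (1 - \<alpha>)\<^sup>2"
  have Dm: "(\<lambda>p. ?D (fst p) (snd p)) \<in> borel_measurable (borel \<Otimes>\<^sub>M borel)" by measurable
  have D: "\<bar>?D \<xi> x\<bar> \<le> (3 * ?c) * (1 + \<bar>\<xi> - xs\<bar>)" for \<xi> x
  proof -
    have "\<bar>?D \<xi> x\<bar> \<le> 3 * ?c" using law.abs_H1_le[of \<xi> x] law.abs_H1_le[of xs x] law.abs_dVfun_le[of \<xi>] by linarith
    also have "\<dots> \<le> (3 * ?c) * (1 + \<bar>\<xi> - xs\<bar>)" using law.alpha by (intro mult_le_cancel_left1[THEN iffD2]) auto
    finally show ?thesis .
  qed
  have mean: "(\<integral>x. ?D \<xi> x \<partial>\<mu>) = 0" for \<xi>
    by (simp add: law.integral_H1 law.dVfun_zero)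
  have Q: "(\<integral>x. (?D \<xi> x)\<^sup>2 \<partial>\<mu>) \<le> ?q * \<bar>\<xi> - xs\<bar>" for \<xi>
  proof -
    have iq: "integrable \<mu> (\<lambda>x. (H1 \<alpha> \<xi> x - H1 \<alpha> xs x)\<^sup>2)"
    proof (rule law.integrable_const_bound[where B="(2 * ?c)\<^sup>2"])
      have "\<bar>H1 \<alpha> \<xi> x - H1 \<alpha> xs x\<bar> \<le> 2 * ?c" for x
        using law.abs_H1_le[of \<xi> x] law.abs_H1_le[of xs x] by linarith
      then have "(H1 \<alpha> \<xi> x - H1 \<alpha> xs x)\<^sup>2 \<le> (2 * ?c)\<^sup>2" for x by (metis abs_ge_zero power2_abs power_mono)
      then show "AE x in \<mu>. norm ((H1 \<alpha> \<xi> x - H1 \<alpha> xs x)\<^sup>2) \<le> (2 * ?c)\<^sup>2" by simp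
    qed measurable
    have "(?D \<xi> x)\<^sup>2 = (H1 \<alpha> \<xi> x - H1 \<alpha> xs x)\<^sup>2 - 2 * dVfun \<alpha> \<mu> \<xi> * (H1 \<alpha> \<xi> x - H1 \<alpha> xs x) + (dVfun \<alpha> \<mu> \<xi>)\<^sup>2" for x
      by (simp add: power2_eq_square algebra_simps)
    then have "(\<integral>x. (?D \<xi> x)\<^sup>2 \<partial>\<mu>) = (\<integral>x. (H1 \<alpha> \<xi> x - H1 \<alpha> xs x)\<^sup>2 \<partial>\<mu>) - 2 * dVfun \<alpha> \<mu> \<xi> * dVfun \<alpha> \<mu> \<xi> + (dVfun \<alpha> \<mu> \<xi>)\<^sup>2"
      using iq by (simp add: law.integral_H1 law.dVfun_zero)
    also have "\<dots> \<le> (\<integral>x. (H1 \<alpha> \<xi> x - H1 \<alpha> xs x)\<^sup>2 \<partial>\<mu>)" by (simp add: power2_eq_square)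
    also have "\<dots> \<le> ?q * \<bar>\<xi> - xs\<bar>" by (rule law.H1_diff_square)
    finally show ?thesis .
  qed
  note ms = martingale_second_moment[where D="?D" and z="\<lambda>_. 0" and A="3 * ?c" and Bz=0 and Q="\<lambda>\<xi>. ?q * \<bar>\<xi> - xs\<bar>" and \<theta>=\<theta> and h="\<lambda>n. - \<gamma> n",
      OF Dm _ D _ mean Q, folded R1_def]
  show "integrable M (\<lambda>\<omega>. (R1 n \<omega>)\<^sup>2)" by (rule ms(1)) auto
  show "R1 n \<in> borel_measurable M" unfolding R1_def by (rule lin_meas[OF Dm]) auto
  show "(\<integral>\<omega>. (R1 n \<omega>)\<^sup>2 \<partial>M) \<le> D1 * real (Suc n) powr (- (3 * b / 2))"
    unfolding D1_def
  proof (rule decay_const(2))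
    fix n
    let ?G = "g * real (Suc n) powr (- b)"
    have G: "\<gamma> (Suc n) = ?G" by (simp add: \<gamma>_def)
    have "(\<integral>\<omega>. (R1 (Suc n) \<omega>)\<^sup>2 \<partial>M) \<le> (\<theta> (Suc n))\<^sup>2 * (\<integral>\<omega>. (R1 n \<omega>)\<^sup>2 \<partial>M) + (- \<gamma> (Suc n))\<^sup>2 * (\<integral>\<omega>. ?q * \<bar>xi n \<omega> - xs\<bar> \<partial>M)"
      by (rule ms(2)) auto
    also have "(\<theta> (Suc n))\<^sup>2 * (\<integral>\<omega>. (R1 n \<omega>)\<^sup>2 \<partial>M) \<le> (1 - 2 * a * ?G + (C / (1 - \<alpha>))\<^sup>2 * ?G\<^sup>2) * (\<integral>\<omega>. (R1 n \<omega>)\<^sup>2 \<partial>M)"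
      using \<theta>_bounds(2)[of "Suc n"] unfolding G by (intro mult_right_mono) auto
    also have "(- \<gamma> (Suc n))\<^sup>2 * (\<integral>\<omega>. ?q * \<bar>xi n \<omega> - xs\<bar> \<partial>M) \<le> ?G\<^sup>2 * (?q * ((D0 + 1) / 2 * real (Suc n) powr (- b / 2)))"
      unfolding G integral_mult_right_zero power2_minus using err_abs[of n] law.C_nonneg by (intro mult_left_mono) auto
    also have "?G\<^sup>2 * (?q * ((D0 + 1) / 2 * real (Suc n) powr (- b / 2)))
        = ?q * ((D0 + 1) / 2) * g * ?G * (real (Suc n) powr (- b) * real (Suc n) powr (- b / 2))"
      by (simp only: power2_eq_square mult_ac)
    also have "real (Suc n) powr (- b) * real (Suc n) powr (- b / 2) = real (Suc n) powr (- (3 * b / 2))"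
      by (simp add: powr_add[symmetric])
    finally show "(\<integral>\<omega>. (R1 (Suc n) \<omega>)\<^sup>2 \<partial>M) \<le> (1 - 2 * a * ?G + (C / (1 - \<alpha>))\<^sup>2 * ?G\<^sup>2) * (\<integral>\<omega>. (R1 n \<omega>)\<^sup>2 \<partial>M)
        + ?q * ((D0 + 1) / 2) * g * ?G * real (Suc n) powr (- (3 * b / 2))" by simp
  qed (use g b a crit D0_nonneg law.C_nonneg law.alpha in \<open>auto simp: R1_def lin_0\<close>)
qed

text \<open>The source is the linearisation error of the drift, quadratic in \<xi> - xs but not
  centred, so it is bounded in mean rather than in mean square. The initial error, bounded by
  \<open>R\<close>, decays along with it.\<close>

lemma R2_abs:
  "integrable M (\<lambda>\<omega>. \<bar>R2 n \<omega>\<bar>)" "R2 n \<in> borel_measurable M"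
  "(\<integral>\<omega>. \<bar>R2 n \<omega>\<bar> \<partial>M) \<le> D2 * real (Suc n) powr (- b)"
proof -
  let ?D = "\<lambda>\<xi> x :: real. dVfun \<alpha> \<mu> \<xi> - v * (\<xi> - xs)" and ?c = "1 / (1 - \<alpha>)"
  have Dm: "(\<lambda>p. ?D (fst p) (snd p)) \<in> borel_measurable (borel \<Otimes>\<^sub>M borel)" by measurable
  have v0: "0 \<le> v" using law.f_nonneg law.alpha by simp
  have D: "\<bar>?D \<xi> x\<bar> \<le> (?c + v) * (1 + \<bar>\<xi> - xs\<bar>)" for \<xi> x :: real
  proof -
    have "\<bar>?D \<xi> x\<bar> \<le> ?c + v * \<bar>\<xi> - xs\<bar>"
      using order_trans[OF abs_triangle_ineq4[of "dVfun \<alpha> \<mu> \<xi>" "v * (\<xi> - xs)"] add_right_mono[OF law.abs_dVfun_le]]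
      unfolding abs_mult[of v "\<xi> - xs"] abs_of_nonneg[OF v0] .
    also have "\<dots> \<le> (?c + v) * (1 + \<bar>\<xi> - xs\<bar>)"
    proof -
      have "p + q * e \<le> (p + q) * (1 + e)" if "0 \<le> p" "0 \<le> q" "0 \<le> e" for p q e :: real
        using mult_nonneg_nonneg[OF that(1,3)] that by (simp add: algebra_simps)
      from this[of ?c v "\<bar>\<xi> - xs\<bar>"] show ?thesis using v0 law.alpha by simp
    qed
    finally show ?thesis .
  qed
  have meas: "R2 n \<in> borel_measurable M" for n unfolding R2_def by (rule lin_meas[OF Dm]) auto
  then show "R2 n \<in> borel_measurable M" .
  have int: "integrable M (\<lambda>\<omega>. \<bar>R2 n \<omega>\<bar>)" for n
  proof -
    obtain B where "\<And>\<omega>. \<bar>R2 n \<omega>\<bar> \<le> B" using lin_bounded[of ?D "?c + v" "\<lambda>y. y - xs" R \<theta> "\<lambda>n. - \<gamma> n" n] D Y0 unfolding R2_def by blast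
    then show ?thesis using meas[of n] by (intro integrable_bounded[where B=B]) auto
  qed
  then show "integrable M (\<lambda>\<omega>. \<bar>R2 n \<omega>\<bar>)" .
  show "(\<integral>\<omega>. \<bar>R2 n \<omega>\<bar> \<partial>M) \<le> D2 * real (Suc n) powr (- b)"
    unfolding D2_def
  proof (rule decay_const(2))
    show "(\<integral>\<omega>. \<bar>R2 0 \<omega>\<bar> \<partial>M) \<le> R"
    proof -
      have "(\<integral>\<omega>. \<bar>R2 0 \<omega>\<bar> \<partial>M) \<le> (\<integral>\<omega>. R \<partial>M)" using int[of 0] Y0 by (intro integral_mono) (auto simp: R2_def lin_0)
      then show ?thesis by (simp add: prob_space)
    qed
    fix n
    let ?G = "g * real (Suc n) powr (- b)" and ?q = "C / (1 - \<alpha>)"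
    have G: "\<gamma> (Suc n) = ?G" by (simp add: \<gamma>_def)
    have "\<bar>R2 (Suc n) \<omega>\<bar> \<le> \<bar>\<theta> (Suc n)\<bar> * \<bar>R2 n \<omega>\<bar> + \<gamma> (Suc n) * (?q * (xi n \<omega> - xs)\<^sup>2)" for \<omega>
    proof -
      have "\<bar>- \<gamma> (Suc n) * ?D (xi n \<omega>) (Y (Suc n) \<omega>)\<bar> \<le> \<gamma> (Suc n) * (?q * (xi n \<omega> - xs)\<^sup>2)"
        unfolding abs_mult using \<gamma>_nonneg[of "Suc n"] law.dVfun_linearization[of "xi n \<omega>"] by (intro mult_mono) auto
      then show ?thesis unfolding R2_def lin_Suc by (intro order_trans[OF abs_triangle_ineq] add_mono) (auto simp: abs_mult)
    qed
    then have "(\<integral>\<omega>. \<bar>R2 (Suc n) \<omega>\<bar> \<partial>M) \<le> (\<integral>\<omega>. \<bar>\<theta> (Suc n)\<bar> * \<bar>R2 n \<omega>\<bar> + \<gamma> (Suc n) * (?q * (xi n \<omega> - xs)\<^sup>2) \<partial>M)"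
      using int by (intro integral_mono) auto
    also have "\<dots> = \<bar>\<theta> (Suc n)\<bar> * (\<integral>\<omega>. \<bar>R2 n \<omega>\<bar> \<partial>M) + \<gamma> (Suc n) * (?q * (\<integral>\<omega>. (xi n \<omega> - xs)\<^sup>2 \<partial>M))"
      using int by simp
    also have "\<bar>\<theta> (Suc n)\<bar> * (\<integral>\<omega>. \<bar>R2 n \<omega>\<bar> \<partial>M) \<le> (1 - a * ?G + ?q\<^sup>2 * ?G\<^sup>2) * (\<integral>\<omega>. \<bar>R2 n \<omega>\<bar> \<partial>M)"
      using \<theta>_bounds(1)[of "Suc n"] unfolding G by (intro mult_right_mono) auto
    also have "\<gamma> (Suc n) * (?q * (\<integral>\<omega>. (xi n \<omega> - xs)\<^sup>2 \<partial>M)) \<le> ?G * (?q * (D0 * real (Suc n) powr (- b)))"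
      unfolding G using err_sq[of n] law.C_nonneg law.alpha g by (intro mult_left_mono) auto
    finally show "(\<integral>\<omega>. \<bar>R2 (Suc n) \<omega>\<bar> \<partial>M) \<le> (1 - a * ?G + ?q\<^sup>2 * ?G\<^sup>2) * (\<integral>\<omega>. \<bar>R2 n \<omega>\<bar> \<partial>M) + ?q * D0 * ?G * real (Suc n) powr (- b)"
      by (simp only: mult_ac) 
  qed (use g b a crit D0_nonneg law.C_nonneg law.alpha R_nonneg in auto)
qed

text \<open>The sources are martingale differences and Lipschitz in \<xi>, so second moments add up
  to a multiple of the sum of the mean-square errors of the quantile iterates.\<close>

lemma T1_square:
  "integrable M (\<lambda>\<omega>. (T1 n \<omega>)\<^sup>2)" "T1 n \<in> borel_measurable M"
  "(\<integral>\<omega>. (T1 n \<omega>)\<^sup>2 \<partial>M) \<le> (1 + 2 / (1 - \<alpha>))\<^sup>2 * D0 * (\<Sum>k<n. real (Suc k) powr (- b))"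
proof -
  let ?D = "\<lambda>\<xi> x. Jfun \<alpha> \<xi> x - Vfun \<alpha> \<mu> \<xi> - (Jfun \<alpha> xs x - Vfun \<alpha> \<mu> xs)" and ?A = "1 + 2 / (1 - \<alpha>)"
  have Dm: "(\<lambda>p. ?D (fst p) (snd p)) \<in> borel_measurable (borel \<Otimes>\<^sub>M borel)" by measurable
  have D': "\<bar>?D \<xi> x\<bar> \<le> ?A * \<bar>\<xi> - xs\<bar>" for \<xi> x
  proof -
    have "\<bar>?D \<xi> x\<bar> \<le> (1 + 1 / (1 - \<alpha>)) * \<bar>\<xi> - xs\<bar> + 1 / (1 - \<alpha>) * \<bar>\<xi> - xs\<bar>"
      using law.Jfun_lipschitz[of \<xi> x xs] law.Vfun_lipschitz[of \<xi> xs] by linarith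
    then show ?thesis by (simp add: distrib_right add_divide_distrib[symmetric])
  qed
  have A0: "0 \<le> ?A" using law.alpha by simp
  have D: "\<bar>?D \<xi> x\<bar> \<le> ?A * (1 + \<bar>\<xi> - xs\<bar>)" for \<xi> x
    using D'[of \<xi> x] A0 by (simp add: distrib_left)
  have mean: "(\<integral>x. ?D \<xi> x \<partial>\<mu>) = 0" for \<xi>
    by (simp add: law.integral_Jfun)
  have Q: "(\<integral>x. (?D \<xi> x)\<^sup>2 \<partial>\<mu>) \<le> ?A\<^sup>2 * (\<xi> - xs)\<^sup>2" for \<xi>
  proof -
    have p: "(?D \<xi> x)\<^sup>2 \<le> ?A\<^sup>2 * (\<xi> - xs)\<^sup>2" for x
      using power_mono[OF D'[of \<xi> x], of 2] by (simp add: power_mult_distrib)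
    have iD: "integrable \<mu> (\<lambda>x. (?D \<xi> x)\<^sup>2)"
      by (rule law.integrable_const_bound[where B="?A\<^sup>2 * (\<xi> - xs)\<^sup>2"]) (use p in auto)
    have "(\<integral>x. (?D \<xi> x)\<^sup>2 \<partial>\<mu>) \<le> (\<integral>x. ?A\<^sup>2 * (\<xi> - xs)\<^sup>2 \<partial>\<mu>)"
      using iD p by (intro integral_mono) auto
    then show ?thesis by simp
  qed
  note ms = martingale_second_moment[where D="?D" and z="\<lambda>_. 0" and A="?A" and Bz=0 and Q="\<lambda>\<xi>. ?A\<^sup>2 * (\<xi> - xs)\<^sup>2" and \<theta>="\<lambda>_. 1" and h="\<lambda>_. 1",
      OF Dm _ D _ mean Q, folded T1_def]
  show "integrable M (\<lambda>\<omega>. (T1 n \<omega>)\<^sup>2)" by (rule ms(1)) auto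
  show "T1 n \<in> borel_measurable M" unfolding T1_def by (rule lin_meas[OF Dm]) auto
  show "(\<integral>\<omega>. (T1 n \<omega>)\<^sup>2 \<partial>M) \<le> ?A\<^sup>2 * D0 * (\<Sum>k<n. real (Suc k) powr (- b))"
  proof (induct n)
    case 0
    then show ?case by (simp add: T1_def lin_0)
  next
    case (Suc n)
    have "(\<integral>\<omega>. (T1 (Suc n) \<omega>)\<^sup>2 \<partial>M) \<le> 1\<^sup>2 * (\<integral>\<omega>. (T1 n \<omega>)\<^sup>2 \<partial>M) + 1\<^sup>2 * (\<integral>\<omega>. ?A\<^sup>2 * (xi n \<omega> - xs)\<^sup>2 \<partial>M)"
      by (rule ms(2)) auto
    also have "\<dots> \<le> ?A\<^sup>2 * D0 * (\<Sum>k<n. real (Suc k) powr (- b)) + ?A\<^sup>2 * (D0 * real (Suc n) powr (- b))"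
      using Suc mult_left_mono[OF err_sq[of n], of "?A\<^sup>2"] by simp
    finally show ?case by (simp only: sum.lessThan_Suc distrib_left mult.assoc)
  qed
qed

text \<open>The source is the excess of \<open>Vfun\<close>, nonnegative and quadratic, so first
  moments add up to a multiple of the sum of mean-square errors.\<close>

lemma T2_abs:
  "integrable M (\<lambda>\<omega>. \<bar>T2 n \<omega>\<bar>)" "T2 n \<in> borel_measurable M"
  "(\<integral>\<omega>. \<bar>T2 n \<omega>\<bar> \<partial>M) \<le> C / (1 - \<alpha>) * D0 * (\<Sum>k<n. real (Suc k) powr (- b))"
proof -
  let ?D = "\<lambda>\<xi> x :: real. Vfun \<alpha> \<mu> \<xi> - Vfun \<alpha> \<mu> xs" and ?q = "C / (1 - \<alpha>)"
  have Dm: "(\<lambda>p. ?D (fst p) (snd p)) \<in> borel_measurable (borel \<Otimes>\<^sub>M borel)" by measurable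
  have D: "\<bar>?D \<xi> x\<bar> \<le> 1 / (1 - \<alpha>) * (1 + \<bar>\<xi> - xs\<bar>)" for \<xi> x :: real
  proof -
    have "0 \<le> 1 / (1 - \<alpha>)" using law.alpha by simp
    then show ?thesis using law.Vfun_lipschitz[of \<xi> xs] unfolding distrib_left by linarith
  qed
  have meas: "T2 n \<in> borel_measurable M" for n unfolding T2_def by (rule lin_meas[OF Dm]) auto
  then show "T2 n \<in> borel_measurable M" .
  have int: "integrable M (\<lambda>\<omega>. \<bar>T2 n \<omega>\<bar>)" for n
  proof -
    obtain B where "\<And>\<omega>. \<bar>T2 n \<omega>\<bar> \<le> B" using lin_bounded[of ?D "1 / (1 - \<alpha>)" "\<lambda>y. 0" 0 "\<lambda>_. 1" "\<lambda>_. 1" n] D unfolding T2_def by auto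
    then show ?thesis using meas[of n] by (intro integrable_bounded[where B=B]) auto
  qed
  then show "integrable M (\<lambda>\<omega>. \<bar>T2 n \<omega>\<bar>)" .
  show "(\<integral>\<omega>. \<bar>T2 n \<omega>\<bar> \<partial>M) \<le> ?q * D0 * (\<Sum>k<n. real (Suc k) powr (- b))"
  proof (induct n)
    case 0
    then show ?case by (simp add: T2_def lin_0)
  next
    case (Suc n)
    have "\<bar>T2 (Suc n) \<omega>\<bar> \<le> \<bar>T2 n \<omega>\<bar> + ?q * (xi n \<omega> - xs)\<^sup>2" for \<omega>
      using law.Vfun_excess[of "xi n \<omega>"] unfolding T2_def lin_Suc mult_1 by linarith
    then have "(\<integral>\<omega>. \<bar>T2 (Suc n) \<omega>\<bar> \<partial>M) \<le> (\<integral>\<omega>. \<bar>T2 n \<omega>\<bar> + ?q * (xi n \<omega> - xs)\<^sup>2 \<partial>M)"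
      using int by (intro integral_mono) auto
    also have "\<dots> = (\<integral>\<omega>. \<bar>T2 n \<omega>\<bar> \<partial>M) + ?q * (\<integral>\<omega>. (xi n \<omega> - xs)\<^sup>2 \<partial>M)" using int by simp
    also have "\<dots> \<le> ?q * D0 * (\<Sum>k<n. real (Suc k) powr (- b)) + ?q * (D0 * real (Suc n) powr (- b))"
      using Suc err_sq[of n] law.C_nonneg law.alpha by (intro add_mono mult_left_mono) auto
    finally show ?case by (simp only: sum.lessThan_Suc distrib_left mult.assoc)
  qed
qed

definition rem :: "nat \<Rightarrow> 'w \<Rightarrow> real \<times> real" where
  "rem K \<omega> = (real K powr b * (R1 (K\<^sup>2) \<omega> + R2 (K\<^sup>2) \<omega>), (T1 (K\<^sup>2) \<omega> + T2 (K\<^sup>2) \<omega>) / real K)"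

text \<open>One summand for each of \<open>R1\<close>, \<open>R2\<close>, \<open>T1\<close>,
  \<open>T2\<close> after scaling. It is a number formed from the parameters of the locale, hence
  uniform in the laws.\<close>

definition rem_bound :: "nat \<Rightarrow> real" where
  "rem_bound K = (D1 + 1) / 2 * real K powr (- b / 2) + D2 * real K powr (- b)
     + ((1 + 2 / (1 - \<alpha>))\<^sup>2 * D0 * ((\<Sum>k<K\<^sup>2. real (Suc k) powr (- b)) / real K) + 1) / 2 * real K powr (- 1 / 2)
     + C / (1 - \<alpha>) * D0 * ((\<Sum>k<K\<^sup>2. real (Suc k) powr (- b)) / real K)"

lemma rem_bound_tendsto: "rem_bound \<longlonglongrightarrow> 0"
proof -
  have p: "(\<lambda>K. real K powr (- c)) \<longlonglongrightarrow> 0" if "c > 0" for c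
    using that by (intro tendsto_neg_powr) (auto simp: filterlim_real_sequentially)
  have q: "(\<lambda>K. (\<Sum>k<K\<^sup>2. real (Suc k) powr (- b)) / real K) \<longlonglongrightarrow> 0" by (rule sum_powr_over_root[OF b(1)])
  have p1: "(\<lambda>K. real K powr (- b / 2)) \<longlonglongrightarrow> 0" using p[of "b / 2"] b by simp
  have p2: "(\<lambda>K. real K powr (- b)) \<longlonglongrightarrow> 0" using p[of b] b by simp
  have p3: "(\<lambda>K. real K powr (- 1 / 2)) \<longlonglongrightarrow> 0" using p[of "1 / 2"] by simp
  have "(\<lambda>K. (x * ((\<Sum>k<K\<^sup>2. real (Suc k) powr (- b)) / real K) + 1) / 2) \<longlonglongrightarrow> (x * 0 + 1) / 2" for x
    by (rule tendsto_divide[OF tendsto_add[OF tendsto_mult_left[OF q] tendsto_const] tendsto_const]) simp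
  from tendsto_add[OF tendsto_add[OF tendsto_add[OF tendsto_mult_left[OF p1] tendsto_mult_left[OF p2]] tendsto_mult[OF this p3]]
      tendsto_mult_left[OF q]]
  show ?thesis unfolding rem_bound_def[abs_def] by (simp only: mult_zero_right add_0_right)
qed

lemma rem_meas [measurable]: "rem K \<in> borel_measurable M"
  unfolding rem_def[abs_def] 
  by (intro borel_measurable_Pair borel_measurable_times borel_measurable_divide borel_measurable_add
      borel_measurable_const R1_square(2) R2_abs(2) T1_square(2) T2_abs(2))

lemma expectation_rem:
  assumes K: "K \<ge> 1"
  shows "integrable M (\<lambda>\<omega>. norm (rem K \<omega>))" "(\<integral>\<omega>. norm (rem K \<omega>) \<partial>M) \<le> rem_bound K"
proof -
  let ?n = "K\<^sup>2" and ?S = "\<Sum>k<K\<^sup>2. real (Suc k) powr (- b)"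
  have Kp: "real K > 0" using K by simp
  have pw: "real (Suc ?n) powr (- c) \<le> real K powr (- 2 * c)" if "0 \<le> c" for c
  proof -
    have "real (Suc ?n) powr (- c) \<le> (real ?n) powr (- c)" using that K by (intro powr_mono2') auto
    also have "\<dots> = real K powr (- 2 * c)" using K by (intro of_nat_square_powr) auto
    finally show ?thesis .
  qed
  \<comment> \<open>The reciprocal of the size n^(-3b/4) of \<open>R1\<close> in mean
    square.\<close>
  let ?t = "real (Suc ?n) powr (3 * b / 4)"
  have t: "?t > 0" by (simp add: add_nonneg_eq_0_iff)
  note a1 = expectation_abs_le_square[OF t R1_square(2,1)]
  have r1: "(\<integral>\<omega>. \<bar>R1 ?n \<omega>\<bar> \<partial>M) \<le> (D1 + 1) / 2 * real K powr (- (3 * b / 2))"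
  proof -
    have D1: "0 \<le> D1" unfolding D1_def by (rule decay_const(1)) (use g b a crit D0_nonneg law.C_nonneg law.alpha in auto)
    have "(\<integral>\<omega>. \<bar>R1 ?n \<omega>\<bar> \<partial>M) \<le> (?t * (D1 * real (Suc ?n) powr (- (3 * b / 2))) + 1 / ?t) / 2"
      by (rule order_trans[OF a1(2)]) (intro divide_right_mono add_right_mono mult_left_mono R1_square(3), auto)
    also have "\<dots> = (D1 + 1) / 2 * real (Suc ?n) powr (- (3 * b / 4))"
    proof -
      have "?t * real (Suc ?n) powr (- (3 * b / 2)) = real (Suc ?n) powr (- (3 * b / 4))" by (simp add: powr_add[symmetric])
      moreover have "1 / ?t = real (Suc ?n) powr (- (3 * b / 4))" by (simp add: powr_minus_divide)
      moreover have gen: "(t * (d * u) + 1 / t) / 2 = (d + 1) / 2 * r" if "t * u = r" "1 / t = r" for t d u r :: real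
        unfolding that(2) unfolding that(1)[symmetric] by (simp add: algebra_simps)
      ultimately show ?thesis by (intro gen)
    qed
    also have "\<dots> \<le> (D1 + 1) / 2 * real K powr (- 2 * (3 * b / 4))"
      using pw[of "3 * b / 4"] b D1 by (intro mult_left_mono) auto
    finally show ?thesis by simp
  qed
  have r2: "(\<integral>\<omega>. \<bar>R2 ?n \<omega>\<bar> \<partial>M) \<le> D2 * real K powr (- 2 * b)"
  proof -
    have D2: "0 \<le> D2" unfolding D2_def by (rule decay_const(1)) (use g b a crit D0_nonneg law.C_nonneg law.alpha R_nonneg in auto)
    show ?thesis using R2_abs(3)[of ?n] mult_left_mono[OF pw[of b] D2] b by linarith
  qed
  \<comment> \<open>\<open>T1\<close> has second moment o(K), so t = K^(-1/2) gives a mean of order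
    K^(1/2), negligible after division by K.\<close>
  let ?s = "real K powr (- 1 / 2)"
  have s: "?s / real K > 0" using Kp by simp
  note a2 = expectation_abs_le_square[OF _ T1_square(2,1), of "real K powr (- 1 / 2)"]
  have r3: "(\<integral>\<omega>. \<bar>T1 ?n \<omega>\<bar> \<partial>M) / real K \<le> ((1 + 2 / (1 - \<alpha>))\<^sup>2 * D0 * (?S / real K) + 1) / 2 * ?s"
  proof -
    let ?A = "(1 + 2 / (1 - \<alpha>))\<^sup>2 * D0"
    have "(\<integral>\<omega>. \<bar>T1 ?n \<omega>\<bar> \<partial>M) \<le> (?s * (\<integral>\<omega>. (T1 ?n \<omega>)\<^sup>2 \<partial>M) + 1 / ?s) / 2" using a2(2) Kp by simp
    also have "\<dots> \<le> (?s * (?A * ?S) + 1 / ?s) / 2"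
      using T1_square(3)[of ?n] by (intro divide_right_mono add_right_mono mult_left_mono) auto
    finally have "(\<integral>\<omega>. \<bar>T1 ?n \<omega>\<bar> \<partial>M) / real K \<le> ((?s * (?A * ?S) + 1 / ?s) / 2) / real K" using Kp by (intro divide_right_mono) auto
    also have "\<dots> = (?A * (?S / real K) + 1) / 2 * ?s"
    proof -
      have "?s * ?s = 1 / real K" using Kp by (simp add: powr_add[symmetric] powr_minus_divide)
      moreover have gen: "((s * (d * y) + 1 / s) / 2) / k = (d * (y / k) + 1) / 2 * s" if "s * s = 1 / k" "k > 0" for s d y k :: real
      proof -
        have "s \<noteq> 0" using that by auto
        then have "1 / s = k * s" using that by (simp add: field_simps)
        then show ?thesis using that by (simp add: field_simps)
      qed
      ultimately show ?thesis using Kp by (intro gen)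
    qed
    finally show ?thesis .
  qed
  have r4: "(\<integral>\<omega>. \<bar>T2 ?n \<omega>\<bar> \<partial>M) / real K \<le> C / (1 - \<alpha>) * D0 * (?S / real K)"
    using divide_right_mono[OF T2_abs(3)[of ?n], of "real K"] by simp
  let ?B = "\<lambda>\<omega>. real K powr b * (\<bar>R1 ?n \<omega>\<bar> + \<bar>R2 ?n \<omega>\<bar>) + (\<bar>T1 ?n \<omega>\<bar> + \<bar>T2 ?n \<omega>\<bar>) / real K"
  have nb: "norm (rem K \<omega>) \<le> ?B \<omega>" for \<omega>
  proof -
    have "norm (rem K \<omega>) \<le> \<bar>real K powr b * (R1 ?n \<omega> + R2 ?n \<omega>)\<bar> + \<bar>(T1 ?n \<omega> + T2 ?n \<omega>) / real K\<bar>"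
      unfolding rem_def using norm_Pair_le[of "real K powr b * (R1 ?n \<omega> + R2 ?n \<omega>)" "(T1 ?n \<omega> + T2 ?n \<omega>) / real K"] by simp
    also have "\<dots> \<le> ?B \<omega>"
      using Kp abs_triangle_ineq[of "R1 ?n \<omega>" "R2 ?n \<omega>"] abs_triangle_ineq[of "T1 ?n \<omega>" "T2 ?n \<omega>"]
      by (auto simp: abs_mult intro!: add_mono mult_left_mono divide_right_mono)
    finally show ?thesis .
  qed
  have e: "real K powr b * ((D1 + 1) / 2 * real K powr (- (3 * b / 2)) + D2 * real K powr (- 2 * b))
      = (D1 + 1) / 2 * real K powr (- b / 2) + D2 * real K powr (- b)"
  proof -
    have gen: "k * (x * p + y * q) = x * r + y * s" if "k * p = r" "k * q = s" for k x p y q r s :: real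
      unfolding that[symmetric] by (simp add: algebra_simps)
    show ?thesis by (rule gen) (use Kp in \<open>simp_all add: powr_add[symmetric]\<close>)
  qed
  have iT: "integrable M (\<lambda>\<omega>. \<bar>T1 ?n \<omega>\<bar>)" using a2(1) Kp by simp
  have iB: "integrable M ?B" using a1(1) iT R2_abs(1)[of ?n] T2_abs(1)[of ?n] by simp
  show i: "integrable M (\<lambda>\<omega>. norm (rem K \<omega>))"
  proof (rule Bochner_Integration.integrable_bound[OF iB])
    show "AE \<omega> in M. norm (norm (rem K \<omega>)) \<le> norm (?B \<omega>)"
      unfolding real_norm_def abs_norm_cancel by (intro AE_I2 order_trans[OF nb abs_ge_self])
  qed measurable
  have "(\<integral>\<omega>. norm (rem K \<omega>) \<partial>M) \<le> (\<integral>\<omega>. ?B \<omega> \<partial>M)" using i iB nb by (intro integral_mono) auto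
  also have "\<dots> = real K powr b * ((\<integral>\<omega>. \<bar>R1 ?n \<omega>\<bar> \<partial>M) + (\<integral>\<omega>. \<bar>R2 ?n \<omega>\<bar> \<partial>M))
      + ((\<integral>\<omega>. \<bar>T1 ?n \<omega>\<bar> \<partial>M) / real K + (\<integral>\<omega>. \<bar>T2 ?n \<omega>\<bar> \<partial>M) / real K)"
    using a1(1) iT R2_abs(1)[of ?n] T2_abs(1)[of ?n] by (simp add: add_divide_distrib)
  also have "\<dots> \<le> real K powr b * ((D1 + 1) / 2 * real K powr (- (3 * b / 2)) + D2 * real K powr (- 2 * b))
      + (((1 + 2 / (1 - \<alpha>))\<^sup>2 * D0 * (?S / real K) + 1) / 2 * ?s + C / (1 - \<alpha>) * D0 * (?S / real K))"
    by (intro add_mono mult_left_mono r1 r2 r3 r4) auto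
  also have "\<dots> = rem_bound K" unfolding e rem_bound_def by (rule add.assoc[symmetric])
  finally show "(\<integral>\<omega>. norm (rem K \<omega>) \<partial>M) \<le> rem_bound K" .
qed

end

subsection \<open>Characteristic function of the leading part\<close>

lemma exp_minus_linear_bound:
  fixes s :: real
  assumes "0 \<le> s"
  shows "\<bar>(1 - s) - exp (- s)\<bar> \<le> s\<^sup>2 / 2"
proof -
  have l: "1 - s \<le> exp (- s)" using exp_ge_add_one_self[of "- s"] by simp
  have p: "1 + s + s\<^sup>2 / 2 > 0" using assms by (simp add: add_pos_nonneg)
  have "exp (- s) \<le> 1 / (1 + s + s\<^sup>2 / 2)"
    unfolding exp_minus inverse_eq_divide using exp_lower_Taylor_quadratic[OF assms] p by (intro divide_left_mono) auto
  also have "\<dots> \<le> 1 - s + s\<^sup>2 / 2"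
  proof -
    have "(1 - s + s\<^sup>2 / 2) * (1 + s + s\<^sup>2 / 2) = 1 + s ^ 4 / 4"
      by (simp add: power2_eq_square power4_eq_xxxx algebra_simps)
    then have "1 \<le> (1 - s + s\<^sup>2 / 2) * (1 + s + s\<^sup>2 / 2)" by simp
    then show ?thesis using p by (simp add: pos_divide_le_eq)
  qed
  finally show ?thesis using l by linarith
qed

text \<open>The Taylor error of a characteristic function is a mean of the minimum of a square and a
  cube; the interpolation makes a moment of order m with 2 \<le> m \<le> 3 sufficient.\<close>

lemma min_square_cube_le_powr:
  fixes x m :: real
  assumes "2 \<le> m" "m \<le> 3"
  shows "min (6 * x\<^sup>2) (\<bar>x\<bar> ^ 3) \<le> 6 * \<bar>x\<bar> powr m"
proof (cases "\<bar>x\<bar> \<le> 1")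
  case True
  show ?thesis
  proof (cases "x = 0")
    case False
    have "\<bar>x\<bar> ^ 3 = \<bar>x\<bar> powr 3" using False by (simp add: powr_numeral)
    also have "\<dots> \<le> \<bar>x\<bar> powr m" using True False assms by (intro powr_mono') auto
    also have "\<dots> \<le> 6 * \<bar>x\<bar> powr m" by simp
    finally show ?thesis unfolding min_le_iff_disj ..
  qed simp
next
  case False
  then have "x\<^sup>2 = \<bar>x\<bar> powr 2" by (simp add: powr_numeral)
  also have "\<dots> \<le> \<bar>x\<bar> powr m" using False assms by (intro powr_mono) auto
  finally show ?thesis by (simp add: min_le_iff_disj)
qed

lemma powr_add_le:
  fixes x y m :: real
  assumes "0 \<le> m" "m \<le> 3"
  shows "\<bar>x + y\<bar> powr m \<le> 8 * (\<bar>x\<bar> powr m + \<bar>y\<bar> powr m)"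
proof -
  let ?z = "max \<bar>x\<bar> \<bar>y\<bar>"
  have "\<bar>x + y\<bar> powr m \<le> (2 * ?z) powr m" using assms by (intro powr_mono2) auto
  also have "\<dots> = 2 powr m * ?z powr m" by (simp add: powr_mult)
  also have "\<dots> \<le> 8 * ?z powr m"
  proof (rule mult_right_mono)
    have "2 powr m \<le> 2 powr (3::real)" using assms by (intro powr_mono) auto
    then show "2 powr m \<le> 8" by (simp add: powr_numeral)
  qed simp
  also have "?z powr m \<le> \<bar>x\<bar> powr m + \<bar>y\<bar> powr m" by (auto simp: max_def)
  finally show ?thesis by simp
qed

lemma square_le_one_plus_powr:
  fixes x m :: real
  assumes "2 \<le> m"
  shows "x\<^sup>2 \<le> 1 + \<bar>x\<bar> powr m"
proof (cases "\<bar>x\<bar> \<le> 1")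
  case True
  then have "x\<^sup>2 \<le> 1" by (simp add: abs_square_le_1)
  then show ?thesis using powr_ge_zero[of "\<bar>x\<bar>" m] by argo
next
  case False
  then have "x\<^sup>2 = \<bar>x\<bar> powr 2" by (simp add: powr_numeral)
  also have "\<dots> \<le> \<bar>x\<bar> powr m" using False assms by (intro powr_mono) auto
  finally show ?thesis by simp
qed

section \<open>Power sums of the noise weights\<close>

context nsa_process
begin

text \<open>Up to the sign, the weight carried by the k-th sample in \<open>L1\<close> after n
  steps. One more step multiplies all existing weights by the same factor and adds a new one, so
  each power sum \<open>wsum m\<close> obeys a one-step recursion.\<close>

definition wt :: "nat \<Rightarrow> nat \<Rightarrow> real" where "wt n k = \<gamma> k * (\<Prod>j\<in>{k<..n}. \<theta> j)"
definition wsum :: "nat \<Rightarrow> nat \<Rightarrow> real" where "wsum m n = (\<Sum>k\<in>{1..n}. wt n k ^ m)"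

lemma wt_Suc: "k \<le> n \<Longrightarrow> wt (Suc n) k = \<theta> (Suc n) * wt n k" and wt_diag: "wt n n = \<gamma> n"
proof -
  assume "k \<le> n"
  then have "{k<..Suc n} = insert (Suc n) {k<..n}" by auto
  then show "wt (Suc n) k = \<theta> (Suc n) * wt n k" by (simp add: wt_def)
qed (simp add: wt_def)

lemma wsum_0: "wsum m 0 = 0"
  and wsum_Suc: "wsum m (Suc n) = \<theta> (Suc n) ^ m * wsum m n + \<gamma> (Suc n) ^ m"
proof -
  have "{1..Suc n} = insert (Suc n) {1..n}" by auto
  then show "wsum m (Suc n) = \<theta> (Suc n) ^ m * wsum m n + \<gamma> (Suc n) ^ m"
    by (simp add: wsum_def wt_diag wt_Suc power_mult_distrib sum_distrib_left)
qed (simp add: wsum_def)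

lemma L1_eq: "L1 n \<omega> = (\<Sum>k\<in>{1..n}. - wt n k * H1 \<alpha> xs (Y k \<omega>))"
proof (induct n)
  case (Suc n)
  have "{1..Suc n} = insert (Suc n) {1..n}" by auto
  then show ?case using Suc
    by (simp add: L1_def lin_Suc wt_diag wt_Suc sum_distrib_left mult.assoc)
qed (simp add: L1_def lin_0)

lemma S1_eq: "S1 n \<omega> = (\<Sum>k\<in>{1..n}. Jfun \<alpha> xs (Y k \<omega>) - Vfun \<alpha> \<mu> xs)"
proof (induct n)
  case (Suc n)
  have "{1..Suc n} = insert (Suc n) {1..n}" by auto
  then show ?case using Suc by (simp add: S1_def lin_Suc)
qed (simp add: S1_def lin_0)

lemma v_pos: "0 < v" using a by linarith

text \<open>Decay constants for the power sums of orders 4, 2 and 1, the last two for the distance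
  to their leading terms. In \<open>D5\<close> the exponent must exceed \<open>b\<close>: 1 does
  this for b < 1, while b = 1 takes 2.\<close>

definition "D4 = decay_const g b (4 * a) (3 * b) ((6 + (C / (1 - \<alpha>) * g)\<^sup>2) * (C / (1 - \<alpha>))\<^sup>2) (g ^ 3) 0"
definition "D5 = decay_const g b (2 * a) (if b = 1 then 2 else 1) ((C / (1 - \<alpha>))\<^sup>2) ((1 + g\<^sup>2 * (C / (1 - \<alpha>))\<^sup>2) / a) (g / a)"
definition "D6 = decay_const g b a 1 ((C / (1 - \<alpha>))\<^sup>2) 0 (1 / a)"

lemma wsum4: "0 \<le> wsum 4 n" "wsum 4 n \<le> D4 * real (Suc n) powr (- (3 * b))"
proof -
  show nn: "0 \<le> wsum 4 n" for n unfolding wsum_def by (intro sum_nonneg) auto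
  show "wsum 4 n \<le> D4 * real (Suc n) powr (- (3 * b))" unfolding D4_def
  proof (rule decay_const(2))
    fix n
    let ?G = "g * real (Suc n) powr (- b)"
    have G: "\<gamma> (Suc n) = ?G" by (simp add: \<gamma>_def)
    have p3: "(real (Suc n) powr (- b)) ^ 3 = real (Suc n) powr (- (3 * b))" by (simp add: powr_power)
    have e: "?G ^ 4 = g ^ 3 * ?G * real (Suc n) powr (- (3 * b))"
      unfolding p3[symmetric] by (simp only: power_mult_distrib power4_eq_xxxx power3_eq_cube mult_ac)
    have "wsum 4 (Suc n) = \<theta> (Suc n) ^ 4 * wsum 4 n + ?G ^ 4" by (simp only: wsum_Suc G)
    also have "\<dots> \<le> (1 - 4 * a * ?G + (6 + (C / (1 - \<alpha>) * g)\<^sup>2) * (C / (1 - \<alpha>))\<^sup>2 * ?G\<^sup>2) * wsum 4 n + ?G ^ 4"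
      using \<theta>_bounds(3)[of "Suc n"] nn unfolding G by (intro add_right_mono mult_right_mono) auto
    finally show "wsum 4 (Suc n) \<le> (1 - 4 * a * ?G + (6 + (C / (1 - \<alpha>) * g)\<^sup>2) * (C / (1 - \<alpha>))\<^sup>2 * ?G\<^sup>2) * wsum 4 n
       + g ^ 3 * ?G * real (Suc n) powr (- (3 * b))" unfolding e .
  qed (use g b a crit nn in \<open>auto simp: wsum_0\<close>)
qed

text \<open>1/v is the fixed point of w \<mapsto> (1 - \<gamma> v) w + \<gamma> for every \<gamma>,
  so the distance to it contracts without forcing.\<close>

lemma wsum1: "\<bar>wsum 1 n - 1 / v\<bar> \<le> D6 * real (Suc n) powr (- 1)"
  unfolding D6_def
proof (rule decay_const(2))
  have "\<bar>0 - 1 / y\<bar> \<le> 1 / x" if "0 < x" "x \<le> y" for x y :: real using that by (simp add: frac_le)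
  from this[OF a] show "\<bar>wsum 1 0 - 1 / v\<bar> \<le> 1 / a" unfolding wsum_0 .
  fix n
  let ?G = "g * real (Suc n) powr (- b)"
  have G: "\<gamma> (Suc n) = ?G" by (simp add: \<gamma>_def)
  have "t * w + y - 1 / v = t * (w - 1 / v)" if "t = 1 - y * v" "v > 0" for t w y v :: real
    using that by (simp add: field_simps)
  from this[of "\<theta> (Suc n)" "\<gamma> (Suc n)" v "wsum 1 n"]
  have "wsum 1 (Suc n) - 1 / v = \<theta> (Suc n) * (wsum 1 n - 1 / v)"
    using v_pos unfolding wsum_Suc power_one_right \<theta>_def by blast
  then have "\<bar>wsum 1 (Suc n) - 1 / v\<bar> = \<bar>\<theta> (Suc n)\<bar> * \<bar>wsum 1 n - 1 / v\<bar>" by (simp only: abs_mult)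
  also have "\<dots> \<le> (1 - a * ?G + (C / (1 - \<alpha>))\<^sup>2 * ?G\<^sup>2) * \<bar>wsum 1 n - 1 / v\<bar>"
    using \<theta>_bounds(1)[of "Suc n"] unfolding G by (intro mult_right_mono) auto
  finally show "\<bar>wsum 1 (Suc n) - 1 / v\<bar> \<le> (1 - a * ?G + (C / (1 - \<alpha>))\<^sup>2 * ?G\<^sup>2) * \<bar>wsum 1 n - 1 / v\<bar>
      + 0 * ?G * real (Suc n) powr (- 1)" by simp
qed (use g b a crit in auto)

text \<open>Inserting \<kappa> n^(-b) for the sum of squares and matching the order n^(-2b) gives 2
  g v \<kappa> = g^2, with \<kappa> added on the right when b = 1, where the decrement of n^(-b) has
  the same order.\<close>

definition "kappa = g / (2 * v - (if b = 1 then 1 / g else 0))"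

lemma wsum2: "\<bar>wsum 2 n - kappa * real (Suc n) powr (- b)\<bar> \<le> D5 * real (Suc n) powr (- (if b = 1 then 2 else 1))"
  unfolding D5_def
proof (rule decay_const(2))
  let ?L = "C / (1 - \<alpha>)"
  have den: "a \<le> 2 * v - (if b = 1 then 1 / g else 0)"
  proof (cases "b = 1")
    case True
    then have "1 / g \<le> a" using crit g by (simp add: pos_divide_le_eq)
    then show ?thesis using True a by simp
  qed (use a in auto)
  have k0: "0 < kappa" using den a g unfolding kappa_def by (intro divide_pos_pos) auto
  have kg: "kappa / g \<le> 1 / a" unfolding kappa_def using den a g by (simp add: frac_le)
  have vL: "v\<^sup>2 \<le> ?L\<^sup>2" using v_le v_pos by (intro power_mono) auto
  show "\<bar>wsum 2 0 - kappa * real (Suc 0) powr (- b)\<bar> \<le> g / a"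
    using k0 kg g a by (simp add: wsum_0 field_simps)
  fix n
  let ?N = "real (Suc n)" and ?s = "if b = 1 then 2 else (1::real)"
  let ?X = "?N powr (- b)"
  let ?G = "g * ?X"
  have G: "\<gamma> (Suc n) = ?G" by (simp add: \<gamma>_def)
  have N: "?N \<ge> 1" by simp
  have X0: "?X > 0" by (simp add: add_nonneg_eq_0_iff)
  define Z where "Z = real (Suc (Suc n)) powr (- b)"
  \<comment> \<open>The defect of the ansatz \<open>kappa * ?X\<close> in the recursion. The value
    of \<open>kappa\<close> cancels its leading order, and the rest is of order \<gamma> times
    \<open>?N powr (- ?s)\<close>.\<close>
  define E where "E = kappa * (?X - Z) + (g\<^sup>2 * ?X\<^sup>2 - 2 * g * v * kappa * ?X\<^sup>2) + g\<^sup>2 * v\<^sup>2 * kappa * ?X ^ 3"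
  have step: "wsum 2 (Suc n) - kappa * Z = (\<theta> (Suc n))\<^sup>2 * (wsum 2 n - kappa * ?X) + E"
  proof -
    have "(1 - y * v)\<^sup>2 * w + y\<^sup>2 - k * Z = (1 - y * v)\<^sup>2 * (w - k * X)
        + (k * (X - Z) + (g\<^sup>2 * X\<^sup>2 - 2 * g * v * k * X\<^sup>2) + g\<^sup>2 * v\<^sup>2 * k * X ^ 3)" if "y = g * X" for y v w k X Z g :: real
      unfolding that by (simp add: power2_eq_square power3_eq_cube algebra_simps)
    then show ?thesis unfolding wsum_Suc G \<theta>_def E_def by blast
  qed
  have cube: "kappa * (1 + g\<^sup>2 * v\<^sup>2) \<le> (1 + g\<^sup>2 * ?L\<^sup>2) / a * g"
  proof -
    have "kappa / g * (1 + g\<^sup>2 * v\<^sup>2) \<le> 1 / a * (1 + g\<^sup>2 * ?L\<^sup>2)"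
      using kg vL k0 g a by (intro mult_mono add_mono mult_left_mono) auto
    then show ?thesis using g by (simp add: field_simps)
  qed
  have E: "\<bar>E\<bar> \<le> (1 + g\<^sup>2 * ?L\<^sup>2) / a * ?G * ?N powr (- ?s)"
  \<comment> \<open>For b = 1 the decrement X - Z agrees with X^2 up to third order and belongs to
    the balance that fixes \<open>kappa\<close>. For b < 1 it is of order X/N and stays in the
    defect, and the cubic term is no larger because 2b > 1.\<close>
  proof (cases "b = 1")
    case True
    have X: "?X = 1 / ?N" "Z = 1 / (?N + 1)" using True by (auto simp: powr_minus_divide Z_def)
    have kap: "g\<^sup>2 - 2 * g * v * kappa = - kappa"
    proof -
      have "kappa * (2 * v - 1 / g) = g" using den a True unfolding kappa_def by simp
      then have "kappa * (2 * v - 1 / g) * g = g * g" by simp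
      then show ?thesis using g by (simp add: algebra_simps power2_eq_square)
    qed
    have x: "1 / y - 1 / (y + 1) - (1 / y)\<^sup>2 = - ((1 / y)\<^sup>2 / (y + 1))" if "y > 0" for y :: real
      using that by (simp add: divide_simps power2_eq_square)
    have x': "(1 / y)\<^sup>2 / (y + 1) \<le> (1 / y) ^ 3" if "y > 0" for y :: real
      using that by (simp add: divide_simps power2_eq_square power3_eq_cube)
    have "g\<^sup>2 * ?X\<^sup>2 - 2 * g * v * kappa * ?X\<^sup>2 = - kappa * ?X\<^sup>2" unfolding kap[symmetric] by (simp add: algebra_simps)
    then have "E = kappa * (?X - Z - ?X\<^sup>2) + g\<^sup>2 * v\<^sup>2 * kappa * ?X ^ 3" unfolding E_def by (simp add: algebra_simps)
    also have "?X - Z - ?X\<^sup>2 = - (?X\<^sup>2 / (?N + 1))" unfolding X by (rule x) simp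
    finally have E1: "E = - (kappa * (?X\<^sup>2 / (?N + 1))) + g\<^sup>2 * v\<^sup>2 * kappa * ?X ^ 3" by simp
    have "?X\<^sup>2 / (?N + 1) \<le> ?X ^ 3" unfolding X by (rule x') simp
    then have "kappa * (?X\<^sup>2 / (?N + 1)) \<le> kappa * ?X ^ 3" using k0 by (intro mult_left_mono) auto
    moreover have "0 \<le> kappa * (?X\<^sup>2 / (?N + 1))" using k0 by (intro mult_nonneg_nonneg divide_nonneg_nonneg) auto
    moreover have "0 \<le> g\<^sup>2 * v\<^sup>2 * kappa * ?X ^ 3" using k0 by (intro mult_nonneg_nonneg) auto
    ultimately have "\<bar>E\<bar> \<le> kappa * ?X ^ 3 + g\<^sup>2 * v\<^sup>2 * kappa * ?X ^ 3" unfolding E1 by linarith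
    also have "\<dots> = kappa * (1 + g\<^sup>2 * v\<^sup>2) * ?X ^ 3" by (simp add: algebra_simps)
    also have "\<dots> \<le> ((1 + g\<^sup>2 * ?L\<^sup>2) / a * g) * ?X ^ 3" using cube by (intro mult_right_mono) auto
    also have "?X ^ 3 = ?X * ?N powr (- 2)"
    proof -
      have e: "- b + - b = - 2" using True by simp
      have "?X\<^sup>2 = ?N powr (- b + - b)" unfolding power2_eq_square by (rule powr_add[symmetric])
      then have "?N powr (- 2) = ?X\<^sup>2" by (simp only: e)
      then show ?thesis by (simp only: power2_eq_square power3_eq_cube mult_ac)
    qed
    finally show ?thesis using True by (simp add: mult.assoc)
  next
    case False
    have kap: "g\<^sup>2 - 2 * g * v * kappa = 0"
    proof -
      have "g\<^sup>2 - 2 * g * v * (g / (2 * v)) = 0" if "0 < v" for v :: real using that by (simp add: power2_eq_square)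
      from this[OF v_pos] show ?thesis using False by (simp add: kappa_def)
    qed
    have "g\<^sup>2 * ?X\<^sup>2 - 2 * g * v * kappa * ?X\<^sup>2 = 0 * ?X\<^sup>2" unfolding kap[symmetric] by (simp add: algebra_simps)
    then have E1: "E = kappa * (?X - Z) + g\<^sup>2 * v\<^sup>2 * kappa * ?X ^ 3" unfolding E_def by simp
    have ZX: "Z \<le> ?X" unfolding Z_def using b by (intro powr_mono2') auto
    have "?X - Z \<le> ?X * ?N powr (- 1)"
    proof -
      let ?q = "?N / (?N + 1)"
      have q: "0 < ?q" "?q \<le> 1" by (auto simp: add_nonneg_pos)
      have gen: "1 - 1 / y \<le> y / (y + 1)" if "0 < y" for y :: real using that by (simp add: divide_simps algebra_simps)
      have "1 - 1 / ?N \<le> ?q" by (rule gen) simp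
      also have "?q = ?q powr 1" using q by simp
      also have "\<dots> \<le> ?q powr b" using q b by (intro powr_mono') auto
      also have "\<dots> = Z / ?X"
      proof -
        have "?q powr b = ?N powr b / (?N + 1) powr b" by (subst powr_divide) auto
        then show ?thesis by (simp add: Z_def powr_minus_divide)
      qed
      finally have "(1 - 1 / ?N) * ?X \<le> Z" using X0 by (simp only: pos_le_divide_eq)
      moreover have "(1 - 1 / ?N) * ?X = ?X - ?X * ?N powr (- 1)"
      proof -
        have "?N powr (- 1) = 1 / ?N" by (simp add: powr_minus_divide)
        moreover have "(1 - 1 / N) * X = X - X * p" if "p = 1 / N" for N X p :: real
          unfolding that by (simp add: left_diff_distrib)
        ultimately show ?thesis by blast
      qed
      ultimately show ?thesis by linarith
    qed
    then have m1: "kappa * (?X - Z) \<le> kappa * (?X * ?N powr (- 1))" using k0 by (intro mult_left_mono) auto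
    have "?X\<^sup>2 = ?N powr (- (2 * b))" by (simp add: powr_power)
    also have "\<dots> \<le> ?N powr (- 1)" using b N by (intro powr_mono) auto
    finally have "?X * ?X\<^sup>2 \<le> ?X * ?N powr (- 1)" using X0 by (intro mult_left_mono) auto
    then have "?X ^ 3 \<le> ?X * ?N powr (- 1)" by (simp only: power3_eq_cube power2_eq_square mult_ac)
    then have m2: "g\<^sup>2 * v\<^sup>2 * kappa * ?X ^ 3 \<le> g\<^sup>2 * v\<^sup>2 * kappa * (?X * ?N powr (- 1))" using k0 by (intro mult_left_mono) auto
    have "0 \<le> E" unfolding E1 using k0 ZX by (intro add_nonneg_nonneg mult_nonneg_nonneg) auto
    then have "\<bar>E\<bar> \<le> kappa * (?X * ?N powr (- 1)) + g\<^sup>2 * v\<^sup>2 * kappa * (?X * ?N powr (- 1))" using m1 m2 unfolding E1 by linarith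
    also have "\<dots> = kappa * (1 + g\<^sup>2 * v\<^sup>2) * (?X * ?N powr (- 1))" by (simp add: algebra_simps)
    also have "\<dots> \<le> ((1 + g\<^sup>2 * ?L\<^sup>2) / a * g) * (?X * ?N powr (- 1))" using cube by (intro mult_right_mono) auto
    finally show ?thesis using False by (simp add: mult.assoc)
  qed
  have "\<bar>wsum 2 (Suc n) - kappa * Z\<bar> \<le> (\<theta> (Suc n))\<^sup>2 * \<bar>wsum 2 n - kappa * ?X\<bar> + \<bar>E\<bar>"
    unfolding step by (rule order_trans[OF abs_triangle_ineq]) (simp add: abs_mult)
  also have "\<dots> \<le> (1 - 2 * a * ?G + ?L\<^sup>2 * ?G\<^sup>2) * \<bar>wsum 2 n - kappa * ?X\<bar> + (1 + g\<^sup>2 * ?L\<^sup>2) / a * ?G * ?N powr (- ?s)"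
    using \<theta>_bounds(2)[of "Suc n"] E unfolding G by (intro add_mono mult_right_mono) auto
  finally show "\<bar>wsum 2 (Suc n) - kappa * real (Suc (Suc n)) powr (- b)\<bar> \<le> (1 - 2 * a * ?G + ?L\<^sup>2 * ?G\<^sup>2) * \<bar>wsum 2 n - kappa * ?X\<bar>
      + (1 + g\<^sup>2 * ?L\<^sup>2) / a * ?G * ?N powr (- ?s)" unfolding Z_def .
qed (use g b a crit in auto)

definition H0 :: "real \<Rightarrow> real" where "H0 x = H1 \<alpha> xs x"
definition J0 :: "real \<Rightarrow> real" where "J0 x = Jfun \<alpha> xs x - Vfun \<alpha> \<mu> xs"

lemma H0_meas [measurable]: "H0 \<in> borel_measurable borel" unfolding H0_def[abs_def] by measurable
lemma J0_meas [measurable]: "J0 \<in> borel_measurable borel" unfolding J0_def[abs_def] by measurable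

lemma integrable_J0_square:
  assumes m: "2 \<le> m" and i: "integrable \<mu> (\<lambda>x. \<bar>J0 x\<bar> powr m)"
  shows "integrable \<mu> (\<lambda>x. (J0 x)\<^sup>2)"
proof (rule Bochner_Integration.integrable_bound[of _ "\<lambda>x. 1 + \<bar>J0 x\<bar> powr m"])
  show "AE x in \<mu>. norm ((J0 x)\<^sup>2) \<le> norm (1 + \<bar>J0 x\<bar> powr m)"
    using square_le_one_plus_powr[OF m] by (auto simp: abs_of_nonneg add_nonneg_nonneg)
qed (use i in auto)

lemma integrable_J0: "integrable \<mu> J0" and integral_J0: "(\<integral>x. J0 x \<partial>\<mu>) = 0"
  unfolding J0_def by (auto simp: law.integral_Jfun)

lemma H0_moments:
  "integrable \<mu> H0" "(\<integral>x. H0 x \<partial>\<mu>) = 0" "(\<integral>x. (H0 x)\<^sup>2 \<partial>\<mu>) = \<alpha> / (1 - \<alpha>)" "integrable \<mu> (\<lambda>x. (H0 x)\<^sup>2)"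
  "integrable \<mu> (\<lambda>x. H0 x * J0 x)" "(\<integral>x. H0 x * J0 x \<partial>\<mu>) = - (\<alpha> / (1 - \<alpha>) * (chi_star \<alpha> \<mu> - xs))"
  "\<bar>H0 x\<bar> \<le> 1 / (1 - \<alpha>)"
proof -
  show H0: "\<bar>H0 x\<bar> \<le> 1 / (1 - \<alpha>)" for x unfolding H0_def by (rule law.abs_H1_le)
  show "integrable \<mu> (\<lambda>x. (H0 x)\<^sup>2)"
  proof (rule law.integrable_const_bound[where B="(1 / (1 - \<alpha>))\<^sup>2"])
    have "(H0 x)\<^sup>2 \<le> (1 / (1 - \<alpha>))\<^sup>2" for x using H0[of x] by (metis abs_ge_zero power2_abs power_mono)
    then show "AE x in \<mu>. norm ((H0 x)\<^sup>2) \<le> (1 / (1 - \<alpha>))\<^sup>2" by simp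
  qed measurable
qed (use law.H1_star_moments law.integrable_H1[of xs] in \<open>auto simp: H0_def[abs_def] J0_def[abs_def]\<close>)

lemma L1_square:
  "integrable M (\<lambda>\<omega>. (L1 n \<omega>)\<^sup>2)" "L1 n \<in> borel_measurable M" "(\<integral>\<omega>. (L1 n \<omega>)\<^sup>2 \<partial>M) \<le> \<alpha> / (1 - \<alpha>) * wsum 2 n"
proof -
  have Dm: "(\<lambda>p. H1 \<alpha> xs (snd p)) \<in> borel_measurable (borel \<Otimes>\<^sub>M borel)" by measurable
  have c0: "0 \<le> 1 / (1 - \<alpha>)" using law.alpha by simp
  have D: "\<bar>H1 \<alpha> xs x\<bar> \<le> 1 / (1 - \<alpha>) * (1 + \<bar>\<xi> - xs\<bar>)" for \<xi> x
    using law.abs_H1_le[of xs x] mult_nonneg_nonneg[OF c0, of "\<bar>\<xi> - xs\<bar>"] unfolding distrib_left by simp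
  have Q: "(\<integral>x. (H1 \<alpha> xs x)\<^sup>2 \<partial>\<mu>) \<le> \<alpha> / (1 - \<alpha>)" using law.H1_star_moments(2) by simp
  note ms = martingale_second_moment[where D="\<lambda>\<xi> x. H1 \<alpha> xs x" and z="\<lambda>_. 0" and A="1 / (1 - \<alpha>)" and Bz=0
      and Q="\<lambda>\<xi>. \<alpha> / (1 - \<alpha>)" and \<theta>=\<theta> and h="\<lambda>n. - \<gamma> n", OF Dm _ D _ law.H1_star_moments(1) Q, folded L1_def]
  show "integrable M (\<lambda>\<omega>. (L1 n \<omega>)\<^sup>2)" by (rule ms(1)) auto
  show "L1 n \<in> borel_measurable M" unfolding L1_def by (rule lin_meas[OF Dm]) auto
  show "(\<integral>\<omega>. (L1 n \<omega>)\<^sup>2 \<partial>M) \<le> \<alpha> / (1 - \<alpha>) * wsum 2 n"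
  proof (induct n)
    case 0
    then show ?case by (simp add: L1_def lin_0 wsum_0)
  next
    case (Suc n)
    have "(\<integral>\<omega>. (L1 (Suc n) \<omega>)\<^sup>2 \<partial>M) \<le> (\<theta> (Suc n))\<^sup>2 * (\<integral>\<omega>. (L1 n \<omega>)\<^sup>2 \<partial>M) + (- \<gamma> (Suc n))\<^sup>2 * (\<integral>\<omega>. \<alpha> / (1 - \<alpha>) \<partial>M)"
      by (rule ms(2)) auto
    also have "\<dots> \<le> (\<theta> (Suc n))\<^sup>2 * (\<alpha> / (1 - \<alpha>) * wsum 2 n) + (- \<gamma> (Suc n))\<^sup>2 * (\<alpha> / (1 - \<alpha>))"
      using mult_left_mono[OF Suc, of "(\<theta> (Suc n))\<^sup>2"] by (simp add: prob_space)
    also have "\<dots> = \<alpha> / (1 - \<alpha>) * wsum 2 (Suc n)" unfolding wsum_Suc power2_minus distrib_left by (simp only: mult_ac)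
    finally show ?case .
  qed
qed

text \<open>\<open>martingale_second_moment\<close> asks for a source bounded in the sample, whereas
  \<open>J0\<close> grows linearly; the orthogonality argument is repeated here with square
  integrability.\<close>

lemma S1_square:
  assumes i2: "integrable \<mu> (\<lambda>x. (J0 x)\<^sup>2)"
  shows "integrable M (\<lambda>\<omega>. (S1 n \<omega>)\<^sup>2)" "S1 n \<in> borel_measurable M"
    "(\<integral>\<omega>. (S1 n \<omega>)\<^sup>2 \<partial>M) = real n * (\<integral>x. (J0 x)\<^sup>2 \<partial>\<mu>)"
proof -
  have Dm: "(\<lambda>p. Jfun \<alpha> xs (snd p) - Vfun \<alpha> \<mu> xs) \<in> borel_measurable (borel \<Otimes>\<^sub>M borel)" by measurable
  have ad: "adapted_to Y n (S1 n)" for n unfolding S1_def by (rule lin_adapted[OF Dm]) auto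
  have meas[measurable]: "S1 n \<in> borel_measurable M" for n by (rule adapted_to_measurable[OF ad Y_meas])
  then show "S1 n \<in> borel_measurable M" .
  have S_Suc: "S1 (Suc n) \<omega> = S1 n \<omega> + J0 (Y (Suc n) \<omega>)" for n \<omega> by (simp add: S1_def lin_Suc J0_def)
  have iJ: "integrable M (\<lambda>\<omega>. (J0 (Y (Suc n) \<omega>))\<^sup>2)" and eJ: "(\<integral>\<omega>. (J0 (Y (Suc n) \<omega>))\<^sup>2 \<partial>M) = (\<integral>x. (J0 x)\<^sup>2 \<partial>\<mu>)" for n
  proof -
    have J2: "(\<lambda>x. (J0 x)\<^sup>2) \<in> borel_measurable borel" by measurable
    show "integrable M (\<lambda>\<omega>. (J0 (Y (Suc n) \<omega>))\<^sup>2)"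
      using integrable_distr_eq[OF Y_meas J2, of "Suc n"] i2 unfolding distr_Y by simp
    show "(\<integral>\<omega>. (J0 (Y (Suc n) \<omega>))\<^sup>2 \<partial>M) = (\<integral>x. (J0 x)\<^sup>2 \<partial>\<mu>)"
      using integral_distr[OF Y_meas J2, of "Suc n"] unfolding distr_Y by simp
  qed
  have "integrable M (\<lambda>\<omega>. (S1 n \<omega>)\<^sup>2) \<and> (\<integral>\<omega>. (S1 n \<omega>)\<^sup>2 \<partial>M) = real n * (\<integral>x. (J0 x)\<^sup>2 \<partial>\<mu>)"
  proof (induct n)
    case 0
    then show ?case by (simp add: S1_def lin_0)
  next
    case (Suc n)
    then have iS: "integrable M (\<lambda>\<omega>. (S1 n \<omega>)\<^sup>2)" by simp
    have iSJ: "integrable M (\<lambda>\<omega>. S1 n \<omega> * J0 (Y (Suc n) \<omega>))"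
    proof (rule Bochner_Integration.integrable_bound[OF Bochner_Integration.integrable_add[OF iS iJ[of n]]])
      have "\<bar>x * y\<bar> \<le> x\<^sup>2 + y\<^sup>2" for x y :: real
      proof -
        have "2 * (\<bar>x\<bar> * \<bar>y\<bar>) \<le> x\<^sup>2 + y\<^sup>2" using sum_squares_bound[of "\<bar>x\<bar>" "\<bar>y\<bar>"] by simp
        moreover have "0 \<le> \<bar>x\<bar> * \<bar>y\<bar>" by simp
        ultimately show ?thesis unfolding abs_mult by linarith
      qed
      then show "AE \<omega> in M. norm (S1 n \<omega> * J0 (Y (Suc n) \<omega>)) \<le> norm ((S1 n \<omega>)\<^sup>2 + (J0 (Y (Suc n) \<omega>))\<^sup>2)"
        by (simp add: add_nonneg_nonneg)
    qed measurable
    let ?\<phi> = "\<lambda>q. fst q * J0 (snd q)"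
    have m: "?\<phi> \<in> borel_measurable (borel \<Otimes>\<^sub>M borel)" by measurable
    have "(\<integral>\<omega>. ?\<phi> (S1 n \<omega>, Y (Suc n) \<omega>) \<partial>M) = (\<integral>\<omega>. (\<integral>x. ?\<phi> (S1 n \<omega>, x) \<partial>\<mu>) \<partial>M)"
      by (rule adapted_next_expectation(2)[OF indep ad distr_Y m]) (use iSJ in simp)
    then have z: "(\<integral>\<omega>. S1 n \<omega> * J0 (Y (Suc n) \<omega>) \<partial>M) = 0" by (simp add: integral_J0)
    have e: "(S1 (Suc n) \<omega>)\<^sup>2 = (S1 n \<omega>)\<^sup>2 + (2 * (S1 n \<omega> * J0 (Y (Suc n) \<omega>)) + (J0 (Y (Suc n) \<omega>))\<^sup>2)" for \<omega>
      unfolding S_Suc by (simp add: power2_sum)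
    show ?case unfolding e using iS iSJ iJ[of n] z eJ[of n] Suc by (simp add: algebra_simps)
  qed
  then show "integrable M (\<lambda>\<omega>. (S1 n \<omega>)\<^sup>2)" "(\<integral>\<omega>. (S1 n \<omega>)\<^sup>2 \<partial>M) = real n * (\<integral>x. (J0 x)\<^sup>2 \<partial>\<mu>)" by auto
qed

text \<open>The weights are put inside the variable, so the characteristic function is taken at 1.
  Taylor expansion compares it with 1 - s/2 at a cost of m-th moments, and 1 - s/2 is compared with
  exp(-s/2) at a cost of fourth powers of the weights; both errors are to be summed over the
  steps.\<close>

lemma char_step_bound:
  assumes m: "2 < m" "m \<le> 3" and i: "integrable \<mu> (\<lambda>x. \<bar>J0 x\<bar> powr m)"
  defines "\<sigma>J \<equiv> (\<integral>x. (J0 x)\<^sup>2 \<partial>\<mu>)" and "\<sigma>H \<equiv> \<alpha> / (1 - \<alpha>)" and "cHJ \<equiv> (\<integral>x. H0 x * J0 x \<partial>\<mu>)"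
  defines "s \<equiv> \<lambda>c q. c\<^sup>2 * \<sigma>H + 2 * c * q * cHJ + q\<^sup>2 * \<sigma>J"
  shows "0 \<le> s c q"
    and "cmod (char (distr \<mu> borel (\<lambda>x. c * H0 x + q * J0 x)) 1 - complex_of_real (exp (- (s c q) / 2)))
     \<le> 8 * ((\<bar>c\<bar> / (1 - \<alpha>)) powr m + \<bar>q\<bar> powr m * (\<integral>x. \<bar>J0 x\<bar> powr m \<partial>\<mu>)) + (c ^ 4 * \<sigma>H\<^sup>2 + q ^ 4 * \<sigma>J\<^sup>2)"
proof -
  let ?Z = "\<lambda>x. c * H0 x + q * J0 x"
  have iJ2: "integrable \<mu> (\<lambda>x. (J0 x)\<^sup>2)" using integrable_J0_square[OF _ i] m by simp
  have Zm: "?Z \<in> borel_measurable \<mu>" by measurable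
  have iZ: "integrable \<mu> ?Z" using H0_moments(1) integrable_J0 by simp
  have eZ: "(\<integral>x. ?Z x \<partial>\<mu>) = 0" using H0_moments(1,2) integrable_J0 integral_J0 by simp
  have Z2: "(?Z x)\<^sup>2 = c\<^sup>2 * (H0 x)\<^sup>2 + (2 * c * q * (H0 x * J0 x) + q\<^sup>2 * (J0 x)\<^sup>2)" for x
    by (simp add: power2_eq_square algebra_simps)
  have iZ2: "integrable \<mu> (\<lambda>x. (?Z x)\<^sup>2)" unfolding Z2 using H0_moments(4,5) iJ2 by simp
  have sZ: "(\<integral>x. (?Z x)\<^sup>2 \<partial>\<mu>) = s c q"
    unfolding Z2 s_def \<sigma>J_def \<sigma>H_def cHJ_def using H0_moments(3,4,5) iJ2 by simp
  show s0: "0 \<le> s c q" unfolding sZ[symmetric] by (rule Bochner_Integration.integral_nonneg) simp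
  have sH0: "0 \<le> \<sigma>H" using law.alpha by (simp add: \<sigma>H_def)
  have sJ0: "0 \<le> \<sigma>J" unfolding \<sigma>J_def by (rule Bochner_Integration.integral_nonneg) simp
  have s_le: "s c q \<le> 2 * (c\<^sup>2 * \<sigma>H) + 2 * (q\<^sup>2 * \<sigma>J)"
  proof -
    have "(?Z x)\<^sup>2 \<le> 2 * c\<^sup>2 * (H0 x)\<^sup>2 + 2 * q\<^sup>2 * (J0 x)\<^sup>2" for x
    proof -
      have "(u + w)\<^sup>2 \<le> 2 * u\<^sup>2 + 2 * w\<^sup>2" for u w :: real
        using sum_squares_bound[of u w] by (simp add: power2_sum)
      from this[of "c * H0 x" "q * J0 x"] show ?thesis unfolding power_mult_distrib by simp
    qed
    then have "s c q \<le> (\<integral>x. 2 * c\<^sup>2 * (H0 x)\<^sup>2 + 2 * q\<^sup>2 * (J0 x)\<^sup>2 \<partial>\<mu>)"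
      unfolding sZ[symmetric] using iZ2 H0_moments(4) iJ2 by (intro integral_mono) auto
    also have "\<dots> = 2 * (c\<^sup>2 * \<sigma>H) + 2 * (q\<^sup>2 * \<sigma>J)"
      using H0_moments(3,4) iJ2 by (simp add: \<sigma>J_def \<sigma>H_def)
    finally show ?thesis .
  qed
  have s2: "(s c q / 2)\<^sup>2 / 2 \<le> c ^ 4 * \<sigma>H\<^sup>2 + q ^ 4 * \<sigma>J\<^sup>2"
  proof -
    have "(s c q / 2)\<^sup>2 \<le> (c\<^sup>2 * \<sigma>H + q\<^sup>2 * \<sigma>J)\<^sup>2" using s_le s0 by (intro power_mono) auto
    also have "\<dots> \<le> 2 * (c\<^sup>2 * \<sigma>H)\<^sup>2 + 2 * (q\<^sup>2 * \<sigma>J)\<^sup>2"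
      using sum_squares_bound[of "c\<^sup>2 * \<sigma>H" "q\<^sup>2 * \<sigma>J"] by (simp add: power2_sum)
    also have "(c\<^sup>2 * \<sigma>H)\<^sup>2 = c ^ 4 * \<sigma>H\<^sup>2" by (simp add: power_mult_distrib)
    also have "(q\<^sup>2 * \<sigma>J)\<^sup>2 = q ^ 4 * \<sigma>J\<^sup>2" by (simp add: power_mult_distrib)
    finally show ?thesis by simp
  qed
  have "law.variance ?Z = s c q" using eZ sZ by simp
  from law.char_approx3'[OF Zm iZ iZ2 eZ this refl, of 1]
  have c1: "cmod (char (distr \<mu> borel ?Z) 1 - complex_of_real (1 - s c q / 2)) \<le> (1 / 6) * (\<integral>x. min (6 * (?Z x)\<^sup>2) (\<bar>?Z x\<bar> ^ 3) \<partial>\<mu>)"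
    by simp
  let ?B = "\<lambda>x. 8 * ((\<bar>c\<bar> / (1 - \<alpha>)) powr m + \<bar>q\<bar> powr m * \<bar>J0 x\<bar> powr m)"
  have iB: "integrable \<mu> (\<lambda>x. 6 * ?B x)" using i by simp
  have pt: "min (6 * (?Z x)\<^sup>2) (\<bar>?Z x\<bar> ^ 3) \<le> 6 * ?B x" for x
  proof -
    have "min (6 * (?Z x)\<^sup>2) (\<bar>?Z x\<bar> ^ 3) \<le> 6 * \<bar>?Z x\<bar> powr m" using m by (intro min_square_cube_le_powr) auto
    also have "\<bar>?Z x\<bar> powr m \<le> 8 * (\<bar>c * H0 x\<bar> powr m + \<bar>q * J0 x\<bar> powr m)" using m by (intro powr_add_le) auto
    also have "\<bar>c * H0 x\<bar> powr m \<le> (\<bar>c\<bar> / (1 - \<alpha>)) powr m"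
    proof -
      have "\<bar>c * H0 x\<bar> \<le> \<bar>c\<bar> * (1 / (1 - \<alpha>))" unfolding abs_mult using H0_moments(7)[of x] by (intro mult_left_mono) auto
      then show ?thesis using m by (intro powr_mono2) auto
    qed
    also have "\<bar>q * J0 x\<bar> powr m = \<bar>q\<bar> powr m * \<bar>J0 x\<bar> powr m" by (simp add: abs_mult powr_mult)
    finally show ?thesis by simp
  qed
  have "(\<integral>x. min (6 * (?Z x)\<^sup>2) (\<bar>?Z x\<bar> ^ 3) \<partial>\<mu>) \<le> (\<integral>x. 6 * ?B x \<partial>\<mu>)"
  proof (rule integral_mono[OF _ iB pt])
    show "integrable \<mu> (\<lambda>x. min (6 * (?Z x)\<^sup>2) (\<bar>?Z x\<bar> ^ 3))"
      by (rule Bochner_Integration.integrable_bound[OF integrable_mult_right[OF iZ2, of 6]]) auto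
  qed
  also have "\<dots> = 6 * (8 * ((\<bar>c\<bar> / (1 - \<alpha>)) powr m + \<bar>q\<bar> powr m * (\<integral>x. \<bar>J0 x\<bar> powr m \<partial>\<mu>)))" using i by simp
  finally have c2: "cmod (char (distr \<mu> borel ?Z) 1 - complex_of_real (1 - s c q / 2)) \<le> 8 * ((\<bar>c\<bar> / (1 - \<alpha>)) powr m + \<bar>q\<bar> powr m * (\<integral>x. \<bar>J0 x\<bar> powr m \<partial>\<mu>))"
    using c1 by linarith
  have c3: "cmod (complex_of_real (1 - s c q / 2) - complex_of_real (exp (- (s c q) / 2))) \<le> c ^ 4 * \<sigma>H\<^sup>2 + q ^ 4 * \<sigma>J\<^sup>2"
    unfolding of_real_diff[symmetric] norm_of_real
    using exp_minus_linear_bound[of "s c q / 2"] s0 s2 by simp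
  show "cmod (char (distr \<mu> borel ?Z) 1 - complex_of_real (exp (- (s c q) / 2)))
     \<le> 8 * ((\<bar>c\<bar> / (1 - \<alpha>)) powr m + \<bar>q\<bar> powr m * (\<integral>x. \<bar>J0 x\<bar> powr m \<partial>\<mu>)) + (c ^ 4 * \<sigma>H\<^sup>2 + q ^ 4 * \<sigma>J\<^sup>2)"
    using norm_triangle_ineq[of "char (distr \<mu> borel ?Z) 1 - complex_of_real (1 - s c q / 2)"
        "complex_of_real (1 - s c q / 2) - complex_of_real (exp (- (s c q) / 2))"] c2 c3 by simp
qed

definition lead :: "nat \<Rightarrow> 'w \<Rightarrow> real \<times> real" where
  "lead K \<omega> = (real K powr b * L1 (K\<^sup>2) \<omega>, S1 (K\<^sup>2) \<omega> / real K)"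

text \<open>Both components of \<open>lead\<close> are sums over the same independent samples, so a
  linear combination of them is one sum of independent terms. The minus sign in the middle term of
  \<open>Q\<close> comes from the sign of the noise in \<open>L1\<close>. The product of
  characteristic functions is compared with the Gaussian product factor by factor, all factors
  having modulus at most 1.\<close>

lemma lead_char_bound:
  fixes u :: "real \<times> real" and K :: nat
  assumes m: "2 < m" "m \<le> 3" and i: "integrable \<mu> (\<lambda>x. \<bar>J0 x\<bar> powr m)"
  defines "\<sigma>J \<equiv> (\<integral>x. (J0 x)\<^sup>2 \<partial>\<mu>)" and "\<sigma>H \<equiv> \<alpha> / (1 - \<alpha>)" and "cHJ \<equiv> (\<integral>x. H0 x * J0 x \<partial>\<mu>)"
    and "p \<equiv> fst u * real K powr b" and "q \<equiv> snd u / real K" and "n \<equiv> K\<^sup>2"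
  defines "Q \<equiv> p\<^sup>2 * wsum 2 n * \<sigma>H - 2 * p * q * wsum 1 n * cHJ + real n * q\<^sup>2 * \<sigma>J"
  shows "0 \<le> Q"
    and "cmod ((CLINT \<omega>|M. cis (u \<bullet> lead K \<omega>)) - complex_of_real (exp (- Q / 2)))
      \<le> 8 * ((p / (1 - \<alpha>))\<^sup>2 * wsum 2 n * ((p / (1 - \<alpha>)) ^ 4 * wsum 4 n) powr ((m - 2) / 4)
             + real n * (\<bar>q\<bar> powr m * (\<integral>x. \<bar>J0 x\<bar> powr m \<partial>\<mu>)))
        + (p ^ 4 * wsum 4 n * \<sigma>H\<^sup>2 + real n * (q ^ 4 * \<sigma>J\<^sup>2))"
proof -
  define c where "c k = - (p * wt n k)" for k
  define Z where "Z k x = c k * H0 x + q * J0 x" for k x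
  define s where "s k = (c k)\<^sup>2 * \<sigma>H + 2 * c k * q * cHJ + q\<^sup>2 * \<sigma>J" for k
  have Zm[measurable]: "Z k \<in> borel_measurable borel" for k unfolding Z_def[abs_def] by measurable
  have s0: "0 \<le> s k" for k
    using char_step_bound(1)[OF m i, of "c k" q] unfolding s_def \<sigma>J_def \<sigma>H_def cHJ_def .
  have Qs: "Q = (\<Sum>k\<in>{1..n}. s k)"
  proof -
    have "s k = p\<^sup>2 * \<sigma>H * wt n k ^ 2 + - (2 * p * q * cHJ) * wt n k ^ 1 + q\<^sup>2 * \<sigma>J" for k
      unfolding s_def c_def by (simp add: power_mult_distrib)
    then have "(\<Sum>k\<in>{1..n}. s k) = p\<^sup>2 * \<sigma>H * wsum 2 n + - (2 * p * q * cHJ) * wsum 1 n + real n * (q\<^sup>2 * \<sigma>J)"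
      unfolding wsum_def by (simp only: sum.distrib sum_distrib_left[symmetric] sum_constant card_atLeastAtMost) simp
    then show ?thesis unfolding Q_def by (simp add: mult_ac)
  qed
  show "0 \<le> Q" unfolding Qs using s0 by (intro sum_nonneg) auto
  have lead: "u \<bullet> lead K \<omega> = (\<Sum>k\<in>{1..n}. Z k (Y k \<omega>))" for \<omega>
  proof -
    have "u \<bullet> lead K \<omega> = (\<Sum>k\<in>{1..n}. fst u * (real K powr b * (- wt n k * H0 (Y k \<omega>)))) + (\<Sum>k\<in>{1..n}. snd u * (J0 (Y k \<omega>) / real K))"
      unfolding lead_def L1_eq S1_eq H0_def J0_def n_def
      by (simp only: inner_prod_def fst_conv snd_conv inner_real_def sum_distrib_left sum_divide_distrib)
    also have "\<dots> = (\<Sum>k\<in>{1..n}. Z k (Y k \<omega>))"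
      unfolding sum.distrib[symmetric] Z_def c_def p_def q_def by (intro sum.cong refl) simp
    finally show ?thesis .
  qed
  have ind: "indep_vars (\<lambda>_. borel) (\<lambda>k \<omega>. Z k (Y k \<omega>)) {1..n}"
    by (rule indep_vars_compose2[OF indep_vars_subset[OF indep]]) auto
  have dk: "distr M borel (\<lambda>\<omega>. Z k (Y k \<omega>)) = distr \<mu> borel (Z k)" if "k \<in> {1..n}" for k
  proof -
    have "distr M borel (Y k) = \<mu>" using distr_Y[of "k - 1"] that by simp
    then have "distr \<mu> borel (Z k) = distr (distr M borel (Y k)) borel (Z k)" by simp
    also have "\<dots> = distr M borel (Z k \<circ> Y k)" by (rule distr_distr) auto
    finally show ?thesis by (simp add: comp_def)
  qed
  have sm: "(\<lambda>\<omega>. \<Sum>k\<in>{1..n}. Z k (Y k \<omega>)) \<in> borel_measurable M" by measurable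
  have "(CLINT \<omega>|M. cis (u \<bullet> lead K \<omega>)) = char (distr M borel (\<lambda>\<omega>. \<Sum>k\<in>{1..n}. Z k (Y k \<omega>))) 1"
    unfolding char_def lead by (subst integral_distr[OF sm]) (auto simp: cis_conv_exp)
  also have "\<dots> = (\<Prod>k\<in>{1..n}. char (distr \<mu> borel (Z k)) 1)"
    unfolding char_distr_sum[OF ind] by (intro prod.cong refl) (simp add: dk)
  finally have e1: "(CLINT \<omega>|M. cis (u \<bullet> lead K \<omega>)) = (\<Prod>k\<in>{1..n}. char (distr \<mu> borel (Z k)) 1)" .
  have e2: "complex_of_real (exp (- Q / 2)) = (\<Prod>k\<in>{1..n}. complex_of_real (exp (- (s k) / 2)))"
  proof -
    have "- Q / 2 = (\<Sum>k\<in>{1..n}. - (s k) / 2)" unfolding Qs by (simp only: sum_negf[symmetric] sum_divide_distrib)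
    then show ?thesis by (simp only: exp_sum[OF finite_atLeastAtMost] of_real_prod)
  qed
  have n1: "cmod (char (distr \<mu> borel (Z k)) 1) \<le> 1" for k
  proof -
    interpret D: real_distribution "distr \<mu> borel (Z k)" by (rule law.real_distribution_distr) measurable
    show ?thesis by (rule D.cmod_char_le_1)
  qed
  let ?mJ = "\<integral>x. \<bar>J0 x\<bar> powr m \<partial>\<mu>"
  have "cmod ((CLINT \<omega>|M. cis (u \<bullet> lead K \<omega>)) - complex_of_real (exp (- Q / 2)))
     \<le> (\<Sum>k\<in>{1..n}. cmod (char (distr \<mu> borel (Z k)) 1 - complex_of_real (exp (- (s k) / 2))))"
    unfolding e1 e2 by (rule norm_prod_diff) (use n1 s0 in auto)
  also have "\<dots> \<le> (\<Sum>k\<in>{1..n}. 8 * ((\<bar>c k\<bar> / (1 - \<alpha>)) powr m + \<bar>q\<bar> powr m * ?mJ) + (c k ^ 4 * \<sigma>H\<^sup>2 + q ^ 4 * \<sigma>J\<^sup>2))"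
    using char_step_bound(2)[OF m i, of _ q] unfolding Z_def[abs_def] s_def \<sigma>J_def \<sigma>H_def cHJ_def by (intro sum_mono)
  also have "\<dots> = 8 * ((\<Sum>k\<in>{1..n}. (\<bar>c k\<bar> / (1 - \<alpha>)) powr m) + real n * (\<bar>q\<bar> powr m * ?mJ))
      + ((\<Sum>k\<in>{1..n}. c k ^ 4) * \<sigma>H\<^sup>2 + real n * (q ^ 4 * \<sigma>J\<^sup>2))"
    by (simp only: sum.distrib sum_distrib_left[symmetric] sum_distrib_right[symmetric] sum_constant card_atLeastAtMost) simp
  also have "(\<Sum>k\<in>{1..n}. c k ^ 4) = p ^ 4 * wsum 4 n"
    unfolding wsum_def c_def by (simp add: power_mult_distrib sum_distrib_left)
  also have "(\<Sum>k\<in>{1..n}. (\<bar>c k\<bar> / (1 - \<alpha>)) powr m)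
      \<le> (p / (1 - \<alpha>))\<^sup>2 * wsum 2 n * ((p / (1 - \<alpha>)) ^ 4 * wsum 4 n) powr ((m - 2) / 4)"
  proof -
    \<comment> \<open>The m-th powers are bounded by the squares times the largest weight to the
      power m - 2, and the largest weight by the fourth-power sum, so that second and fourth powers
      are all that has to be known.\<close>
    define d where "d k = \<bar>c k\<bar> / (1 - \<alpha>)" for k
    have d0: "0 \<le> d k" for k using law.alpha by (simp add: d_def)
    have d2: "(\<Sum>k\<in>{1..n}. (d k)\<^sup>2) = (p / (1 - \<alpha>))\<^sup>2 * wsum 2 n"
      unfolding wsum_def d_def c_def by (simp add: power_mult_distrib power_divide sum_distrib_left)
    have d4: "(\<Sum>k\<in>{1..n}. (d k) ^ 4) = (p / (1 - \<alpha>)) ^ 4 * wsum 4 n"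
      unfolding wsum_def d_def c_def by (simp add: power_mult_distrib power_divide sum_distrib_left power_even_abs)
    have "d k powr m \<le> (d k)\<^sup>2 * ((p / (1 - \<alpha>)) ^ 4 * wsum 4 n) powr ((m - 2) / 4)" if k: "k \<in> {1..n}" for k
    proof (cases "d k = 0")
      case False
      then have dp: "d k > 0" using d0[of k] by simp
      have "d k powr m = d k powr 2 * d k powr (m - 2)" by (simp add: powr_add[symmetric])
      also have "d k powr 2 = (d k)\<^sup>2" using dp by (simp add: powr_numeral)
      also have "d k powr (m - 2) = (d k ^ 4) powr ((m - 2) / 4)"
      proof -
        have "d k ^ 4 = d k powr 4" using dp by (simp add: powr_numeral)
        moreover have "4 * ((m - 2) / 4) = m - 2" by simp
        ultimately show ?thesis by (simp only: powr_powr)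
      qed
      also have "(d k)\<^sup>2 * (d k ^ 4) powr ((m - 2) / 4) \<le> (d k)\<^sup>2 * ((p / (1 - \<alpha>)) ^ 4 * wsum 4 n) powr ((m - 2) / 4)"
      proof (intro mult_left_mono powr_mono2)
        show "d k ^ 4 \<le> (p / (1 - \<alpha>)) ^ 4 * wsum 4 n" unfolding d4[symmetric]
          using k by (intro member_le_sum) auto
      qed (use m in auto)
      finally show ?thesis .
    qed simp
    then have "(\<Sum>k\<in>{1..n}. d k powr m) \<le> (\<Sum>k\<in>{1..n}. (d k)\<^sup>2 * ((p / (1 - \<alpha>)) ^ 4 * wsum 4 n) powr ((m - 2) / 4))"
      by (intro sum_mono)
    then show ?thesis unfolding sum_distrib_right[symmetric] d2 unfolding d_def .
  qed
  finally show "cmod ((CLINT \<omega>|M. cis (u \<bullet> lead K \<omega>)) - complex_of_real (exp (- Q / 2)))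
      \<le> 8 * ((p / (1 - \<alpha>))\<^sup>2 * wsum 2 n * ((p / (1 - \<alpha>)) ^ 4 * wsum 4 n) powr ((m - 2) / 4)
             + real n * (\<bar>q\<bar> powr m * ?mJ))
        + (p ^ 4 * wsum 4 n * \<sigma>H\<^sup>2 + real n * (q ^ 4 * \<sigma>J\<^sup>2))" by simp
qed

lemma nsa_eq_lead_plus_rem:
  assumes "K \<ge> 1"
  shows "(real K powr b * (fst (nsa \<alpha> \<gamma> (Y 0 \<omega>) (\<lambda>i. Y i \<omega>) (K\<^sup>2)) - xs),
          real K * (snd (nsa \<alpha> \<gamma> (Y 0 \<omega>) (\<lambda>i. Y i \<omega>) (K\<^sup>2)) - chi_star \<alpha> \<mu>)) = lead K \<omega> + rem K \<omega>"
proof -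
  have "fst (nsa \<alpha> \<gamma> (Y 0 \<omega>) (\<lambda>i. Y i \<omega>) (K\<^sup>2)) - xs = L1 (K\<^sup>2) \<omega> + R1 (K\<^sup>2) \<omega> + R2 (K\<^sup>2) \<omega>"
    unfolding fst_nsa[of \<alpha> \<gamma> "\<lambda>i. Y i \<omega>"] using xi_decomposition[of "K\<^sup>2" \<omega>] by (simp add: xi_def)
  moreover have "real K * (snd (nsa \<alpha> \<gamma> (Y 0 \<omega>) (\<lambda>i. Y i \<omega>) (K\<^sup>2)) - chi_star \<alpha> \<mu>)
      = (S1 (K\<^sup>2) \<omega> + T1 (K\<^sup>2) \<omega> + T2 (K\<^sup>2) \<omega>) / real K"
    unfolding chi_decomposition[symmetric] using assms by (simp add: power2_eq_square)
  ultimately show ?thesis by (simp add: lead_def rem_def add_divide_distrib distrib_left)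
qed

end

subsection \<open>Sequences of laws\<close>

lemma abs_le_square_plus_one: "\<bar>x\<bar> \<le> 1 + (x::real)\<^sup>2"
proof -
  have "0 \<le> (\<bar>x\<bar> - 1)\<^sup>2" by simp
  then have "2 * \<bar>x\<bar> \<le> 1 + x\<^sup>2" unfolding power2_diff by simp
  then show ?thesis by (smt (verit) abs_ge_zero)
qed

text \<open>What the limit theorem uses of the nested averages: a common constant \<open>C\<close>,
  pointwise convergence of the densities, and a uniform moment of order above 2, for laws arranged
  in a sequence. The range \<open>m \<le> 3\<close> is that of the expansion of characteristic
  functions.\<close>

locale law_sequence = lim: positive_law \<alpha> \<mu>0 f0 C
  for \<alpha> :: real and \<mu>0 :: "real measure" and f0 :: "real \<Rightarrow> real" and C :: real +
  fixes \<mu> :: "nat \<Rightarrow> real measure" and f :: "nat \<Rightarrow> real \<Rightarrow> real" and m B :: real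
  assumes laws: "\<And>k. positive_law \<alpha> (\<mu> k) (f k) C"
    and f_lim: "\<And>x. (\<lambda>k. f k x) \<longlonglongrightarrow> f0 x"
    and m: "2 < m" "m \<le> 3" and B: "0 \<le> B"
    and moment: "\<And>k. (\<integral>\<^sup>+x. ennreal ((1 + \<bar>x\<bar> powr m) * f k x) \<partial>lborel) \<le> ennreal B"
begin

abbreviation "c \<equiv> 1 / (1 - \<alpha>)"
definition "xs0 = xi_star \<alpha> \<mu>0"
definition "xk k = xi_star \<alpha> (\<mu> k)"
definition "P0 = (\<integral>x. max (x - xs0) 0 \<partial>\<mu>0)"
definition "Pk k = (\<integral>x. max (x - xk k) 0 \<partial>\<mu> k)"
definition "vk k = f k (xk k) / (1 - \<alpha>)"
definition "v0 = f0 xs0 / (1 - \<alpha>)"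

lemma f_meas [measurable]: "f k \<in> borel_measurable borel"
proof -
  interpret positive_law \<alpha> "\<mu> k" "f k" C by (rule laws)
  show ?thesis by (rule f_meas)
qed

lemma f_bounds: "0 \<le> f k x" "f k x \<le> C" "\<bar>f k x - f k y\<bar> \<le> C * \<bar>x - y\<bar>"
proof -
  interpret positive_law \<alpha> "\<mu> k" "f k" C by (rule laws)
  show "0 \<le> f k x" "f k x \<le> C" "\<bar>f k x - f k y\<bar> \<le> C * \<bar>x - y\<bar>" by (rule f_nonneg f_le f_lip)+
qed

lemma integral_law:
  assumes [measurable]: "\<psi> \<in> borel_measurable borel"
  shows "(\<integral>x. \<psi> x \<partial>\<mu> k) = (\<integral>x. \<psi> x * f k x \<partial>lborel)" "(\<integral>x. \<psi> x \<partial>\<mu>0) = (\<integral>x. \<psi> x * f0 x \<partial>lborel)"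
proof -
  interpret K: positive_law \<alpha> "\<mu> k" "f k" C by (rule laws)
  show "(\<integral>x. \<psi> x \<partial>\<mu> k) = (\<integral>x. \<psi> x * f k x \<partial>lborel)"
    unfolding K.mu by (subst integral_density) (auto simp: K.f_nonneg mult.commute)
  show "(\<integral>x. \<psi> x \<partial>\<mu>0) = (\<integral>x. \<psi> x * f0 x \<partial>lborel)"
    unfolding lim.mu by (subst integral_density) (auto simp: lim.f_nonneg mult.commute)
qed

lemma integral_tendsto:
  fixes \<psi> :: "nat \<Rightarrow> real \<Rightarrow> real"
  assumes psi: "\<And>k. \<psi> k \<in> borel_measurable borel" "\<psi>0 \<in> borel_measurable borel"
    and A: "\<And>k x. \<bar>\<psi> k x\<bar> \<le> A * (1 + x\<^sup>2)" and l: "\<And>x. (\<lambda>k. \<psi> k x) \<longlonglongrightarrow> \<psi>0 x"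
  shows "(\<lambda>k. \<integral>x. \<psi> k x \<partial>\<mu> k) \<longlonglongrightarrow> (\<integral>x. \<psi>0 x \<partial>\<mu>0)"
  unfolding integral_law(1)[OF psi(1)] integral_law(2)[OF psi(2)]
  by (rule density_integral_tendsto[OF m(1) f_meas f_bounds(1,2) f_lim moment B psi(1) A l])

text \<open>Pointwise convergence of the cdfs squeezes the quantiles, because the limit cdf is
  strictly below and strictly above \<alpha> at distance r/2 on the two sides of
  \<open>xs0\<close>.\<close>

lemma xk_tendsto: "xk \<longlonglongrightarrow> xs0"
proof -
  have F: "(\<lambda>k. measure (\<mu> k) {..x}) \<longlonglongrightarrow> measure \<mu>0 {..x}" for x
  proof -
    have e: "measure (\<mu> k) {..x} = (\<integral>y. indicator {..x} y \<partial>\<mu> k)" for k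
    proof -
      interpret positive_law \<alpha> "\<mu> k" "f k" C by (rule laws)
      show ?thesis by simp
    qed
    have e0: "measure \<mu>0 {..x} = (\<integral>y. indicator {..x} y \<partial>\<mu>0)" by simp
    show ?thesis unfolding e e0
      by (rule integral_tendsto[where A=1]) (auto simp: indicator_def)
  qed
  have xk: "measure (\<mu> k) {..xk k} = \<alpha>" for k
  proof -
    interpret positive_law \<alpha> "\<mu> k" "f k" C by (rule laws)
    show ?thesis unfolding xk_def by (rule xi_star)
  qed
  have mono: "measure (\<mu> k) {..x} \<le> measure (\<mu> k) {..y}" if "x \<le> y" for k x y
  proof -
    interpret positive_law \<alpha> "\<mu> k" "f k" C by (rule laws)
    show ?thesis by (rule cdf_mono[OF that])
  qed
  have x0: "measure \<mu>0 {..xs0} = \<alpha>" unfolding xs0_def by (rule lim.xi_star)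
  show ?thesis
  proof (rule LIMSEQ_I)
    fix r :: real assume r: "r > 0"
    have "measure \<mu>0 {..xs0 - r / 2} < \<alpha>" using lim.cdf_strict_mono[of "xs0 - r / 2" xs0] x0 r by simp
    then have e1: "\<forall>\<^sub>F k in sequentially. measure (\<mu> k) {..xs0 - r / 2} < \<alpha>" by (rule order_tendstoD(2)[OF F])
    have "\<alpha> < measure \<mu>0 {..xs0 + r / 2}" using lim.cdf_strict_mono[of xs0 "xs0 + r / 2"] x0 r by simp
    then have e2: "\<forall>\<^sub>F k in sequentially. \<alpha> < measure (\<mu> k) {..xs0 + r / 2}" by (rule order_tendstoD(1)[OF F])
    from e1 e2 have "\<forall>\<^sub>F k in sequentially. norm (xk k - xs0) < r"
    proof eventually_elim
      case (elim k)
      have "xs0 - r / 2 < xk k" using elim(1) mono[of "xk k" "xs0 - r / 2" k] xk[of k] by (cases "xs0 - r / 2 < xk k") auto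
      moreover have "xk k < xs0 + r / 2" using elim(2) mono[of "xs0 + r / 2" "xk k" k] xk[of k] by (cases "xk k < xs0 + r / 2") auto
      ultimately show ?case using r by (simp add: abs_less_iff)
    qed
    then show "\<exists>no. \<forall>k\<ge>no. norm (xk k - xs0) < r" by (simp add: eventually_sequentially)
  qed
qed

lemma xk_bounded: "\<exists>D\<ge>0. \<forall>k. \<bar>xk k\<bar> \<le> D"
proof -
  have "Bseq xk" using xk_tendsto by (intro convergent_imp_Bseq convergentI)
  then obtain D where "D > 0" "\<forall>k. norm (xk k) \<le> D" by (auto simp: Bseq_def)
  then show ?thesis by (intro exI[of _ D]) auto
qed

text \<open>The common Lipschitz constant moves the argument from \<open>xk k\<close> to the fixed
  point \<open>xs0\<close>, where the densities converge.\<close>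

lemma vk_tendsto: "vk \<longlonglongrightarrow> v0"
proof -
  have "(\<lambda>k. f k (xk k) - f k xs0) \<longlonglongrightarrow> 0"
  proof (rule Lim_null_comparison)
    show "\<forall>\<^sub>F k in sequentially. norm (f k (xk k) - f k xs0) \<le> C * \<bar>xk k - xs0\<bar>"
      using f_bounds(3) by (intro always_eventually) auto
    have "(\<lambda>k. C * \<bar>xk k - xs0\<bar>) \<longlonglongrightarrow> C * \<bar>xs0 - xs0\<bar>" by (intro tendsto_intros xk_tendsto)
    then show "(\<lambda>k. C * \<bar>xk k - xs0\<bar>) \<longlonglongrightarrow> 0" by simp
  qed
  from tendsto_add[OF this f_lim[of xs0]] have "(\<lambda>k. f k (xk k)) \<longlonglongrightarrow> f0 xs0" by simp
  then show ?thesis unfolding vk_def[abs_def] v0_def using lim.alpha by (intro tendsto_divide tendsto_const) auto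
qed

lemma max_tendsto: "(\<lambda>k. max (x - xk k) 0) \<longlonglongrightarrow> max (x - xs0) 0"
  by (intro tendsto_max tendsto_diff tendsto_const xk_tendsto)

lemma Pk_tendsto: "Pk \<longlonglongrightarrow> P0"
proof -
  obtain D where D: "D \<ge> 0" "\<And>k. \<bar>xk k\<bar> \<le> D" using xk_bounded by blast
  show ?thesis unfolding Pk_def[abs_def] P0_def
  proof (rule integral_tendsto[where A="1 + D", OF _ _ _ max_tendsto])
    show "\<bar>max (x - xk k) 0\<bar> \<le> (1 + D) * (1 + x\<^sup>2)" for k x
    proof -
      have "\<bar>max (x - xk k) 0\<bar> \<le> \<bar>x\<bar> + D" using D(2)[of k] by auto
      also have "\<dots> \<le> (1 + x\<^sup>2) + D * (1 + x\<^sup>2)" using abs_le_square_plus_one[of x] D(1) by (intro add_mono) (auto simp: distrib_left)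
      finally show ?thesis by (simp add: algebra_simps)
    qed
  qed auto
qed

lemma Pk_bounded: "\<exists>D\<ge>0. \<forall>k. \<bar>Pk k\<bar> \<le> D"
proof -
  have "Bseq Pk" using Pk_tendsto by (intro convergent_imp_Bseq convergentI)
  then obtain D where "D > 0" "\<forall>k. norm (Pk k) \<le> D" by (auto simp: Bseq_def)
  then show ?thesis by (intro exI[of _ D]) auto
qed

lemma centered_bound: "\<exists>D\<ge>1. \<forall>k x. \<bar>max (x - xk k) 0 - Pk k\<bar> \<le> \<bar>x\<bar> + D"
proof -
  obtain D where D: "D \<ge> 0" "\<And>k. \<bar>xk k\<bar> \<le> D" using xk_bounded by blast
  obtain E where E: "E \<ge> 0" "\<And>k. \<bar>Pk k\<bar> \<le> E" using Pk_bounded by blast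
  have "\<bar>max (x - xk k) 0 - Pk k\<bar> \<le> \<bar>x\<bar> + (1 + D + E)" for k x using D(2)[of k] E(2)[of k] by auto
  then show ?thesis using D(1) E(1) by (intro exI[of _ "1 + D + E"]) auto
qed

lemma variance_tendsto:
  "(\<lambda>k. \<integral>x. (max (x - xk k) 0 - Pk k)\<^sup>2 \<partial>\<mu> k) \<longlonglongrightarrow> (\<integral>x. (max (x - xs0) 0 - P0)\<^sup>2 \<partial>\<mu>0)"
proof -
  obtain D where D: "D \<ge> 1" "\<And>k x. \<bar>max (x - xk k) 0 - Pk k\<bar> \<le> \<bar>x\<bar> + D" using centered_bound by blast
  show ?thesis
  proof (rule integral_tendsto[where A="2 * D\<^sup>2"])
    show "\<bar>(max (x - xk k) 0 - Pk k)\<^sup>2\<bar> \<le> 2 * D\<^sup>2 * (1 + x\<^sup>2)" for k x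
    proof -
      have "\<bar>max (x - xk k) 0 - Pk k\<bar>\<^sup>2 \<le> (\<bar>x\<bar> + D)\<^sup>2" using D(2)[of x k] by (intro power_mono) auto
      also have "\<dots> \<le> 2 * x\<^sup>2 + 2 * D\<^sup>2" using sum_squares_bound[of "\<bar>x\<bar>" D] by (simp add: power2_sum)
      also have "\<dots> \<le> 2 * (D\<^sup>2 * x\<^sup>2) + 2 * D\<^sup>2"
        using mult_right_mono[of 1 "D\<^sup>2" "x\<^sup>2"] power_mono[of 1 D 2] D(1) by simp
      finally show ?thesis by (simp add: algebra_simps)
    qed
    show "(\<lambda>k. (max (x - xk k) 0 - Pk k)\<^sup>2) \<longlonglongrightarrow> (max (x - xs0) 0 - P0)\<^sup>2" for x
      by (intro tendsto_power tendsto_diff max_tendsto Pk_tendsto)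
  qed auto
qed

lemma centered_moment:
  "\<exists>E\<ge>0. \<forall>k. integrable (\<mu> k) (\<lambda>x. \<bar>c * (max (x - xk k) 0 - Pk k)\<bar> powr m)
      \<and> (\<integral>x. \<bar>c * (max (x - xk k) 0 - Pk k)\<bar> powr m \<partial>\<mu> k) \<le> E"
proof -
  obtain D where D: "D \<ge> 1" "\<And>k x. \<bar>max (x - xk k) 0 - Pk k\<bar> \<le> \<bar>x\<bar> + D" using centered_bound by blast
  define A where "A = c powr m * (8 * (D powr m))"
  have A0: "0 \<le> A" by (simp add: A_def)
  have c0: "0 \<le> c" using lim.alpha by simp
  have pt: "\<bar>c * (max (x - xk k) 0 - Pk k)\<bar> powr m \<le> A * (1 + \<bar>x\<bar> powr m)" for k x
  proof -
    have "\<bar>max (x - xk k) 0 - Pk k\<bar> powr m \<le> \<bar>\<bar>x\<bar> + D\<bar> powr m" using D(2)[of x k] m D(1) by (intro powr_mono2) auto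
    also have "\<dots> \<le> 8 * (\<bar>\<bar>x\<bar>\<bar> powr m + \<bar>D\<bar> powr m)" using m by (intro powr_add_le) auto
    also have "\<dots> = 8 * (\<bar>x\<bar> powr m + D powr m)" using D(1) by simp
    also have "\<dots> \<le> 8 * (D powr m * \<bar>x\<bar> powr m + D powr m)"
    proof -
      have "1 \<le> D powr m" using D(1) m by (intro ge_one_powr_ge_zero) auto
      from mult_right_mono[OF this, of "\<bar>x\<bar> powr m"] show ?thesis by simp
    qed
    finally have h: "\<bar>max (x - xk k) 0 - Pk k\<bar> powr m \<le> 8 * (D powr m * \<bar>x\<bar> powr m + D powr m)" .
    have "\<bar>c * (max (x - xk k) 0 - Pk k)\<bar> powr m = c powr m * \<bar>max (x - xk k) 0 - Pk k\<bar> powr m"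
      unfolding abs_mult abs_of_nonneg[OF c0] by (rule powr_mult)
    also have "\<dots> \<le> c powr m * (8 * (D powr m * \<bar>x\<bar> powr m + D powr m))" using h by (intro mult_left_mono) auto
    also have "\<dots> = A * (1 + \<bar>x\<bar> powr m)" 
    proof -
      have "u * (8 * (d * y + d)) = u * (8 * d) * (1 + y)" for u d y :: real by (simp add: algebra_simps)
      then show ?thesis unfolding A_def by blast
    qed
    finally show ?thesis .
  qed
  have "integrable (\<mu> k) (\<lambda>x. \<bar>c * (max (x - xk k) 0 - Pk k)\<bar> powr m)
      \<and> (\<integral>x. \<bar>c * (max (x - xk k) 0 - Pk k)\<bar> powr m \<partial>\<mu> k) \<le> A * B" for k
  proof -
    interpret K: positive_law \<alpha> "\<mu> k" "f k" C by (rule laws)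
    let ?w = "\<lambda>x. 1 + \<bar>x\<bar> powr m"
    have wm: "(\<integral>\<^sup>+x. ennreal (?w x) \<partial>\<mu> k) \<le> ennreal B"
    proof -
      have "(\<integral>\<^sup>+x. ennreal (?w x) \<partial>\<mu> k) = (\<integral>\<^sup>+x. ennreal (f k x) * ennreal (?w x) \<partial>lborel)"
        unfolding K.mu by (rule nn_integral_density) auto
      also have "\<dots> = (\<integral>\<^sup>+x. ennreal (?w x * f k x) \<partial>lborel)"
        by (intro nn_integral_cong) (simp add: ennreal_mult'' K.f_nonneg mult.commute)
      finally show ?thesis using moment[of k] by simp
    qed
    have iw: "integrable (\<mu> k) ?w"
      by (rule integrableI_nonneg) (use wm in \<open>auto simp: less_top[symmetric] top_unique\<close>)
    have ew: "(\<integral>x. ?w x \<partial>\<mu> k) \<le> B" using wm B by (subst integral_eq_nn_integral) (auto intro!: enn2real_leI)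
    have i: "integrable (\<mu> k) (\<lambda>x. \<bar>c * (max (x - xk k) 0 - Pk k)\<bar> powr m)"
    proof (rule Bochner_Integration.integrable_bound[OF integrable_mult_right[OF iw, of A]])
      show "AE x in \<mu> k. norm (\<bar>c * (max (x - xk k) 0 - Pk k)\<bar> powr m) \<le> norm (A * ?w x)"
        using pt by (intro AE_I2) (metis abs_ge_self abs_of_nonneg order_trans powr_ge_zero real_norm_def)
    qed measurable
    have "(\<integral>x. \<bar>c * (max (x - xk k) 0 - Pk k)\<bar> powr m \<partial>\<mu> k) \<le> (\<integral>x. A * ?w x \<partial>\<mu> k)"
      using i iw pt by (intro integral_mono) auto
    also have "\<dots> = A * (\<integral>x. ?w x \<partial>\<mu> k)" by (rule integral_mult_right_zero)
    also have "\<dots> \<le> A * B" using ew A0 by (rule mult_left_mono)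
    finally show ?thesis using i by blast
  qed
  then show ?thesis using A0 B by (intro exI[of _ "A * B"]) auto
qed

end

section \<open>Limits of the scaled weight sums\<close>

lemma Suc_powr_tendsto_0: "c > 0 \<Longrightarrow> (\<lambda>k. real (Suc k) powr (- c)) \<longlonglongrightarrow> 0"
  by (rule LIMSEQ_Suc[OF tendsto_neg_powr[OF _ filterlim_real_sequentially]]) simp

lemma Suc_square_powr_le:
  assumes "0 \<le> s"
  shows "real (Suc ((Suc k)\<^sup>2)) powr (- s) \<le> real (Suc k) powr (- 2 * s)"
proof -
  have "real (Suc ((Suc k)\<^sup>2)) powr (- s) \<le> real ((Suc k)\<^sup>2) powr (- s)" using assms by (intro powr_mono2') auto
  also have "\<dots> = real (Suc k) powr (- 2 * s)" by (rule of_nat_square_powr) simp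
  finally show ?thesis .
qed

text \<open>The squared scaling K^(2b) compensates (n+1)^(-b) for n = K^2 up to a power of n/(n+1);
  the error exponent, 2 or 1, exceeds \<open>b\<close>, so the error vanishes after scaling.\<close>

lemma weight_square_limit:
  assumes b: "1 / 2 < b" "b \<le> 1"
    and W: "\<forall>\<^sub>F k in sequentially. \<bar>W k - \<kappa> k * real (Suc ((Suc k)\<^sup>2)) powr (- b)\<bar>
              \<le> D * real (Suc ((Suc k)\<^sup>2)) powr (- (if b = 1 then 2 else 1))"
    and \<kappa>: "\<kappa> \<longlonglongrightarrow> \<kappa>0"
  shows "(\<lambda>k. (real (Suc k) powr b)\<^sup>2 * W k) \<longlonglongrightarrow> \<kappa>0"
proof -
  define s :: real where "s = (if b = 1 then 2 else 1)"
  have s: "b < s" "0 \<le> s" using b by (auto simp: s_def)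
  let ?N = "\<lambda>k. real (Suc ((Suc k)\<^sup>2))"
  have Kb: "(real (Suc k) powr b)\<^sup>2 = real ((Suc k)\<^sup>2) powr b" for k
    unfolding power2_eq_square of_nat_mult by (rule powr_mult[symmetric])
  have "(\<lambda>k. (real (Suc k) powr b)\<^sup>2 * ?N k powr (- b)) = (\<lambda>k. (real ((Suc k)\<^sup>2) / ?N k) powr b)"
    unfolding Kb by (auto simp: powr_minus_divide powr_divide simp del: of_nat_Suc)
  moreover have "(\<lambda>k. (real ((Suc k)\<^sup>2) / ?N k) powr b) \<longlonglongrightarrow> 1 powr b"
  proof (rule tendsto_powr)
    have "(\<lambda>k. inverse (real (Suc ((Suc k)\<^sup>2)))) \<longlonglongrightarrow> 0"
    proof (rule Lim_null_comparison)
      show "\<forall>\<^sub>F k in sequentially. norm (inverse (real (Suc ((Suc k)\<^sup>2)))) \<le> inverse (real (Suc k))"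
      proof (rule always_eventually, rule allI)
        fix k
        have "real (Suc k) \<le> real (Suc ((Suc k)\<^sup>2))" unfolding of_nat_le_iff by (simp add: power2_eq_square)
        then have "inverse (real (Suc ((Suc k)\<^sup>2))) \<le> inverse (real (Suc k))" by (intro le_imp_inverse_le) auto
        then show "norm (inverse (real (Suc ((Suc k)\<^sup>2)))) \<le> inverse (real (Suc k))" by simp
      qed
      show "(\<lambda>k. inverse (real (Suc k))) \<longlonglongrightarrow> 0" by (rule LIMSEQ_inverse_real_of_nat)
    qed
    from tendsto_diff[OF tendsto_const this, of 1]
    have "(\<lambda>k. 1 - inverse (real (Suc ((Suc k)\<^sup>2)))) \<longlonglongrightarrow> 1" by simp
    moreover have "1 - inverse (real (Suc n)) = real n / real (Suc n)" for n by (simp add: field_simps)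
    ultimately show "(\<lambda>k. real ((Suc k)\<^sup>2) / ?N k) \<longlonglongrightarrow> 1" by (simp only:)
  qed auto
  ultimately have one: "(\<lambda>k. (real (Suc k) powr b)\<^sup>2 * ?N k powr (- b)) \<longlonglongrightarrow> 1" by simp
  have zero: "(\<lambda>k. (real (Suc k) powr b)\<^sup>2 * (W k - \<kappa> k * ?N k powr (- b))) \<longlonglongrightarrow> 0"
  proof (rule Lim_null_comparison)
    show "\<forall>\<^sub>F k in sequentially. norm ((real (Suc k) powr b)\<^sup>2 * (W k - \<kappa> k * ?N k powr (- b))) \<le> \<bar>D\<bar> * real (Suc k) powr (- (2 * (s - b)))"
      using W
    proof eventually_elim
      case (elim k)
      have "\<bar>W k - \<kappa> k * ?N k powr (- b)\<bar> \<le> \<bar>D\<bar> * ?N k powr (- s)"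
        unfolding s_def by (rule order_trans[OF elim mult_right_mono]) auto
      also have "\<dots> \<le> \<bar>D\<bar> * real (Suc k) powr (- 2 * s)" using Suc_square_powr_le[OF s(2)] by (intro mult_left_mono) auto
      finally have "(real (Suc k) powr b)\<^sup>2 * \<bar>W k - \<kappa> k * ?N k powr (- b)\<bar> \<le> (real (Suc k) powr b)\<^sup>2 * (\<bar>D\<bar> * real (Suc k) powr (- 2 * s))"
        by (intro mult_left_mono) auto
      also have "\<dots> = \<bar>D\<bar> * ((real (Suc k) powr b * real (Suc k) powr b) * real (Suc k) powr (- 2 * s))" by (simp only: power2_eq_square mult_ac)
      also have "(real (Suc k) powr b * real (Suc k) powr b) * real (Suc k) powr (- 2 * s) = real (Suc k) powr (- (2 * (s - b)))"
        unfolding powr_add[symmetric] by (simp add: algebra_simps)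
      finally show ?case by (simp add: abs_mult)
    qed
    show "(\<lambda>k. \<bar>D\<bar> * real (Suc k) powr (- (2 * (s - b)))) \<longlonglongrightarrow> 0"
      using s by (intro tendsto_mult_right_zero Suc_powr_tendsto_0) auto
  qed
  have "(\<lambda>k. (real (Suc k) powr b)\<^sup>2 * (W k - \<kappa> k * ?N k powr (- b)) + \<kappa> k * ((real (Suc k) powr b)\<^sup>2 * ?N k powr (- b))) \<longlonglongrightarrow> 0 + \<kappa>0 * 1"
    by (intro tendsto_add zero tendsto_mult \<kappa> one)
  then show ?thesis by (simp add: algebra_simps)
qed

text \<open>The weight sum tends to 1/v while its scaling K^b/K tends to 0 unless b = 1; this is the
  origin of the indicator off the diagonal.\<close>

lemma weight_sum_limit:
  assumes b: "b \<le> (1::real)" and v: "v \<longlonglongrightarrow> v0" "0 < v0"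
    and W: "\<forall>\<^sub>F k in sequentially. \<bar>W k - 1 / v k\<bar> \<le> D * real (Suc ((Suc k)\<^sup>2)) powr (- 1)"
  shows "(\<lambda>k. real (Suc k) powr b / real (Suc k) * W k) \<longlonglongrightarrow> (if b = 1 then 1 / v0 else 0)"
proof -
  have "(\<lambda>k. W k - 1 / v k) \<longlonglongrightarrow> 0"
  proof (rule Lim_null_comparison)
    show "\<forall>\<^sub>F k in sequentially. norm (W k - 1 / v k) \<le> \<bar>D\<bar> * real (Suc k) powr (- 2)"
      using W
    proof eventually_elim
      case (elim k)
      have "\<bar>W k - 1 / v k\<bar> \<le> \<bar>D\<bar> * real (Suc ((Suc k)\<^sup>2)) powr (- 1)"
        by (rule order_trans[OF elim mult_right_mono]) auto
      also have "\<dots> \<le> \<bar>D\<bar> * real (Suc k) powr (- 2 * 1)" using Suc_square_powr_le[of 1 k] by (intro mult_left_mono) auto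
      finally show ?case by simp
    qed
    show "(\<lambda>k. \<bar>D\<bar> * real (Suc k) powr (- 2)) \<longlonglongrightarrow> 0" by (intro tendsto_mult_right_zero Suc_powr_tendsto_0) auto
  qed
  moreover have "(\<lambda>k. 1 / v k) \<longlonglongrightarrow> 1 / v0" using v by (intro tendsto_divide tendsto_const) auto
  ultimately have "(\<lambda>k. (W k - 1 / v k) + 1 / v k) \<longlonglongrightarrow> 0 + 1 / v0" by (rule tendsto_add)
  then have w: "W \<longlonglongrightarrow> 1 / v0" by simp
  have "(\<lambda>k. real (Suc k) powr b / real (Suc k)) \<longlonglongrightarrow> (if b = 1 then 1 else 0)"
  proof (cases "b = 1")
    case False
    have "real (Suc k) powr b / real (Suc k) = real (Suc k) powr (- (1 - b))" for k
      using powr_diff[of "real (Suc k)" b 1] by simp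
    then show ?thesis using False b Suc_powr_tendsto_0[of "1 - b"] by simp
  qed simp
  from tendsto_mult[OF this w] show ?thesis by (auto split: if_splits)
qed

text \<open>K^(4b) n^(-3b) with n = K^2 leaves K^(-2b): no single scaled weight survives, as a
  central limit theorem requires.\<close>

lemma weight_fourth_limit:
  assumes b: "0 < b" and W: "\<forall>\<^sub>F k in sequentially. 0 \<le> W k \<and> W k \<le> D * real (Suc ((Suc k)\<^sup>2)) powr (- (3 * b))"
  shows "(\<lambda>k. (real (Suc k) powr b) ^ 4 * W k) \<longlonglongrightarrow> 0"
proof (rule Lim_null_comparison)
  show "\<forall>\<^sub>F k in sequentially. norm ((real (Suc k) powr b) ^ 4 * W k) \<le> \<bar>D\<bar> * real (Suc k) powr (- (2 * b))"
    using W
  proof eventually_elim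
    case (elim k)
    have "W k \<le> \<bar>D\<bar> * real (Suc ((Suc k)\<^sup>2)) powr (- (3 * b))"
      by (rule order_trans[OF conjunct2[OF elim] mult_right_mono]) auto
    also have "\<dots> \<le> \<bar>D\<bar> * real (Suc k) powr (- 2 * (3 * b))" using Suc_square_powr_le[of "3 * b" k] b by (intro mult_left_mono) auto
    finally have "(real (Suc k) powr b) ^ 4 * W k \<le> (real (Suc k) powr b) ^ 4 * (\<bar>D\<bar> * real (Suc k) powr (- 2 * (3 * b)))"
      by (intro mult_left_mono) auto
    also have "\<dots> = \<bar>D\<bar> * ((real (Suc k) powr b * real (Suc k) powr b * real (Suc k) powr b * real (Suc k) powr b) * real (Suc k) powr (- 2 * (3 * b)))"
      by (simp only: power4_eq_xxxx mult_ac)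
    also have "(real (Suc k) powr b * real (Suc k) powr b * real (Suc k) powr b * real (Suc k) powr b) * real (Suc k) powr (- 2 * (3 * b)) = real (Suc k) powr (- (2 * b))"
      unfolding powr_add[symmetric] by (simp add: algebra_simps)
    finally show ?case using elim by (simp add: abs_mult)
  qed
  show "(\<lambda>k. \<bar>D\<bar> * real (Suc k) powr (- (2 * b))) \<longlonglongrightarrow> 0" using b by (intro tendsto_mult_right_zero Suc_powr_tendsto_0) auto
qed

text \<open>The K^2 equal weights of order 1/K contribute K^(2-m), which vanishes for m > 2.\<close>

lemma lyapunov_term_limit:
  fixes q :: real
  assumes m: "2 < m" and J: "\<And>k. 0 \<le> J k \<and> J k \<le> E"
  shows "(\<lambda>k. real ((Suc k)\<^sup>2) * (\<bar>q / real (Suc k)\<bar> powr m * J k)) \<longlonglongrightarrow> 0"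
proof (rule Lim_null_comparison)
  show "\<forall>\<^sub>F k in sequentially. norm (real ((Suc k)\<^sup>2) * (\<bar>q / real (Suc k)\<bar> powr m * J k)) \<le> \<bar>q\<bar> powr m * E * real (Suc k) powr (- (m - 2))"
  proof (rule always_eventually, rule allI)
    fix k
    have "\<bar>q / real (Suc k)\<bar> powr m = \<bar>q\<bar> powr m / real (Suc k) powr m" by (simp add: abs_divide powr_divide)
    moreover have "real ((Suc k)\<^sup>2) = real (Suc k) powr 2" by (simp add: powr_numeral)
    moreover have "real (Suc k) powr 2 / real (Suc k) powr m = real (Suc k) powr (- (m - 2))" unfolding powr_diff[symmetric] by simp
    ultimately have e: "real ((Suc k)\<^sup>2) * (\<bar>q / real (Suc k)\<bar> powr m * J k) = \<bar>q\<bar> powr m * J k * real (Suc k) powr (- (m - 2))"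
    proof -
      assume "\<bar>q / real (Suc k)\<bar> powr m = \<bar>q\<bar> powr m / real (Suc k) powr m" "real ((Suc k)\<^sup>2) = real (Suc k) powr 2"
        "real (Suc k) powr 2 / real (Suc k) powr m = real (Suc k) powr (- (m - 2))"
      note h = this
      show ?thesis unfolding h(1,2) h(3)[symmetric] by simp
    qed
    have "\<bar>q\<bar> powr m * J k * real (Suc k) powr (- (m - 2)) \<le> \<bar>q\<bar> powr m * E * real (Suc k) powr (- (m - 2))"
      using J by (intro mult_right_mono mult_left_mono) auto
    moreover have "0 \<le> \<bar>q\<bar> powr m * J k * real (Suc k) powr (- (m - 2))" using J by (intro mult_nonneg_nonneg) auto
    ultimately show "norm (real ((Suc k)\<^sup>2) * (\<bar>q / real (Suc k)\<bar> powr m * J k)) \<le> \<bar>q\<bar> powr m * E * real (Suc k) powr (- (m - 2))"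
      unfolding e real_norm_def by (simp only: abs_of_nonneg)
  qed
  show "(\<lambda>k. \<bar>q\<bar> powr m * E * real (Suc k) powr (- (m - 2))) \<longlonglongrightarrow> 0" using m by (intro tendsto_mult_right_zero Suc_powr_tendsto_0) auto
qed

lemma nsa_cong:
  assumes "\<And>i. X (Suc i) = X' (Suc i)"
  shows "nsa \<alpha> \<gamma> z X n = nsa \<alpha> \<gamma> z X' n"
  by (induct n) (auto simp: assms)

lemma nsa_measurable:
  assumes "z \<in> borel_measurable M" "\<And>i. X (Suc i) \<in> borel_measurable M"
  shows "(\<lambda>\<omega>. fst (nsa \<alpha> \<gamma> (z \<omega>) (\<lambda>i. X i \<omega>) n)) \<in> borel_measurable M \<and>
         (\<lambda>\<omega>. snd (nsa \<alpha> \<gamma> (z \<omega>) (\<lambda>i. X i \<omega>) n)) \<in> borel_measurable M"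
proof (induct n)
  case (Suc n)
  then have [measurable]: "(\<lambda>\<omega>. fst (nsa \<alpha> \<gamma> (z \<omega>) (\<lambda>i. X i \<omega>) n)) \<in> borel_measurable M"
    "(\<lambda>\<omega>. snd (nsa \<alpha> \<gamma> (z \<omega>) (\<lambda>i. X i \<omega>) n)) \<in> borel_measurable M" "X (Suc n) \<in> borel_measurable M"
    using assms(2) by auto
  show ?case unfolding nsa.simps Let_def case_prod_beta fst_conv snd_conv H2_def
    by (intro conjI borel_measurable_diff borel_measurable_times borel_measurable_const borel_measurable_max) measurable
qed (use assms in auto)

section \<open>Central limit theorem along a sequence of laws\<close>

context law_sequence
begin

text \<open>The index k stands for K = k + 1. The threshold 8/3 is what \<lambda> g > 1 gives
  through \<lambda> \<le> 3/8 \<open>v0\<close>. The covariance is read off the limit of the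
  variances of linear combinations of the leading part.\<close>

lemma nsa_sequence_clt:
  fixes M :: "nat \<Rightarrow> 'w measure" and X :: "nat \<Rightarrow> nat \<Rightarrow> 'w \<Rightarrow> real" and z :: "nat \<Rightarrow> 'w \<Rightarrow> real" and g b :: real
  assumes Mp: "\<And>k. prob_space (M k)"
    and ind: "\<And>k. prob_space.indep_vars (M k) (\<lambda>_. borel) (\<lambda>n. if n = 0 then z k else X k n) UNIV"
    and dX: "\<And>k n. distr (M k) borel (X k (Suc n)) = \<mu> k"
    and tight: "\<And>e. e > 0 \<Longrightarrow> \<exists>R>0. \<forall>k. measure (M k) {\<omega>\<in>space (M k). \<bar>z k \<omega>\<bar> > R} \<le> e"
    and g: "g > 0" and b: "1 / 2 < b" "b \<le> 1" and crit: "b = 1 \<Longrightarrow> 8 / 3 < v0 * g"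
  defines "U \<equiv> \<lambda>k \<omega>. let p = nsa \<alpha> (\<lambda>n. g * real n powr (- b)) (z k \<omega>) (\<lambda>n. X k n \<omega>) ((Suc k)\<^sup>2) in
      (real (Suc k) powr b * (fst p - xk k), real (Suc k) * (snd p - chi_star \<alpha> (\<mu> k)))"
  shows "\<exists>N. is_gaussian2 N (\<alpha> * g / (2 * f0 xs0 - (if b = 1 then (1 - \<alpha>) / g else 0)))
       (if b = 1 then \<alpha> * (chi_star \<alpha> \<mu>0 - xs0) / f0 xs0 else 0)
       ((\<integral>x. (max (x - xs0) 0 - P0)\<^sup>2 \<partial>\<mu>0) / (1 - \<alpha>)\<^sup>2)
     \<and> (\<forall>G :: real \<times> real \<Rightarrow> real. continuous_on UNIV G \<and> bounded (range G) \<longrightarrow> (\<lambda>k. \<integral>\<omega>. G (U k \<omega>) \<partial>M k) \<longlonglongrightarrow> (\<integral>x. G x \<partial>N))"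
proof -
  define \<sigma>H where "\<sigma>H = \<alpha> / (1 - \<alpha>)"
  \<comment> \<open>Strictly below the limit slope, so that \<open>a \<le> vk k\<close> from some
    index on, and yet large enough in the critical case: 9/10 times 8/3 is 12/5 > 2.\<close>
  define a where "a = 9 / 10 * v0"
  have f0p: "0 < f0 xs0" by (rule lim.f_pos)
  have v0p: "0 < v0" unfolding v0_def using f0p lim.alpha by simp
  have a0: "0 < a" using v0p by (simp add: a_def)
  have acrit: "2 < a * g" if "b = 1" using crit[OF that] by (simp add: a_def)
  have "\<forall>\<^sub>F k in sequentially. a < vk k" using vk_tendsto v0p by (intro order_tendstoD) (auto simp: a_def)
  then obtain k0 where k0: "\<And>k. k \<ge> k0 \<Longrightarrow> a \<le> vk k" by (force simp: eventually_sequentially)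
  obtain D where D: "D \<ge> 0" "\<And>k. \<bar>xk k\<bar> \<le> D" using xk_bounded by blast
  \<comment> \<open>Clamping touches index 0 alone, so independence and the laws of the samples
    persist.\<close>
  define Y where "Y R k n \<omega> = (if n = 0 then max (- R) (min (z k \<omega>) R) else X k n \<omega>)" for R :: real and k n :: nat and \<omega>
  have rv: "z k \<in> borel_measurable (M k)" "X k (Suc i) \<in> borel_measurable (M k)" for k i
  proof -
    interpret prob_space "M k" by (rule Mp)
    have "\<forall>i. (if i = 0 then z k else X k i) \<in> borel_measurable (M k)" using ind[of k] unfolding indep_vars_def by auto
    from spec[OF this, of 0] spec[OF this, of "Suc i"] show "z k \<in> borel_measurable (M k)" "X k (Suc i) \<in> borel_measurable (M k)" by auto
  qed
  have proc: "nsa_process \<alpha> (\<mu> k) (f k) C (M k) (Y R k) g b a (R + D)" if k: "k \<ge> k0" and R: "R > 0" for k R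
  proof -
    interpret prob_space "M k" by (rule Mp)
    have "indep_vars (\<lambda>_. borel) (\<lambda>n \<omega>. (if n = 0 then (\<lambda>x. max (- R) (min x R)) else (\<lambda>x. x)) ((if n = 0 then z k else X k n) \<omega>)) UNIV"
      by (rule indep_vars_compose2[OF ind]) auto
    moreover have "(\<lambda>n \<omega>. (if n = 0 then (\<lambda>x. max (- R) (min x R)) else (\<lambda>x. x)) ((if n = 0 then z k else X k n) \<omega>)) = Y R k"
      by (auto simp: Y_def fun_eq_iff)
    ultimately have i: "indep_vars (\<lambda>_. borel) (Y R k) UNIV" by simp
    have "Y R k (Suc n) = X k (Suc n)" for n by (auto simp: Y_def)
    then have d: "distr (M k) borel (Y R k (Suc n)) = \<mu> k" for n using dX by simp
    have "\<bar>Y R k 0 \<omega> - xi_star \<alpha> (\<mu> k)\<bar> \<le> R + D" for \<omega>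
      using D(2)[of k] R unfolding xk_def Y_def by (auto simp: abs_le_iff)
    then show ?thesis
      unfolding nsa_process_def nsa_process_axioms_def
      using laws Mp i d g b a0 acrit k0[OF k] unfolding vk_def xk_def by auto
  qed
  have proc1: "nsa_process \<alpha> (\<mu> k) (f k) C (M k) (Y 1 k) g b a (1 + D)" if "k \<ge> k0" for k by (rule proc[OF that]) simp
  \<comment> \<open>The leading part involves the samples from index 1 on and is therefore the same
    for every clamping level; level 1 is fixed to have a definite process.\<close>
  define S where "S k = nsa_process.lead \<alpha> (\<mu> k) (f k) (Y 1 k) g b (Suc k)" for k
  define W where "W i k = nsa_process.wsum \<alpha> (\<mu> k) (f k) g b i ((Suc k)\<^sup>2)" for i k
  define J where "J k = nsa_process.J0 \<alpha> (\<mu> k)" for k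
  have J_eq: "J k x = c * (max (x - xk k) 0 - Pk k)" if "k \<ge> k0" for k x
    unfolding J_def nsa_process.J0_def[OF proc1[OF that]] Jfun_def Vfun_def xk_def Pk_def by (simp add: algebra_simps)
  obtain E where E: "E \<ge> 0" "\<And>k. integrable (\<mu> k) (\<lambda>x. \<bar>c * (max (x - xk k) 0 - Pk k)\<bar> powr m)"
     "\<And>k. (\<integral>x. \<bar>c * (max (x - xk k) 0 - Pk k)\<bar> powr m \<partial>\<mu> k) \<le> E" using centered_moment by blast
  define mJ where "mJ k = (\<integral>x. \<bar>c * (max (x - xk k) 0 - Pk k)\<bar> powr m \<partial>\<mu> k)" for k
  have mJ: "0 \<le> mJ k \<and> mJ k \<le> E" for k using E(3)[of k] by (auto simp: mJ_def intro!: Bochner_Integration.integral_nonneg)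
  define sJ where "sJ k = c\<^sup>2 * (\<integral>x. (max (x - xk k) 0 - Pk k)\<^sup>2 \<partial>\<mu> k)" for k
  define sJ0 where "sJ0 = c\<^sup>2 * (\<integral>x. (max (x - xs0) 0 - P0)\<^sup>2 \<partial>\<mu>0)"
  have sJ_lim: "sJ \<longlonglongrightarrow> sJ0" unfolding sJ_def[abs_def] sJ0_def by (intro tendsto_mult_left variance_tendsto)
  have iJ: "integrable (\<mu> k) (\<lambda>x. \<bar>J k x\<bar> powr m)" and emJ: "(\<integral>x. \<bar>J k x\<bar> powr m \<partial>\<mu> k) = mJ k"
    and esJ: "(\<integral>x. (J k x)\<^sup>2 \<partial>\<mu> k) = sJ k" if "k \<ge> k0" for k
    unfolding J_eq[OF that] using E(2) by (auto simp: mJ_def sJ_def power_mult_distrib power_divide)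
  have i2J: "integrable (\<mu> k) (\<lambda>x. (J k x)\<^sup>2)" if "k \<ge> k0" for k
    using nsa_process.integrable_J0_square[OF proc1[OF that], of m] iJ[OF that] m unfolding J_def by simp
  define ch where "ch k = - (\<sigma>H * (c * Pk k))" for k
  define ch0 where "ch0 = - (\<sigma>H * (c * P0))"
  have ch_lim: "ch \<longlonglongrightarrow> ch0" unfolding ch_def[abs_def] ch0_def by (intro tendsto_minus tendsto_mult_left Pk_tendsto)
  have ech: "(\<integral>x. nsa_process.H0 \<alpha> (\<mu> k) x * nsa_process.J0 \<alpha> (\<mu> k) x \<partial>\<mu> k) = ch k" if "k \<ge> k0" for k
  proof -
    interpret positive_law \<alpha> "\<mu> k" "f k" C by (rule laws)
    show ?thesis unfolding nsa_process.H0_moments(6)[OF proc1[OF that]] ch_def \<sigma>H_def chi_star_eq Pk_def xk_def by simp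
  qed
  have ev: "\<forall>\<^sub>F k in sequentially. k \<ge> k0" by (rule eventually_ge_at_top)
  define kk where "kk v = g / (2 * v - (if b = 1 then 1 / g else 0))" for v
  have den0: "0 < 2 * v0 - (if b = 1 then 1 / g else 0)"
  proof (cases "b = 1")
    case True
    have "1 / g < v0" using crit[OF True] g by (simp add: pos_divide_less_eq)
    then show ?thesis using True v0p by simp
  qed (use v0p in simp)
  have kk_lim: "(\<lambda>k. kk (vk k)) \<longlonglongrightarrow> kk v0"
    unfolding kk_def using den0 by (intro tendsto_divide tendsto_diff tendsto_mult tendsto_const vk_tendsto) auto
  have W2_lim: "(\<lambda>k. (real (Suc k) powr b)\<^sup>2 * W 2 k) \<longlonglongrightarrow> kk v0"
  proof (rule weight_square_limit[OF b _ kk_lim])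
    show "\<forall>\<^sub>F k in sequentially. \<bar>W 2 k - kk (vk k) * real (Suc ((Suc k)\<^sup>2)) powr (- b)\<bar>
        \<le> nsa_process.D5 \<alpha> C g b a * real (Suc ((Suc k)\<^sup>2)) powr (- (if b = 1 then 2 else 1))"
      using ev
    proof eventually_elim
      case (elim k)
      show ?case using nsa_process.wsum2[OF proc1[OF elim], of "(Suc k)\<^sup>2"]
        unfolding nsa_process.kappa_def[OF proc1[OF elim]] W_def kk_def vk_def xk_def .
    qed
  qed
  have W1_lim: "(\<lambda>k. real (Suc k) powr b / real (Suc k) * W 1 k) \<longlonglongrightarrow> (if b = 1 then 1 / v0 else 0)"
  proof (rule weight_sum_limit[OF b(2) vk_tendsto v0p])
    show "\<forall>\<^sub>F k in sequentially. \<bar>W 1 k - 1 / vk k\<bar> \<le> nsa_process.D6 \<alpha> C g b a * real (Suc ((Suc k)\<^sup>2)) powr (- 1)"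
      using ev
    proof eventually_elim
      case (elim k)
      show ?case using nsa_process.wsum1[OF proc1[OF elim], of "(Suc k)\<^sup>2"] unfolding W_def vk_def xk_def .
    qed
  qed
  have W4_lim: "(\<lambda>k. (real (Suc k) powr b) ^ 4 * W 4 k) \<longlonglongrightarrow> 0"
  proof (rule weight_fourth_limit)
    show "\<forall>\<^sub>F k in sequentially. 0 \<le> W 4 k \<and> W 4 k \<le> nsa_process.D4 \<alpha> C g b a * real (Suc ((Suc k)\<^sup>2)) powr (- (3 * b))"
      using ev
    proof eventually_elim
      case (elim k)
      show ?case using nsa_process.wsum4[OF proc1[OF elim], of "(Suc k)\<^sup>2"] unfolding W_def by blast
    qed
  qed (use b in simp)
  define Q where "Q u k = (fst u * real (Suc k) powr b)\<^sup>2 * W 2 k * \<sigma>H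
      - 2 * (fst u * real (Suc k) powr b) * (snd u / real (Suc k)) * W 1 k * ch k
      + real ((Suc k)\<^sup>2) * (snd u / real (Suc k))\<^sup>2 * sJ k" for u :: "real \<times> real" and k
  define Q0 where "Q0 u = (fst u)\<^sup>2 * (kk v0 * \<sigma>H) - 2 * fst u * snd u * ((if b = 1 then 1 / v0 else 0) * ch0) + (snd u)\<^sup>2 * sJ0" for u :: "real \<times> real"
  have Q_lim: "Q u \<longlonglongrightarrow> Q0 u" for u
  proof -
    have "Q u k = (fst u)\<^sup>2 * ((real (Suc k) powr b)\<^sup>2 * W 2 k * \<sigma>H)
        - 2 * fst u * snd u * (real (Suc k) powr b / real (Suc k) * W 1 k * ch k) + (snd u)\<^sup>2 * sJ k" for k
      unfolding Q_def by (simp add: power_mult_distrib power_divide del: of_nat_Suc)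
    moreover have "(\<lambda>k. (fst u)\<^sup>2 * ((real (Suc k) powr b)\<^sup>2 * W 2 k * \<sigma>H)
        - 2 * fst u * snd u * (real (Suc k) powr b / real (Suc k) * W 1 k * ch k) + (snd u)\<^sup>2 * sJ k) \<longlonglongrightarrow> Q0 u"
      unfolding Q0_def
      by (intro tendsto_add tendsto_diff tendsto_mult_left tendsto_mult_right[OF W2_lim] tendsto_mult[OF W1_lim ch_lim] sJ_lim)
    ultimately have "(\<lambda>k. Q u k) \<longlonglongrightarrow> Q0 u" by (simp only:)
    then show ?thesis .
  qed
  have Q_nonneg: "0 \<le> Q u k" if "k \<ge> k0" for u k
    using nsa_process.lead_char_bound(1)[OF proc1[OF that] m iJ[OF that, unfolded J_def], of u "Suc k"]
    unfolding ech[OF that] esJ[OF that, unfolded J_def] \<sigma>H_def[symmetric] W_def[symmetric] Q_def[symmetric] .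
  have Q0_nonneg: "0 \<le> Q0 u" for u
    by (rule LIMSEQ_le_const[OF Q_lim]) (use Q_nonneg in blast)
  have char_lim: "(\<lambda>k. CLINT \<omega>|M k. cis (u \<bullet> S k \<omega>)) \<longlonglongrightarrow> complex_of_real (exp (- Q0 u / 2))" for u
  proof -
    let ?err = "\<lambda>k. 8 * ((fst u * real (Suc k) powr b / (1 - \<alpha>))\<^sup>2 * W 2 k * ((fst u * real (Suc k) powr b / (1 - \<alpha>)) ^ 4 * W 4 k) powr ((m - 2) / 4)
             + real ((Suc k)\<^sup>2) * (\<bar>snd u / real (Suc k)\<bar> powr m * mJ k))
        + ((fst u * real (Suc k) powr b) ^ 4 * W 4 k * \<sigma>H\<^sup>2 + real ((Suc k)\<^sup>2) * ((snd u / real (Suc k)) ^ 4 * (sJ k)\<^sup>2))"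
    have bound: "cmod ((CLINT \<omega>|M k. cis (u \<bullet> S k \<omega>)) - complex_of_real (exp (- Q u k / 2))) \<le> ?err k" if "k \<ge> k0" for k
      using nsa_process.lead_char_bound(2)[OF proc1[OF that] m iJ[OF that, unfolded J_def], of u "Suc k"]
      unfolding ech[OF that] esJ[OF that, unfolded J_def] emJ[OF that, unfolded J_def] \<sigma>H_def[symmetric] W_def[symmetric] Q_def[symmetric] S_def[symmetric] .
    have e1: "(\<lambda>k. (fst u * real (Suc k) powr b / (1 - \<alpha>))\<^sup>2 * W 2 k) \<longlonglongrightarrow> (fst u / (1 - \<alpha>))\<^sup>2 * kk v0"
    proof -
      have "(fst u * real (Suc k) powr b / (1 - \<alpha>))\<^sup>2 * W 2 k = (fst u / (1 - \<alpha>))\<^sup>2 * ((real (Suc k) powr b)\<^sup>2 * W 2 k)" for k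
        by (simp add: power_mult_distrib power_divide del: of_nat_Suc)
      then show ?thesis using tendsto_mult_left[OF W2_lim, of "(fst u / (1 - \<alpha>))\<^sup>2"] by (simp only:)
    qed
    have e2: "(\<lambda>k. (fst u * real (Suc k) powr b / (1 - \<alpha>)) ^ 4 * W 4 k) \<longlonglongrightarrow> 0"
    proof -
      have "(fst u * real (Suc k) powr b / (1 - \<alpha>)) ^ 4 * W 4 k = (fst u / (1 - \<alpha>)) ^ 4 * ((real (Suc k) powr b) ^ 4 * W 4 k)" for k
        by (simp add: power_mult_distrib power_divide del: of_nat_Suc)
      then show ?thesis using tendsto_mult_right_zero[OF W4_lim, of "(fst u / (1 - \<alpha>)) ^ 4"] by (simp only:)
    qed
    have e2': "(\<lambda>k. ((fst u * real (Suc k) powr b / (1 - \<alpha>)) ^ 4 * W 4 k) powr ((m - 2) / 4)) \<longlonglongrightarrow> 0"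
    proof (rule tendsto_zero_powrI[OF e2 tendsto_const])
      show "\<forall>\<^sub>F k in sequentially. 0 \<le> (fst u * real (Suc k) powr b / (1 - \<alpha>)) ^ 4 * W 4 k"
        using ev
      proof eventually_elim
        case (elim k)
        show ?case using nsa_process.wsum4(1)[OF proc1[OF elim], of "(Suc k)\<^sup>2"] unfolding W_def by (intro mult_nonneg_nonneg) auto
      qed
    qed (use m in simp)
    have e3: "(\<lambda>k. real ((Suc k)\<^sup>2) * (\<bar>snd u / real (Suc k)\<bar> powr m * mJ k)) \<longlonglongrightarrow> 0"
      by (rule lyapunov_term_limit[OF m(1) mJ])
    have e4: "(\<lambda>k. (fst u * real (Suc k) powr b) ^ 4 * W 4 k * \<sigma>H\<^sup>2) \<longlonglongrightarrow> 0"
    proof -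
      have "(fst u * real (Suc k) powr b) ^ 4 * W 4 k * \<sigma>H\<^sup>2 = ((fst u) ^ 4 * \<sigma>H\<^sup>2) * ((real (Suc k) powr b) ^ 4 * W 4 k)" for k
        by (simp add: power_mult_distrib del: of_nat_Suc)
      then show ?thesis using tendsto_mult_right_zero[OF W4_lim, of "(fst u) ^ 4 * \<sigma>H\<^sup>2"] by (simp only:)
    qed
    have e5: "(\<lambda>k. real ((Suc k)\<^sup>2) * ((snd u / real (Suc k)) ^ 4 * (sJ k)\<^sup>2)) \<longlonglongrightarrow> 0"
    proof -
      have i: "(\<lambda>k. inverse (real (Suc k))) \<longlonglongrightarrow> 0" by (rule LIMSEQ_inverse_real_of_nat)
      have "(\<lambda>k. (snd u) ^ 4 * (sJ k)\<^sup>2 * (inverse (real (Suc k)))\<^sup>2) \<longlonglongrightarrow> (snd u) ^ 4 * sJ0\<^sup>2 * 0\<^sup>2"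
        by (intro tendsto_mult tendsto_power sJ_lim i tendsto_const)
      moreover have "(snd u) ^ 4 * (sJ k)\<^sup>2 * (inverse (real (Suc k)))\<^sup>2 = real ((Suc k)\<^sup>2) * ((snd u / real (Suc k)) ^ 4 * (sJ k)\<^sup>2)" for k
      proof -
        have gen: "s ^ 4 * j\<^sup>2 * (inverse y)\<^sup>2 = y\<^sup>2 * ((s / y) ^ 4 * j\<^sup>2)" if "y \<noteq> 0" for s j y :: real
          using that by (simp add: power_divide power2_eq_square power4_eq_xxxx field_simps)
        show ?thesis unfolding of_nat_power by (rule gen) simp
      qed
      moreover have "(snd u) ^ 4 * sJ0\<^sup>2 * 0\<^sup>2 = 0" by simp
      ultimately show ?thesis by (simp only:)
    qed
    have "?err \<longlonglongrightarrow> 8 * ((fst u / (1 - \<alpha>))\<^sup>2 * kk v0 * 0 + 0) + (0 + 0)"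
      by (intro tendsto_add tendsto_mult_left tendsto_mult[OF e1 e2'] e3 e4 e5)
    then have "?err \<longlonglongrightarrow> 0" by simp
    then have "(\<lambda>k. (CLINT \<omega>|M k. cis (u \<bullet> S k \<omega>)) - complex_of_real (exp (- Q u k / 2))) \<longlonglongrightarrow> 0"
    proof (rule Lim_null_comparison[rotated])
      show "\<forall>\<^sub>F k in sequentially. norm ((CLINT \<omega>|M k. cis (u \<bullet> S k \<omega>)) - complex_of_real (exp (- Q u k / 2))) \<le> ?err k"
        using ev by (rule eventually_mono) (rule bound)
    qed
    moreover have "(\<lambda>k. complex_of_real (exp (- Q u k / 2))) \<longlonglongrightarrow> complex_of_real (exp (- Q0 u / 2))"
      by (intro tendsto_of_real tendsto_exp tendsto_divide tendsto_minus Q_lim tendsto_const) simp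
    ultimately have "(\<lambda>k. (CLINT \<omega>|M k. cis (u \<bullet> S k \<omega>)) - complex_of_real (exp (- Q u k / 2)) + complex_of_real (exp (- Q u k / 2)))
        \<longlonglongrightarrow> 0 + complex_of_real (exp (- Q0 u / 2))" by (rule tendsto_add)
    then show ?thesis by (simp only: diff_add_cancel add_0_left)
  qed
  let ?s11 = "\<alpha> * g / (2 * f0 xs0 - (if b = 1 then (1 - \<alpha>) / g else 0))"
  let ?s12 = "if b = 1 then \<alpha> * (chi_star \<alpha> \<mu>0 - xs0) / f0 xs0 else 0"
  let ?s22 = "(\<integral>x. (max (x - xs0) 0 - P0)\<^sup>2 \<partial>\<mu>0) / (1 - \<alpha>)\<^sup>2"
  have s11: "?s11 = kk v0 * \<sigma>H"
  proof -
    have "2 * v0 - (if b = 1 then 1 / g else 0) = (2 * f0 xs0 - (if b = 1 then (1 - \<alpha>) / g else 0)) / (1 - \<alpha>)"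
    proof -
      have "2 * (x / y) - 1 / g = (2 * x - y / g) / y" if "y \<noteq> 0" for x y :: real using that by (simp add: diff_divide_distrib)
      from this[of "1 - \<alpha>" "f0 xs0"] show ?thesis using lim.alpha by (simp add: v0_def)
    qed
    then show ?thesis unfolding kk_def \<sigma>H_def using lim.alpha by simp
  qed
  have s12: "?s12 = - ((if b = 1 then 1 / v0 else 0) * ch0)"
    unfolding ch0_def \<sigma>H_def v0_def xs0_def P0_def lim.chi_star_eq using lim.alpha by simp
  have s22: "?s22 = sJ0" unfolding sJ0_def by (simp add: power_divide)
  have Q0_eq: "Q0 u = ?s11 * (fst u)\<^sup>2 + 2 * ?s12 * fst u * snd u + ?s22 * (snd u)\<^sup>2" for u
  proof -
    have "x\<^sup>2 * s - 2 * x * y * t + y\<^sup>2 * r = s * x\<^sup>2 + 2 * (- t) * x * y + r * y\<^sup>2" for x y s t r :: real by simp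
    then show ?thesis unfolding Q0_def s11 s12 s22 .
  qed
  have s11p: "0 < ?s11" unfolding s11 kk_def \<sigma>H_def using den0 g lim.alpha by (intro mult_pos_pos divide_pos_pos) auto
  \<comment> \<open>The limit form is nonnegative as a limit of variances. At the point (s12, -s11)
    it equals s11 times the determinant, which gives the condition for the Gaussian law to
    exist.\<close>
  have psd: "?s12\<^sup>2 \<le> ?s11 * ?s22"
  proof -
    have q: "0 \<le> s * x\<^sup>2 + 2 * t * x * y + r * y\<^sup>2 \<Longrightarrow> x = t \<Longrightarrow> y = - s \<Longrightarrow> 0 < s \<Longrightarrow> t\<^sup>2 \<le> s * r" for s t r x y :: real
    proof -
      assume h: "0 \<le> s * x\<^sup>2 + 2 * t * x * y + r * y\<^sup>2" "x = t" "y = - s" "0 < s"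
      then have "0 \<le> s * (s * r - t\<^sup>2)" by (simp add: power2_eq_square algebra_simps)
      then show "t\<^sup>2 \<le> s * r" using h(4) by (simp add: zero_le_mult_iff)
    qed
    show ?thesis by (rule q[OF Q0_nonneg[of "(?s12, - ?s11)", unfolded Q0_eq fst_conv snd_conv] refl refl s11p])
  qed
  obtain N where N: "is_gaussian2 N ?s11 ?s12 ?s22" using exists_gaussian2[OF s11p psd] by blast
  then have Np: "prob_space N" "sets N = sets borel" and Nc: "\<And>u. char2 N u = complex_of_real (exp (- Q0 u / 2))"
    unfolding is_gaussian2_def Q0_eq by auto
  have near: "(\<lambda>k. measure (M k) {\<omega>\<in>space (M k). norm (U k \<omega> - S k \<omega>) > \<tau>}) \<longlonglongrightarrow> 0" if \<tau>: "\<tau> > 0" for \<tau>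
  proof (rule LIMSEQ_I)
    fix e :: real assume e: "e > 0"
    \<comment> \<open>The clamping level depends on \<open>e\<close> but not on k. Outside an event
      of probability at most e/2 the clamped and the original scheme coincide, and there the
      remainder is handled by Markov's inequality.\<close>
    obtain R where R: "R > 0" "\<And>k. measure (M k) {\<omega>\<in>space (M k). \<bar>z k \<omega>\<bar> > R} \<le> e / 2" using tight[of "e / 2"] e by auto
    let ?rb = "nsa_process.rem_bound \<alpha> C g b a (R + D)"
    have rb: "?rb \<longlonglongrightarrow> 0" by (rule nsa_process.rem_bound_tendsto[OF proc[OF order_refl R(1)]])
    have "(\<lambda>k. ?rb (Suc k) / \<tau>) \<longlonglongrightarrow> 0 / \<tau>" by (rule tendsto_divide[OF LIMSEQ_Suc[OF rb] tendsto_const]) (use \<tau> in simp)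
    then have "\<forall>\<^sub>F k in sequentially. ?rb (Suc k) / \<tau> < e / 2" using e by (intro order_tendstoD) auto
    then have "\<forall>\<^sub>F k in sequentially. norm (measure (M k) {\<omega>\<in>space (M k). norm (U k \<omega> - S k \<omega>) > \<tau>} - 0) < e"
      using ev
    proof eventually_elim
      case (elim k)
      interpret pr: nsa_process \<alpha> "\<mu> k" "f k" C "M k" "Y R k" g b a "R + D" by (rule proc[OF elim(2) R(1)])
      interpret p1: nsa_process \<alpha> "\<mu> k" "f k" C "M k" "Y 1 k" g b a "1 + D" by (rule proc1[OF elim(2)])
      have K1: "1 \<le> Suc k" by simp
      have Y1: "Y R k i \<omega> = Y 1 k i \<omega>" if "i \<in> {1..n}" for i n \<omega> using that by (simp add: Y_def)
      have L: "pr.L1 n \<omega> = p1.L1 n \<omega>" for n \<omega>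
        unfolding pr.L1_eq p1.L1_eq by (rule sum.cong[OF refl]) (simp only: Y1)
      have S: "pr.S1 n \<omega> = p1.S1 n \<omega>" for n \<omega>
        unfolding pr.S1_eq p1.S1_eq by (rule sum.cong[OF refl]) (simp only: Y1)
      have lead: "pr.lead (Suc k) \<omega> = S k \<omega>" for \<omega>
        unfolding S_def pr.lead_def p1.lead_def L S by (rule refl)
      have UR: "U k \<omega> = S k \<omega> + pr.rem (Suc k) \<omega>" if "\<bar>z k \<omega>\<bar> \<le> R" for \<omega>
      proof -
        have y0: "Y R k 0 \<omega> = z k \<omega>" using that by (auto simp: Y_def abs_le_iff)
        have c: "nsa \<alpha> pr.\<gamma> (z k \<omega>) (\<lambda>i. Y R k i \<omega>) n = nsa \<alpha> pr.\<gamma> (z k \<omega>) (\<lambda>i. X k i \<omega>) n" for n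
          by (rule nsa_cong) (simp only: Y_def nat.distinct if_False)
        have "pr.\<gamma> = (\<lambda>n. g * real n powr (- b))" by (rule ext) (rule pr.\<gamma>_def)
        then show ?thesis using pr.nsa_eq_lead_plus_rem[OF K1, of \<omega>, unfolded y0 c lead]
          unfolding U_def Let_def xk_def by (simp only:)
      qed
      let ?A = "{\<omega>\<in>space (M k). norm (pr.rem (Suc k) \<omega>) \<ge> \<tau>}" and ?B = "{\<omega>\<in>space (M k). \<bar>z k \<omega>\<bar> > R}"
      have sub: "{\<omega>\<in>space (M k). norm (U k \<omega> - S k \<omega>) > \<tau>} \<subseteq> ?A \<union> ?B"
      proof (rule subsetI)
        fix \<omega> assume w: "\<omega> \<in> {\<omega>\<in>space (M k). norm (U k \<omega> - S k \<omega>) > \<tau>}"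
        show "\<omega> \<in> ?A \<union> ?B"
        proof (cases "\<bar>z k \<omega>\<bar> \<le> R")
          case True
          have "U k \<omega> - S k \<omega> = pr.rem (Suc k) \<omega>" unfolding UR[OF True] by simp
          then show ?thesis using w by auto
        next
          case False
          then show ?thesis using w by auto
        qed
      qed
      have Am: "?A \<in> sets (M k)" 
        by (rule borel_measurable_le[OF borel_measurable_const borel_measurable_integrable[OF pr.expectation_rem(1)[OF K1]]])
      have Bm: "?B \<in> sets (M k)" 
        by (rule borel_measurable_less[OF borel_measurable_const borel_measurable_abs[OF rv(1)]])
      have "measure (M k) {\<omega>\<in>space (M k). norm (U k \<omega> - S k \<omega>) > \<tau>} \<le> measure (M k) (?A \<union> ?B)"
        by (rule pr.finite_measure_mono[OF sub sets.Un[OF Am Bm]])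
      also have "\<dots> \<le> measure (M k) ?A + measure (M k) ?B" using Am Bm by (rule measure_Un_le)
      also have "measure (M k) ?A \<le> (\<integral>\<omega>. norm (pr.rem (Suc k) \<omega>) \<partial>M k) / \<tau>"
        by (rule integral_Markov_inequality_measure[where A="{}"]) (rule pr.expectation_rem(1)[OF K1], simp_all add: \<tau>)
      also have "\<dots> \<le> ?rb (Suc k) / \<tau>" 
        using pr.expectation_rem(2)[OF K1] less_imp_le[OF \<tau>] by (rule divide_right_mono)
      finally show ?case using R(2)[of k] elim(1) unfolding diff_0_right real_norm_def abs_of_nonneg[OF measure_nonneg] by linarith
    qed
    then show "\<exists>no. \<forall>k\<ge>no. norm (measure (M k) {\<omega>\<in>space (M k). norm (U k \<omega> - S k \<omega>) > \<tau>} - 0) < e"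
      by (simp add: eventually_sequentially)
  qed
  have Um: "U k \<in> borel_measurable (M k)" for k
  proof -
    note n = nsa_measurable[of "z k" "M k" "X k", OF rv, of \<alpha> "\<lambda>n. g * real n powr (- b)" "(Suc k)\<^sup>2"]
    show ?thesis unfolding U_def Let_def
      by (intro borel_measurable_Pair borel_measurable_times borel_measurable_diff borel_measurable_const conjunct1[OF n] conjunct2[OF n])
  qed
  have Sm: "S k \<in> borel_measurable (M k)" and Si: "integrable (M k) (\<lambda>\<omega>. (norm (S k \<omega>))\<^sup>2)"
    and Se: "(\<integral>\<omega>. (norm (S k \<omega>))\<^sup>2 \<partial>M k) \<le> \<sigma>H * ((real (Suc k) powr b)\<^sup>2 * W 2 k) + sJ k" if k: "k \<ge> k0" for k
  proof -
    interpret p1: nsa_process \<alpha> "\<mu> k" "f k" C "M k" "Y 1 k" g b a "1 + D" by (rule proc1[OF k])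
    note S1 = p1.S1_square[OF i2J[OF k, unfolded J_def]]
    show "S k \<in> borel_measurable (M k)" unfolding S_def p1.lead_def[abs_def]
      by (intro borel_measurable_Pair borel_measurable_times borel_measurable_divide borel_measurable_const p1.L1_square(2) S1(2))
    have e: "(norm (S k \<omega>))\<^sup>2 = (real (Suc k) powr b)\<^sup>2 * (p1.L1 ((Suc k)\<^sup>2) \<omega>)\<^sup>2 + (p1.S1 ((Suc k)\<^sup>2) \<omega>)\<^sup>2 / (real (Suc k))\<^sup>2" for \<omega>
      unfolding S_def p1.lead_def by (simp add: norm_Pair power_mult_distrib power_divide del: of_nat_Suc)
    show "integrable (M k) (\<lambda>\<omega>. (norm (S k \<omega>))\<^sup>2)" unfolding e using p1.L1_square(1) S1(1) by (intro Bochner_Integration.integrable_add integrable_mult_right integrable_divide)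
    have "(\<integral>\<omega>. (norm (S k \<omega>))\<^sup>2 \<partial>M k) = (real (Suc k) powr b)\<^sup>2 * (\<integral>\<omega>. (p1.L1 ((Suc k)\<^sup>2) \<omega>)\<^sup>2 \<partial>M k)
        + (\<integral>\<omega>. (p1.S1 ((Suc k)\<^sup>2) \<omega>)\<^sup>2 \<partial>M k) / (real (Suc k))\<^sup>2"
      unfolding e using p1.L1_square(1) S1(1) by (subst Bochner_Integration.integral_add) auto
    also have "\<dots> \<le> \<sigma>H * ((real (Suc k) powr b)\<^sup>2 * W 2 k) + sJ k"
    proof (rule add_mono)
      show "(real (Suc k) powr b)\<^sup>2 * (\<integral>\<omega>. (p1.L1 ((Suc k)\<^sup>2) \<omega>)\<^sup>2 \<partial>M k) \<le> \<sigma>H * ((real (Suc k) powr b)\<^sup>2 * W 2 k)"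
        unfolding mult.left_commute[of \<sigma>H] unfolding \<sigma>H_def W_def by (intro mult_left_mono p1.L1_square(3)) auto
      show "(\<integral>\<omega>. (p1.S1 ((Suc k)\<^sup>2) \<omega>)\<^sup>2 \<partial>M k) / (real (Suc k))\<^sup>2 \<le> sJ k"
        unfolding S1(3) esJ[OF k, unfolded J_def] by (simp del: of_nat_Suc)
    qed
    finally show "(\<integral>\<omega>. (norm (S k \<omega>))\<^sup>2 \<partial>M k) \<le> \<sigma>H * ((real (Suc k) powr b)\<^sup>2 * W 2 k) + sJ k" .
  qed
  have "(\<lambda>k. \<sigma>H * ((real (Suc k) powr b)\<^sup>2 * W 2 k) + sJ k) \<longlonglongrightarrow> \<sigma>H * kk v0 + sJ0"
    by (intro tendsto_add tendsto_mult_left W2_lim sJ_lim)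
  then have "Bseq (\<lambda>k. \<sigma>H * ((real (Suc k) powr b)\<^sup>2 * W 2 k) + sJ k)" by (intro convergent_imp_Bseq convergentI)
  then obtain Cb where Cb: "\<And>k. \<bar>\<sigma>H * ((real (Suc k) powr b)\<^sup>2 * W 2 k) + sJ k\<bar> \<le> Cb" by (auto simp: Bseq_def)
  have "(\<lambda>k. \<integral>\<omega>. G (U k \<omega>) \<partial>M k) \<longlonglongrightarrow> (\<integral>x. G x \<partial>N)" if G: "continuous_on UNIV G" "bounded (range G)" for G :: "real \<times> real \<Rightarrow> real"
  \<comment> \<open>Indices below \<open>k0\<close>, where \<open>a \<le> vk k\<close> is not
    guaranteed, are dropped.\<close>
  proof (rule LIMSEQ_offset[where k=k0])
    obtain B where B: "\<And>x. \<bar>G x\<bar> \<le> B" using G(2) by (auto simp: bounded_iff)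
    show "(\<lambda>j. \<integral>\<omega>. G (U (j + k0) \<omega>) \<partial>M (j + k0)) \<longlonglongrightarrow> (\<integral>x. G x \<partial>N)"
    proof (rule weak_convergence_from_char2[where S="\<lambda>j. S (j + k0)" and C=Cb, OF Mp Um _ Np])
      show "S (j + k0) \<in> borel_measurable (M (j + k0))" for j by (rule Sm) simp
      show "(\<lambda>j. CLINT \<omega>|M (j + k0). cis (u \<bullet> S (j + k0) \<omega>)) \<longlonglongrightarrow> char2 N u" for u
        unfolding Nc by (rule LIMSEQ_ignore_initial_segment[OF char_lim])
      show "integrable (M (j + k0)) (\<lambda>\<omega>. (norm (S (j + k0) \<omega>))\<^sup>2)" for j by (rule Si) simp
      show "(\<integral>\<omega>. (norm (S (j + k0) \<omega>))\<^sup>2 \<partial>M (j + k0)) \<le> Cb" for j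
        using Se[of "j + k0"] abs_le_D1[OF Cb[of "j + k0"]] by simp
      show "(\<lambda>j. measure (M (j + k0)) {\<omega>\<in>space (M (j + k0)). norm (U (j + k0) \<omega> - S (j + k0) \<omega>) > \<tau>}) \<longlonglongrightarrow> 0" if "\<tau> > 0" for \<tau>
        by (rule LIMSEQ_ignore_initial_segment[OF near[OF that]])
    qed (rule G(1), rule B)
  qed
  then show ?thesis using N by blast
qed

end

subsection \<open>Passage to the nested averages\<close>

lemma Hset_Suc: "1 / real (Suc k) \<in> Hset"
  unfolding Hset_def by (intro CollectI exI[of _ "Suc k"]) simp

lemma filterlim_Hset_Suc: "filterlim (\<lambda>k. 1 / real (Suc k)) (at 0 within Hset) sequentially"
proof -
  have "(\<lambda>k. 1 / real (Suc k)) \<longlonglongrightarrow> 0"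
    using LIMSEQ_inverse_real_of_nat by (simp only: inverse_eq_divide)
  then show ?thesis unfolding filterlim_at using Hset_Suc by (auto simp del: of_nat_Suc)
qed

text \<open>Near 0 the set \<open>Hset\<close> is the sequence 1/(k+1): its points closer to 0 than
  1/(n+1) are those with k > n. So a limit within it is a sequential limit.\<close>

lemma tendsto_within_Hset:
  fixes E :: "real \<Rightarrow> 'a::metric_space"
  assumes "(\<lambda>k. E (1 / real (Suc k))) \<longlonglongrightarrow> L"
  shows "(E \<longlongrightarrow> L) (at 0 within Hset)"
proof (rule tendstoI)
  fix e :: real assume "e > 0"
  with assms obtain n where n: "\<And>k. k \<ge> n \<Longrightarrow> dist (E (1 / real (Suc k))) L < e"
    by (meson lim_sequentially)
  show "\<forall>\<^sub>F h in at 0 within Hset. dist (E h) L < e"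
    unfolding eventually_at
  proof (intro exI[of _ "1 / real (Suc n)"] conjI ballI impI)
    fix h assume "h \<in> Hset" and h: "h \<noteq> 0 \<and> dist h 0 < 1 / real (Suc n)"
    then obtain K where K: "h = 1 / real K" "K \<ge> 1" by (auto simp: Hset_def)
    then obtain k where k: "K = Suc k" by (cases K) auto
    have "1 / real (Suc k) < 1 / real (Suc n)" using h K(1) unfolding k by (simp add: dist_real_def)
    then have "n < k" by (simp add: field_simps)
    then show "dist (E h) L < e" using n[of k] unfolding K(1) k by simp
  qed simp
qed

section \<open>From the assumptions of the theorem to sequences of laws\<close>

lemma lipschitz_law_of_density:
  assumes "0 < \<alpha>" "\<alpha> < 1" and mu: "\<mu> = density lborel (\<lambda>x. ennreal (f x))" and prob: "prob_space \<mu>"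
    and cont: "continuous_on UNIV f" and nn: "\<And>x. 0 \<le> f x"
    and C: "\<And>x y. \<bar>f x\<bar> \<le> C \<and> \<bar>f x - f y\<bar> \<le> C * \<bar>x - y\<bar>"
    and m: "2 < m" "0 \<le> B" "(\<integral>\<^sup>+x. ennreal ((1 + \<bar>x\<bar> powr m) * f x) \<partial>lborel) \<le> ennreal B"
  shows "lipschitz_law \<alpha> \<mu> f C"
proof -
  have fm: "f \<in> borel_measurable borel" using cont by (rule borel_measurable_continuous_onI)
  have "integrable lborel (\<lambda>x. x * f x)"
    by (rule weighted_density_integral(1)[OF m(1) fm nn m(3,2), of _ 1]) (use abs_le_square_plus_one in auto)
  then have "integrable \<mu> (\<lambda>x. x)" unfolding mu using fm nn by (subst integrable_density) (auto simp: mult.commute)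
  then show ?thesis
    by (rule lipschitz_law.intro[OF assms(1,2) mu prob fm nn order_trans[OF abs_ge_self conjunct1[OF C]] conjunct2[OF C]])
qed

lemma supnorm_bounds:
  assumes "\<And>x. \<bar>g x\<bar> \<le> C"
  shows "0 \<le> supnorm g" "supnorm g \<le> C"
proof -
  have bdd: "bdd_above (range (\<lambda>x. \<bar>g x\<bar>))" using assms by (auto intro!: bdd_aboveI)
  have "0 \<le> \<bar>g 0\<bar>" by simp
  also have "\<dots> \<le> supnorm g" unfolding supnorm_def by (rule cSUP_upper[OF UNIV_I bdd])
  finally show "0 \<le> supnorm g" .
  show "supnorm g \<le> C" unfolding supnorm_def by (rule cSUP_least) (auto simp: assms)
qed

text \<open>The infimum is compared with the first entry of the minimum at h = 0. For a real infimum
  this requires the family to be bounded below, hence the sign check of all entries.\<close>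

lemma lambda_const_le:
  assumes \<alpha>: "\<alpha> < 1" and C: "\<And>h x. h \<in> Hset \<union> {0} \<Longrightarrow> \<bar>f h x\<bar> \<le> C" and nn: "\<And>h x. h \<in> Hset \<union> {0} \<Longrightarrow> 0 \<le> f h x"
  shows "lambda_const \<alpha> f xs \<le> 3 / 8 * (f 0 (xs 0) / (1 - \<alpha>))"
proof -
  let ?T = "\<lambda>h. let V2 = (\<lambda>x. f h x / (1 - \<alpha>)) in
        min (3 / 8 * V2 (xs h)) (supnorm V2 * V2 (xs h) ^ 4 / (4 * (lipconst V2)\<^sup>2))"
  have "0 \<le> ?T h" if "h \<in> Hset \<union> {0}" for h
  proof -
    have "\<bar>f h x / (1 - \<alpha>)\<bar> \<le> C / (1 - \<alpha>)" for x using C[OF that] \<alpha> by (simp add: abs_divide divide_right_mono)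
    then have "0 \<le> supnorm (\<lambda>x. f h x / (1 - \<alpha>))" by (rule supnorm_bounds(1))
    then show ?thesis using nn[OF that, of "xs h"] \<alpha> unfolding Let_def
      by (intro min.boundedI mult_nonneg_nonneg divide_nonneg_nonneg zero_le_power2 zero_le_power) auto
  qed
  then have "bdd_below (?T ` (Hset \<union> {0}))" by (intro bdd_belowI[of _ 0]) blast
  then have "lambda_const \<alpha> f xs \<le> ?T 0" unfolding lambda_const_def by (rule cINF_lower) simp
  also have "\<dots> \<le> 3 / 8 * (f 0 (xs 0) / (1 - \<alpha>))" unfolding Let_def by (rule min.cobounded1)
  finally show ?thesis .
qed

lemma (in prob_space) nn_integral_one_plus:
  assumes X: "X \<in> borel_measurable M" and nn: "\<And>\<omega>. 0 \<le> X \<omega>"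
  shows "(\<integral>\<^sup>+\<omega>. ennreal (1 + X \<omega>) \<partial>M) = 1 + (\<integral>\<^sup>+\<omega>. ennreal (X \<omega>) \<partial>M)"
proof -
  have "(\<integral>\<^sup>+\<omega>. ennreal (1 + X \<omega>) \<partial>M) = (\<integral>\<^sup>+\<omega>. 1 + ennreal (X \<omega>) \<partial>M)"
    by (intro nn_integral_cong) (simp only: ennreal_plus[OF zero_le_one nn] ennreal_1)
  also have "\<dots> = (\<integral>\<^sup>+\<omega>. 1 \<partial>M) + (\<integral>\<^sup>+\<omega>. ennreal (X \<omega>) \<partial>M)"
    by (rule nn_integral_add) (use X in auto)
  also have "(\<integral>\<^sup>+\<omega>. 1 \<partial>M) = 1" by (simp only: nn_integral_const emeasure_space_1 mult_1_right)
  finally show ?thesis .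
qed

lemma density_moment_eq:
  assumes P: "prob_space \<mu>" and mu: "\<mu> = density lborel (\<lambda>x. ennreal (f x))"
    and f: "f \<in> borel_measurable borel" and nn: "\<And>x. 0 \<le> f x"
  shows "(\<integral>\<^sup>+x. ennreal ((1 + \<bar>x\<bar> powr m) * f x) \<partial>lborel) = 1 + (\<integral>\<^sup>+x. ennreal (\<bar>x\<bar> powr m) \<partial>\<mu>)"
proof -
  interpret prob_space \<mu> by (rule P)
  have "(\<integral>\<^sup>+x. ennreal ((1 + \<bar>x\<bar> powr m) * f x) \<partial>lborel) = (\<integral>\<^sup>+x. ennreal (f x) * ennreal (1 + \<bar>x\<bar> powr m) \<partial>lborel)"
    by (intro nn_integral_cong) (simp add: ennreal_mult'' nn mult.commute)
  also have "\<dots> = (\<integral>\<^sup>+x. ennreal (1 + \<bar>x\<bar> powr m) \<partial>density lborel (\<lambda>x. ennreal (f x)))"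
    using f by (subst nn_integral_density) auto
  also have "\<dots> = (\<integral>\<^sup>+x. ennreal (1 + \<bar>x\<bar> powr m) \<partial>\<mu>)" by (simp only: mu)
  also have "\<dots> = 1 + (\<integral>\<^sup>+x. ennreal (\<bar>x\<bar> powr m) \<partial>\<mu>)"
  proof (rule nn_integral_one_plus)
    have "(\<lambda>x. \<bar>x\<bar> powr m) \<in> borel_measurable (density lborel (\<lambda>x. ennreal (f x)))" by measurable
    then show "(\<lambda>x. \<bar>x\<bar> powr m) \<in> borel_measurable \<mu>" by (simp only: mu)
  qed (rule powr_ge_zero)
  finally show ?thesis .
qed

lemma powr_le_one_plus_powr:
  fixes x m p :: real
  assumes "0 \<le> x" "0 \<le> m" "m \<le> p"
  shows "x powr m \<le> 1 + x powr p"
proof (cases "x \<le> 1")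
  case True
  then have "x powr m \<le> 1 powr m" using assms by (intro powr_mono2) auto
  moreover have "0 \<le> x powr p" by (rule powr_ge_zero)
  ultimately show ?thesis unfolding powr_one_eq_one by linarith
next
  case False
  then have "x powr m \<le> x powr p" using assms by (intro powr_mono) auto
  then show ?thesis by linarith
qed

text \<open>The exponential factor is at least 1, so the weighted moment dominates the second moment
  and Chebyshev's inequality applies.\<close>

lemma tail_bound_from_square:
  assumes P: "prob_space P" and X: "X \<in> borel_measurable P" and k: "0 \<le> (k::real)"
    and le: "(\<integral>\<^sup>+\<omega>. ennreal ((X \<omega>)\<^sup>2 * exp (k * \<bar>X \<omega>\<bar>)) \<partial>P) \<le> ennreal B" and B: "0 \<le> B" and R: "0 < R"
  shows "measure P {\<omega>\<in>space P. \<bar>X \<omega>\<bar> > R} \<le> B / R\<^sup>2"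
proof -
  interpret prob_space P by fact
  let ?A = "{\<omega>\<in>space P. \<bar>X \<omega>\<bar> > R}"
  have A: "?A \<in> sets P" using X by measurable
  have "ennreal (R\<^sup>2) * emeasure P ?A = (\<integral>\<^sup>+\<omega>. ennreal (R\<^sup>2) * indicator ?A \<omega> \<partial>P)"
    using A by (simp add: nn_integral_cmult_indicator)
  also have "\<dots> \<le> (\<integral>\<^sup>+\<omega>. ennreal ((X \<omega>)\<^sup>2 * exp (k * \<bar>X \<omega>\<bar>)) \<partial>P)"
  proof (rule nn_integral_mono)
    fix \<omega> assume "\<omega> \<in> space P"
    have "R\<^sup>2 \<le> (X \<omega>)\<^sup>2 * exp (k * \<bar>X \<omega>\<bar>)" if "\<bar>X \<omega>\<bar> > R"
    proof -
      have "R\<^sup>2 \<le> \<bar>X \<omega>\<bar>\<^sup>2" using that R by (intro power_mono) auto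
      moreover have "1 \<le> exp (k * \<bar>X \<omega>\<bar>)" using k by simp
      ultimately show ?thesis using mult_mono[of "R\<^sup>2" "(X \<omega>)\<^sup>2" 1 "exp (k * \<bar>X \<omega>\<bar>)"] by simp
    qed
    then show "ennreal (R\<^sup>2) * indicator ?A \<omega> \<le> ennreal ((X \<omega>)\<^sup>2 * exp (k * \<bar>X \<omega>\<bar>))"
      by (auto simp: indicator_def intro!: ennreal_leI)
  qed
  also have "\<dots> \<le> ennreal B" by (rule le)
  finally have "ennreal (R\<^sup>2 * measure P ?A) \<le> ennreal B" by (simp add: emeasure_eq_measure ennreal_mult)
  then have "R\<^sup>2 * measure P ?A \<le> B" using B by (simp add: ennreal_le_iff)
  then show ?thesis using R by (simp add: pos_le_divide_eq mult.commute)
qed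

text \<open>The spaces \<open>M h\<close> differ, so convergence in law is expressed by expectations
  of bounded continuous functions. The Gaussian law is described by its characteristic function, a
  form that also admits a singular covariance matrix.\<close>

theorem mainTheorem1:
  fixes \<alpha> \<delta> \<gamma>1 \<beta> :: real
    and PY :: "'d::euclidean_space measure" and PZ :: "'q::euclidean_space measure"
    and \<phi> :: "'d \<Rightarrow> 'q \<Rightarrow> real"
    and f :: "real \<Rightarrow> real \<Rightarrow> real"
    and M :: "real \<Rightarrow> 'w measure"
    and Xs :: "real \<Rightarrow> nat \<Rightarrow> 'w \<Rightarrow> real"
    and \<xi>0 :: "real \<Rightarrow> 'w \<Rightarrow> real"
  assumes alpha: "0 < \<alpha>" "\<alpha> < 1"
    and PY: "prob_space PY" "sets PY = sets borel"
    and PZ: "prob_space PZ" "sets PZ = sets borel"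
    and phi_meas: "(\<lambda>(y, z). \<phi> y z) \<in> borel_measurable (PY \<Otimes>\<^sub>M PZ)"
    and phi_L1: "integrable (PY \<Otimes>\<^sub>M PZ) (\<lambda>(y, z). \<phi> y z)"
    and delta: "\<delta> > 0"
    and phi_moment: "(\<integral>\<^sup>+ p. ennreal (\<bar>\<phi> (fst p) (snd p)\<bar> powr (2 + \<delta>)) \<partial>(PY \<Otimes>\<^sub>M PZ)) < \<infinity>"
    \<comment> \<open>Assumption A (i)\<close>
    and A1: "\<exists>v w. (\<forall>h\<in>Hset. \<forall>\<xi>.
                 measure (lawX PY PZ \<phi> h) {..\<xi>} - measure (lawX PY PZ \<phi> 0) {..\<xi>}
                   = v \<xi> * h + w \<xi> h * h)
             \<and> (\<forall>m. is_minimizer (Vfun \<alpha> (lawX PY PZ \<phi> 0)) m \<longrightarrow>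
                  set_integrable lborel {m..} v
                  \<and> ((\<lambda>h. w m h) \<longlongrightarrow> 0) (at 0 within Hset)
                  \<and> ((\<lambda>h. LBINT \<xi>:{m..}. w \<xi> h) \<longlongrightarrow> 0) (at 0 within Hset))"
    \<comment> \<open>Assumption A (ii)\<close>
    and A2_pdf: "\<forall>h\<in>Hset \<union> {0}. continuous_on UNIV (f h) \<and> (\<forall>x. 0 \<le> f h x)
                   \<and> lawX PY PZ \<phi> h = density lborel (\<lambda>x. ennreal (f h x))"
    and A2_conv: "\<forall>C. compact C \<longrightarrow> uniform_limit C (\<lambda>h x. f h x) (f 0) (at 0 within Hset)"
    \<comment> \<open>Assumption A (iii)\<close>
    and A3: "\<forall>m. is_minimizer (Vfun \<alpha> (lawX PY PZ \<phi> 0)) m \<longrightarrow>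
               (\<forall>R>0. \<exists>c>0. \<forall>h\<in>Hset \<union> {0}. \<forall>\<xi>\<in>ball m R. c \<le> f h \<xi>)"
    \<comment> \<open>Assumption A (iv)\<close>
    and A4: "\<exists>C. \<forall>h\<in>Hset \<union> {0}. \<forall>x y. \<bar>f h x\<bar> \<le> C \<and> \<bar>f h x - f h y\<bar> \<le> C * \<bar>x - y\<bar>"
    \<comment> \<open>the NSA setting: for each h in H, X_h^(n), n >= 1, i.i.d. copies of X_h, xi_0^h independent\<close>
    and Msp: "\<forall>h\<in>Hset. prob_space (M h)
               \<and> prob_space.indep_vars (M h) (\<lambda>_. borel) (\<lambda>n. if n = 0 then \<xi>0 h else Xs h n) UNIV
               \<and> (\<forall>n\<ge>1. distr (M h) borel (Xs h n) = lawX PY PZ \<phi> h)"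
    \<comment> \<open>Assumption B\<close>
    and B: "(SUP h\<in>Hset. \<integral>\<^sup>+ \<omega>. ennreal ((\<xi>0 h \<omega>)\<^sup>2 *
               exp (4 / (1 - \<alpha>) * max 1 (\<alpha> / (1 - \<alpha>)) * (SUP h'\<in>Hset. supnorm (f h')) * \<bar>\<xi>0 h \<omega>\<bar>))
             \<partial>M h) < \<infinity>"
    \<comment> \<open>step sizes\<close>
    and gamma1: "\<gamma>1 > 0"
    and beta: "1 / 2 < \<beta>" "\<beta> \<le> 1"
    and beta1: "\<beta> = 1 \<longrightarrow> lambda_const \<alpha> f (\<lambda>h. xi_star \<alpha> (lawX PY PZ \<phi> h)) * \<gamma>1 > 1"
  shows "\<exists>N. is_gaussian2 N
            (\<alpha> * \<gamma>1 / (2 * f 0 (xi_star \<alpha> (lawX PY PZ \<phi> 0))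
                         - (if \<beta> = 1 then (1 - \<alpha>) / \<gamma>1 else 0)))
            (if \<beta> = 1 then \<alpha> * (chi_star \<alpha> (lawX PY PZ \<phi> 0) - xi_star \<alpha> (lawX PY PZ \<phi> 0))
                            / f 0 (xi_star \<alpha> (lawX PY PZ \<phi> 0)) else 0)
            ((\<integral>x. (max (x - xi_star \<alpha> (lawX PY PZ \<phi> 0)) 0
                     - (\<integral>y. max (y - xi_star \<alpha> (lawX PY PZ \<phi> 0)) 0 \<partial>lawX PY PZ \<phi> 0))\<^sup>2
                 \<partial>lawX PY PZ \<phi> 0) / (1 - \<alpha>)\<^sup>2)
        \<and> conv_in_law2 M
            (\<lambda>h \<omega>. let p = nsa \<alpha> (\<lambda>n. \<gamma>1 * real n powr (- \<beta>)) (\<xi>0 h \<omega>) (\<lambda>n. Xs h n \<omega>)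
                              (nat \<lceil>1 / h\<^sup>2\<rceil>) in
               (h powr (- \<beta>) * (fst p - xi_star \<alpha> (lawX PY PZ \<phi> h)),
                1 / h * (snd p - chi_star \<alpha> (lawX PY PZ \<phi> h))))
            N (at 0 within Hset)"
proof -
  define \<mu> where "\<mu> h = lawX PY PZ \<phi> h" for h
  define hk where "hk k = 1 / real (Suc k)" for k
  have hk: "hk k \<in> Hset" for k unfolding hk_def by (rule Hset_Suc)
  \<comment> \<open>The moment order is cut at 3, the range in which
    \<open>min_square_cube_le_powr\<close> interpolates.\<close>
  define m where "m = 2 + min \<delta> 1"
  have m: "2 < m" "m \<le> 3" "m \<le> 2 + \<delta>" using delta by (auto simp: m_def)
  obtain C where C: "\<And>h x y. h \<in> Hset \<union> {0} \<Longrightarrow> \<bar>f h x\<bar> \<le> C \<and> \<bar>f h x - f h y\<bar> \<le> C * \<bar>x - y\<bar>" using A4 by blast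
  have fc: "continuous_on UNIV (f h)" and fnn: "0 \<le> f h x" and dens: "\<mu> h = density lborel (\<lambda>x. ennreal (f h x))"
    if "h \<in> Hset \<union> {0}" for h x using A2_pdf that unfolding \<mu>_def by auto
  have flim: "(\<lambda>k. f (hk k) x) \<longlonglongrightarrow> f 0 x" for x
  proof -
    have "((\<lambda>h. f h x) \<longlongrightarrow> f 0 x) (at 0 within Hset)" using A2_conv[rule_format, of "{x}"] by simp
    from filterlim_compose[OF this filterlim_Hset_Suc] show ?thesis unfolding hk_def .
  qed
  have law: "\<mu> (hk k) = lawXK PY PZ \<phi> (Suc k)" for k
    unfolding \<mu>_def lawX_def hk_def Kof_def by (simp del: of_nat_Suc)
  have prob_k: "prob_space (\<mu> (hk k))" for k
    unfolding law by (rule nn_integral_powr_lawXK_le(1)[OF PY(1) PZ(1) phi_meas, of 1]) auto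
  have prob_0: "prob_space (\<mu> 0)"
  proof -
    interpret Y: prob_space PY by fact
    interpret Z: prob_space PZ by fact
    have "(\<lambda>y. \<integral>z. \<phi> y z \<partial>PZ) \<in> borel_measurable PY" by (rule Z.borel_measurable_lebesgue_integral[OF phi_meas])
    then show ?thesis unfolding \<mu>_def lawX_def lawX0_def by (simp add: Y.prob_space_distr)
  qed
  let ?I = "\<integral>\<^sup>+ p. ennreal (\<bar>\<phi> (fst p) (snd p)\<bar> powr m) \<partial>(PY \<Otimes>\<^sub>M PZ)"
  have I: "?I < \<infinity>"
  proof -
    interpret Y: prob_space PY by fact
    interpret Z: prob_space PZ by fact
    interpret YZ: pair_prob_space PY PZ ..
    have pm: "(\<lambda>p. \<phi> (fst p) (snd p)) \<in> borel_measurable (PY \<Otimes>\<^sub>M PZ)" using phi_meas by (simp add: case_prod_beta')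
    have "?I \<le> (\<integral>\<^sup>+ p. ennreal (1 + \<bar>\<phi> (fst p) (snd p)\<bar> powr (2 + \<delta>)) \<partial>(PY \<Otimes>\<^sub>M PZ))"
    proof (rule nn_integral_mono, rule ennreal_leI)
      show "\<bar>\<phi> (fst p) (snd p)\<bar> powr m \<le> 1 + \<bar>\<phi> (fst p) (snd p)\<bar> powr (2 + \<delta>)" for p
        by (rule powr_le_one_plus_powr) (use m in auto)
    qed
    also have "\<dots> = 1 + (\<integral>\<^sup>+ p. ennreal (\<bar>\<phi> (fst p) (snd p)\<bar> powr (2 + \<delta>)) \<partial>(PY \<Otimes>\<^sub>M PZ))"
      by (rule YZ.nn_integral_one_plus[OF powr_real_measurable[OF borel_measurable_abs[OF pm] borel_measurable_const]]) (rule powr_ge_zero)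
    also have "\<dots> < \<infinity>" using phi_moment by (simp add: ennreal_add_less_top)
    finally show ?thesis .
  qed
  \<comment> \<open>The summand 1 is the total mass, belonging to the weight
    \<open>1 + \<bar>x\<bar> powr m\<close>.\<close>
  define B0 where "B0 = 1 + enn2real ?I"
  have B0: "0 \<le> B0" by (simp add: B0_def)
  have moment: "(\<integral>\<^sup>+x. ennreal ((1 + \<bar>x\<bar> powr m) * f (hk k) x) \<partial>lborel) \<le> ennreal B0" for k
  proof -
    have h: "hk k \<in> Hset \<union> {0}" using hk by simp
    have "(\<integral>\<^sup>+x. ennreal (\<bar>x\<bar> powr m) \<partial>\<mu> (hk k)) \<le> ?I"
      unfolding law by (rule nn_integral_powr_lawXK_le(2)[OF PY(1) PZ(1) phi_meas]) (use m(1) in simp_all)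
    from add_left_mono[OF this, of 1]
    have "(\<integral>\<^sup>+x. ennreal ((1 + \<bar>x\<bar> powr m) * f (hk k) x) \<partial>lborel) \<le> 1 + ?I"
      unfolding density_moment_eq[OF prob_k dens[OF h] borel_measurable_continuous_onI[OF fc[OF h]] fnn[OF h]] .
    also have "1 + ?I = ennreal B0"
    proof -
      have "ennreal (enn2real ?I) = ?I" using I by (intro ennreal_enn2real) simp
      then show ?thesis unfolding B0_def by (simp only: ennreal_plus[OF zero_le_one enn2real_nonneg] ennreal_1)
    qed
    finally show ?thesis .
  qed
  have fm: "f (hk k) \<in> borel_measurable borel" for k
    by (rule borel_measurable_continuous_onI[OF fc]) (use hk in simp)
  have moment0: "(\<integral>\<^sup>+x. ennreal ((1 + \<bar>x\<bar> powr m) * f 0 x) \<partial>lborel) \<le> ennreal B0"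
    by (rule density_moment_limit[where f = "\<lambda>k. f (hk k)" and ?f0.0 = "f 0" and p = m and B = B0, OF fm flim moment])
  have lip: "lipschitz_law \<alpha> (\<mu> h) (f h) C" if h: "h \<in> Hset \<union> {0}" and p: "prob_space (\<mu> h)"
    and mo: "(\<integral>\<^sup>+x. ennreal ((1 + \<bar>x\<bar> powr m) * f h x) \<partial>lborel) \<le> ennreal B0" for h
    by (rule lipschitz_law_of_density[OF alpha dens[OF h] p fc[OF h] fnn[OF h] C[OF h] m(1) B0 mo])
  have lip_k: "lipschitz_law \<alpha> (\<mu> (hk k)) (f (hk k)) C" for k
  proof -
    have "hk k \<in> Hset \<union> {0}" using hk[of k] by (rule UnI1)
    from lip[OF this prob_k[of k] moment[of k]] show ?thesis .
  qed
  have lip_0: "lipschitz_law \<alpha> (\<mu> 0) (f 0) C"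
  proof -
    have "0 \<in> Hset \<union> {0::real}" by simp
    from lip[OF this prob_0 moment0] show ?thesis .
  qed
  \<comment> \<open>Assumption A (iii) speaks of minimizers, so one is produced from a quantile at a
    point where positivity of the densities, and with it uniqueness, is not yet available.\<close>
  obtain m0 where m0: "measure (\<mu> 0) {..m0} = \<alpha>" by (rule exE[OF lipschitz_law.exists_quantile[OF lip_0]])
  have min0: "is_minimizer (Vfun \<alpha> (lawX PY PZ \<phi> 0)) m0"
    using lipschitz_law.quantile_is_minimizer[OF lip_0 m0] unfolding \<mu>_def .
  have fpos: "0 < f h x" if "h \<in> Hset \<union> {0}" for h x
  proof -
    have "\<bar>x - m0\<bar> + 1 > 0" by simp
    from A3[rule_format, OF min0 this]
    obtain c where c: "c > 0" "\<forall>h\<in>Hset \<union> {0}. \<forall>\<xi>\<in>ball m0 (\<bar>x - m0\<bar> + 1). c \<le> f h \<xi>" by (elim exE conjE)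
    have "x \<in> ball m0 (\<bar>x - m0\<bar> + 1)" by (simp add: dist_real_def abs_minus_commute)
    from less_le_trans[OF c(1) bspec[OF bspec[OF c(2) that] this]] show ?thesis .
  qed
  have pos_k: "positive_law \<alpha> (\<mu> (hk k)) (f (hk k)) C" for k
    by (rule positive_law.intro[OF lip_k positive_law_axioms.intro[OF fpos[OF UnI1[OF hk]]]])
  have pos_0: "positive_law \<alpha> (\<mu> 0) (f 0) C"
    by (rule positive_law.intro[OF lip_0 positive_law_axioms.intro[OF fpos[OF UnI2[OF singletonI]]]])
  have ls: "law_sequence \<alpha> (\<mu> 0) (f 0) C (\<lambda>k. \<mu> (hk k)) (\<lambda>k. f (hk k)) m B0"
    by (rule law_sequence.intro[OF pos_0 law_sequence_axioms.intro[OF pos_k flim m(1,2) B0 moment]])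
  interpret S: law_sequence \<alpha> "\<mu> 0" "f 0" C "\<lambda>k. \<mu> (hk k)" "\<lambda>k. f (hk k)" m B0
    by (rule ls)
  let ?\<kappa> = "4 / (1 - \<alpha>) * max 1 (\<alpha> / (1 - \<alpha>)) * (SUP h'\<in>Hset. supnorm (f h'))"
  have kap: "0 \<le> ?\<kappa>"
  proof -
    have sb: "0 \<le> supnorm (f h)" "supnorm (f h) \<le> C" if "h \<in> Hset" for h
      using supnorm_bounds[of "f h" C] C[of h] that by auto
    have "bdd_above ((\<lambda>h. supnorm (f h)) ` Hset)" using sb(2) by (auto intro!: bdd_aboveI[of _ C])
    then have "supnorm (f (hk 0)) \<le> (SUP h'\<in>Hset. supnorm (f h'))" by (rule cSUP_upper[OF hk])
    then have "0 \<le> (SUP h'\<in>Hset. supnorm (f h'))" using sb(1)[OF hk[of 0]] by linarith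
    then show ?thesis using alpha by (intro mult_nonneg_nonneg) auto
  qed
  let ?SUP = "SUP h\<in>Hset. \<integral>\<^sup>+ \<omega>. ennreal ((\<xi>0 h \<omega>)\<^sup>2 * exp (?\<kappa> * \<bar>\<xi>0 h \<omega>\<bar>)) \<partial>M h"
  define BB where "BB = enn2real ?SUP"
  have BB0: "0 \<le> BB" by (simp add: BB_def)
  have BBle: "(\<integral>\<^sup>+ \<omega>. ennreal ((\<xi>0 h \<omega>)\<^sup>2 * exp (?\<kappa> * \<bar>\<xi>0 h \<omega>\<bar>)) \<partial>M h) \<le> ennreal BB" if "h \<in> Hset" for h
  proof -
    have "(\<integral>\<^sup>+ \<omega>. ennreal ((\<xi>0 h \<omega>)\<^sup>2 * exp (?\<kappa> * \<bar>\<xi>0 h \<omega>\<bar>)) \<partial>M h) \<le> ?SUP" using that by (rule SUP_upper)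
    also have "\<dots> = ennreal BB" unfolding BB_def by (rule ennreal_enn2real[symmetric]) (use B in simp)
    finally show ?thesis .
  qed
  have Mp: "prob_space (M (hk k))" for k using Msp hk by blast
  have ind: "prob_space.indep_vars (M (hk k)) (\<lambda>_. borel) (\<lambda>n. if n = 0 then \<xi>0 (hk k) else Xs (hk k) n) UNIV" for k
    using Msp hk by blast
  have dX: "distr (M (hk k)) borel (Xs (hk k) (Suc n)) = \<mu> (hk k)" for k n
    using Msp hk unfolding \<mu>_def by simp
  have xm: "\<xi>0 (hk k) \<in> borel_measurable (M (hk k))" for k
  proof -
    interpret prob_space "M (hk k)" by (rule Mp)
    have "\<forall>i. (if i = 0 then \<xi>0 (hk k) else Xs (hk k) i) \<in> borel_measurable (M (hk k))" using ind[of k] unfolding indep_vars_def by auto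
    from spec[OF this, of 0] show ?thesis by simp
  qed
  have tight: "\<exists>R>0. \<forall>k. measure (M (hk k)) {\<omega>\<in>space (M (hk k)). \<bar>\<xi>0 (hk k) \<omega>\<bar> > R} \<le> e" if e: "e > 0" for e
  \<comment> \<open>The summand 1 makes the radius at least 1, so its square is at least BB/e and
    the Chebyshev bound is at most \<open>e\<close>.\<close>
  proof (intro exI[of _ "BB / e + 1"] conjI allI)
    let ?R = "BB / e + 1"
    have "0 \<le> BB / e" using BB0 e by simp
    then have R: "0 < ?R" and R1: "1 \<le> ?R" by linarith+
    show "0 < ?R" by (rule R)
    fix k
    have "measure (M (hk k)) {\<omega>\<in>space (M (hk k)). \<bar>\<xi>0 (hk k) \<omega>\<bar> > ?R} \<le> BB / ?R\<^sup>2"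
      by (rule tail_bound_from_square[OF Mp xm kap BBle[OF hk] BB0 R])
    also have "\<dots> \<le> e"
    proof -
      have "BB = e * (BB / e)" using e by simp
      also have "\<dots> \<le> e * ?R\<^sup>2"
      proof (rule mult_left_mono)
        have "BB / e \<le> ?R" by simp
        also have "\<dots> \<le> ?R\<^sup>2" by (rule self_le_power[OF R1]) simp
        finally show "BB / e \<le> ?R\<^sup>2" .
      qed (use e in simp)
      finally show ?thesis using R by (simp add: pos_divide_le_eq)
    qed
    finally show "measure (M (hk k)) {\<omega>\<in>space (M (hk k)). \<bar>\<xi>0 (hk k) \<omega>\<bar> > ?R} \<le> e" .
  qed
  have crit: "8 / 3 < S.v0 * \<gamma>1" if "\<beta> = 1"
  proof -
    have "lambda_const \<alpha> f (\<lambda>h. xi_star \<alpha> (lawX PY PZ \<phi> h)) \<le> 3 / 8 * S.v0"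
      unfolding S.v0_def S.xs0_def unfolding \<mu>_def by (rule lambda_const_le[OF alpha(2)]) (use C fnn in auto)
    from mult_right_mono[OF this less_imp_le[OF gamma1]] beta1 that show ?thesis by simp
  qed
  have xs0_eq: "S.xs0 = xi_star \<alpha> (lawX PY PZ \<phi> 0)" and P0_eq: "S.P0 = (\<integral>y. max (y - xi_star \<alpha> (lawX PY PZ \<phi> 0)) 0 \<partial>lawX PY PZ \<phi> 0)"
    unfolding S.P0_def S.xs0_def unfolding \<mu>_def by (rule refl)+
  obtain N where N0: "is_gaussian2 N (\<alpha> * \<gamma>1 / (2 * f 0 S.xs0 - (if \<beta> = 1 then (1 - \<alpha>) / \<gamma>1 else 0)))
       (if \<beta> = 1 then \<alpha> * (chi_star \<alpha> (\<mu> 0) - S.xs0) / f 0 S.xs0 else 0)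
       ((\<integral>x. (max (x - S.xs0) 0 - S.P0)\<^sup>2 \<partial>\<mu> 0) / (1 - \<alpha>)\<^sup>2)
     \<and> (\<forall>G :: real \<times> real \<Rightarrow> real. continuous_on UNIV G \<and> bounded (range G) \<longrightarrow> (\<lambda>k. \<integral>\<omega>. G (let p = nsa \<alpha> (\<lambda>n. \<gamma>1 * real n powr (- \<beta>)) (\<xi>0 (hk k) \<omega>) (\<lambda>n. Xs (hk k) n \<omega>) ((Suc k)\<^sup>2) in
      (real (Suc k) powr \<beta> * (fst p - S.xk k), real (Suc k) * (snd p - chi_star \<alpha> (\<mu> (hk k))))) \<partial>M (hk k)) \<longlonglongrightarrow> (\<integral>x. G x \<partial>N))"
    by (rule exE[OF S.nsa_sequence_clt[OF Mp ind dX tight gamma1 beta crit]])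
  have N: "is_gaussian2 N
            (\<alpha> * \<gamma>1 / (2 * f 0 (xi_star \<alpha> (lawX PY PZ \<phi> 0)) - (if \<beta> = 1 then (1 - \<alpha>) / \<gamma>1 else 0)))
            (if \<beta> = 1 then \<alpha> * (chi_star \<alpha> (lawX PY PZ \<phi> 0) - xi_star \<alpha> (lawX PY PZ \<phi> 0)) / f 0 (xi_star \<alpha> (lawX PY PZ \<phi> 0)) else 0)
            ((\<integral>x. (max (x - xi_star \<alpha> (lawX PY PZ \<phi> 0)) 0 - (\<integral>y. max (y - xi_star \<alpha> (lawX PY PZ \<phi> 0)) 0 \<partial>lawX PY PZ \<phi> 0))\<^sup>2
                 \<partial>lawX PY PZ \<phi> 0) / (1 - \<alpha>)\<^sup>2)"
    using conjunct1[OF N0] unfolding P0_eq xs0_eq unfolding \<mu>_def .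
  have conv: "continuous_on UNIV G \<Longrightarrow> bounded (range G) \<Longrightarrow>
      (\<lambda>k. \<integral>\<omega>. G (let p = nsa \<alpha> (\<lambda>n. \<gamma>1 * real n powr (- \<beta>)) (\<xi>0 (hk k) \<omega>) (\<lambda>n. Xs (hk k) n \<omega>) ((Suc k)\<^sup>2) in
      (real (Suc k) powr \<beta> * (fst p - S.xk k), real (Suc k) * (snd p - chi_star \<alpha> (\<mu> (hk k))))) \<partial>M (hk k)) \<longlonglongrightarrow> (\<integral>x. G x \<partial>N)" for G :: "real \<times> real \<Rightarrow> real"
    using spec[OF conjunct2[OF N0], of G] by (rule mp) (rule conjI)
  show ?thesis
  proof (intro exI[of _ N] conjI N)
    show "conv_in_law2 M
            (\<lambda>h \<omega>. let p = nsa \<alpha> (\<lambda>n. \<gamma>1 * real n powr (- \<beta>)) (\<xi>0 h \<omega>) (\<lambda>n. Xs h n \<omega>) (nat \<lceil>1 / h\<^sup>2\<rceil>) in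
               (h powr (- \<beta>) * (fst p - xi_star \<alpha> (lawX PY PZ \<phi> h)), 1 / h * (snd p - chi_star \<alpha> (lawX PY PZ \<phi> h))))
            N (at 0 within Hset)"
      unfolding conv_in_law2_def
    proof (intro allI impI, elim conjE)
      fix G :: "real \<times> real \<Rightarrow> real" assume G: "continuous_on UNIV G" "bounded (range G)"
      \<comment> \<open>Along h = 1/K the number of steps 1/h^2 is an integer, so the ceiling rounds
        nothing.\<close>
      have e1: "nat \<lceil>1 / (1 / real (Suc k))\<^sup>2\<rceil> = (Suc k)\<^sup>2" for k
      proof -
        have "1 / (1 / real (Suc k))\<^sup>2 = real ((Suc k)\<^sup>2)" by (simp add: power_divide del: of_nat_Suc)
        then show ?thesis by (simp only: ceiling_of_nat nat_int)
      qed
      have e2: "(1 / real (Suc k)) powr (- \<beta>) = real (Suc k) powr \<beta>" for k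
        by (simp add: powr_divide powr_minus_divide del: of_nat_Suc)
      have e3: "1 / (1 / real (Suc k)) = real (Suc k)" for k by simp
      show "((\<lambda>h. \<integral>\<omega>. G (let p = nsa \<alpha> (\<lambda>n. \<gamma>1 * real n powr (- \<beta>)) (\<xi>0 h \<omega>) (\<lambda>n. Xs h n \<omega>) (nat \<lceil>1 / h\<^sup>2\<rceil>) in
               (h powr (- \<beta>) * (fst p - xi_star \<alpha> (lawX PY PZ \<phi> h)), 1 / h * (snd p - chi_star \<alpha> (lawX PY PZ \<phi> h)))) \<partial>M h)
          \<longlongrightarrow> (\<integral>x. G x \<partial>N)) (at 0 within Hset)"
        by (rule tendsto_within_Hset) (use conv[OF G, unfolded S.xk_def] in \<open>simp only: e1 e2 e3 hk_def \<mu>_def\<close>)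
    qed
  qed
qed

end
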